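(* Let $\mathfrak h=\mathfrak h_-\oplus\mathfrak h_0\oplus\mathfrak h_+$ be a graded Lie algebra and let $Q=G\cdot N$ be the semidirect product of Lie groups $G$, $N$ with $\mathrm{Lie}(G)=\mathfrak h_0$, $\mathrm{Lie}(N)=\mathfrak h_+$, $\mathrm{Lie}(Q)=\mathfrak h_0\oplus\mathfrak h_+$. Let $(\mathcal D,\pi_G:P_G\to M)$ be a Tanaka structure which is induced by a regular Cartan connection $\kappa\in\Omega^1(P,\mathfrak h)$ on a principal $Q$-bundle $\pi:P\to M$. Fix an admissible metric on $\mathfrak h$. Then the given Tanaka structure is induced also by a normal Cartan connection $\kappa^n\in\Omega^1(P,\mathfrak h)$.
   Context: Graded Lie algebras. $\mathfrak{h}=\mathfrak{h}_{-k}\oplus\cdots\oplus\mathfrak{h}_{l}$ ($k>0$, $l\ge0$) is finite dimensional with $[\mathfrak{h}_i,\mathfrak{h}_j]\subset\mathfrak{h}_{i+j}$; the gradation is fundamental: $\mathfrak{h}_-:=\oplus_{i<0}\mathfrak{h}_i$ is generated by $\mathfrak{h}_{-1}$; $\mathfrak{h}_0,\mathfrak{h}_{-k},\mathfrak{h}_l$ are non-trivial; the adjoint action of $\mathfrak{h}_0$ on $\mathfrak{h}_{-1}$ is exact (faithful). $\mathfrak{h}_+=\oplus_{i>0}\mathfrak{h}_i$, $\mathfrak{h}^i=\oplus_{j\ge i}\mathfrak{h}_j$, $\mathfrak q=\mathfrak{h}_0\oplus\mathfrak{h}_+$. $H$ is a connected Lie group with Lie algebra $\mathfrak h$, and $G=H_0$,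 $Q$ are connected subgroups with Lie algebras $\mathfrak h_0$, $\mathfrak q$; $G$ is regarded as a subgroup of the group $\mathrm{Aut}_{\mathrm{gr}}(\mathfrak h_-)$ of grading-preserving automorphisms of $\mathfrak h_-$ via the adjoint action. Complex and admissible metrics. $C^k(\mathfrak h_-,\mathfrak h)=\Lambda^k(\mathfrak h_-^* )\otimes\mathfrak h$, with Lie algebra differential $$(\partial\phi)(X_0,\dots,X_k)=\sum_i(-1)^i[X_i,\phi(\dots,\widehat{X_i},\dots)]+\sum_{i<j}(-1)^{i+j}\phi([X_i,X_j],\dots,\widehat{X_i},\dots,\widehat{X_j},\dots).$$ A Euclidean metric $\langle\cdot,\cdot\rangle$ on $\mathfrak h$ is adapted to the gradation if $\langle\mathfrak h_i,\mathfrak h_j\rangle=0$ for $i\ne j$; it induces a Euclidean metric on every $C^k(\mathfrak h_-,\mathfrak h)$, and $\partial^*:C^{k+1}(\mathfrak h_-,\mathfrak h)\to C^k(\mathfrak h_-,\mathfrak h)$ is the metric adjoint of $\partial$. $Q$ acts on $\mathfrak h_-\cong\mathfrak h/\mathfrak q$ by the action $\mathrm{Ad}^-$ induced by the adjoint action, and on $C^k(\mathfrak h_-,\mathfrak h)$ by $(g\cdot\phi)(X_1,\dots,X_k)=\mathrm{Ad}_g(\phi(\mathrm{Ad}^-_{g^{-1}}X_1,\dots,\mathrm{Ad}^-_{g^{-1}}X_k))$. The (Euclidean, adapted to the gradation) metric is admissible if $\partial^*:C^{k+1}(\mathfrak h_-,\mathfrak h)\to C^k(\mathfrak h_-,\mathfrak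 h)$ is $Q$-invariant (commutes with the $Q$-actions) for all $k\ge0$. Cartan connections. A Cartan connection of type $\mathfrak h$ on a principal $Q$-bundle $\pi:P\to M$ is $\kappa\in\Omega^1(P,\mathfrak h)$ such that: $\kappa(X^a)=a$ for $a\in\mathfrak q$ ($X^a$ the fundamental vector field); $\kappa|_{T_uP}:T_uP\to\mathfrak h$ is an isomorphism for all $u$; $(r^g)^*\kappa=\mathrm{Ad}(g^{-1})\circ\kappa$ for $g\in Q$. Put $X^a:=\kappa^{-1}(a)$, $a\in\mathfrak h$. The curvature is $\Omega(X,Y)=d\kappa(X,Y)+[\kappa(X),\kappa(Y)]$; the curvature function is $K:P\to C^2(\mathfrak h_-,\mathfrak h)$, $K(u)(a,b)=\Omega(X^a_u,X^b_u)$. $\kappa$ is regular if $K(u)(\mathfrak h_i,\mathfrak h_j)\subset\mathfrak h^{i+j+1}$ for all $u\in P$, $i,j<0$. $\kappa$ is normal (with respect to a fixed admissible metric) if it is regular and $\partial^*(K)=0$. Tanaka structures. For a distribution $\mathcal D$ on $M$, $\mathcal D_{-1}=\mathcal D$ and $\mathcal D_{-j}(p)$ is spanned by $\mathcal D(p)$ and the values at $p$ of commutators of vector fields $X_1,\dots,X_s$ ($2\le s\le j$) in $\mathcal D$. The commutator of vector fields makes $\mathrm{gr}_{\mathcal D}(T_pM)=\mathcal D(p)\oplus\bigoplus_{i\ge2}\mathcal D_{-i}(p)/\mathcal D_{-i+1}(p)$ a graded Lie algebra. $\mathcal D$ is regular of type $\mathfrak m$ if all of these are isomorphic to a given negatively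 graded Lie algebra $\mathfrak m$ generated by $\mathfrak m_{-1}$. $\mathbb L(M,\mathcal D)$ is the principal $\mathrm{Aut}_{\mathrm{gr}}(\mathfrak m)$-bundle of adapted frames, i.e. isomorphisms $\mathfrak m_{-1}\to\mathcal D(p)$ that extend (uniquely) to graded Lie algebra isomorphisms $\mathfrak m\to\mathrm{gr}_{\mathcal D}(T_pM)$. A Tanaka structure of type $(\mathfrak m,G)$, $G\subset\mathrm{Aut}_{\mathrm{gr}}(\mathfrak m)$, is a regular distribution $\mathcal D$ of type $\mathfrak m$ with a principal $G$-subbundle $\pi_G:P_G\subset\mathbb L(M,\mathcal D)\to M$. A regular Cartan connection $\kappa$ on $P$ induces a Tanaka structure of type $(\mathfrak h_-,G)$: $\mathcal D=T^{-1}M$, where $T^iM:=\pi_*(\kappa^{-1}(\mathfrak h^i))$ ($T^0M:=0$), and $P_G:=P/N$ is embedded in $\mathbb L(M,\mathcal D)$ by sending the class $p_0$ of $u\in P$ to the restriction to $\mathfrak h_{-1}$ of $\hat p_0:\mathfrak h_-\to\mathrm{gr}_{\mathcal D}(T_{\pi(u)}M)$, $\hat p_0(a)=$ class of $\pi_*(X^a_u)$ in $T^iM/T^{i+1}M$ for $a\in\mathfrak h_i$. Two regular Cartan connections on $P$ induce the same Tanaka structure if they yield the same $\mathcal D$ and the same map $P/N\to\mathbb L(M,\mathcal D)$. *)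

theory Defs
  imports "HOL-Analysis.Analysis" "HOL-Algebra.Coset"
begin

section \<open>Smooth manifolds\<close>

text \<open>Maps of class \<open>C\<^sup>n\<close> and smooth maps on an open subset of a normed space.\<close>

primrec Ck_on :: "nat \<Rightarrow> 'a::real_normed_vector set \<Rightarrow> ('a \<Rightarrow> 'b::real_normed_vector) \<Rightarrow> bool" where
  "Ck_on 0 S f \<longleftrightarrow> continuous_on S f"
| "Ck_on (Suc n) S f \<longleftrightarrow>
     (\<forall>x\<in>S. f differentiable (at x)) \<and> (\<forall>v. Ck_on n S (\<lambda>x. frechet_derivative f (at x) v))"

definition smooth_on :: "'a::real_normed_vector set \<Rightarrow> ('a \<Rightarrow> 'b::real_normed_vector) \<Rightarrow> bool" where
  "smooth_on S f \<longleftrightarrow> (\<forall>n. Ck_on n S f)"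

text \<open>A chart is a pair (domain, coordinate map); a manifold is a topology with an atlas, which is
  not required to be maximal.\<close>

type_synonym ('m, 'e) chart = "'m set \<times> ('m \<Rightarrow> 'e)"

record ('m, 'e) mfd =
  mtop :: "'m topology"
  atlas :: "('m, 'e) chart set"

abbreviation pts :: "('m, 'e, 'z) mfd_scheme \<Rightarrow> 'm set" where
  "pts M \<equiv> topspace (mtop M)"

definition cinv :: "('m, 'e) chart \<Rightarrow> 'e \<Rightarrow> 'm" where
  "cinv c = inv_into (fst c) (snd c)"

definition smooth_manifold :: "('m, 'e::euclidean_space) mfd \<Rightarrow> bool" where
  "smooth_manifold M \<longleftrightarrow>
     Hausdorff_space (mtop M) \<and> second_countable (mtop M) \<and>
     (\<Union>c\<in>atlas M. fst c) = pts M \<and>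
     (\<forall>c\<in>atlas M. openin (mtop M) (fst c) \<and> open (snd c ` fst c) \<and>
        homeomorphic_map (subtopology (mtop M) (fst c)) (top_of_set (snd c ` fst c)) (snd c)) \<and>
     (\<forall>c\<in>atlas M. \<forall>d\<in>atlas M. smooth_on (snd c ` (fst c \<inter> fst d)) (snd d \<circ> cinv c))"

definition smooth_map :: "('m, 'e::euclidean_space) mfd \<Rightarrow> ('n, 'f::euclidean_space) mfd \<Rightarrow> ('m \<Rightarrow> 'n) \<Rightarrow> bool" where
  "smooth_map M N f \<longleftrightarrow>
     continuous_map (mtop M) (mtop N) f \<and>
     (\<forall>c\<in>atlas M. \<forall>d\<in>atlas N.
        smooth_on (snd c ` {p \<in> fst c. f p \<in> fst d}) (snd d \<circ> f \<circ> cinv c))"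

definition diffeo :: "('m, 'e::euclidean_space) mfd \<Rightarrow> ('n, 'f::euclidean_space) mfd \<Rightarrow> ('m \<Rightarrow> 'n) \<Rightarrow> bool" where
  "diffeo M N f \<longleftrightarrow>
     smooth_map M N f \<and> bij_betw f (pts M) (pts N) \<and> smooth_map N M (inv_into (pts M) f)"

definition euclid_mfd :: "('e::euclidean_space, 'e) mfd" where
  "euclid_mfd = \<lparr>mtop = euclidean, atlas = {(UNIV, \<lambda>x. x)}\<rparr>"

definition prod_mfd :: "('m, 'e) mfd \<Rightarrow> ('n, 'f) mfd \<Rightarrow> ('m \<times> 'n, 'e \<times> 'f) mfd" where
  "prod_mfd M N =
     \<lparr>mtop = prod_topology (mtop M) (mtop N),
      atlas = {(fst c \<times> fst d, \<lambda>(x, y). (snd c x, snd d y)) | c d. c \<in> atlas M \<and> d \<in> atlas N}\<rparr>"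

definition open_submfd :: "('m, 'e) mfd \<Rightarrow> 'm set \<Rightarrow> ('m, 'e) mfd" where
  "open_submfd M U =
     \<lparr>mtop = subtopology (mtop M) U, atlas = {(fst c \<inter> U, snd c) | c. c \<in> atlas M}\<rparr>"

text \<open>The tangent space at \<open>p\<close> is realised as the model space, a vector being identified with its
  components in the preferred chart \<open>pref M p\<close>.  \<open>coords M c p v\<close> are the components of the vector
  \<open>v\<close> at \<open>p\<close> in an arbitrary chart \<open>c\<close> around \<open>p\<close>.\<close>

definition pref :: "('m, 'e) mfd \<Rightarrow> 'm \<Rightarrow> ('m, 'e) chart" where
  "pref M p = (SOME c. c \<in> atlas M \<and> p \<in> fst c)"

definition mderiv ::
    "('m, 'e::euclidean_space) mfd \<Rightarrow> ('n, 'f::euclidean_space) mfd \<Rightarrow> ('m \<Rightarrow> 'n) \<Rightarrow> 'm \<Rightarrow> 'e \<Rightarrow> 'f" where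
  "mderiv M N f p =
     frechet_derivative (snd (pref N (f p)) \<circ> f \<circ> cinv (pref M p)) (at (snd (pref M p) p))"

definition coords :: "('m, 'e::euclidean_space) mfd \<Rightarrow> ('m, 'e) chart \<Rightarrow> 'm \<Rightarrow> 'e \<Rightarrow> 'e" where
  "coords M c p = frechet_derivative (snd c \<circ> cinv (pref M p)) (at (snd (pref M p) p))"

definition chart_field :: "('m, 'e::euclidean_space) mfd \<Rightarrow> ('m, 'e) chart \<Rightarrow> ('m \<Rightarrow> 'e) \<Rightarrow> 'e \<Rightarrow> 'e" where
  "chart_field M c X x = coords M c (cinv c x) (X (cinv c x))"

definition smooth_field :: "('m, 'e::euclidean_space) mfd \<Rightarrow> 'm set \<Rightarrow> ('m \<Rightarrow> 'e) \<Rightarrow> bool" where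
  "smooth_field M W X \<longleftrightarrow> (\<forall>c\<in>atlas M. smooth_on (snd c ` (fst c \<inter> W)) (chart_field M c X))"

text \<open>The commutator \<open>[X, Y]\<close> of vector fields, with components \<open>X\<^sup>i \<partial>\<^sub>i Y\<^sup>j - Y\<^sup>i \<partial>\<^sub>i X\<^sup>j\<close>.\<close>

definition commutator ::
    "('m, 'e::euclidean_space) mfd \<Rightarrow> ('m \<Rightarrow> 'e) \<Rightarrow> ('m \<Rightarrow> 'e) \<Rightarrow> 'm \<Rightarrow> 'e" where
  "commutator M X Y p =
     (let c = pref M p; x = snd c p in
      frechet_derivative (chart_field M c Y) (at x) (chart_field M c X x)
      - frechet_derivative (chart_field M c X) (at x) (chart_field M c Y x))"

text \<open>Vector-valued 1-forms \<open>\<kappa> p : T\<^sub>p M \<rightarrow> V\<close>; \<open>chart_form M c \<kappa>\<close> is the pullback of \<open>\<kappa>\<close> along the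
  inverse of the chart \<open>c\<close>, and \<open>ext_deriv\<close> is normalised by
  \<open>d\<kappa>(X, Y) = X(\<kappa>(Y)) - Y(\<kappa>(X)) - \<kappa>([X, Y])\<close>.\<close>

definition chart_form ::
    "('m, 'e::euclidean_space) mfd \<Rightarrow> ('m, 'e) chart \<Rightarrow> ('m \<Rightarrow> 'e \<Rightarrow> 'v) \<Rightarrow> 'e \<Rightarrow> 'e \<Rightarrow> 'v" where
  "chart_form M c \<kappa> x v =
     \<kappa> (cinv c x) (frechet_derivative (snd (pref M (cinv c x)) \<circ> cinv c) (at x) v)"

definition one_form ::
    "('m, 'e::euclidean_space) mfd \<Rightarrow> ('m \<Rightarrow> 'e \<Rightarrow> 'v::real_normed_vector) \<Rightarrow> bool" where
  "one_form M \<kappa> \<longleftrightarrow>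
     (\<forall>p\<in>pts M. linear (\<kappa> p)) \<and>
     (\<forall>c\<in>atlas M. \<forall>v. smooth_on (snd c ` fst c) (\<lambda>x. chart_form M c \<kappa> x v))"

definition ext_deriv ::
    "('m, 'e::euclidean_space) mfd \<Rightarrow> ('m \<Rightarrow> 'e \<Rightarrow> 'v::real_normed_vector) \<Rightarrow> 'm \<Rightarrow> 'e \<Rightarrow> 'e \<Rightarrow> 'v" where
  "ext_deriv M \<kappa> p v w =
     (let c = pref M p; x = snd c p in
      frechet_derivative (\<lambda>y. chart_form M c \<kappa> y w) (at x) v
      - frechet_derivative (\<lambda>y. chart_form M c \<kappa> y v) (at x) w)"


section \<open>Graded Lie algebras\<close>

definition lie_bracket :: "('h::real_vector \<Rightarrow> 'h \<Rightarrow> 'h) \<Rightarrow> bool" where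
  "lie_bracket br \<longleftrightarrow>
     bilinear br \<and> (\<forall>x. br x x = 0) \<and>
     (\<forall>x y z. br x (br y z) + br y (br z x) + br z (br x y) = 0)"

definition hminus :: "(int \<Rightarrow> 'h::real_vector set) \<Rightarrow> 'h set" where
  "hminus gr = span (\<Union>i\<in>{..<0}. gr i)"

definition hplus :: "(int \<Rightarrow> 'h::real_vector set) \<Rightarrow> 'h set" where
  "hplus gr = span (\<Union>i\<in>{0<..}. gr i)"

definition hfilt :: "(int \<Rightarrow> 'h::real_vector set) \<Rightarrow> int \<Rightarrow> 'h set" where
  "hfilt gr i = span (\<Union>j\<in>{i..}. gr j)"

definition lie_generated :: "('h::real_vector \<Rightarrow> 'h \<Rightarrow> 'h) \<Rightarrow> 'h set \<Rightarrow> 'h set" where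
  "lie_generated br S = \<Inter>{V. subspace V \<and> S \<subseteq> V \<and> (\<forall>x\<in>V. \<forall>y\<in>V. br x y \<in> V)}"

text \<open>The Lie algebra is the whole type, graded by \<open>gr (-k) \<oplus> \<dots> \<oplus> gr l\<close>.\<close>

definition graded_lie_algebra ::
    "('h::real_vector \<Rightarrow> 'h \<Rightarrow> 'h) \<Rightarrow> (int \<Rightarrow> 'h set) \<Rightarrow> int \<Rightarrow> int \<Rightarrow> bool" where
  "graded_lie_algebra br gr k l \<longleftrightarrow>
     lie_bracket br \<and> 0 < k \<and> 0 \<le> l \<and>
     (\<forall>i. subspace (gr i)) \<and> (\<forall>i. i < - k \<or> l < i \<longrightarrow> gr i = {0}) \<and>
     (\<forall>x. \<exists>!f. (\<forall>i. f i \<in> gr i) \<and> x = (\<Sum>i=-k..l. f i)) \<and>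
     (\<forall>i j. \<forall>x\<in>gr i. \<forall>y\<in>gr j. br x y \<in> gr (i + j)) \<and>
     lie_generated br (gr (-1)) = hminus gr \<and>
     gr 0 \<noteq> {0} \<and> gr (- k) \<noteq> {0} \<and> gr l \<noteq> {0} \<and>
     (\<forall>a\<in>gr 0. (\<forall>x\<in>gr (-1). br a x = 0) \<longrightarrow> a = 0)"


section \<open>Lie groups\<close>

definition lie_group :: "'g monoid \<Rightarrow> ('g, 'a::euclidean_space) mfd \<Rightarrow> bool" where
  "lie_group H M \<longleftrightarrow>
     group H \<and> smooth_manifold M \<and> pts M = carrier H \<and>
     smooth_map (prod_mfd M M) M (\<lambda>(x, y). x \<otimes>\<^bsub>H\<^esub> y) \<and> smooth_map M M (m_inv H)"

definition left_invariant :: "'g monoid \<Rightarrow> ('g, 'a::euclidean_space) mfd \<Rightarrow> 'a \<Rightarrow> 'g \<Rightarrow> 'a" where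
  "left_invariant H M v g = mderiv M M (\<lambda>x. g \<otimes>\<^bsub>H\<^esub> x) \<one>\<^bsub>H\<^esub> v"

text \<open>\<open>lam\<close> identifies the Lie algebra of \<open>H\<close> (the tangent space at the identity with the bracket of
  left invariant vector fields) with the Lie algebra \<open>('h, br)\<close>.\<close>

definition lie_algebra_iso ::
    "'g monoid \<Rightarrow> ('g, 'a::euclidean_space) mfd \<Rightarrow> ('h::real_vector \<Rightarrow> 'h \<Rightarrow> 'h) \<Rightarrow> ('a \<Rightarrow> 'h) \<Rightarrow> bool" where
  "lie_algebra_iso H M br lam \<longleftrightarrow>
     linear lam \<and> bij lam \<and>
     (\<forall>v w. lam (commutator M (left_invariant H M v) (left_invariant H M w) \<one>\<^bsub>H\<^esub>)
              = br (lam v) (lam w))"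

text \<open>Lie subgroups are immersed: \<open>S\<close> carries its own topology and smooth structure.\<close>

definition lie_subgroup ::
    "'g monoid \<Rightarrow> ('g, 'a::euclidean_space) mfd \<Rightarrow> ('g, 'b::euclidean_space) mfd \<Rightarrow> bool" where
  "lie_subgroup H M S \<longleftrightarrow>
     subgroup (pts S) H \<and> lie_group (H\<lparr>carrier := pts S\<rparr>) S \<and>
     smooth_map S M (\<lambda>x. x) \<and> (\<forall>x\<in>pts S. inj (mderiv S M (\<lambda>x. x) x))"

text \<open>The data of a model: the graded Lie algebra, a Lie group \<open>Hgrp\<close> whose Lie algebra is
  identified with it by \<open>lieid\<close>, a Lie subgroup \<open>Qmfd\<close>, and subgroups \<open>Ggrp\<close>, \<open>Ngrp\<close> of the latter.\<close>

record ('h, 'g, 'a, 'b) model =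
  brk :: "'h \<Rightarrow> 'h \<Rightarrow> 'h"
  grd :: "int \<Rightarrow> 'h set"
  depth :: int
  height :: int
  Hgrp :: "'g monoid"
  Hmfd :: "('g, 'a) mfd"
  lieid :: "'a \<Rightarrow> 'h"
  Qmfd :: "('g, 'b) mfd"
  Ggrp :: "'g set"
  Ngrp :: "'g set"

abbreviation Qgrp :: "('h, 'g, 'a, 'b) model \<Rightarrow> 'g monoid" where
  "Qgrp A \<equiv> (Hgrp A)\<lparr>carrier := pts (Qmfd A)\<rparr>"

definition lieQ :: "('h, 'g, 'a::euclidean_space, 'b::euclidean_space) model \<Rightarrow> 'b \<Rightarrow> 'h" where
  "lieQ A v = lieid A (mderiv (Qmfd A) (Hmfd A) (\<lambda>x. x) \<one>\<^bsub>Hgrp A\<^esub> v)"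

text \<open>The Lie algebra of a subgroup \<open>S\<close> of the Lie group \<open>Q\<close>, as the set of initial velocities of
  smooth curves in \<open>S\<close> through the identity.  This avoids a manifold structure on \<open>S\<close>, which would
  exclude zero-dimensional groups because \<open>euclidean_space\<close> types have positive dimension
  (\<open>Ngrp\<close> is trivial if \<open>height = 0\<close>).\<close>

definition lie_of_subgroup ::
    "('h, 'g, 'a::euclidean_space, 'b::euclidean_space) model \<Rightarrow> 'g set \<Rightarrow> 'h set" where
  "lie_of_subgroup A S =
     {lieid A (mderiv euclid_mfd (Hmfd A) \<gamma> (0::real) 1) | \<gamma>.
        smooth_map euclid_mfd (Qmfd A) \<gamma> \<and> range \<gamma> \<subseteq> S \<and> \<gamma> 0 = \<one>\<^bsub>Hgrp A\<^esub>}"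

text \<open>\<open>Q = G \<cdot> N\<close> as a semidirect product of Lie groups: the decomposition \<open>q = g \<cdot> n\<close> is unique and
  depends smoothly on \<open>q\<close>, i.e. the multiplication \<open>G \<times> N \<rightarrow> Q\<close> is a diffeomorphism.\<close>

definition semidirect_product ::
    "('h, 'g, 'a, 'b::euclidean_space) model \<Rightarrow> bool" where
  "semidirect_product A \<longleftrightarrow>
     subgroup (Ggrp A) (Qgrp A) \<and> normal (Ngrp A) (Qgrp A) \<and> Ggrp A \<inter> Ngrp A = {\<one>\<^bsub>Hgrp A\<^esub>} \<and>
     (\<exists>prG prN. smooth_map (Qmfd A) (Qmfd A) prG \<and> smooth_map (Qmfd A) (Qmfd A) prN \<and>
        (\<forall>q\<in>pts (Qmfd A). prG q \<in> Ggrp A \<and> prN q \<in> Ngrp A \<and> q = prG q \<otimes>\<^bsub>Hgrp A\<^esub> prN q))"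

definition Ad :: "('h, 'g, 'a::euclidean_space, 'b) model \<Rightarrow> 'g \<Rightarrow> 'h \<Rightarrow> 'h" where
  "Ad A g x =
     lieid A (mderiv (Hmfd A) (Hmfd A) (\<lambda>y. g \<otimes>\<^bsub>Hgrp A\<^esub> y \<otimes>\<^bsub>Hgrp A\<^esub> m_inv (Hgrp A) g) \<one>\<^bsub>Hgrp A\<^esub>
                (inv_into UNIV (lieid A) x))"

definition proj_minus :: "(int \<Rightarrow> 'h::real_vector set) \<Rightarrow> 'h \<Rightarrow> 'h" where
  "proj_minus gr x = (THE y. y \<in> hminus gr \<and> x - y \<in> hfilt gr 0)"

text \<open>The action of \<open>Q\<close> on \<open>hminus\<close>, identified with the quotient of the Lie algebra by \<open>hfilt 0\<close>.\<close>

definition Ad_minus :: "('h::real_vector, 'g, 'a::euclidean_space, 'b) model \<Rightarrow> 'g \<Rightarrow> 'h \<Rightarrow> 'h" where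
  "Ad_minus A g x = proj_minus (grd A) (Ad A g x)"

text \<open>The standing assumptions.  The last clause says that \<open>G\<close> is a subgroup of the group of
  automorphisms of \<open>hminus\<close> via the adjoint action.\<close>

definition cartan_model ::
    "('h::euclidean_space, 'g, 'a::euclidean_space, 'b::euclidean_space) model \<Rightarrow> bool" where
  "cartan_model A \<longleftrightarrow>
     graded_lie_algebra (brk A) (grd A) (depth A) (height A) \<and>
     lie_group (Hgrp A) (Hmfd A) \<and> connected_space (mtop (Hmfd A)) \<and>
     lie_algebra_iso (Hgrp A) (Hmfd A) (brk A) (lieid A) \<and>
     lie_subgroup (Hgrp A) (Hmfd A) (Qmfd A) \<and> connected_space (mtop (Qmfd A)) \<and>
     range (lieQ A) = hfilt (grd A) 0 \<and>
     semidirect_product A \<and> connectedin (mtop (Qmfd A)) (Ggrp A) \<and>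
     lie_of_subgroup A (Ggrp A) = grd A 0 \<and>
     lie_of_subgroup A (Ngrp A) = hplus (grd A) \<and>
     inj_on (\<lambda>g. restrict (Ad A g) (hminus (grd A))) (Ggrp A)"


section \<open>Cochains and admissible metrics\<close>

text \<open>An \<open>n\<close>-cochain is an alternating multilinear map on lists of length \<open>n\<close> over \<open>hminus\<close>, extended
  by 0 to all other lists.\<close>

definition cochain_args :: "(int \<Rightarrow> 'h::real_vector set) \<Rightarrow> nat \<Rightarrow> 'h list set" where
  "cochain_args gr n = {xs. length xs = n \<and> set xs \<subseteq> hminus gr}"

definition cochains :: "(int \<Rightarrow> 'h::real_vector set) \<Rightarrow> nat \<Rightarrow> ('h list \<Rightarrow> 'h) set" where
  "cochains gr n =
     {\<phi>. (\<forall>xs. xs \<notin> cochain_args gr n \<longrightarrow> \<phi> xs = 0) \<and>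
         (\<forall>xs\<in>cochain_args gr n. \<forall>i<n. \<forall>c. \<forall>x\<in>hminus gr. \<forall>y\<in>hminus gr.
            \<phi> (xs[i := c *\<^sub>R x + y]) = c *\<^sub>R \<phi> (xs[i := x]) + \<phi> (xs[i := y])) \<and>
         (\<forall>xs\<in>cochain_args gr n. \<not> distinct xs \<longrightarrow> \<phi> xs = 0)}"

definition drop_nth :: "nat \<Rightarrow> 'x list \<Rightarrow> 'x list" where
  "drop_nth i xs = take i xs @ drop (Suc i) xs"

definition lie_diff ::
    "('h::real_vector, 'g, 'a, 'b) model \<Rightarrow> nat \<Rightarrow> ('h list \<Rightarrow> 'h) \<Rightarrow> 'h list \<Rightarrow> 'h" where
  "lie_diff A n \<phi> xs =
     (if xs \<in> cochain_args (grd A) (Suc n) then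
        (\<Sum>i\<le>n. (-1) ^ i *\<^sub>R brk A (xs ! i) (\<phi> (drop_nth i xs)))
        + (\<Sum>j\<le>n. \<Sum>i<j. (-1) ^ (i + j) *\<^sub>R
             \<phi> (brk A (xs ! i) (xs ! j) # drop_nth i (drop_nth j xs)))
      else 0)"

definition euclidean_metric :: "('h::real_vector \<Rightarrow> 'h \<Rightarrow> real) \<Rightarrow> bool" where
  "euclidean_metric ip \<longleftrightarrow>
     bilinear ip \<and> (\<forall>x y. ip x y = ip y x) \<and> (\<forall>x. x \<noteq> 0 \<longrightarrow> 0 < ip x x)"

definition adapted :: "(int \<Rightarrow> 'h set) \<Rightarrow> ('h \<Rightarrow> 'h \<Rightarrow> real) \<Rightarrow> bool" where
  "adapted gr ip \<longleftrightarrow> (\<forall>i j. i \<noteq> j \<longrightarrow> (\<forall>x\<in>gr i. \<forall>y\<in>gr j. ip x y = 0))"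

definition orthonormal_basis :: "('h::real_vector \<Rightarrow> 'h \<Rightarrow> real) \<Rightarrow> 'h set \<Rightarrow> 'h set \<Rightarrow> bool" where
  "orthonormal_basis ip V B \<longleftrightarrow>
     finite B \<and> B \<subseteq> V \<and> span B = V \<and> (\<forall>x\<in>B. \<forall>y\<in>B. ip x y = (if x = y then 1 else 0))"

text \<open>The induced metric on \<open>n\<close>-cochains.  Dividing the sum over all tuples of basis vectors by \<open>n!\<close>
  gives the sum over increasing tuples.\<close>

definition cochain_metric ::
    "(int \<Rightarrow> 'h::real_vector set) \<Rightarrow> ('h \<Rightarrow> 'h \<Rightarrow> real) \<Rightarrow> nat \<Rightarrow> ('h list \<Rightarrow> 'h) \<Rightarrow> ('h list \<Rightarrow> 'h) \<Rightarrow> real" where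
  "cochain_metric gr ip n \<phi> \<psi> =
     (let B = (SOME B. orthonormal_basis ip (hminus gr) B) in
      (\<Sum>xs\<in>{xs. length xs = n \<and> set xs \<subseteq> B}. ip (\<phi> xs) (\<psi> xs)) / fact n)"

text \<open>The metric adjoint, from \<open>(n+1)\<close>-cochains to \<open>n\<close>-cochains, of the differential \<open>lie_diff A n\<close>.\<close>

definition adjoint_diff ::
    "('h::real_vector, 'g, 'a, 'b) model \<Rightarrow> ('h \<Rightarrow> 'h \<Rightarrow> real) \<Rightarrow> nat \<Rightarrow> ('h list \<Rightarrow> 'h) \<Rightarrow> 'h list \<Rightarrow> 'h" where
  "adjoint_diff A ip n \<phi> =
     (THE \<psi>. \<psi> \<in> cochains (grd A) n \<and>
        (\<forall>\<omega>\<in>cochains (grd A) n.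
           cochain_metric (grd A) ip n \<omega> \<psi> = cochain_metric (grd A) ip (Suc n) (lie_diff A n \<omega>) \<phi>))"

definition cochain_action ::
    "('h::real_vector, 'g, 'a::euclidean_space, 'b) model \<Rightarrow> nat \<Rightarrow> 'g \<Rightarrow> ('h list \<Rightarrow> 'h) \<Rightarrow> 'h list \<Rightarrow> 'h" where
  "cochain_action A n g \<phi> xs =
     (if xs \<in> cochain_args (grd A) n
      then Ad A g (\<phi> (map (Ad_minus A (m_inv (Hgrp A) g)) xs)) else 0)"

definition admissible_metric ::
    "('h::real_vector, 'g, 'a::euclidean_space, 'b) model \<Rightarrow> ('h \<Rightarrow> 'h \<Rightarrow> real) \<Rightarrow> bool" where
  "admissible_metric A ip \<longleftrightarrow>
     euclidean_metric ip \<and> adapted (grd A) ip \<and>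
     (\<forall>n. \<forall>g\<in>pts (Qmfd A). \<forall>\<phi>\<in>cochains (grd A) (Suc n).
        adjoint_diff A ip n (cochain_action A (Suc n) g \<phi>)
          = cochain_action A n g (adjoint_diff A ip n \<phi>))"


section \<open>Principal bundles and Cartan connections\<close>

record ('p, 'c, 'm, 'd, 'g) pbundle =
  total :: "('p, 'c) mfd"
  base :: "('m, 'd) mfd"
  bproj :: "'p \<Rightarrow> 'm"
  ract :: "'p \<Rightarrow> 'g \<Rightarrow> 'p"

definition principal_bundle ::
    "'g monoid \<Rightarrow> ('g, 'b::euclidean_space) mfd
      \<Rightarrow> ('p, 'c::euclidean_space, 'm, 'd::euclidean_space, 'g) pbundle \<Rightarrow> bool" where
  "principal_bundle Q QM P \<longleftrightarrow>
     smooth_manifold (total P) \<and> smooth_manifold (base P) \<and> smooth_map (total P) (base P) (bproj P) \<and>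
     smooth_map (prod_mfd (total P) QM) (total P) (\<lambda>(u, q). ract P u q) \<and>
     (\<forall>u\<in>pts (total P). ract P u \<one>\<^bsub>Q\<^esub> = u \<and>
        (\<forall>q\<in>carrier Q. \<forall>r\<in>carrier Q. ract P (ract P u q) r = ract P u (q \<otimes>\<^bsub>Q\<^esub> r)) \<and>
        (\<forall>q\<in>carrier Q. bproj P (ract P u q) = bproj P u)) \<and>
     (\<forall>x\<in>pts (base P). \<exists>U \<Phi>. openin (mtop (base P)) U \<and> x \<in> U \<and>
        diffeo (prod_mfd (open_submfd (base P) U) QM)
               (open_submfd (total P) {u \<in> pts (total P). bproj P u \<in> U}) \<Phi> \<and>
        (\<forall>y\<in>U. \<forall>q\<in>carrier Q. bproj P (\<Phi> (y, q)) = y \<and>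
           (\<forall>r\<in>carrier Q. \<Phi> (y, q \<otimes>\<^bsub>Q\<^esub> r) = ract P (\<Phi> (y, q)) r)))"

text \<open>In the second clause, the argument of \<open>\<kappa> u\<close> is the value at \<open>u\<close> of the fundamental vector field
  of \<open>lieQ A v\<close>, the derivative of \<open>q \<mapsto> u \<cdot> q\<close> at the identity applied to \<open>v\<close>.\<close>

definition cartan_connection ::
    "('h::euclidean_space, 'g, 'a::euclidean_space, 'b::euclidean_space) model
      \<Rightarrow> ('p, 'c::euclidean_space, 'm, 'd, 'g) pbundle \<Rightarrow> ('p \<Rightarrow> 'c \<Rightarrow> 'h) \<Rightarrow> bool" where
  "cartan_connection A P \<kappa> \<longleftrightarrow>
     one_form (total P) \<kappa> \<and>
     (\<forall>u\<in>pts (total P). \<forall>v.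
        \<kappa> u (mderiv (Qmfd A) (total P) (ract P u) \<one>\<^bsub>Hgrp A\<^esub> v) = lieQ A v) \<and>
     (\<forall>u\<in>pts (total P). bij (\<kappa> u)) \<and>
     (\<forall>g\<in>pts (Qmfd A). \<forall>u\<in>pts (total P). \<forall>v.
        \<kappa> (ract P u g) (mderiv (total P) (total P) (\<lambda>w. ract P w g) u v)
          = Ad A (m_inv (Hgrp A) g) (\<kappa> u v))"

definition const_field :: "('p \<Rightarrow> 'c \<Rightarrow> 'h) \<Rightarrow> 'h \<Rightarrow> 'p \<Rightarrow> 'c" where
  "const_field \<kappa> a u = inv_into UNIV (\<kappa> u) a"

definition curvature ::
    "('h::euclidean_space, 'g, 'a, 'b) model \<Rightarrow> ('p, 'c::euclidean_space, 'm, 'd, 'g) pbundle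
      \<Rightarrow> ('p \<Rightarrow> 'c \<Rightarrow> 'h) \<Rightarrow> 'p \<Rightarrow> 'c \<Rightarrow> 'c \<Rightarrow> 'h" where
  "curvature A P \<kappa> u v w = ext_deriv (total P) \<kappa> u v w + brk A (\<kappa> u v) (\<kappa> u w)"

definition curvature_fun ::
    "('h::euclidean_space, 'g, 'a, 'b) model \<Rightarrow> ('p, 'c::euclidean_space, 'm, 'd, 'g) pbundle
      \<Rightarrow> ('p \<Rightarrow> 'c \<Rightarrow> 'h) \<Rightarrow> 'p \<Rightarrow> 'h list \<Rightarrow> 'h" where
  "curvature_fun A P \<kappa> u xs =
     (if xs \<in> cochain_args (grd A) 2
      then curvature A P \<kappa> u (const_field \<kappa> (xs ! 0) u) (const_field \<kappa> (xs ! 1) u) else 0)"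

definition regular_cartan_connection ::
    "('h::euclidean_space, 'g, 'a::euclidean_space, 'b::euclidean_space) model
      \<Rightarrow> ('p, 'c::euclidean_space, 'm, 'd, 'g) pbundle \<Rightarrow> ('p \<Rightarrow> 'c \<Rightarrow> 'h) \<Rightarrow> bool" where
  "regular_cartan_connection A P \<kappa> \<longleftrightarrow>
     cartan_connection A P \<kappa> \<and>
     (\<forall>u\<in>pts (total P). \<forall>i<0. \<forall>j<0. \<forall>a\<in>grd A i. \<forall>b\<in>grd A j.
        curvature_fun A P \<kappa> u [a, b] \<in> hfilt (grd A) (i + j + 1))"

definition normal_cartan_connection ::
    "('h::euclidean_space, 'g, 'a::euclidean_space, 'b::euclidean_space) model \<Rightarrow> ('h \<Rightarrow> 'h \<Rightarrow> real)
      \<Rightarrow> ('p, 'c::euclidean_space, 'm, 'd, 'g) pbundle \<Rightarrow> ('p \<Rightarrow> 'c \<Rightarrow> 'h) \<Rightarrow> bool" where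
  "normal_cartan_connection A ip P \<kappa> \<longleftrightarrow>
     regular_cartan_connection A P \<kappa> \<and>
     (\<forall>u\<in>pts (total P). adjoint_diff A ip 1 (curvature_fun A P \<kappa> u) = (\<lambda>_. 0))"


section \<open>Tanaka structures\<close>

definition distribution :: "('m, 'd::euclidean_space) mfd \<Rightarrow> ('m \<Rightarrow> 'd set) \<Rightarrow> bool" where
  "distribution M D \<longleftrightarrow>
     (\<forall>x\<in>pts M. \<exists>W n X. openin (mtop M) W \<and> x \<in> W \<and> (\<forall>i<(n::nat). smooth_field M W (X i)) \<and>
        (\<forall>y\<in>W. D y = span ((\<lambda>i. X i y) ` {..<n}) \<and> dim (D y) = n))"

definition section_on ::
    "('m, 'd::euclidean_space) mfd \<Rightarrow> ('m \<Rightarrow> 'd set) \<Rightarrow> 'm set \<Rightarrow> ('m \<Rightarrow> 'd) \<Rightarrow> bool" where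
  "section_on M D W X \<longleftrightarrow> smooth_field M W X \<and> (\<forall>y\<in>W. X y \<in> D y)"

fun iterated_commutator ::
    "('m, 'd::euclidean_space) mfd \<Rightarrow> ('m \<Rightarrow> 'd) list \<Rightarrow> 'm \<Rightarrow> 'd" where
  "iterated_commutator M [] = (\<lambda>_. 0)"
| "iterated_commutator M [X] = X"
| "iterated_commutator M (X # Y # Zs) = commutator M X (iterated_commutator M (Y # Zs))"

text \<open>\<open>derived_dist M D j x\<close> is the value at \<open>x\<close> of the \<open>(-j)\<close>-th member of the filtration generated by
  \<open>D\<close>, which is 0 for \<open>j = 0\<close> and \<open>D\<close> for \<open>j = 1\<close>.\<close>

definition derived_dist ::
    "('m, 'd::euclidean_space) mfd \<Rightarrow> ('m \<Rightarrow> 'd set) \<Rightarrow> nat \<Rightarrow> 'm \<Rightarrow> 'd set" where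
  "derived_dist M D j x =
     (if j = 0 then {0}
      else span (D x \<union>
        {iterated_commutator M Xs x | Xs W. 2 \<le> length Xs \<and> length Xs \<le> j \<and>
           openin (mtop M) W \<and> x \<in> W \<and> (\<forall>X\<in>set Xs. section_on M D W X)}))"

text \<open>Elements of the quotient of consecutive members of the filtration are cosets of the smaller one.\<close>

definition coset_of :: "'d::real_vector set \<Rightarrow> 'd \<Rightarrow> 'd set" where
  "coset_of V v = (\<lambda>w. v + w) ` V"

definition gr_space ::
    "('m, 'd::euclidean_space) mfd \<Rightarrow> ('m \<Rightarrow> 'd set) \<Rightarrow> nat \<Rightarrow> 'm \<Rightarrow> 'd set set" where
  "gr_space M D j x = coset_of (derived_dist M D (j - 1) x) ` derived_dist M D j x"

definition gr_bracket ::
    "('m, 'd::euclidean_space) mfd \<Rightarrow> ('m \<Rightarrow> 'd set) \<Rightarrow> 'm \<Rightarrow> nat \<Rightarrow> nat \<Rightarrow> 'd set \<Rightarrow> 'd set \<Rightarrow> 'd set" where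
  "gr_bracket M D x i j S T =
     {commutator M X Y x + w | X Y W w. openin (mtop M) W \<and> x \<in> W \<and>
        section_on M (derived_dist M D i) W X \<and> section_on M (derived_dist M D j) W Y \<and>
        X x \<in> S \<and> Y x \<in> T \<and> w \<in> derived_dist M D (i + j - 1) x}"

text \<open>\<open>F\<close> is a graded Lie algebra isomorphism from \<open>hminus\<close> onto the graded Lie algebra of \<open>D\<close> at \<open>x\<close>;
  \<open>F i\<close> is its component in degree \<open>-i\<close>.  The second clause is linearity, expressed on cosets.\<close>

definition gr_iso ::
    "('h::real_vector, 'g, 'a, 'b) model \<Rightarrow> ('m, 'd::euclidean_space) mfd \<Rightarrow> ('m \<Rightarrow> 'd set) \<Rightarrow> 'm
      \<Rightarrow> (nat \<Rightarrow> 'h \<Rightarrow> 'd set) \<Rightarrow> bool" where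
  "gr_iso A M D x F \<longleftrightarrow>
     (\<forall>i\<ge>1. bij_betw (F i) (grd A (- int i)) (gr_space M D i x)) \<and>
     (\<forall>i\<ge>1. \<forall>c. \<forall>a\<in>grd A (- int i). \<forall>b\<in>grd A (- int i).
        F i (c *\<^sub>R a + b) = {c *\<^sub>R v + w | v w. v \<in> F i a \<and> w \<in> F i b}) \<and>
     (\<forall>i\<ge>1. \<forall>j\<ge>1. \<forall>a\<in>grd A (- int i). \<forall>b\<in>grd A (- int j).
        F (i + j) (brk A a b) = gr_bracket M D x i j (F i a) (F j b))"

definition regular_distribution ::
    "('h::real_vector, 'g, 'a, 'b) model \<Rightarrow> ('m, 'd::euclidean_space) mfd \<Rightarrow> ('m \<Rightarrow> 'd set) \<Rightarrow> bool" where
  "regular_distribution A M D \<longleftrightarrow> distribution M D \<and> (\<forall>x\<in>pts M. \<exists>F. gr_iso A M D x F)"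

text \<open>An adapted frame \<open>f : grd A (-1) \<rightarrow> D x\<close> is undefined outside of \<open>grd A (-1)\<close>.\<close>

definition adapted_frames ::
    "('h::real_vector, 'g, 'a, 'b) model \<Rightarrow> ('m, 'd::euclidean_space) mfd \<Rightarrow> ('m \<Rightarrow> 'd set)
      \<Rightarrow> ('m \<times> ('h \<Rightarrow> 'd)) set" where
  "adapted_frames A M D =
     {(x, f). x \<in> pts M \<and> f \<in> extensional (grd A (-1)) \<and>
        (\<exists>F. gr_iso A M D x F \<and> (\<forall>a\<in>grd A (-1). F 1 a = {f a}))}"

text \<open>A principal \<open>G\<close>-subbundle (reduction to \<open>G\<close>) of the bundle of adapted frames: the fibres are
  orbits of \<open>G\<close>, acting by \<open>f \<cdot> g = f \<circ> Ad g\<close>, and there are local smooth sections.  The action is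
  free because \<open>G\<close> acts effectively.\<close>

definition tanaka_structure ::
    "('h::real_vector, 'g, 'a::euclidean_space, 'b) model \<Rightarrow> ('m, 'd::euclidean_space) mfd
      \<Rightarrow> ('m \<Rightarrow> 'd set) \<Rightarrow> ('m \<times> ('h \<Rightarrow> 'd)) set \<Rightarrow> bool" where
  "tanaka_structure A M D PG \<longleftrightarrow>
     regular_distribution A M D \<and> PG \<subseteq> adapted_frames A M D \<and>
     (\<forall>x f. (x, f) \<in> PG \<longrightarrow>
        {f'. (x, f') \<in> PG} = {restrict (f \<circ> Ad A g) (grd A (-1)) | g. g \<in> Ggrp A}) \<and>
     (\<forall>x\<in>pts M. \<exists>W s. openin (mtop M) W \<and> x \<in> W \<and> (\<forall>y\<in>W. (y, s y) \<in> PG) \<and>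
        (\<forall>a\<in>grd A (-1). smooth_field M W (\<lambda>y. s y a)))"

text \<open>\<open>\<pi>\<^sub>*(\<kappa>\<inverse>(hfilt i))\<close>, with value 0 for \<open>i \<ge> 0\<close>.\<close>

definition induced_filtration ::
    "('h::real_vector, 'g, 'a, 'b) model \<Rightarrow> ('p, 'c::euclidean_space, 'm, 'd::euclidean_space, 'g) pbundle
      \<Rightarrow> ('p \<Rightarrow> 'c \<Rightarrow> 'h) \<Rightarrow> int \<Rightarrow> 'm \<Rightarrow> 'd set" where
  "induced_filtration A P \<kappa> i x =
     (if i \<ge> 0 then {0}
      else {mderiv (total P) (base P) (bproj P) u (const_field \<kappa> a u) | u a.
              u \<in> pts (total P) \<and> bproj P u = x \<and> a \<in> hfilt (grd A) i})"

text \<open>No quotient is needed in degree \<open>-1\<close>, since the next member of the filtration is 0.\<close>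

definition induced_frame ::
    "('h::real_vector, 'g, 'a, 'b) model \<Rightarrow> ('p, 'c::euclidean_space, 'm, 'd::euclidean_space, 'g) pbundle
      \<Rightarrow> ('p \<Rightarrow> 'c \<Rightarrow> 'h) \<Rightarrow> 'p \<Rightarrow> 'h \<Rightarrow> 'd" where
  "induced_frame A P \<kappa> u =
     restrict (\<lambda>a. mderiv (total P) (base P) (bproj P) u (const_field \<kappa> a u)) (grd A (-1))"

definition N_orbit ::
    "('h, 'g, 'a, 'b) model \<Rightarrow> ('p, 'c, 'm, 'd, 'g) pbundle \<Rightarrow> 'p \<Rightarrow> 'p set" where
  "N_orbit A P u = ract P u ` Ngrp A"

text \<open>\<open>\<kappa>\<close> induces the Tanaka structure \<open>(D, PG)\<close>, where the orbit space \<open>P/N\<close> is identified with \<open>PG\<close>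
  by the map \<open>j\<close> into the bundle of adapted frames.\<close>

definition induces_tanaka ::
    "('h::real_vector, 'g, 'a, 'b) model \<Rightarrow> ('p, 'c::euclidean_space, 'm, 'd::euclidean_space, 'g) pbundle
      \<Rightarrow> ('p \<Rightarrow> 'c \<Rightarrow> 'h) \<Rightarrow> ('m \<Rightarrow> 'd set) \<Rightarrow> ('m \<times> ('h \<Rightarrow> 'd)) set
      \<Rightarrow> ('p set \<Rightarrow> 'm \<times> ('h \<Rightarrow> 'd)) \<Rightarrow> bool" where
  "induces_tanaka A P \<kappa> D PG j \<longleftrightarrow>
     (\<forall>x\<in>pts (base P). D x = induced_filtration A P \<kappa> (-1) x) \<and>
     (\<forall>u\<in>pts (total P). j (N_orbit A P u) = (bproj P u, induced_frame A P \<kappa> u)) \<and>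
     bij_betw j (N_orbit A P ` pts (total P)) PG"

end

theory Submission
  imports Defs
begin

text \<open>
  A change of the connection that keeps the Tanaka structure replaces \<open>\<kappa>\<close> by \<open>(1 + \<phi>) \<circ> \<kappa>\<close>, where
  \<open>\<phi>\<close> is a \<open>Q\<close>-equivariant field of \<open>1\<close>-cochains of positive homogeneity: such a \<open>\<phi>\<close> alters the
  constant fields of degree \<open>-1\<close> by vertical fields only.  If \<open>\<psi>\<close> has homogeneity \<open>r\<close>, adding \<open>\<psi>\<close> to \<open>\<phi>\<close>
  changes the curvature by \<open>\<partial>\<psi>\<close> modulo homogeneity \<open>r + 1\<close>, so one wants to solve \<open>\<partial>\<^sup>*\<partial>\<psi> = - \<partial>\<^sup>*K\<close>
  successively in each homogeneity.  On the image of \<open>\<partial>\<^sup>*\<close> (\<open>coexact\<close>) the operator \<open>\<partial>\<^sup>*\<partial>\<close> is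
  invertible and respects the homogeneity (\<open>coexact_right_inverse\<close>, \<open>coexact_cofilt1\<close>), so there is
  exactly one solution with values in \<open>coexact\<close>.

  The operator \<open>\<partial>\<^sup>*\<partial>\<close> does not commute with \<open>Q\<close>, so a solution obtained in this way pointwise on the
  bundle is not visibly equivariant; but the derivative of a non-equivariant \<open>\<phi>\<close> in vertical directions has
  the wrong homogeneity and would spoil the recursion.  The recursion is therefore run with a formal
  curvature (\<open>fcurv\<close>), in which the vertical derivatives of \<open>\<phi>\<close> are replaced by the algebraic
  expressions that they equal for equivariant \<open>\<phi>\<close>.  It has the same leading term
  (\<open>fcurv_perturb\<close>) and is transformed by \<open>Q\<close> as a curvature is, up to the failure of equivariance of
  \<open>\<phi>\<close> (\<open>fcurv_transform\<close>).  This gives a global solution \<open>\<phi>\<close> without local sections or gluing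
  (\<open>formal_normalization\<close>).  Its translates \<open>q \<cdot> \<phi>\<close> have values in \<open>coexact\<close> again, since \<open>\<partial>\<^sup>*\<close> is
  \<open>Q\<close>-invariant.  If they agree with \<open>\<phi>\<close> up to homogeneity \<open>r\<close>, they are solutions up to homogeneity
  \<open>r + 1\<close>, and by uniqueness they agree with \<open>\<phi>\<close> up to homogeneity \<open>r + 1\<close>.  Hence \<open>\<phi>\<close> is equivariant
  (\<open>formal_solution_equivariant\<close>) and the formal curvature is the curvature (\<open>curv_deform\<close>).

  Besides this algebra, the argument uses that the curvature of \<open>\<kappa>\<close> is horizontal and equivariant
  (\<open>curv_horizontal\<close>, \<open>curv_equivariant\<close>) and that \<open>Ad\<close> maps \<open>Q\<close> to automorphisms of the filtered Lie
  algebra (\<open>AdB_bracket\<close>, \<open>AdB_hfilt\<close>), for which the derivative of \<open>Ad\<close> at the identity has to be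
  found from the definition of the bracket by left invariant fields (\<open>deriv_adj\<close>).
\<close>

section \<open>Calculus of smooth maps between normed spaces\<close>

lemma Ck_on_cong:
  assumes "open S"
  shows "(\<And>x. x \<in> S \<Longrightarrow> f x = g x) \<Longrightarrow> Ck_on n S f \<Longrightarrow> Ck_on n S g"
proof (induction n arbitrary: f g)
  case 0
  then show ?case using continuous_on_cong[of S S f g] by auto
next
  case (Suc n)
  have d: "(g has_derivative frechet_derivative f (at x)) (at x)" if "x \<in> S" for x
  proof -
    have "(f has_derivative frechet_derivative f (at x)) (at x)"
      using Suc.prems that by (simp add: frechet_derivative_works)
    then show ?thesis
      by (rule has_derivative_transform_within_open[OF _ assms that]) (use Suc.prems(1) in blast)
  qed
  have eq: "frechet_derivative f (at x) v = frechet_derivative g (at x) v" if "x \<in> S" for x v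
    using frechet_derivative_at[OF d[OF that]] by simp
  have "Ck_on n S (\<lambda>x. frechet_derivative g (at x) v)" for v
    by (rule Suc.IH[OF eq]) (use Suc.prems(2) in auto)
  moreover have "g differentiable (at x)" if "x \<in> S" for x
    using d[OF that] by (auto simp: differentiable_def)
  ultimately show ?case by simp
qed

lemma Ck_on_Suc:
  assumes "open S" "\<And>x. x \<in> S \<Longrightarrow> (f has_derivative F x) (at x)"
    and "\<And>v. Ck_on n S (\<lambda>x. F x v)"
  shows "Ck_on (Suc n) S f"
proof -
  have eq: "F x v = frechet_derivative f (at x) v" if "x \<in> S" for x v
    using frechet_derivative_at[OF assms(2)[OF that]] by simp
  have "Ck_on n S (\<lambda>x. frechet_derivative f (at x) v)" for v
    by (rule Ck_on_cong[OF assms(1) eq assms(3)])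
  then show ?thesis
    using assms(2) by (auto simp: differentiable_def)
qed

lemma Ck_on_derivative:
  assumes "Ck_on (Suc n) S f" "x \<in> S"
  shows "(f has_derivative frechet_derivative f (at x)) (at x)"
  using assms by (simp add: frechet_derivative_works)

lemma Ck_on_subset: "Ck_on n S f \<Longrightarrow> T \<subseteq> S \<Longrightarrow> Ck_on n T f"
  by (induction n arbitrary: f) (auto intro: continuous_on_subset)

lemma Ck_on_imp_lower: "Ck_on (Suc n) S f \<Longrightarrow> Ck_on n S f"
proof (induction n arbitrary: f)
  case 0
  then show ?case
    by (auto intro!: continuous_at_imp_continuous_on differentiable_imp_continuous_within)
qed auto

lemma Ck_on_imp_continuous: "Ck_on n S f \<Longrightarrow> continuous_on S f"
proof (induction n)
  case (Suc n)
  then show ?case using Ck_on_imp_lower by blast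
qed simp

lemma Ck_on_locally:
  assumes "\<And>x. x \<in> S \<Longrightarrow> \<exists>U. open U \<and> x \<in> U \<and> Ck_on n U f" "open S"
  shows "Ck_on n S f"
  using assms(1)
proof (induction n arbitrary: f)
  case 0
  then have "\<And>x. x \<in> S \<Longrightarrow> continuous (at x) f"
    using continuous_on_eq_continuous_at by (metis Ck_on.simps(1))
  then show ?case by (simp add: continuous_at_imp_continuous_on)
next
  case (Suc n)
  have "f differentiable (at x)" if "x \<in> S" for x using Suc.prems[OF that] by auto
  moreover have "Ck_on n S (\<lambda>x. frechet_derivative f (at x) v)" for v
  proof (rule Suc.IH)
    fix x assume "x \<in> S"
    from Suc.prems[OF this] show "\<exists>U. open U \<and> x \<in> U \<and> Ck_on n U (\<lambda>x. frechet_derivative f (at x) v)"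
      by (auto intro: exI)
  qed
  ultimately show ?case by auto
qed

lemma Ck_on_const: "Ck_on n S (\<lambda>x. c)"
  by (induction n arbitrary: c) auto

lemma Ck_on_bounded_linear:
  assumes "bounded_linear L" "open S"
  shows "Ck_on n S f \<Longrightarrow> Ck_on n S (\<lambda>x. L (f x))"
proof (induction n arbitrary: f)
  case 0
  then show ?case by (simp add: assms(1) bounded_linear.continuous_on)
next
  case (Suc n)
  show ?case
  proof (rule Ck_on_Suc[OF assms(2)])
    show "((\<lambda>x. L (f x)) has_derivative (\<lambda>v. L (frechet_derivative f (at x) v))) (at x)" if "x \<in> S" for x
      by (rule bounded_linear.has_derivative[OF assms(1) Ck_on_derivative[OF Suc.prems that]])
    show "Ck_on n S (\<lambda>x. L (frechet_derivative f (at x) v))" for v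
      by (rule Suc.IH) (use Suc.prems in simp)
  qed
qed

lemma Ck_on_id: "open S \<Longrightarrow> Ck_on n S (\<lambda>x. x)"
  by (cases n) (auto intro!: Ck_on_Suc[where F = "\<lambda>x v. v"] Ck_on_const)

lemma Ck_on_add:
  assumes "open S"
  shows "Ck_on n S f \<Longrightarrow> Ck_on n S g \<Longrightarrow> Ck_on n S (\<lambda>x. f x + g x)"
proof (induction n arbitrary: f g)
  case 0
  then show ?case by (simp add: continuous_on_add)
next
  case (Suc n)
  show ?case
  proof (rule Ck_on_Suc[OF assms])
    show "((\<lambda>x. f x + g x) has_derivative
        (\<lambda>v. frechet_derivative f (at x) v + frechet_derivative g (at x) v)) (at x)" if "x \<in> S" for x
      using Ck_on_derivative[OF Suc.prems(1) that] Ck_on_derivative[OF Suc.prems(2) that]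
      by (rule has_derivative_add)
    show "Ck_on n S (\<lambda>x. frechet_derivative f (at x) v + frechet_derivative g (at x) v)" for v
      by (rule Suc.IH) (use Suc.prems in simp_all)
  qed
qed

lemma Ck_on_sum:
  assumes "open S" "\<And>i. i \<in> I \<Longrightarrow> Ck_on n S (f i)"
  shows "Ck_on n S (\<lambda>x. \<Sum>i\<in>I. f i x)"
  using assms(2) by (induction I rule: infinite_finite_induct) (auto intro: Ck_on_add assms Ck_on_const)

lemma Ck_on_bilinear:
  assumes "bounded_bilinear B" "open S"
  shows "Ck_on n S f \<Longrightarrow> Ck_on n S g \<Longrightarrow> Ck_on n S (\<lambda>x. B (f x) (g x))"
proof (induction n arbitrary: f g)
  case 0
  then show ?case by (simp add: assms(1) bounded_bilinear.continuous_on)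
next
  case (Suc n)
  show ?case
  proof (rule Ck_on_Suc[OF assms(2)])
    show "((\<lambda>x. B (f x) (g x)) has_derivative
        (\<lambda>v. B (f x) (frechet_derivative g (at x) v) + B (frechet_derivative f (at x) v) (g x))) (at x)"
      if "x \<in> S" for x
      using Ck_on_derivative[OF Suc.prems(1) that] Ck_on_derivative[OF Suc.prems(2) that]
      by (rule bounded_bilinear.FDERIV[OF assms(1)])
    show "Ck_on n S (\<lambda>x. B (f x) (frechet_derivative g (at x) v) + B (frechet_derivative f (at x) v) (g x))" for v
      using Suc.prems by (intro Ck_on_add Suc.IH assms(2) Ck_on_imp_lower[OF Suc.prems(1)] Ck_on_imp_lower[OF Suc.prems(2)]) simp_all
  qed
qed

text \<open>The chain rule expresses the derivative of \<open>g \<circ> f\<close> through the partial derivatives of \<open>g\<close>,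
  to which the induction hypothesis applies.\<close>

lemma Ck_on_compose:
  fixes f :: "'a::real_normed_vector \<Rightarrow> 'b::euclidean_space"
  assumes "open S" "open T"
  shows "Ck_on n T g \<Longrightarrow> Ck_on n S f \<Longrightarrow> f ` S \<subseteq> T \<Longrightarrow> Ck_on n S (\<lambda>x. g (f x))"
proof (induction n arbitrary: g)
  case 0
  then show ?case by (auto intro: continuous_on_compose2)
next
  case (Suc n)
  let ?G = "\<lambda>x v. \<Sum>b\<in>Basis. (frechet_derivative f (at x) v \<bullet> b) *\<^sub>R frechet_derivative g (at (f x)) b"
  have G: "?G x v = frechet_derivative g (at (f x)) (frechet_derivative f (at x) v)" if "x \<in> S" for x v
  proof -
    have "linear (frechet_derivative g (at (f x)))"
      using Suc.prems that by (auto intro: linear_frechet_derivative)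
    then show ?thesis
      by (subst (3) euclidean_representation[symmetric]) (simp add: linear_sum linear_cmul)
  qed
  show ?case
  proof (rule Ck_on_Suc[OF assms(1)])
    show "((\<lambda>x. g (f x)) has_derivative ?G x) (at x)" if "x \<in> S" for x
    proof -
      have "(g has_derivative frechet_derivative g (at (f x))) (at (f x))"
        using Ck_on_derivative[OF Suc.prems(1)] that Suc.prems(3) by auto
      from has_derivative_compose[OF Ck_on_derivative[OF Suc.prems(2) that] this]
      show ?thesis by (simp add: G[OF that, abs_def])
    qed
    show "Ck_on n S (\<lambda>x. ?G x v)" for v
    proof (intro Ck_on_sum assms Ck_on_bilinear[OF bounded_bilinear_scaleR])
      show "Ck_on n S (\<lambda>x. frechet_derivative f (at x) v \<bullet> b)" for b
        by (rule Ck_on_bounded_linear[OF bounded_linear_inner_left assms(1)]) (use Suc.prems in simp)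
      show "Ck_on n S (\<lambda>x. frechet_derivative g (at (f x)) b)" for b
        by (rule Suc.IH) (use Suc.prems Ck_on_imp_lower[OF Suc.prems(2)] in simp_all)
    qed
  qed
qed

lemma smooth_on_cong: "open S \<Longrightarrow> smooth_on S f \<Longrightarrow> (\<And>x. x \<in> S \<Longrightarrow> f x = g x) \<Longrightarrow> smooth_on S g"
  unfolding smooth_on_def using Ck_on_cong by metis

lemma smooth_on_subset: "smooth_on S f \<Longrightarrow> T \<subseteq> S \<Longrightarrow> smooth_on T f"
  unfolding smooth_on_def using Ck_on_subset by blast

lemma smooth_on_derivative:
  "smooth_on S f \<Longrightarrow> x \<in> S \<Longrightarrow> (f has_derivative frechet_derivative f (at x)) (at x)"
  unfolding smooth_on_def using Ck_on_derivative by blast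

lemma smooth_on_frechet:
  "smooth_on S f \<Longrightarrow> smooth_on S (\<lambda>x. frechet_derivative f (at x) v)"
  unfolding smooth_on_def by (metis Ck_on.simps(2))

lemma smooth_on_continuous: "smooth_on S f \<Longrightarrow> continuous_on S f"
  unfolding smooth_on_def using Ck_on_imp_continuous by blast

lemma smooth_on_locally:
  "open S \<Longrightarrow> (\<And>x. x \<in> S \<Longrightarrow> \<exists>U. open U \<and> x \<in> U \<and> smooth_on U f) \<Longrightarrow> smooth_on S f"
  unfolding smooth_on_def by (intro allI Ck_on_locally) blast+

lemma smooth_on_const [simp]: "smooth_on S (\<lambda>x. c)"
  by (simp add: smooth_on_def Ck_on_const)

lemma smooth_on_id: "open S \<Longrightarrow> smooth_on S (\<lambda>x. x)"
  by (simp add: smooth_on_def Ck_on_id)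

lemma smooth_on_bounded_linear:
  "bounded_linear L \<Longrightarrow> open S \<Longrightarrow> smooth_on S f \<Longrightarrow> smooth_on S (\<lambda>x. L (f x))"
  by (simp add: smooth_on_def Ck_on_bounded_linear)

lemma smooth_on_add:
  "open S \<Longrightarrow> smooth_on S f \<Longrightarrow> smooth_on S g \<Longrightarrow> smooth_on S (\<lambda>x. f x + g x)"
  by (simp add: smooth_on_def Ck_on_add)

lemma smooth_on_minus: "open S \<Longrightarrow> smooth_on S f \<Longrightarrow> smooth_on S (\<lambda>x. - f x)"
  using smooth_on_bounded_linear[OF bounded_linear_minus[OF bounded_linear_ident]] .

lemma smooth_on_diff:
  "open S \<Longrightarrow> smooth_on S f \<Longrightarrow> smooth_on S g \<Longrightarrow> smooth_on S (\<lambda>x. f x - g x)"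
  using smooth_on_add[OF _ _ smooth_on_minus, of S f g] by simp

lemma smooth_on_sum:
  "open S \<Longrightarrow> (\<And>i. i \<in> I \<Longrightarrow> smooth_on S (f i)) \<Longrightarrow> smooth_on S (\<lambda>x. \<Sum>i\<in>I. f i x)"
  by (simp add: smooth_on_def Ck_on_sum)

lemma smooth_on_bilinear:
  "bounded_bilinear B \<Longrightarrow> open S \<Longrightarrow> smooth_on S f \<Longrightarrow> smooth_on S g \<Longrightarrow> smooth_on S (\<lambda>x. B (f x) (g x))"
  by (simp add: smooth_on_def Ck_on_bilinear)

lemma smooth_on_compose:
  fixes f :: "'a::real_normed_vector \<Rightarrow> 'b::euclidean_space"
  shows "open S \<Longrightarrow> open T \<Longrightarrow> smooth_on T g \<Longrightarrow> smooth_on S f \<Longrightarrow> f ` S \<subseteq> T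
    \<Longrightarrow> smooth_on S (\<lambda>x. g (f x))"
  unfolding smooth_on_def using Ck_on_compose by blast

lemma smooth_on_Pair:
  "open S \<Longrightarrow> smooth_on S f \<Longrightarrow> smooth_on S g \<Longrightarrow> smooth_on S (\<lambda>x. (f x, g x))"
  using smooth_on_add[of S "\<lambda>x. (f x, 0)" "\<lambda>x. (0, g x)"]
    smooth_on_bounded_linear[of "\<lambda>x. (x, 0)" S f] smooth_on_bounded_linear[of "\<lambda>x. (0, x)" S g]
  by (simp add: bounded_linear_Pair bounded_linear_zero bounded_linear_ident)


lemma open_preimage_line:
  fixes x v w :: "'a::real_normed_vector"
  assumes "open S" "x \<in> S"
  obtains h where "h > 0" "\<And>s t. 0 \<le> s \<Longrightarrow> s \<le> h \<Longrightarrow> 0 \<le> t \<Longrightarrow> t \<le> h \<Longrightarrow> x + s *\<^sub>R v + t *\<^sub>R w \<in> S"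
proof -
  obtain e where e: "e > 0" "ball x e \<subseteq> S"
    using assms by (meson openE)
  define h where "h = e / (2 * (norm v + norm w + 1))"
  have pos: "norm v + norm w + 1 > 0" by (smt (verit) norm_ge_zero)
  have "h > 0" using e pos by (simp add: h_def)
  moreover have "x + s *\<^sub>R v + t *\<^sub>R w \<in> S" if "0 \<le> s" "s \<le> h" "0 \<le> t" "t \<le> h" for s t
  proof -
    have "norm (s *\<^sub>R v + t *\<^sub>R w) \<le> s * norm v + t * norm w"
      using norm_triangle_ineq[of "s *\<^sub>R v" "t *\<^sub>R w"] that by simp
    also have "\<dots> \<le> h * norm v + h * norm w"
      using that by (intro add_mono mult_right_mono) auto
    also have "\<dots> \<le> h * (norm v + norm w + 1)"
      using \<open>h > 0\<close> by (simp add: algebra_simps)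
    also have "\<dots> = e / 2" using pos by (simp add: h_def field_simps)
    also have "\<dots> < e" using e by simp
    finally have "dist (x + (s *\<^sub>R v + t *\<^sub>R w)) x < e"
      by (simp add: dist_norm)
    then have "x + (s *\<^sub>R v + t *\<^sub>R w) \<in> ball x e" by (simp add: dist_commute)
    then show ?thesis using e by (auto simp: add.assoc)
  qed
  ultimately show ?thesis using that by blast
qed

text \<open>By the mean value theorem in each variable.  The left side is symmetric in \<open>v\<close> and \<open>w\<close>, which
  makes the two mixed second derivatives agree at nearby points.\<close>

lemma second_difference:
  fixes g :: "'a::real_normed_vector \<Rightarrow> real"
  assumes g: "Ck_on (Suc (Suc 0)) S g" and h: "h > 0"
    and S: "\<And>s t. 0 \<le> s \<Longrightarrow> s \<le> h \<Longrightarrow> 0 \<le> t \<Longrightarrow> t \<le> h \<Longrightarrow> x + s *\<^sub>R v + t *\<^sub>R w \<in> S"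
  shows "\<exists>s t. 0 < s \<and> s < h \<and> 0 < t \<and> t < h \<and>
    g (x + h *\<^sub>R v + h *\<^sub>R w) - g (x + h *\<^sub>R v) - g (x + h *\<^sub>R w) + g x =
    h * (h * frechet_derivative (\<lambda>y. frechet_derivative g (at y) v) (at (x + s *\<^sub>R v + t *\<^sub>R w)) w)"
proof -
  let ?Dg = "\<lambda>y. frechet_derivative g (at y)"
  let ?D2 = "\<lambda>y. frechet_derivative (\<lambda>y. ?Dg y v) (at y)"
  define F where "F s = g (x + s *\<^sub>R v + h *\<^sub>R w) - g (x + s *\<^sub>R v + 0 *\<^sub>R w)" for s
  have d1: "((\<lambda>s. g (x + s *\<^sub>R v + t *\<^sub>R w)) has_derivative (\<lambda>r. r * ?Dg (x + s *\<^sub>R v + t *\<^sub>R w) v)) (at s)"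
    if "0 \<le> s" "s \<le> h" "0 \<le> t" "t \<le> h" for s t
  proof -
    have D: "(g has_derivative ?Dg (x + s *\<^sub>R v + t *\<^sub>R w)) (at (x + s *\<^sub>R v + t *\<^sub>R w))"
      using Ck_on_derivative[OF g S] that by blast
    have "((\<lambda>s. x + s *\<^sub>R v + t *\<^sub>R w) has_derivative (\<lambda>r. r *\<^sub>R v)) (at s)"
      by (auto intro!: derivative_eq_intros)
    from has_derivative_compose[OF this D]
    show ?thesis using linear_cmul[OF has_derivative_linear[OF D]] by simp
  qed
  have "DERIV F s :> ?Dg (x + s *\<^sub>R v + h *\<^sub>R w) v - ?Dg (x + s *\<^sub>R v + 0 *\<^sub>R w) v"
    if "0 \<le> s" "s \<le> h" for s
    unfolding F_def has_field_derivative_def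
    using has_derivative_diff[OF d1[of s h] d1[of s 0]] that h
    by (simp add: right_diff_distrib[symmetric] mult_commute_abs)
  from MVT2[OF h this] obtain s where s: "0 < s" "s < h"
    "F h - F 0 = h * (?Dg (x + s *\<^sub>R v + h *\<^sub>R w) v - ?Dg (x + s *\<^sub>R v + 0 *\<^sub>R w) v)"
    by auto
  have "DERIV (\<lambda>t. ?Dg (x + s *\<^sub>R v + t *\<^sub>R w) v) t :> ?D2 (x + s *\<^sub>R v + t *\<^sub>R w) w"
    if t: "0 \<le> t" "t \<le> h" for t
  proof -
    have D: "((\<lambda>y. ?Dg y v) has_derivative ?D2 (x + s *\<^sub>R v + t *\<^sub>R w)) (at (x + s *\<^sub>R v + t *\<^sub>R w))"
      using Ck_on_derivative[of 0 S "\<lambda>y. ?Dg y v"] g S[of s t] t s by auto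
    have "((\<lambda>t. x + s *\<^sub>R v + t *\<^sub>R w) has_derivative (\<lambda>r. r *\<^sub>R w)) (at t)"
      by (auto intro!: derivative_eq_intros)
    from has_derivative_compose[OF this D]
    show ?thesis unfolding has_field_derivative_def
      using linear_cmul[OF has_derivative_linear[OF D]] by (simp add: mult_commute_abs)
  qed
  from MVT2[OF h this] obtain t where t: "0 < t" "t < h"
    "?Dg (x + s *\<^sub>R v + h *\<^sub>R w) v - ?Dg (x + s *\<^sub>R v + 0 *\<^sub>R w) v = h * ?D2 (x + s *\<^sub>R v + t *\<^sub>R w) w"
    by auto
  have "F h - F 0 = g (x + h *\<^sub>R v + h *\<^sub>R w) - g (x + h *\<^sub>R v) - g (x + h *\<^sub>R w) + g x"
    by (simp add: F_def)
  then show ?thesis using s t by (intro exI[of _ s] exI[of _ t]) simp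
qed

lemma second_derivative_symmetric_real:
  fixes g :: "'a::real_normed_vector \<Rightarrow> real"
  assumes g: "Ck_on (Suc (Suc 0)) S g" and S: "open S" and x: "x \<in> S"
  shows "frechet_derivative (\<lambda>y. frechet_derivative g (at y) v) (at x) w =
         frechet_derivative (\<lambda>y. frechet_derivative g (at y) w) (at x) v"
proof (rule ccontr)
  let ?A = "\<lambda>v w y. frechet_derivative (\<lambda>y. frechet_derivative g (at y) v) (at y) w"
  assume ne: "?A v w x \<noteq> ?A w v x"
  define e where "e = \<bar>?A v w x - ?A w v x\<bar> / 2"
  have e: "e > 0" using ne by (simp add: e_def)
  have cont: "continuous_on S (?A v w)" for v w using g by simp
  have nbhd: "\<exists>U. open U \<and> x \<in> U \<and> U \<subseteq> S \<and> (\<forall>y\<in>U. dist (?A v w y) (?A v w x) < e)" for v w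
  proof (intro exI conjI)
    show "open (S \<inter> ?A v w -` ball (?A v w x) e)"
      using cont S by (simp add: continuous_on_open_vimage Int_commute)
  qed (use x e in \<open>auto simp: dist_commute\<close>)
  obtain U where U: "open U" "x \<in> U" "U \<subseteq> S" "\<And>y. y \<in> U \<Longrightarrow> dist (?A v w y) (?A v w x) < e"
    using nbhd[of v w] by blast
  obtain V where V: "open V" "x \<in> V" "V \<subseteq> S" "\<And>y. y \<in> V \<Longrightarrow> dist (?A w v y) (?A w v x) < e"
    using nbhd[of w v] by blast
  have "open (U \<inter> V)" "x \<in> U \<inter> V" using U V by auto
  from open_preimage_line[OF this, of v w]
  obtain h where h: "h > 0"
    "\<And>s t. 0 \<le> s \<Longrightarrow> s \<le> h \<Longrightarrow> 0 \<le> t \<Longrightarrow> t \<le> h \<Longrightarrow> x + s *\<^sub>R v + t *\<^sub>R w \<in> U \<inter> V"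
    by blast
  have swap: "x + s *\<^sub>R w + t *\<^sub>R v = x + t *\<^sub>R v + s *\<^sub>R w" for s t :: real
    by (simp only: add.assoc add.commute[of "s *\<^sub>R w"])
  obtain s t where st: "0 < s" "s < h" "0 < t" "t < h"
    "g (x + h *\<^sub>R v + h *\<^sub>R w) - g (x + h *\<^sub>R v) - g (x + h *\<^sub>R w) + g x = h * (h * ?A v w (x + s *\<^sub>R v + t *\<^sub>R w))"
    using second_difference[OF g h(1), of x v w] h(2) U(3) by blast
  have "x + s *\<^sub>R w + t *\<^sub>R v \<in> S" if "0 \<le> s" "s \<le> h" "0 \<le> t" "t \<le> h" for s t
    using h(2)[of t s] that U(3) unfolding swap[of s t] by blast
  from second_difference[OF g h(1) this]
  obtain s' t' where st': "0 < s'" "s' < h" "0 < t'" "t' < h"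
    "g (x + h *\<^sub>R w + h *\<^sub>R v) - g (x + h *\<^sub>R w) - g (x + h *\<^sub>R v) + g x = h * (h * ?A w v (x + s' *\<^sub>R w + t' *\<^sub>R v))"
    by blast
  have "h * (h * ?A v w (x + s *\<^sub>R v + t *\<^sub>R w)) = h * (h * ?A w v (x + s' *\<^sub>R w + t' *\<^sub>R v))"
    using st(5) st'(5) unfolding swap by linarith
  then have eq: "?A v w (x + s *\<^sub>R v + t *\<^sub>R w) = ?A w v (x + s' *\<^sub>R w + t' *\<^sub>R v)"
    using h(1) by (simp del: mult_cancel_left add: mult_left_cancel)
  have "x + s *\<^sub>R v + t *\<^sub>R w \<in> U" using h(2)[of s t] st(1-4) by simp
  moreover have "x + s' *\<^sub>R w + t' *\<^sub>R v \<in> V"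
    unfolding swap using h(2)[of t' s'] st'(1-4) by simp
  ultimately have "dist (?A v w (x + s *\<^sub>R v + t *\<^sub>R w)) (?A v w x) < e" "dist (?A w v (x + s' *\<^sub>R w + t' *\<^sub>R v)) (?A w v x) < e"
    using U(4) V(4) by blast+
  then have "\<bar>?A v w x - ?A w v x\<bar> < 2 * e" using eq by (simp add: dist_real_def)
  then show False by (simp add: e_def)
qed

lemma second_derivative_symmetric:
  fixes f :: "'a::real_normed_vector \<Rightarrow> 'b::euclidean_space"
  assumes f: "smooth_on S f" and S: "open S" and x: "x \<in> S"
  shows "frechet_derivative (\<lambda>y. frechet_derivative f (at y) v) (at x) w =
         frechet_derivative (\<lambda>y. frechet_derivative f (at y) w) (at x) v"
proof (rule euclidean_eqI)
  fix b :: 'b assume "b \<in> Basis"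
  have sm: "smooth_on S (\<lambda>y. f y \<bullet> b)"
    by (rule smooth_on_bounded_linear[OF bounded_linear_inner_left S f])
  have i: "frechet_derivative (\<lambda>y. g y \<bullet> b) (at y) v = frechet_derivative g (at y) v \<bullet> b"
    if "smooth_on S g" "y \<in> S" for g y v
    using frechet_derivative_at[OF bounded_linear.has_derivative[OF bounded_linear_inner_left
          smooth_on_derivative[OF that], of b]] by metis
  have *: "frechet_derivative (\<lambda>y. frechet_derivative (\<lambda>y. f y \<bullet> b) (at y) v) (at x) w
     = frechet_derivative (\<lambda>y. frechet_derivative f (at y) v) (at x) w \<bullet> b" for v w
  proof -
    have "((\<lambda>y. frechet_derivative f (at y) v \<bullet> b) has_derivative
        (\<lambda>w. frechet_derivative (\<lambda>y. frechet_derivative f (at y) v) (at x) w \<bullet> b)) (at x)"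
      by (rule bounded_linear.has_derivative[OF bounded_linear_inner_left
            smooth_on_derivative[OF smooth_on_frechet[OF f] x]])
    then have "((\<lambda>y. frechet_derivative (\<lambda>y. f y \<bullet> b) (at y) v) has_derivative
        (\<lambda>w. frechet_derivative (\<lambda>y. frechet_derivative f (at y) v) (at x) w \<bullet> b)) (at x)"
      by (rule has_derivative_transform_within_open[OF _ S x]) (simp add: i[OF f])
    then show ?thesis using frechet_derivative_at by metis
  qed
  have "Ck_on (Suc (Suc 0)) S (\<lambda>y. f y \<bullet> b)" using sm unfolding smooth_on_def by blast
  from second_derivative_symmetric_real[OF this S x]
  show "frechet_derivative (\<lambda>y. frechet_derivative f (at y) v) (at x) w \<bullet> b =
        frechet_derivative (\<lambda>y. frechet_derivative f (at y) w) (at x) v \<bullet> b"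
    by (simp add: *)
qed

text \<open>Smoothness of a family of operators can be tested on basis vectors, because the operator is a finite
  sum of its values there, tensored with fixed functionals.\<close>

lemma smooth_on_blinfunI:
  fixes f :: "'a::real_normed_vector \<Rightarrow> 'b::euclidean_space \<Rightarrow>\<^sub>L 'v::real_normed_vector"
  assumes S: "open S" and f: "\<And>b. b \<in> Basis \<Longrightarrow> smooth_on S (\<lambda>x. f x b)"
  shows "smooth_on S f"
proof -
  have eq: "(\<Sum>b\<in>Basis. blinfun_scaleR_left (f x b) o\<^sub>L blinfun_inner_left b) = f x" for x
    by (rule blinfun_eqI) (subst (3) euclidean_representation[symmetric],
      simp add: blinfun.bilinear_simps inner_commute del: euclidean_representation)
  have "smooth_on S (\<lambda>x. \<Sum>b\<in>Basis. blinfun_scaleR_left (f x b) o\<^sub>L blinfun_inner_left b)"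
    by (intro smooth_on_sum S smooth_on_bounded_linear[OF _ S f]
        bounded_linear_compose[OF bounded_bilinear.bounded_linear_left[OF bounded_bilinear_blinfun_compose]]
        bounded_linear_blinfun_scaleR_left)
  then show ?thesis by (simp add: eq)
qed

lemma smooth_on_blinfun_apply:
  "open S \<Longrightarrow> smooth_on S f \<Longrightarrow> smooth_on S g \<Longrightarrow> smooth_on S (\<lambda>x. blinfun_apply (f x) (g x))"
  by (rule smooth_on_bilinear[OF bounded_bilinear_blinfun_apply])

text \<open>For mutually inverse \<open>A x\<close> and \<open>B x\<close>, the identity \<open>B y - B x = - B y (A y - A x) B x\<close> first gives
  continuity of \<open>B\<close> and then its derivative, as a polynomial in \<open>B\<close> and the derivative of \<open>A\<close>; so every order
  of differentiability of \<open>A\<close> passes to \<open>B\<close>.\<close>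

lemma continuous_on_blinfun_inverse:
  fixes A :: "'e::real_normed_vector \<Rightarrow> 'a::real_normed_vector \<Rightarrow>\<^sub>L 'b::real_normed_vector"
    and B :: "'e \<Rightarrow> 'b \<Rightarrow>\<^sub>L 'a"
  assumes S: "open S" and A: "continuous_on S A"
    and AB: "\<And>x z. x \<in> S \<Longrightarrow> A x (B x z) = z" and BA: "\<And>x z. x \<in> S \<Longrightarrow> B x (A x z) = z"
  shows "continuous_on S B"
proof (rule continuous_at_imp_continuous_on, rule ballI)
  fix x assume x: "x \<in> S"
  define K where "K = norm (B x) + 1"
  have K: "K > 0" by (simp add: K_def add_nonneg_pos)
  have ctsA: "(A \<longlongrightarrow> A x) (at x)"
    using A S x by (simp add: continuous_on_eq_continuous_at isCont_def)
  have ev: "eventually (\<lambda>y. y \<in> S \<and> norm (A y - A x) < 1 / (2 * K)) (at x)"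
    using eventually_at_topological S x tendstoD[OF ctsA, of "1 / (2 * K)"] K
    by (auto simp: dist_norm eventually_conj_iff)
  have bound: "norm (B y) \<le> 2 * K" if y: "y \<in> S" "norm (A y - A x) < 1 / (2 * K)" for y
  proof (rule norm_blinfun_bound)
    show "norm (B y z) \<le> 2 * K * norm z" for z
    proof -
      let ?u = "B y z"
      have "?u = B x (A x ?u)" using BA[OF x] by simp
      also have "A x ?u = z - (A y - A x) ?u" by (simp add: blinfun.diff_left AB[OF y(1)])
      finally have "norm ?u \<le> norm (B x) * norm (z - (A y - A x) ?u)"
        using norm_blinfun by metis
      also have "\<dots> \<le> K * (norm z + norm (A y - A x) * norm ?u)"
        using norm_triangle_ineq4[of z "(A y - A x) ?u"] norm_blinfun[of "A y - A x" ?u]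
        by (intro mult_mono) (auto simp: K_def)
      also have "\<dots> \<le> K * (norm z + 1 / (2 * K) * norm ?u)"
        using y(2) K by (intro mult_left_mono add_left_mono mult_right_mono) auto
      also have "\<dots> = K * norm z + norm ?u / 2" using K by (simp add: field_simps)
      finally show ?thesis by simp
    qed
  qed (use K in simp)
  have id: "B y - B x = - (B y o\<^sub>L (A y - A x) o\<^sub>L B x)" if "y \<in> S" for y
    by (rule blinfun_eqI) (simp add: blinfun.bilinear_simps AB[OF x] BA[OF that])
  have "((\<lambda>y. 2 * K * norm (A y - A x) * K) \<longlongrightarrow> 2 * K * norm (A x - A x) * K) (at x)"
    by (intro tendsto_intros ctsA)
  moreover have "eventually (\<lambda>y. norm (B y - B x) \<le> 2 * K * norm (A y - A x) * K) (at x)"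
    using ev
  proof eventually_elim
    case (elim y)
    have "norm (B y - B x) = norm (B y o\<^sub>L (A y - A x) o\<^sub>L B x)" using id elim by simp
    also have "\<dots> \<le> norm (B y) * norm (A y - A x) * norm (B x)"
      by (meson norm_blinfun_compose mult_right_mono norm_ge_zero order_trans)
    also have "\<dots> \<le> 2 * K * norm (A y - A x) * K"
      using bound[of y] elim by (intro mult_mono) (auto simp: K_def add_nonneg_pos)
    finally show ?case .
  qed
  ultimately have "((\<lambda>y. B y - B x) \<longlongrightarrow> 0) (at x)"
    using Lim_null_comparison[of "\<lambda>y. B y - B x" "\<lambda>y. 2 * K * norm (A y - A x) * K" "at x"] by simp
  then show "isCont B x" by (simp add: isCont_def LIM_zero_iff)
qed

lemma has_derivative_blinfun_inverse:
  fixes A :: "'e::real_normed_vector \<Rightarrow> 'a::real_normed_vector \<Rightarrow>\<^sub>L 'b::real_normed_vector"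
    and B :: "'e \<Rightarrow> 'b \<Rightarrow>\<^sub>L 'a"
  assumes S: "open S" and x: "x \<in> S" and A: "(A has_derivative A') (at x)" and B: "continuous_on S B"
    and AB: "\<And>x z. x \<in> S \<Longrightarrow> A x (B x z) = z" and BA: "\<And>x z. x \<in> S \<Longrightarrow> B x (A x z) = z"
  shows "(B has_derivative (\<lambda>v. - (B x o\<^sub>L A' v o\<^sub>L B x))) (at x)"
proof -
  have id: "B y - B x = - (B y o\<^sub>L (A y - A x) o\<^sub>L B x)" if "y \<in> S" for y
    by (rule blinfun_eqI) (simp add: blinfun.bilinear_simps AB[OF x] BA[OF that])
  have ctsB: "(B \<longlongrightarrow> B x) (at x)"
    using B S x by (simp add: continuous_on_eq_continuous_at isCont_def)
  have "((\<lambda>y. - (B y o\<^sub>L (A y - A x) o\<^sub>L B x)) has_derivative (\<lambda>v. - (B x o\<^sub>L A' v o\<^sub>L B x))) (at x)"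
  proof -
    have lin: "bounded_linear (\<lambda>v. - (B x o\<^sub>L A' v o\<^sub>L B x))"
      using has_derivative_bounded_linear[OF A]
      by (intro bounded_linear_minus bounded_linear_compose[OF bounded_bilinear.bounded_linear_left[OF bounded_bilinear_blinfun_compose]]
          bounded_linear_compose[OF bounded_bilinear.bounded_linear_right[OF bounded_bilinear_blinfun_compose]])
    obtain R where R: "\<And>y. A y - A x = A' (y - x) + R y" "((\<lambda>y. R y /\<^sub>R norm (y - x)) \<longlongrightarrow> 0) (at x)"
      using A by (auto simp: has_derivative_at_within intro: that[of "\<lambda>y. A y - A x - A' (y - x)"]
          simp: algebra_simps)
    obtain C where C: "C > 0" "\<And>v. norm (A' v) \<le> norm v * C"
      using bounded_linear.pos_bounded[OF has_derivative_bounded_linear[OF A]] by blast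
    have lim: "((\<lambda>y. norm (B y - B x) * C * norm (B x) + norm (B y) * norm (R y /\<^sub>R norm (y - x)) * norm (B x)) \<longlongrightarrow>
        norm (B x - B x) * C * norm (B x) + norm (B x) * norm (0::'a \<Rightarrow>\<^sub>L 'b) * norm (B x)) (at x)"
      by (intro tendsto_intros ctsB R(2))
    have bd: "norm ((- (B y o\<^sub>L (A y - A x) o\<^sub>L B x) - - (B x o\<^sub>L A' (y - x) o\<^sub>L B x)) /\<^sub>R norm (y - x))
       \<le> norm (B y - B x) * C * norm (B x) + norm (B y) * norm (R y /\<^sub>R norm (y - x)) * norm (B x)"
      if "y \<noteq> x" for y
    proof -
      let ?n = "norm (y - x)"
      have n: "?n > 0" using that by simp
      have "- (B y o\<^sub>L (A y - A x) o\<^sub>L B x) - - (B x o\<^sub>L A' (y - x) o\<^sub>L B x)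
         = - ((B y - B x) o\<^sub>L A' (y - x) o\<^sub>L B x) - (B y o\<^sub>L R y o\<^sub>L B x)"
        unfolding R(1) by (rule blinfun_eqI) (simp add: blinfun.bilinear_simps)
      then have "norm (- (B y o\<^sub>L (A y - A x) o\<^sub>L B x) - - (B x o\<^sub>L A' (y - x) o\<^sub>L B x))
        \<le> norm ((B y - B x) o\<^sub>L A' (y - x) o\<^sub>L B x) + norm (B y o\<^sub>L R y o\<^sub>L B x)"
        using norm_triangle_ineq4[of "- ((B y - B x) o\<^sub>L A' (y - x) o\<^sub>L B x)"] by simp
      also have "\<dots> \<le> norm (B y - B x) * (?n * C) * norm (B x) + norm (B y) * norm (R y) * norm (B x)"
      proof (intro add_mono)
        have "norm ((B y - B x) o\<^sub>L A' (y - x)) \<le> norm (B y - B x) * (?n * C)"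
          using norm_blinfun_compose[of "B y - B x" "A' (y - x)"] C(2)[of "y - x"]
          by (meson mult_left_mono norm_ge_zero order_trans)
        then show "norm ((B y - B x) o\<^sub>L A' (y - x) o\<^sub>L B x) \<le> norm (B y - B x) * (?n * C) * norm (B x)"
          by (meson norm_blinfun_compose mult_right_mono norm_ge_zero order_trans)
        show "norm (B y o\<^sub>L R y o\<^sub>L B x) \<le> norm (B y) * norm (R y) * norm (B x)"
          by (meson norm_blinfun_compose mult_right_mono norm_ge_zero order_trans)
      qed
      also have "\<dots> = ?n * (norm (B y - B x) * C * norm (B x) + norm (B y) * norm (R y /\<^sub>R ?n) * norm (B x))"
        using n by (simp add: field_simps)
      finally have "norm (- (B y o\<^sub>L (A y - A x) o\<^sub>L B x) - - (B x o\<^sub>L A' (y - x) o\<^sub>L B x)) / ?n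
        \<le> norm (B y - B x) * C * norm (B x) + norm (B y) * norm (R y /\<^sub>R ?n) * norm (B x)"
        using n by (simp only: pos_divide_le_eq mult.commute)
      then show ?thesis by (simp add: divide_inverse mult.commute)
    qed
    have "eventually (\<lambda>y. norm ((- (B y o\<^sub>L (A y - A x) o\<^sub>L B x) - - (B x o\<^sub>L A' (y - x) o\<^sub>L B x)) /\<^sub>R norm (y - x))
       \<le> norm (B y - B x) * C * norm (B x) + norm (B y) * norm (R y /\<^sub>R norm (y - x)) * norm (B x)) (at x)"
      unfolding eventually_at_topological using bd by blast
    then have "((\<lambda>y. (- (B y o\<^sub>L (A y - A x) o\<^sub>L B x) - - (B x o\<^sub>L A' (y - x) o\<^sub>L B x)) /\<^sub>R norm (y - x)) \<longlongrightarrow> 0) (at x)"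
      by (rule Lim_null_comparison) (use lim in simp)
    then show ?thesis
      using lin by (simp add: has_derivative_at_within algebra_simps)
  qed
  then have "((\<lambda>y. B y - B x) has_derivative (\<lambda>v. - (B x o\<^sub>L A' v o\<^sub>L B x))) (at x)"
    by (rule has_derivative_transform_within_open[OF _ S x]) (simp add: id)
  from has_derivative_add[OF this has_derivative_const[of "B x"]] show ?thesis by simp
qed

lemma smooth_on_blinfun_inverse:
  fixes A :: "'e::real_normed_vector \<Rightarrow> 'a::real_normed_vector \<Rightarrow>\<^sub>L 'b::real_normed_vector"
    and B :: "'e \<Rightarrow> 'b \<Rightarrow>\<^sub>L 'a"
  assumes S: "open S" and A: "smooth_on S A"
    and AB: "\<And>x z. x \<in> S \<Longrightarrow> A x (B x z) = z" and BA: "\<And>x z. x \<in> S \<Longrightarrow> B x (A x z) = z"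
  shows "smooth_on S B"
proof -
  have B: "continuous_on S B"
    by (rule continuous_on_blinfun_inverse[OF S smooth_on_continuous[OF A] AB BA])
  have "Ck_on n S B" for n
  proof (induction n)
    case (Suc n)
    show ?case
    proof (rule Ck_on_Suc[OF S])
      show "(B has_derivative (\<lambda>v. - (B x o\<^sub>L frechet_derivative A (at x) v o\<^sub>L B x))) (at x)" if "x \<in> S" for x
        by (rule has_derivative_blinfun_inverse[OF S that smooth_on_derivative[OF A that] B AB BA])
      show "Ck_on n S (\<lambda>x. - (B x o\<^sub>L frechet_derivative A (at x) v o\<^sub>L B x))" for v
        using smooth_on_frechet[OF A, of v] unfolding smooth_on_def
        by (intro Ck_on_bounded_linear[OF bounded_linear_minus[OF bounded_linear_ident] S]
            Ck_on_bilinear[OF bounded_bilinear_blinfun_compose S] Suc) auto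
    qed
  qed (use B in simp)
  then show ?thesis by (simp add: smooth_on_def)
qed

section \<open>Graded Lie algebras and their filtration\<close>

locale graded_lie =
  fixes br :: "'h::euclidean_space \<Rightarrow> 'h \<Rightarrow> 'h" and gr :: "int \<Rightarrow> 'h set" and k l :: int
  assumes graded: "graded_lie_algebra br gr k l"
begin

lemma br_bounded: "bounded_bilinear br"
  using graded by (simp add: graded_lie_algebra_def lie_bracket_def bilinear_conv_bounded_bilinear)

sublocale br: bounded_bilinear br by (rule br_bounded)

lemma br_self [simp]: "br x x = 0"
  using graded by (simp add: graded_lie_algebra_def lie_bracket_def)

lemma br_anti: "br x y = - br y x"
proof -
  have "br (x + y) (x + y) = 0" by (rule br_self)
  then show ?thesis unfolding br.add_left br.add_right by (simp add: eq_neg_iff_add_eq_0 add.commute)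
qed

lemma gr_subspace: "subspace (gr i)"
  using graded by (simp add: graded_lie_algebra_def)

lemma gr_trivial: "i < - k \<or> l < i \<Longrightarrow> gr i = {0}"
  using graded unfolding graded_lie_algebra_def by blast

lemma br_gr: "x \<in> gr i \<Longrightarrow> y \<in> gr j \<Longrightarrow> br x y \<in> gr (i + j)"
  using graded by (simp add: graded_lie_algebra_def)

definition component :: "int \<Rightarrow> 'h \<Rightarrow> 'h" where
  "component i x = (THE f. (\<forall>i. f i \<in> gr i) \<and> x = (\<Sum>i=-k..l. f i)) i"

lemma component_ex1: "\<exists>!f. (\<forall>i. f i \<in> gr i) \<and> x = (\<Sum>i=-k..l. f i)"
  using graded unfolding graded_lie_algebra_def by blast

lemma component_in [simp]: "component i x \<in> gr i"
  and component_sum: "(\<Sum>i=-k..l. component i x) = x"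
  using theI'[OF component_ex1[of x]] unfolding component_def by auto

lemma component_unique:
  assumes "\<And>i. f i \<in> gr i" "x = (\<Sum>i=-k..l. f i)"
  shows "component i x = f i"
proof -
  have "(THE f. (\<forall>i. f i \<in> gr i) \<and> x = (\<Sum>i=-k..l. f i)) = f"
    using the1_equality[OF component_ex1[of x]] assms by blast
  then show ?thesis by (simp add: component_def)
qed

lemma linear_component: "linear (component i)"
proof (rule linearI)
  fix x y :: 'h and c :: real
  show "component i (x + y) = component i x + component i y"
    by (rule component_unique[where f = "\<lambda>i. component i x + component i y"])
      (simp_all add: sum.distrib component_sum subspace_add gr_subspace)
  show "component i (c *\<^sub>R x) = c *\<^sub>R component i x"
    by (rule component_unique[where f = "\<lambda>i. c *\<^sub>R component i x"])
      (simp_all add: component_sum subspace_scale gr_subspace flip: scaleR_sum_right)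
qed

lemma component_0 [simp]: "component i 0 = 0"
  and component_add: "component i (x + y) = component i x + component i y"
  and component_diff: "component i (x - y) = component i x - component i y"
  and component_minus: "component i (- x) = - component i x"
  and component_scaleR: "component i (c *\<^sub>R x) = c *\<^sub>R component i x"
  and component_of_sum: "component i (sum f S) = (\<Sum>a\<in>S. component i (f a))"
  using linear_component[of i]
  by (simp_all add: linear_0 linear_add linear_diff linear_neg linear_cmul linear_sum)

lemma component_gr:
  assumes "x \<in> gr i"
  shows "component j x = (if j = i then x else 0)"
proof (cases "i \<in> {-k..l}")
  case True
  then show ?thesis
    by (intro component_unique) (auto simp: assms subspace_0 gr_subspace)
next
  case False
  then have "x = 0" using assms gr_trivial[of i] by auto
  then show ?thesis by simp
qed

lemma component_component: "component j (component i x) = (if j = i then component i x else 0)"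
  by (simp add: component_gr)

lemma component_out: "i < - k \<or> l < i \<Longrightarrow> component i x = 0"
  using component_in[of i x] gr_trivial[of i] by auto

lemma component_eqI: "(\<And>i. component i x = component i y) \<Longrightarrow> x = y"
  by (subst component_sum[of x, symmetric], subst component_sum[of y, symmetric]) simp

lemma component_span_gr:
  assumes "x \<in> span (\<Union>i\<in>I. gr i)" "j \<notin> I"
  shows "component j x = 0"
  using assms(1)
proof (induction rule: span_induct)
  case base
  show ?case
    by (auto simp: subspace_def component_add component_scaleR)
next
  case (step x)
  then obtain i where "i \<in> I" "x \<in> gr i" by auto
  then show ?case using assms(2) component_gr by auto
qed

lemma in_span_gr_iff: "x \<in> span (\<Union>i\<in>I. gr i) \<longleftrightarrow> (\<forall>j. j \<notin> I \<longrightarrow> component j x = 0)"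
proof
  assume 0: "\<forall>j. j \<notin> I \<longrightarrow> component j x = 0"
  have *: "component j x \<in> span (\<Union>i\<in>I. gr i)" for j
  proof (cases "j \<in> I")
    case True
    then show ?thesis using component_in[of j x] by (intro span_base) blast
  qed (simp add: 0 span_zero)
  then have "(\<Sum>j=-k..l. component j x) \<in> span (\<Union>i\<in>I. gr i)"
    by (intro span_sum *)
  then show "x \<in> span (\<Union>i\<in>I. gr i)" by (simp add: component_sum)
qed (use component_span_gr in blast)

lemma hfilt_iff: "x \<in> hfilt gr i \<longleftrightarrow> (\<forall>j<i. component j x = 0)"
  unfolding hfilt_def by (simp add: in_span_gr_iff not_le)

lemma hminus_iff: "x \<in> hminus gr \<longleftrightarrow> (\<forall>j\<ge>0. component j x = 0)"
  unfolding hminus_def by (simp add: in_span_gr_iff not_less)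

lemma hfilt_subspace: "subspace (hfilt gr i)"
  unfolding hfilt_def by (rule subspace_span)

lemma hminus_subspace: "subspace (hminus gr)"
  unfolding hminus_def by (rule subspace_span)

lemmas hfilt_0 [simp] = subspace_0[OF hfilt_subspace]
  and hfilt_add = subspace_add[OF hfilt_subspace]
  and hfilt_diff = subspace_diff[OF hfilt_subspace]
  and hfilt_neg = subspace_neg[OF hfilt_subspace]
  and hfilt_scale = subspace_scale[OF hfilt_subspace]
  and hfilt_sum = subspace_sum[OF hfilt_subspace]

lemma hfilt_mono: "x \<in> hfilt gr i \<Longrightarrow> j \<le> i \<Longrightarrow> x \<in> hfilt gr j"
  by (auto simp: hfilt_iff)

lemma hfilt_gr: "x \<in> gr i \<Longrightarrow> j \<le> i \<Longrightarrow> x \<in> hfilt gr j"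
  by (auto simp: hfilt_iff component_gr)

lemma hfilt_top: "l < i \<Longrightarrow> x \<in> hfilt gr i \<Longrightarrow> x = 0"
  by (rule component_eqI) (metis component_0 component_out hfilt_iff linorder_not_less order_less_le_trans)

lemma hfilt_bot: "i \<le> - k \<Longrightarrow> x \<in> hfilt gr i"
  by (auto simp: hfilt_iff component_out)

lemma hfilt_br:
  assumes "x \<in> hfilt gr i" "y \<in> hfilt gr j"
  shows "br x y \<in> hfilt gr (i + j)"
proof -
  have "br (component a x) (component b y) \<in> hfilt gr (i + j)" for a b
  proof (cases "a < i \<or> b < j")
    case True
    then show ?thesis using assms by (auto simp: hfilt_iff br.zero_left br.zero_right)
  next
    case False
    then show ?thesis by (intro hfilt_gr[OF br_gr[OF component_in component_in]]) auto
  qed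
  then have "br (\<Sum>a=-k..l. component a x) (\<Sum>b=-k..l. component b y) \<in> hfilt gr (i + j)"
    unfolding br.sum_left br.sum_right by (intro hfilt_sum)
  then show ?thesis by (simp add: component_sum)
qed

text \<open>Bracketing with a homogeneous element shifts the degree of every component.\<close>

lemma component_br:
  assumes "x \<in> gr i"
  shows "component (i + j) (br x y) = br x (component j y)"
proof -
  have "component (i + j) (br x y) = component (i + j) (br x (\<Sum>a=-k..l. component a y))"
    by (simp add: component_sum)
  also have "\<dots> = (\<Sum>a=-k..l. if a = j then br x (component j y) else 0)"
    unfolding br.sum_right component_of_sum
    using assms by (intro sum.cong) (auto simp: component_gr[OF br_gr[OF assms component_in]])
  also have "\<dots> = br x (component j y)"
    using component_out[of j y] by (auto simp: br.zero_right)
  finally show ?thesis .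
qed

definition pr :: "'h \<Rightarrow> 'h" where
  "pr x = (\<Sum>i=-k..-1. component i x)"

lemma component_pr: "component j (pr x) = (if j < 0 then component j x else 0)"
proof -
  have "component j (pr x) = (\<Sum>i=-k..-1. if j = i then component j x else 0)"
    unfolding pr_def component_of_sum by (intro sum.cong) (auto simp: component_component)
  then show ?thesis using component_out[of j x] by auto
qed

lemma pr_hminus [simp]: "pr x \<in> hminus gr"
  by (simp add: hminus_iff component_pr)

lemma pr_diff_hfilt [simp]: "x - pr x \<in> hfilt gr 0"
  by (simp add: hfilt_iff component_diff component_pr)

lemma hminus_hfilt_eq_0: "x \<in> hminus gr \<Longrightarrow> x \<in> hfilt gr i \<Longrightarrow> 0 \<le> i \<Longrightarrow> x = 0"
  by (rule component_eqI) (metis component_0 hfilt_iff hminus_iff linorder_not_less order_less_le_trans)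

lemma proj_minus_eq: "proj_minus gr x = pr x"
  unfolding proj_minus_def
proof (rule the_equality)
  fix y assume y: "y \<in> hminus gr \<and> x - y \<in> hfilt gr 0"
  have "y - pr x = (x - pr x) - (x - y)" by simp
  then have "y - pr x \<in> hfilt gr 0" using y hfilt_diff pr_diff_hfilt by metis
  moreover have "y - pr x \<in> hminus gr"
    using y by (simp add: subspace_diff hminus_subspace)
  ultimately show "y = pr x" using hminus_hfilt_eq_0 by fastforce
qed simp

lemma linear_pr: "linear pr"
  unfolding pr_def by (intro linear_compose_sum ballI linear_component)

lemma pr_add: "pr (x + y) = pr x + pr y" and pr_diff: "pr (x - y) = pr x - pr y"
  and pr_scaleR: "pr (c *\<^sub>R x) = c *\<^sub>R pr x" and pr_0 [simp]: "pr 0 = 0"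
  using linear_pr by (simp_all add: linear_add linear_diff linear_cmul linear_0)

lemma pr_pr [simp]: "pr (pr x) = pr x"
  by (rule component_eqI) (simp add: component_pr)

lemma pr_id: "x \<in> hminus gr \<Longrightarrow> pr x = x"
  by (rule component_eqI) (simp add: component_pr hminus_iff)

lemma pr_eq_0_iff: "pr x = 0 \<longleftrightarrow> x \<in> hfilt gr 0"
proof
  assume "pr x = 0"
  then show "x \<in> hfilt gr 0" using pr_diff_hfilt[of x] by simp
next
  assume "x \<in> hfilt gr 0"
  then show "pr x = 0"
    by - (rule component_eqI, simp add: component_pr hfilt_iff)
qed

lemma pr_hfilt: "x \<in> hfilt gr i \<Longrightarrow> pr x \<in> hfilt gr i"
  by (simp add: hfilt_iff component_pr)

lemma pr_hfilt_nonneg: "x \<in> hfilt gr i \<Longrightarrow> 0 \<le> i \<Longrightarrow> pr x = 0"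
  by (simp add: pr_eq_0_iff hfilt_mono)

lemma pr_gr: "x \<in> gr i \<Longrightarrow> pr x = (if i < 0 then x else 0)"
  by (rule component_eqI) (auto simp: component_pr component_gr)

lemma gr_hminus: "x \<in> gr i \<Longrightarrow> i < 0 \<Longrightarrow> x \<in> hminus gr"
  by (simp add: hminus_iff component_gr)

lemma hminus_br:
  assumes "x \<in> hminus gr" "y \<in> hminus gr" shows "br x y \<in> hminus gr"
proof -
  have "br (component a x) (component b y) \<in> hminus gr" for a b
  proof (cases "a \<ge> 0 \<or> b \<ge> 0")
    case True
    then have "component a x = 0 \<or> component b y = 0" using assms by (auto simp: hminus_iff)
    then show ?thesis by (auto simp: br.zero_left br.zero_right subspace_0[OF hminus_subspace])
  next
    case False
    then show ?thesis by (intro gr_hminus[OF br_gr[OF component_in component_in]]) auto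
  qed
  then have "br (\<Sum>a=-k..l. component a x) (\<Sum>b=-k..l. component b y) \<in> hminus gr"
    unfolding br.sum_left br.sum_right by (intro subspace_sum[OF hminus_subspace])
  then show ?thesis by (simp add: component_sum)
qed

end

section \<open>Cochains as bounded linear maps\<close>

definition blinfun2 :: "('a::euclidean_space \<Rightarrow> 'b::euclidean_space \<Rightarrow> 'c::real_normed_vector) \<Rightarrow> 'a \<Rightarrow>\<^sub>L 'b \<Rightarrow>\<^sub>L 'c" where
  "blinfun2 f = Blinfun (\<lambda>x. Blinfun (f x))"

lemma blinfun_apply_Blinfun: "linear f \<Longrightarrow> blinfun_apply (Blinfun f) x = f x"
  for f :: "'a::euclidean_space \<Rightarrow> 'b::real_normed_vector"
  by (simp add: bounded_linear_Blinfun_apply linear_conv_bounded_linear)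

lemma blinfun2_apply:
  assumes "bilinear f" shows "blinfun_apply (blinfun_apply (blinfun2 f) x) y = f x y"
proof -
  have l: "linear (f x)" for x using assms by (simp add: bilinear_def)
  have "linear (\<lambda>x. Blinfun (f x))"
    by (rule linearI; rule blinfun_eqI)
      (simp_all add: blinfun_apply_Blinfun[OF l] blinfun.bilinear_simps bilinear_ladd[OF assms] bilinear_lmul[OF assms])
  then show ?thesis by (simp add: blinfun2_def blinfun_apply_Blinfun l)
qed

context graded_lie
begin

text \<open>Cochains on the negative part are encoded as maps on the whole Lie algebra that kill
  \<open>hfilt gr 0\<close>; this makes the action of \<open>Q\<close> on the quotient by \<open>hfilt gr 0\<close> composition with \<open>Ad\<close>.
  Homogeneity at least \<open>r\<close> is expressed by the filtration of the Lie algebra and not by its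
  grading, because \<open>Q\<close> preserves only the former.\<close>

definition cochain1 :: "('h \<Rightarrow>\<^sub>L 'h) \<Rightarrow> bool" where
  "cochain1 f \<longleftrightarrow> (\<forall>x. f (pr x) = f x)"

definition cochain2 :: "('h \<Rightarrow>\<^sub>L 'h \<Rightarrow>\<^sub>L 'h) \<Rightarrow> bool" where
  "cochain2 B \<longleftrightarrow> (\<forall>x. B x x = 0) \<and> (\<forall>x. B (pr x) = B x)"

definition cofilt1 :: "int \<Rightarrow> ('h \<Rightarrow>\<^sub>L 'h) \<Rightarrow> bool" where
  "cofilt1 r f \<longleftrightarrow> cochain1 f \<and> (\<forall>i. \<forall>x\<in>hfilt gr i. f x \<in> hfilt gr (i + r))"

definition cofilt2 :: "int \<Rightarrow> ('h \<Rightarrow>\<^sub>L 'h \<Rightarrow>\<^sub>L 'h) \<Rightarrow> bool" where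
  "cofilt2 r B \<longleftrightarrow> cochain2 B \<and>
     (\<forall>i j. \<forall>x\<in>hfilt gr i. \<forall>y\<in>hfilt gr j. B x y \<in> hfilt gr (i + j + r))"

lemma cochain1_hfilt: "cochain1 f \<Longrightarrow> x \<in> hfilt gr 0 \<Longrightarrow> f x = 0"
  by (metis cochain1_def pr_eq_0_iff blinfun.zero_right)

lemma cochain2_anti: "cochain2 B \<Longrightarrow> B x y = - B y x"
proof -
  assume B: "cochain2 B"
  then have "B (x + y) (x + y) = 0" by (simp add: cochain2_def)
  then show ?thesis using B
    by (simp add: blinfun.bilinear_simps cochain2_def eq_neg_iff_add_eq_0 add.commute)
qed

lemma cochain2_right: "cochain2 B \<Longrightarrow> B x (pr y) = B x y"
  by (metis cochain2_anti cochain2_def)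

lemma cochain2_hfilt: "cochain2 B \<Longrightarrow> x \<in> hfilt gr 0 \<Longrightarrow> B x y = 0"
  by (metis cochain2_def pr_eq_0_iff blinfun.zero_left blinfun.zero_right)

lemma cochain1_simps: "cochain1 0" "cochain1 f \<Longrightarrow> cochain1 g \<Longrightarrow> cochain1 (f + g)"
  "cochain1 f \<Longrightarrow> cochain1 g \<Longrightarrow> cochain1 (f - g)" "cochain1 f \<Longrightarrow> cochain1 (c *\<^sub>R f)" "cochain1 f \<Longrightarrow> cochain1 (- f)"
  by (simp_all add: cochain1_def blinfun.bilinear_simps)

lemma cofilt1_simps: "cofilt1 r 0" "cofilt1 r f \<Longrightarrow> cofilt1 r g \<Longrightarrow> cofilt1 r (f + g)"
  "cofilt1 r f \<Longrightarrow> cofilt1 r g \<Longrightarrow> cofilt1 r (f - g)" "cofilt1 r f \<Longrightarrow> cofilt1 r (c *\<^sub>R f)" "cofilt1 r f \<Longrightarrow> cofilt1 r (- f)"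
  unfolding cofilt1_def
  by (simp_all add: cochain1_simps blinfun.bilinear_simps hfilt_add hfilt_diff hfilt_scale hfilt_neg)

lemma cochain2_simps: "cochain2 0" "cochain2 f \<Longrightarrow> cochain2 g \<Longrightarrow> cochain2 (f + g)"
  "cochain2 f \<Longrightarrow> cochain2 g \<Longrightarrow> cochain2 (f - g)" "cochain2 f \<Longrightarrow> cochain2 (c *\<^sub>R f)"
  by (simp_all add: cochain2_def blinfun.bilinear_simps)

lemma cofilt2_simps: "cofilt2 r 0" "cofilt2 r f \<Longrightarrow> cofilt2 r g \<Longrightarrow> cofilt2 r (f + g)"
  "cofilt2 r f \<Longrightarrow> cofilt2 r g \<Longrightarrow> cofilt2 r (f - g)"
  unfolding cofilt2_def
  by (simp_all add: cochain2_simps blinfun.bilinear_simps hfilt_add hfilt_diff)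

lemma cofilt1_mono: "cofilt1 r f \<Longrightarrow> s \<le> r \<Longrightarrow> cofilt1 s f"
  unfolding cofilt1_def by (meson add_left_mono hfilt_mono)

lemma cofilt2_mono: "cofilt2 r f \<Longrightarrow> s \<le> r \<Longrightarrow> cofilt2 s f"
  unfolding cofilt2_def by (meson add_left_mono hfilt_mono)

lemma cofilt1_apply: "cofilt1 r f \<Longrightarrow> x \<in> hfilt gr i \<Longrightarrow> j \<le> i + r \<Longrightarrow> f x \<in> hfilt gr j"
  unfolding cofilt1_def by (meson hfilt_mono)

lemma cofilt2_apply:
  "cofilt2 r B \<Longrightarrow> x \<in> hfilt gr i \<Longrightarrow> y \<in> hfilt gr j \<Longrightarrow> m \<le> i + j + r \<Longrightarrow> B x y \<in> hfilt gr m"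
  unfolding cofilt2_def by (meson hfilt_mono)

lemma br_apply: "x \<in> hfilt gr i \<Longrightarrow> y \<in> hfilt gr j \<Longrightarrow> m \<le> i + j \<Longrightarrow> br x y \<in> hfilt gr m"
  using hfilt_br hfilt_mono by blast

lemma cofilt1_top: "cofilt1 r f \<Longrightarrow> l + k < r \<Longrightarrow> f = 0"
proof (rule blinfun_eqI)
  fix x assume f: "cofilt1 r f" "l + k < r"
  have "f x \<in> hfilt gr (- k + r)" using cofilt1_apply[OF f(1) hfilt_bot[of "-k" x]] by simp
  then show "f x = blinfun_apply 0 x" using hfilt_top[of "- k + r"] f(2) by simp
qed

text \<open>Arguments in \<open>hfilt gr 0\<close> are killed, so only negative degrees need to be checked.\<close>

lemma cofilt2I:
  assumes "cochain2 B"
    and "\<And>i j x y. i < 0 \<Longrightarrow> j < 0 \<Longrightarrow> x \<in> hfilt gr i \<Longrightarrow> y \<in> hfilt gr j \<Longrightarrow> x \<in> hminus gr \<Longrightarrow> y \<in> hminus gr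
      \<Longrightarrow> B x y \<in> hfilt gr (i + j + r)"
  shows "cofilt2 r B"
  unfolding cofilt2_def
proof (intro conjI allI ballI assms(1))
  fix i j x y assume x: "x \<in> hfilt gr i" and y: "y \<in> hfilt gr j"
  consider "i \<ge> 0" | "j \<ge> 0" | "i < 0" "j < 0" by linarith
  then show "B x y \<in> hfilt gr (i + j + r)"
  proof cases
    case 1
    then show ?thesis using cochain2_hfilt[OF assms(1) hfilt_mono[OF x]] by simp
  next
    case 2
    then show ?thesis
      using cochain2_hfilt[OF assms(1) hfilt_mono[OF y], of x] cochain2_anti[OF assms(1), of x y] by simp
  next
    case 3
    then have "B (pr x) (pr y) \<in> hfilt gr (i + j + r)"
      using assms(2) pr_hfilt x y pr_hminus by blast
    moreover have "B (pr x) (pr y) = B x y"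
      using assms(1) cochain2_right[OF assms(1)] by (simp add: cochain2_def)
    ultimately show ?thesis by simp
  qed
qed

definition lie_d :: "('h \<Rightarrow>\<^sub>L 'h) \<Rightarrow> 'h \<Rightarrow>\<^sub>L 'h \<Rightarrow>\<^sub>L 'h" where
  "lie_d f = blinfun2 (\<lambda>x y. br (pr x) (f (pr y)) - br (pr y) (f (pr x)) - f (br (pr x) (pr y)))"

lemma lie_d_apply: "lie_d f x y = br (pr x) (f (pr y)) - br (pr y) (f (pr x)) - f (br (pr x) (pr y))"
  unfolding lie_d_def
  by (rule blinfun2_apply) (simp add: bilinear_def, intro conjI allI linearI,
    simp_all add: pr_add pr_scaleR blinfun.bilinear_simps br.add_left br.add_right br.scaleR_left br.scaleR_right
      algebra_simps)

lemma lie_d_linear: "lie_d (f + g) = lie_d f + lie_d g" "lie_d (c *\<^sub>R f) = c *\<^sub>R lie_d f"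
    "lie_d (f - g) = lie_d f - lie_d g" "lie_d 0 = 0"
  by (intro blinfun_eqI; simp add: lie_d_apply blinfun.bilinear_simps br.add_right br.diff_right br.scaleR_right
      br.zero_right algebra_simps)+

lemma cochain2_lie_d: "cochain2 (lie_d f)"
  unfolding cochain2_def by (auto intro!: blinfun_eqI simp: lie_d_apply blinfun.bilinear_simps)

lemma cofilt2_lie_d:
  assumes "cofilt1 r f" shows "cofilt2 r (lie_d f)"
proof (rule cofilt2I[OF cochain2_lie_d])
  fix i j x y assume *: "x \<in> hfilt gr i" "y \<in> hfilt gr j" "x \<in> hminus gr" "y \<in> hminus gr"
  have "br x (f y) \<in> hfilt gr (i + j + r)" "br y (f x) \<in> hfilt gr (i + j + r)" "f (br x y) \<in> hfilt gr (i + j + r)"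
    by (rule br_apply[OF *(1) cofilt1_apply[OF assms *(2) order_refl]], simp,
        rule br_apply[OF *(2) cofilt1_apply[OF assms *(1) order_refl]], simp,
        rule cofilt1_apply[OF assms br_apply[OF *(1,2) order_refl]], simp)
  then show "lie_d f x y \<in> hfilt gr (i + j + r)"
    using * by (simp add: lie_d_apply pr_id hfilt_diff)
qed

end

section \<open>The formal curvature\<close>

context graded_lie
begin

definition unip :: "('h \<Rightarrow>\<^sub>L 'h) \<Rightarrow> 'h \<Rightarrow> 'h" where
  "unip \<phi> x = x + \<phi> x"

definition unip_inv :: "('h \<Rightarrow>\<^sub>L 'h) \<Rightarrow> 'h \<Rightarrow> 'h" where
  "unip_inv \<phi> = inv_into UNIV (unip \<phi>)"

text \<open>\<open>\<phi>\<close> raises the filtration, so knowing that \<open>x + \<phi> x\<close> and \<open>\<phi> x\<close> lie in a step of it improves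
  what is known about \<open>x\<close> by one step.\<close>

lemma unip_hfilt_iff:
  assumes "cofilt1 1 \<phi>" shows "unip \<phi> x \<in> hfilt gr i \<longleftrightarrow> x \<in> hfilt gr i"
proof
  assume "x \<in> hfilt gr i"
  then show "unip \<phi> x \<in> hfilt gr i"
    unfolding unip_def by (intro hfilt_add cofilt1_apply[OF assms]) auto
next
  assume *: "unip \<phi> x \<in> hfilt gr i"
  have "x \<in> hfilt gr (min i (int n - k))" for n
  proof (induction n)
    case 0
    then show ?case by (intro hfilt_bot) auto
  next
    case (Suc n)
    have "\<phi> x \<in> hfilt gr (min i (int (Suc n) - k))"
      by (rule cofilt1_apply[OF assms Suc]) auto
    then have "unip \<phi> x - \<phi> x \<in> hfilt gr (min i (int (Suc n) - k))"
      by (intro hfilt_diff hfilt_mono[OF *]) auto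
    then show ?case by (simp add: unip_def)
  qed
  from this[of "nat (i + k)"] show "x \<in> hfilt gr i"
    by (rule hfilt_mono) auto
qed

lemma linear_unip: "linear (unip \<phi>)"
  by (rule linearI) (simp_all add: unip_def blinfun.bilinear_simps scaleR_add_right)

lemma bij_unip:
  assumes "cofilt1 1 \<phi>" shows "bij (unip \<phi>)"
proof -
  have "x = 0" if "unip \<phi> x = 0" for x
    using unip_hfilt_iff[OF assms, of x "l + 1"] that hfilt_top[of "l + 1" x] by simp
  then have "inj (unip \<phi>)"
    using linear_injective_0[OF linear_unip] by blast
  then show ?thesis
    using linear_unip linear_injective_imp_surjective by (auto simp: bij_def)
qed

lemma unip_unip_inv: "cofilt1 1 \<phi> \<Longrightarrow> unip \<phi> (unip_inv \<phi> a) = a"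
  unfolding unip_inv_def by (simp add: bij_is_surj bij_unip surj_f_inv_f)

lemma unip_inv_unique: "cofilt1 1 \<phi> \<Longrightarrow> unip \<phi> x = a \<Longrightarrow> unip_inv \<phi> a = x"
  unfolding unip_inv_def by (simp add: bij_is_inj bij_unip inv_f_eq)

lemma linear_unip_inv: "cofilt1 1 \<phi> \<Longrightarrow> linear (unip_inv \<phi>)"
  by (rule linearI; rule unip_inv_unique)
    (simp_all add: linear_add[OF linear_unip] linear_cmul[OF linear_unip] unip_unip_inv)

lemma unip_inv_hfilt: "cofilt1 1 \<phi> \<Longrightarrow> a \<in> hfilt gr i \<Longrightarrow> unip_inv \<phi> a \<in> hfilt gr i"
  by (metis unip_hfilt_iff unip_unip_inv)

lemma unip_inv_nonneg: "cofilt1 1 \<phi> \<Longrightarrow> a \<in> hfilt gr 0 \<Longrightarrow> unip_inv \<phi> a = a"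
  by (rule unip_inv_unique) (simp_all add: unip_def cochain1_hfilt cofilt1_def)

text \<open>Let \<open>\<phi>\<close> be a field of \<open>1\<close>-cochains with derivative \<open>E\<close> in the directions of the constant fields of
  a Cartan connection with curvature \<open>R\<close>.  If \<open>\<phi>\<close> is \<open>Q\<close>-equivariant, its derivative along the
  fundamental field of \<open>z\<close> is \<open>y \<mapsto> - ([z, \<phi> y] - \<phi> [z, y])\<close>.  The covariant derivative below uses this
  expression in the vertical directions whether or not \<open>\<phi>\<close> is equivariant, so that it has the
  homogeneity that the recursion needs.\<close>

definition cov :: "('h \<Rightarrow>\<^sub>L 'h) \<Rightarrow> ('h \<Rightarrow>\<^sub>L 'h \<Rightarrow>\<^sub>L 'h) \<Rightarrow> 'h \<Rightarrow> 'h \<Rightarrow> 'h" where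
  "cov \<phi> E x y = E (pr x) y - (br (x - pr x) (\<phi> y) - \<phi> (br (x - pr x) y))"

definition fcurv_pre :: "('h \<Rightarrow>\<^sub>L 'h \<Rightarrow>\<^sub>L 'h) \<Rightarrow> ('h \<Rightarrow>\<^sub>L 'h) \<Rightarrow> ('h \<Rightarrow>\<^sub>L 'h \<Rightarrow>\<^sub>L 'h) \<Rightarrow> 'h \<Rightarrow> 'h \<Rightarrow> 'h" where
  "fcurv_pre R \<phi> E x y = unip \<phi> (R x y - br x y) + cov \<phi> E x y - cov \<phi> E y x"

definition fcurv_val :: "('h \<Rightarrow>\<^sub>L 'h \<Rightarrow>\<^sub>L 'h) \<Rightarrow> ('h \<Rightarrow>\<^sub>L 'h) \<Rightarrow> ('h \<Rightarrow>\<^sub>L 'h \<Rightarrow>\<^sub>L 'h) \<Rightarrow> 'h \<Rightarrow> 'h \<Rightarrow> 'h" where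
  "fcurv_val R \<phi> E a b = fcurv_pre R \<phi> E (unip_inv \<phi> a) (unip_inv \<phi> b) + br a b"

text \<open>The curvature of \<open>(1 + \<phi>) \<circ> \<kappa>\<close>, when \<open>\<phi>\<close> is equivariant.\<close>

definition fcurv :: "('h \<Rightarrow>\<^sub>L 'h \<Rightarrow>\<^sub>L 'h) \<Rightarrow> ('h \<Rightarrow>\<^sub>L 'h) \<Rightarrow> ('h \<Rightarrow>\<^sub>L 'h \<Rightarrow>\<^sub>L 'h) \<Rightarrow> 'h \<Rightarrow>\<^sub>L 'h \<Rightarrow>\<^sub>L 'h" where
  "fcurv R \<phi> E = blinfun2 (\<lambda>a b. fcurv_val R \<phi> E (pr a) (pr b))"

lemmas bl_simps = blinfun.bilinear_simps br.add_left br.add_right br.diff_left br.diff_right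
  br.scaleR_left br.scaleR_right br.minus_left br.minus_right br.zero_left br.zero_right
  pr_add pr_diff pr_scaleR

lemma bilinear_cov: "bilinear (cov \<phi> E)"
  unfolding bilinear_def
  by (intro conjI allI linearI) (simp_all add: cov_def bl_simps algebra_simps)

lemma bilinear_fcurv_pre: "bilinear (fcurv_pre R \<phi> E)"
  unfolding bilinear_def
  by (intro conjI allI linearI)
    (simp_all add: fcurv_pre_def unip_def bl_simps bilinear_ladd[OF bilinear_cov] bilinear_radd[OF bilinear_cov]
      bilinear_lmul[OF bilinear_cov] bilinear_rmul[OF bilinear_cov] algebra_simps)

lemma bilinear_fcurv_val:
  assumes "cofilt1 1 \<phi>" shows "bilinear (fcurv_val R \<phi> E)"
  unfolding bilinear_def
  by (intro conjI allI linearI)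
    (simp_all add: fcurv_val_def bl_simps bilinear_ladd[OF bilinear_fcurv_pre] bilinear_radd[OF bilinear_fcurv_pre]
      bilinear_lmul[OF bilinear_fcurv_pre] bilinear_rmul[OF bilinear_fcurv_pre]
      linear_add[OF linear_unip_inv[OF assms]] linear_cmul[OF linear_unip_inv[OF assms]] algebra_simps)

lemma fcurv_apply:
  assumes "cofilt1 1 \<phi>" shows "fcurv R \<phi> E a b = fcurv_val R \<phi> E (pr a) (pr b)"
  unfolding fcurv_def
  by (intro blinfun2_apply, unfold bilinear_def, intro conjI allI linearI)
    (simp_all add: pr_add pr_scaleR bilinear_ladd[OF bilinear_fcurv_val[OF assms]] bilinear_radd[OF bilinear_fcurv_val[OF assms]]
      bilinear_lmul[OF bilinear_fcurv_val[OF assms]] bilinear_rmul[OF bilinear_fcurv_val[OF assms]])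

lemma cochain2_fcurv:
  assumes "cofilt1 1 \<phi>" "cochain2 R" shows "cochain2 (fcurv R \<phi> E)"
  unfolding cochain2_def
proof (intro conjI allI)
  show "fcurv R \<phi> E x x = 0" for x
    using assms(2) by (simp add: fcurv_apply[OF assms(1)] fcurv_val_def fcurv_pre_def cochain2_def unip_def)
  show "fcurv R \<phi> E (pr x) = fcurv R \<phi> E x" for x
    by (rule blinfun_eqI) (simp add: fcurv_apply[OF assms(1)])
qed

lemma fcurv_0: 
  assumes "cochain2 R" shows "fcurv R 0 0 = R"
proof (intro blinfun_eqI)
  fix x y
  have "unip_inv 0 a = a" for a
    by (rule unip_inv_unique) (simp_all add: cofilt1_simps unip_def)
  then show "fcurv R 0 0 x y = R x y"
    using assms cochain2_right[OF assms]
    by (simp add: fcurv_apply cofilt1_simps fcurv_val_def fcurv_pre_def unip_def cov_def bl_simps cochain2_def)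
qed

text \<open>In negative degree \<open>i\<close> the derivative has homogeneity \<open>1\<close> and thus value in \<open>hfilt gr (j + 1)\<close>,
  better than required; in degree \<open>i \<ge> 0\<close> only the algebraic terms remain.\<close>

lemma cov_hfilt:
  fixes E :: "'h \<Rightarrow>\<^sub>L 'h \<Rightarrow>\<^sub>L 'h"
  assumes "cofilt1 1 \<phi>" "\<And>z. cofilt1 1 (E z)" "x \<in> hfilt gr i" "y \<in> hfilt gr j" "m \<le> i + j + 1"
  shows "cov \<phi> E x y \<in> hfilt gr m"
proof -
  let ?z = "x - pr x"
  have z: "?z \<in> hfilt gr (max 0 i)"
    using pr_diff_hfilt[of x] hfilt_diff[OF assms(3) pr_hfilt[OF assms(3)]] by (simp add: max_def)
  have "E (pr x) y \<in> hfilt gr (i + j + 1)"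
  proof (cases "i < 0")
    case True
    show ?thesis by (rule cofilt1_apply[OF assms(2) assms(4)]) (use True in simp)
  qed (use pr_hfilt_nonneg[OF assms(3)] in \<open>simp add: blinfun.zero_right blinfun.zero_left\<close>)
  moreover have "br ?z (\<phi> y) \<in> hfilt gr (i + j + 1)"
    by (rule br_apply[OF z cofilt1_apply[OF assms(1,4) order_refl]]) auto
  moreover have "\<phi> (br ?z y) \<in> hfilt gr (i + j + 1)"
    by (rule cofilt1_apply[OF assms(1) br_apply[OF z assms(4) order_refl]]) auto
  ultimately have "cov \<phi> E x y \<in> hfilt gr (i + j + 1)"
    unfolding cov_def by (intro hfilt_diff)
  then show ?thesis using assms(5) hfilt_mono by blast
qed

lemma cov_hfilt_neg:
  fixes E :: "'h \<Rightarrow>\<^sub>L 'h \<Rightarrow>\<^sub>L 'h"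
  assumes "cofilt1 r \<psi>" "\<And>z. cofilt1 r (E z)" "i < 0" "x \<in> hfilt gr i" "y \<in> hfilt gr j"
  shows "cov \<psi> E x y \<in> hfilt gr (i + j + r + 1)"
proof -
  let ?z = "x - pr x"
  have z: "?z \<in> hfilt gr 0" by simp
  have "E (pr x) y \<in> hfilt gr (i + j + r + 1)"
    by (rule cofilt1_apply[OF assms(2,5)]) (use assms(3) in simp)
  moreover have "br ?z (\<psi> y) \<in> hfilt gr (i + j + r + 1)"
    by (rule br_apply[OF z cofilt1_apply[OF assms(1,5) order_refl]]) (use assms(3) in auto)
  moreover have "\<psi> (br ?z y) \<in> hfilt gr (i + j + r + 1)"
    by (rule cofilt1_apply[OF assms(1) br_apply[OF z assms(5) order_refl]]) (use assms(3) in auto)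
  ultimately show ?thesis unfolding cov_def by (intro hfilt_diff)
qed

text \<open>With \<open>x = (1 + \<phi>)\<^sup>-\<^sup>1 a\<close> and \<open>x' = (1 + \<phi> + \<psi>)\<^sup>-\<^sup>1 a\<close> one has \<open>x' - x = - \<psi> a\<close> up to one more degree.
  The differential of \<open>\<psi>\<close> collects the terms of the difference that are linear in \<open>\<psi>\<close> and algebraic in the
  bracket; every other term has a further factor of positive homogeneity, or is a covariant
  derivative of \<open>\<psi>\<close> along a field of negative degree, which does not lower the degree of the value.\<close>

lemma fcurv_perturb:
  fixes E E' :: "'h \<Rightarrow>\<^sub>L 'h \<Rightarrow>\<^sub>L 'h"
  assumes r: "1 \<le> r" and \<phi>: "cofilt1 1 \<phi>" and \<psi>: "cofilt1 r \<psi>" and R: "cofilt2 1 R"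
    and E: "\<And>z. cofilt1 1 (E z)" and E': "\<And>z. cofilt1 r (E' z)"
  shows "cofilt2 (r + 1) (fcurv R (\<phi> + \<psi>) (E + E') - fcurv R \<phi> E - lie_d \<psi>)"
proof (rule cofilt2I)
  have \<psi>1: "cofilt1 1 \<psi>" using cofilt1_mono[OF \<psi> r] .
  have \<phi>\<psi>: "cofilt1 1 (\<phi> + \<psi>)" by (rule cofilt1_simps(2)[OF \<phi> \<psi>1])
  have R2: "cochain2 R" using R by (simp add: cofilt2_def)
  show "cochain2 (fcurv R (\<phi> + \<psi>) (E + E') - fcurv R \<phi> E - lie_d \<psi>)"
    by (intro cochain2_simps cochain2_fcurv \<phi> \<phi>\<psi> R2 cochain2_lie_d)
  fix i j a b assume i: "i < 0" "j < 0" and a: "a \<in> hfilt gr i" and b: "b \<in> hfilt gr j"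
    and ab: "a \<in> hminus gr" "b \<in> hminus gr"
  define x x' y y' where "x = unip_inv \<phi> a" "x' = unip_inv (\<phi> + \<psi>) a" "y = unip_inv \<phi> b" "y' = unip_inv (\<phi> + \<psi>) b"
  note defs = this
  have x: "x \<in> hfilt gr i" "x' \<in> hfilt gr i" "y \<in> hfilt gr j" "y' \<in> hfilt gr j"
    unfolding defs by (intro unip_inv_hfilt \<phi> \<phi>\<psi> a b)+
  have ax: "a = x + \<phi> x" "a = x' + \<phi> x' + \<psi> x'" "b = y + \<phi> y" "b = y' + \<phi> y' + \<psi> y'"
    using unip_unip_inv[OF \<phi>] unip_unip_inv[OF \<phi>\<psi>] unfolding defs unip_def
    by (simp_all add: blinfun.add_left add.assoc)
  have u: "unip \<phi> (x' - x) = - \<psi> x'" "unip \<phi> (y' - y) = - \<psi> y'"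
    using ax by (simp_all add: unip_def blinfun.bilinear_simps algebra_simps)
  have "x' - x \<in> hfilt gr (i + r)"
    by (subst unip_hfilt_iff[OF \<phi>, symmetric], subst u) (intro hfilt_neg cofilt1_apply[OF \<psi> x(2)], simp)
  moreover have "y' - y \<in> hfilt gr (j + r)"
    by (subst unip_hfilt_iff[OF \<phi>, symmetric], subst u) (intro hfilt_neg cofilt1_apply[OF \<psi> x(4)], simp)
  ultimately have uv: "x' - x \<in> hfilt gr (i + r)" "y' - y \<in> hfilt gr (j + r)" by auto
  have d: "a - x \<in> hfilt gr (i + 1)" "b - y \<in> hfilt gr (j + 1)"
    using ax cofilt1_apply[OF \<phi> x(1)] cofilt1_apply[OF \<phi> x(3)] by (metis add_diff_cancel_left' order_refl)+
  have d': "a - x' \<in> hfilt gr (i + 1)" "b - y' \<in> hfilt gr (j + 1)"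
    using ax(2,4) hfilt_add[OF cofilt1_apply[OF \<phi> x(2) order_refl] cofilt1_apply[OF \<psi>1 x(2) order_refl]]
      hfilt_add[OF cofilt1_apply[OF \<phi> x(4) order_refl] cofilt1_apply[OF \<psi>1 x(4) order_refl]]
    by (metis add.assoc add_diff_cancel_left')+
  have w: "x' - x + \<psi> a = \<psi> (a - x') - \<phi> (x' - x)" "y' - y + \<psi> b = \<psi> (b - y') - \<phi> (y' - y)"
    using u by (simp_all add: unip_def blinfun.bilinear_simps algebra_simps)
  have w': "x' - x + \<psi> a \<in> hfilt gr (i + r + 1)" "y' - y + \<psi> b \<in> hfilt gr (j + r + 1)"
    unfolding w by (intro hfilt_diff cofilt1_apply[OF \<psi> d'(1)] cofilt1_apply[OF \<phi> uv(1)]; simp)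
      (intro hfilt_diff cofilt1_apply[OF \<psi> d'(2)] cofilt1_apply[OF \<phi> uv(2)]; simp)
  let ?m = "i + j + r + 1"
  let ?u = "x' - x" let ?v = "y' - y"
  have R1: "R ?u y' + R x ?v \<in> hfilt gr ?m"
    by (intro hfilt_add cofilt2_apply[OF R uv(1) x(4)] cofilt2_apply[OF R x(1) uv(2)]) auto
  have 1: "unip \<phi> (R ?u y' + R x ?v) \<in> hfilt gr ?m"
    using R1 by (simp add: unip_hfilt_iff[OF \<phi>])
  have 2: "\<psi> (R x' y') \<in> hfilt gr ?m"
    by (rule cofilt1_apply[OF \<psi> cofilt2_apply[OF R x(2,4) order_refl]]) simp
  have 3: "br (?u + \<psi> a) y' \<in> hfilt gr ?m" "br (\<psi> a) (b - y') \<in> hfilt gr ?m"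
    "br x (?v + \<psi> b) \<in> hfilt gr ?m" "br (a - x) (\<psi> b) \<in> hfilt gr ?m"
    by (rule br_apply[OF w'(1) x(4)], simp, rule br_apply[OF cofilt1_apply[OF \<psi> a order_refl] d'(2)], simp,
      rule br_apply[OF x(1) w'(2)], simp, rule br_apply[OF d(1) cofilt1_apply[OF \<psi> b order_refl]], simp)
  have 4: "\<phi> (br ?u y' + br x ?v) \<in> hfilt gr ?m"
    by (rule cofilt1_apply[OF \<phi> hfilt_add[OF br_apply[OF uv(1) x(4)] br_apply[OF x(1) uv(2)], of "i + j + r"]]) auto
  have 5: "\<psi> (br (a - x') b + br x' (b - y')) \<in> hfilt gr ?m"
    by (rule cofilt1_apply[OF \<psi> hfilt_add[OF br_apply[OF d'(1) b] br_apply[OF x(2) d'(2)], of "i + j + 1"]]) auto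
  have 6: "cov \<phi> E ?u y' \<in> hfilt gr ?m" "cov \<phi> E x ?v \<in> hfilt gr ?m" "cov \<phi> E ?v x' \<in> hfilt gr ?m" "cov \<phi> E y ?u \<in> hfilt gr ?m"
    by (rule cov_hfilt[OF \<phi> E uv(1) x(4)], simp, rule cov_hfilt[OF \<phi> E x(1) uv(2)], simp,
      rule cov_hfilt[OF \<phi> E uv(2) x(2)], simp, rule cov_hfilt[OF \<phi> E x(3) uv(1)], simp)
  have 7: "cov \<psi> E' x' y' \<in> hfilt gr ?m" "cov \<psi> E' y' x' \<in> hfilt gr ?m"
    using cov_hfilt_neg[OF \<psi> E' i(1) x(2,4)] cov_hfilt_neg[OF \<psi> E' i(2) x(4,2)] by (simp_all add: ac_simps)
  have ba: "br b (\<psi> a) = - br (\<psi> a) b" by (rule br_anti)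
  have cov: "cov (\<phi> + \<psi>) (E + E') x' y' - cov \<phi> E x y = cov \<phi> E ?u y' + cov \<phi> E x ?v + cov \<psi> E' x' y'"
    "cov (\<phi> + \<psi>) (E + E') y' x' - cov \<phi> E y x = cov \<phi> E ?v x' + cov \<phi> E y ?u + cov \<psi> E' y' x'"
    by (simp_all add: cov_def bl_simps algebra_simps)
  have "(fcurv R (\<phi> + \<psi>) (E + E') - fcurv R \<phi> E - lie_d \<psi>) a b
     = fcurv_pre R (\<phi> + \<psi>) (E + E') x' y' - fcurv_pre R \<phi> E x y - (br a (\<psi> b) - br b (\<psi> a) - \<psi> (br a b))"
    by (simp add: blinfun.diff_left fcurv_apply \<phi> \<phi>\<psi> fcurv_val_def lie_d_apply pr_id ab defs)
  also have "\<dots> = unip \<phi> (R ?u y' + R x ?v) + \<psi> (R x' y')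
     - (br (?u + \<psi> a) y' + br (\<psi> a) (b - y') + br x (?v + \<psi> b) + br (a - x) (\<psi> b))
     - \<phi> (br ?u y' + br x ?v) + \<psi> (br (a - x') b + br x' (b - y'))
     + (cov (\<phi> + \<psi>) (E + E') x' y' - cov \<phi> E x y) - (cov (\<phi> + \<psi>) (E + E') y' x' - cov \<phi> E y x)"
    unfolding fcurv_pre_def unip_def ba by (simp add: bl_simps algebra_simps)
  also have "\<dots> \<in> hfilt gr ?m"
    unfolding cov by (intro hfilt_add hfilt_diff 1 2 3 4 5 6 7)
  finally show "(fcurv R (\<phi> + \<psi>) (E + E') - fcurv R \<phi> E - lie_d \<psi>) a b \<in> hfilt gr (i + j + (r + 1))"
    by (simp add: add.assoc)
qed

lemma cofilt2_fcurv:
  fixes E :: "'h \<Rightarrow>\<^sub>L 'h \<Rightarrow>\<^sub>L 'h"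
  assumes "cofilt1 1 \<phi>" "cofilt2 1 R" "\<And>z. cofilt1 1 (E z)"
  shows "cofilt2 1 (fcurv R \<phi> E)"
proof -
  have R: "cochain2 R" using assms(2) by (simp add: cofilt2_def)
  have "cofilt2 (1 + 1) (fcurv R (0 + \<phi>) (0 + E) - fcurv R 0 0 - lie_d \<phi>)"
    by (rule fcurv_perturb) (simp_all add: assms cofilt1_simps)
  then have "cofilt2 1 (fcurv R \<phi> E - R - lie_d \<phi>)"
    using cofilt2_mono by (simp add: fcurv_0[OF R])
  from cofilt2_simps(2)[OF cofilt2_simps(2)[OF this cofilt2_lie_d[OF assms(1)]] assms(2)]
  show ?thesis by simp
qed

text \<open>With the vertical derivatives of an equivariant map put in, the formal curvature is horizontal,
  like the curvature of a Cartan connection.\<close>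

lemma fcurv_val_vertical:
  fixes E :: "'h \<Rightarrow>\<^sub>L 'h \<Rightarrow>\<^sub>L 'h"
  assumes \<phi>: "cofilt1 1 \<phi>" and E: "\<And>z. cochain1 (E z)" and R: "cochain2 R" and c: "c \<in> hfilt gr 0"
  shows "fcurv_val R \<phi> E c b = 0"
proof -
  have \<phi>': "cochain1 \<phi>" using \<phi> by (simp add: cofilt1_def)
  let ?y = "unip_inv \<phi> b"
  have b: "b = ?y + \<phi> ?y" using unip_unip_inv[OF \<phi>, of b] by (simp add: unip_def)
  have prc: "pr c = 0" using c by (simp add: pr_eq_0_iff)
  have "br (?y - pr ?y) c \<in> hfilt gr 0" using br_apply[OF pr_diff_hfilt c] by simp
  then have "cov \<phi> E ?y c = 0"
    by (simp add: cov_def cochain1_hfilt[OF E c] cochain1_hfilt[OF \<phi>'] cochain1_hfilt[OF \<phi>' c] br.zero_right)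
  moreover have "R c ?y = 0" by (rule cochain2_hfilt[OF R c])
  moreover have "br c b = br c ?y + br c (\<phi> ?y)" by (subst b) (simp add: br.add_right)
  ultimately show ?thesis
    by (simp add: fcurv_val_def fcurv_pre_def unip_inv_nonneg[OF \<phi> c] cov_def prc unip_def bl_simps)
qed

text \<open>For \<open>x\<close> in the negative part, \<open>g' x\<close> has a component in \<open>hfilt gr 0\<close>, on which \<open>Eq\<close> uses the actual
  derivative and the covariant derivative the algebraic expression.  The defect \<open>\<delta>\<close> between the two
  is the only obstruction to equivariance, and it enters with a negative degree to spare.\<close>

lemma fcurv_transform:
  fixes E Eq R Rq :: "'h \<Rightarrow>\<^sub>L 'h \<Rightarrow>\<^sub>L 'h" and g g' \<phi> \<phi>q :: "'h \<Rightarrow>\<^sub>L 'h"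
  assumes g: "\<And>x. g (g' x) = x" "\<And>x. g' (g x) = x" "\<And>x y. g (br x y) = br (g x) (g y)"
    and gf: "\<And>i x. x \<in> hfilt gr i \<Longrightarrow> g x \<in> hfilt gr i" "\<And>i x. x \<in> hfilt gr i \<Longrightarrow> g' x \<in> hfilt gr i"
    and \<phi>: "cofilt1 1 \<phi>" "cofilt1 1 \<phi>q" and R: "cochain2 R" "cochain2 Rq" and E: "\<And>z. cochain1 (E z)"
    and q: "\<And>x. \<phi>q x = g (\<phi> (g' x))" "\<And>x y. Rq x y = g (R (g' x) (g' y))"
      "\<And>x y. x \<in> hminus gr \<Longrightarrow> Eq x y = g (E (g' x) (g' y))"
    and defect: "\<And>b y j. b \<in> hfilt gr 0 \<Longrightarrow> y \<in> hfilt gr j \<Longrightarrow> E b y + br b (\<phi> y) - \<phi> (br b y) \<in> hfilt gr (j + r)"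
    and a: "a \<in> hminus gr" "a \<in> hfilt gr i" "i < 0" and b: "b \<in> hminus gr" "b \<in> hfilt gr j" "j < 0"
  shows "fcurv Rq \<phi>q Eq a b - g (fcurv R \<phi> E (g' a) (g' b)) \<in> hfilt gr (i + j + (r + 1))"
proof -
  have g'br: "g' (br x y) = br (g' x) (g' y)" for x y
    by (metis g)
  define x1 y1 where "x1 = unip_inv \<phi> (g' a)" "y1 = unip_inv \<phi> (g' b)"
  note defs = this
  have inv: "unip_inv \<phi>q c = g (unip_inv \<phi> (g' c))" for c
  proof (rule unip_inv_unique[OF \<phi>(2)])
    have "unip \<phi> (unip_inv \<phi> (g' c)) = g' c" by (rule unip_unip_inv[OF \<phi>(1)])
    then have "g (unip_inv \<phi> (g' c)) + g (\<phi> (unip_inv \<phi> (g' c))) = c"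
      unfolding unip_def by (metis g(1) blinfun.add_right)
    then show "unip \<phi>q (g (unip_inv \<phi> (g' c))) = c" by (simp add: unip_def q(1) g(2))
  qed
  define bb where "bb x = (x - pr x) - g' (g x - pr (g x))" for x
  have bb0: "bb x \<in> hfilt gr 0" for x
    unfolding bb_def by (intro hfilt_diff[OF pr_diff_hfilt gf(2)[OF pr_diff_hfilt]])
  define \<delta> where "\<delta> c y = E c y + br c (\<phi> y) - \<phi> (br c y)" for c y
  have cov: "cov \<phi>q Eq (g x) (g y) = g (cov \<phi> E x y + \<delta> (bb x) y)" for x y
  proof -
    let ?w = "g' (g x - pr (g x))"
    have w: "g ?w = g x - pr (g x)" by (rule g(1))
    have pw: "g' (pr (g x)) = x - ?w" by (simp add: blinfun.diff_right g(2))
    have "cov \<phi>q Eq (g x) (g y) = g (E (x - ?w) y) - (br (g ?w) (g (\<phi> y)) - g (\<phi> (g' (br (g ?w) (g y)))))"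
      unfolding cov_def w by (simp add: q pw g(2))
    also have "\<dots> = g (E (x - ?w) y - (br ?w (\<phi> y) - \<phi> (br ?w y)))"
      unfolding g'br g(2) g(3)[symmetric] by (simp only: blinfun.diff_right)
    also have "E (x - ?w) y - (br ?w (\<phi> y) - \<phi> (br ?w y)) = cov \<phi> E x y + \<delta> (bb x) y"
      unfolding cov_def \<delta>_def bb_def by (simp add: bl_simps algebra_simps)
    finally show ?thesis .
  qed
  have "fcurv_val Rq \<phi>q Eq a b = fcurv_pre Rq \<phi>q Eq (g x1) (g y1) + br (g (g' a)) (g (g' b))"
    unfolding fcurv_val_def inv defs by (simp add: g(1))
  also have "\<dots> = g (fcurv_pre R \<phi> E x1 y1) + g (\<delta> (bb x1) y1 - \<delta> (bb y1) x1) + br (g (g' a)) (g (g' b))"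
    unfolding fcurv_pre_def cov unip_def q g(2) g(3)[symmetric]
    by (simp only: blinfun.diff_right[symmetric] blinfun.add_right[symmetric] g(2))
       (simp add: bl_simps algebra_simps)
  also have "\<dots> = g (fcurv_val R \<phi> E (g' a) (g' b)) + g (\<delta> (bb x1) y1 - \<delta> (bb y1) x1)"
    unfolding fcurv_val_def defs g(3)[symmetric] by (simp add: blinfun.add_right)
  finally have eq: "fcurv_val Rq \<phi>q Eq a b - g (fcurv_val R \<phi> E (g' a) (g' b)) = g (\<delta> (bb x1) y1 - \<delta> (bb y1) x1)"
    by simp
  note bil = bilinear_fcurv_val[OF \<phi>(1), of R E]
  have anti: "fcurv_val R \<phi> E x y = - fcurv_val R \<phi> E y x" for x y
    using br_anti[of x y] cochain2_anti[OF R(1), of "unip_inv \<phi> x" "unip_inv \<phi> y"] br_anti[of "unip_inv \<phi> x" "unip_inv \<phi> y"]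
    by (simp add: fcurv_val_def fcurv_pre_def unip_def blinfun.bilinear_simps)
  have v: "fcurv_val R \<phi> E (pr x) y = fcurv_val R \<phi> E x y" for x y
    using bilinear_ladd[OF bil, of "pr x" "x - pr x" y] fcurv_val_vertical[OF \<phi>(1) E R(1) pr_diff_hfilt] by simp
  then have "fcurv_val R \<phi> E (pr x) (pr y) = fcurv_val R \<phi> E x y" for x y
    by (metis anti)
  then have "fcurv Rq \<phi>q Eq a b - g (fcurv R \<phi> E (g' a) (g' b)) = g (\<delta> (bb x1) y1 - \<delta> (bb y1) x1)"
    using eq by (simp add: fcurv_apply \<phi> pr_id a b)
  moreover have "x1 \<in> hfilt gr i" "y1 \<in> hfilt gr j"
    unfolding defs by (intro unip_inv_hfilt \<phi> gf a b)+
  then have "\<delta> (bb x1) y1 \<in> hfilt gr (i + j + (r + 1))" "\<delta> (bb y1) x1 \<in> hfilt gr (i + j + (r + 1))"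
    using hfilt_mono[OF defect[OF bb0]] a(3) b(3) unfolding \<delta>_def by auto
  ultimately show ?thesis by (auto intro: gf hfilt_diff)
qed

lemma cov_equivariant:
  fixes E :: "'h \<Rightarrow>\<^sub>L 'h \<Rightarrow>\<^sub>L 'h"
    and \<phi> :: "'h \<Rightarrow>\<^sub>L 'h"
  assumes "\<And>c. c \<in> hfilt gr 0 \<Longrightarrow> E c y + br c (\<phi> y) - \<phi> (br c y) = 0"
  shows "cov \<phi> E x y = E x y"
  using assms[OF pr_diff_hfilt[of x]] by (simp add: cov_def bl_simps algebra_simps)

end

section \<open>Orthonormal bases and the adjoint differential\<close>

text \<open>Gram--Schmidt, by induction on the dimension; the metric is an arbitrary one and not the inner
  product of the type.\<close>

lemma orthonormal_basis_exists:
  fixes ip :: "'h::euclidean_space \<Rightarrow> 'h \<Rightarrow> real"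
  assumes ip: "euclidean_metric ip"
  shows "subspace V \<Longrightarrow> \<exists>B. orthonormal_basis ip V B"
proof (induction "dim V" arbitrary: V rule: less_induct)
  case less
  have bil: "bilinear ip" and sym: "\<And>x y. ip x y = ip y x" and pos: "\<And>x. x \<noteq> 0 \<Longrightarrow> 0 < ip x x"
    using ip by (auto simp: euclidean_metric_def)
  show ?case
  proof (cases "V \<subseteq> {0}")
    case True
    then have "V = {0}" using less.prems by (auto simp: subspace_0)
    then show ?thesis by (intro exI[of _ "{}"]) (simp add: orthonormal_basis_def)
  next
    case False
    then obtain x where x: "x \<in> V" "x \<noteq> 0" by auto
    define e where "e = (1 / sqrt (ip x x)) *\<^sub>R x"
    have e: "e \<in> V" "ip e e = 1"
      using x pos[OF x(2)] less.prems
      by (simp_all add: e_def subspace_scale bilinear_lmul[OF bil] bilinear_rmul[OF bil] field_simps)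
    define V' where "V' = {y\<in>V. ip e y = 0}"
    have V': "subspace V'"
      using less.prems by (auto simp: V'_def subspace_def bilinear_radd[OF bil] bilinear_rmul[OF bil] bilinear_rzero[OF bil])
    have "V' \<subset> V" using e unfolding V'_def by force
    then have "dim V' < dim V"
      using dim_psubset[of V' V] V' less.prems by (simp add: span_eq_iff[THEN iffD2])
    from less.hyps[OF this V'] obtain B where B: "orthonormal_basis ip V' B" by blast
    have B': "finite B" "B \<subseteq> V'" "span B = V'" "\<And>x y. x \<in> B \<Longrightarrow> y \<in> B \<Longrightarrow> ip x y = (if x = y then 1 else 0)"
      using B by (auto simp: orthonormal_basis_def)
    have "orthonormal_basis ip V (insert e B)"
      unfolding orthonormal_basis_def
    proof (intro conjI)
      show "finite (insert e B)" "insert e B \<subseteq> V" using B' e by (auto simp: V'_def)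
      show "span (insert e B) = V"
      proof
        show "span (insert e B) \<subseteq> V"
          by (rule span_minimal) (use B' e less.prems in \<open>auto simp: V'_def\<close>)
        show "V \<subseteq> span (insert e B)"
        proof
          fix y assume y: "y \<in> V"
          have "y - ip e y *\<^sub>R e \<in> V'"
            using y e less.prems by (simp add: V'_def subspace_diff subspace_scale bilinear_rsub[OF bil] bilinear_rmul[OF bil])
          then have "y - ip e y *\<^sub>R e \<in> span (insert e B)"
            using B'(3) span_mono[of B "insert e B"] by auto
          moreover have "ip e y *\<^sub>R e \<in> span (insert e B)" by (simp add: span_base span_scale)
          ultimately show "y \<in> span (insert e B)" using span_add by fastforce
        qed
      qed
      show "\<forall>x\<in>insert e B. \<forall>y\<in>insert e B. ip x y = (if x = y then 1 else 0)"
        using B' e sym by (auto simp: V'_def)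
    qed
    then show ?thesis by blast
  qed
qed

lemma orthonormal_basis_expand:
  assumes ip: "euclidean_metric ip" and B: "orthonormal_basis ip V B" and x: "x \<in> V"
  shows "(\<Sum>b\<in>B. ip b x *\<^sub>R b) = x"
proof -
  have bil: "bilinear ip" using ip by (simp add: euclidean_metric_def)
  have B': "finite B" "span B = V" "\<And>x y. x \<in> B \<Longrightarrow> y \<in> B \<Longrightarrow> ip x y = (if x = y then 1 else 0)"
    using B by (auto simp: orthonormal_basis_def)
  obtain u where u: "x = (\<Sum>b\<in>B. u b *\<^sub>R b)"
    using x B'(2) span_finite[OF B'(1)] by auto
  have "ip b x = u b" if b: "b \<in> B" for b
  proof -
    have "linear (ip b)" using bil by (simp add: bilinear_def)
    then have "ip b x = (\<Sum>c\<in>B. u c * ip b c)"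
      unfolding u by (simp add: linear_sum linear_cmul)
    also have "\<dots> = (\<Sum>c\<in>B. if b = c then u b else 0)"
      by (intro sum.cong) (auto simp: B'(3)[OF b])
    finally show ?thesis using B'(1) b by simp
  qed
  then show ?thesis by (subst (2) u) simp
qed

text \<open>The metric on cochains is defined by an arbitrarily chosen orthonormal basis; this allows one to
  compute it in a basis of homogeneous vectors.\<close>

lemma orthonormal_basis_trace:
  fixes f :: "'h::euclidean_space \<Rightarrow> 'h \<Rightarrow> 'v::real_vector"
  assumes ip: "euclidean_metric ip" and B: "orthonormal_basis ip V B" and B': "orthonormal_basis ip V B'"
    and f: "\<And>y. linear (\<lambda>x. f x y)" "\<And>x. linear (f x)"
  shows "(\<Sum>b\<in>B. f b b) = (\<Sum>b\<in>B'. f b b)"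
proof -
  have sub: "B \<subseteq> V" "B' \<subseteq> V" using B B' by (auto simp: orthonormal_basis_def)
  have sym: "\<And>x y. ip x y = ip y x" using ip by (simp add: euclidean_metric_def)
  have "(\<Sum>b\<in>B. f b b) = (\<Sum>b\<in>B. f (\<Sum>c\<in>B'. ip c b *\<^sub>R c) b)"
    using sub by (intro sum.cong) (auto simp: orthonormal_basis_expand[OF ip B'])
  also have "\<dots> = (\<Sum>b\<in>B. \<Sum>c\<in>B'. ip c b *\<^sub>R f c b)"
    by (intro sum.cong refl) (simp add: linear_sum[OF f(1)] linear_cmul[OF f(1)])
  also have "\<dots> = (\<Sum>c\<in>B'. \<Sum>b\<in>B. ip b c *\<^sub>R f c b)"
    by (subst sum.swap) (simp add: sym)
  also have "\<dots> = (\<Sum>c\<in>B'. f c (\<Sum>b\<in>B. ip b c *\<^sub>R b))"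
    by (intro sum.cong refl) (simp add: linear_sum[OF f(2)] linear_cmul[OF f(2)])
  also have "\<dots> = (\<Sum>c\<in>B'. f c c)"
    using sub by (intro sum.cong) (auto simp: orthonormal_basis_expand[OF ip B])
  finally show ?thesis .
qed

locale metric_lie = graded_lie br gr k l
  for br :: "'h::euclidean_space \<Rightarrow> 'h \<Rightarrow> 'h" and gr k l +
  fixes ip :: "'h \<Rightarrow> 'h \<Rightarrow> real"
  assumes metric: "euclidean_metric ip" and adapted: "adapted gr ip"
begin

sublocale ip: bounded_bilinear ip
  using metric by (simp add: euclidean_metric_def bilinear_conv_bounded_bilinear)

lemma ip_sym: "ip x y = ip y x" and ip_pos: "x \<noteq> 0 \<Longrightarrow> 0 < ip x x"
  using metric by (auto simp: euclidean_metric_def)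

lemma ip_nonneg: "0 \<le> ip x x"
  using ip_pos[of x] by (cases "x = 0") (auto simp: ip.zero_left)

lemma ip_gr: "i \<noteq> j \<Longrightarrow> x \<in> gr i \<Longrightarrow> y \<in> gr j \<Longrightarrow> ip x y = 0"
  using adapted by (auto simp: adapted_def)

lemma ip_component: "ip (component i x) y = ip (component i x) (component i y)"
proof -
  have "ip (component i x) y = ip (component i x) (\<Sum>j=-k..l. component j y)" by (simp add: component_sum)
  also have "\<dots> = (\<Sum>j=-k..l. if j = i then ip (component i x) (component i y) else 0)"
    unfolding ip.sum_right by (intro sum.cong refl) (use ip_gr[OF _ component_in component_in, of i] in auto)
  also have "\<dots> = ip (component i x) (component i y)"
    using component_out[of i x] by (auto simp: ip.zero_left)
  finally show ?thesis .
qed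

lemma ip_component_swap: "ip (component i x) y = ip x (component i y)"
  using ip_component[of i x y] ip_component[of i y x] by (simp add: ip_sym)

definition gr_basis :: "int \<Rightarrow> 'h set" where
  "gr_basis i = (SOME B. orthonormal_basis ip (gr i) B)"

lemma gr_basis: "orthonormal_basis ip (gr i) (gr_basis i)"
  unfolding gr_basis_def by (rule someI_ex) (rule orthonormal_basis_exists[OF metric gr_subspace])

lemma gr_basis_Union:
  assumes "finite I"
  shows "orthonormal_basis ip (span (\<Union>i\<in>I. gr i)) (\<Union>i\<in>I. gr_basis i)"
  unfolding orthonormal_basis_def
proof (intro conjI ballI)
  have B: "finite (gr_basis i)" "gr_basis i \<subseteq> gr i" "span (gr_basis i) = gr i"
    "\<And>x y. x \<in> gr_basis i \<Longrightarrow> y \<in> gr_basis i \<Longrightarrow> ip x y = (if x = y then 1 else 0)" for i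
    using gr_basis[of i] by (auto simp: orthonormal_basis_def)
  show "finite (\<Union>i\<in>I. gr_basis i)" using assms B by auto
  show sub: "(\<Union>i\<in>I. gr_basis i) \<subseteq> span (\<Union>i\<in>I. gr i)"
    using B(2) by (auto intro!: span_base)
  have "gr i \<subseteq> span (\<Union>i\<in>I. gr_basis i)" if "i \<in> I" for i
    using B(3)[of i] span_mono[of "gr_basis i" "\<Union>i\<in>I. gr_basis i"] that by auto
  then show "span (\<Union>i\<in>I. gr_basis i) = span (\<Union>i\<in>I. gr i)"
    using sub by (intro subset_antisym span_minimal) auto
  fix x y assume "x \<in> (\<Union>i\<in>I. gr_basis i)" "y \<in> (\<Union>i\<in>I. gr_basis i)"
  then obtain i j where ij: "x \<in> gr_basis i" "y \<in> gr_basis j" by auto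
  show "ip x y = (if x = y then 1 else 0)"
  proof (cases "i = j")
    case False
    then have "ip x y = 0" using ij B(2) ip_gr by blast
    moreover have "ip x x = 1" using ij B(4) by simp
    ultimately show ?thesis by auto
  qed (use ij B(4) in auto)
qed

definition minus_basis :: "'h set" where
  "minus_basis = (\<Union>i\<in>{-k..-1}. gr_basis i)"

definition full_basis :: "'h set" where
  "full_basis = (\<Union>i\<in>{-k..l}. gr_basis i)"

lemma minus_basis: "orthonormal_basis ip (hminus gr) minus_basis"
proof -
  have "span (\<Union>i\<in>{-k..-1}. gr i) = hminus gr"
    unfolding set_eq_iff in_span_gr_iff hminus_iff using component_out by (smt (verit) atLeastAtMost_iff)
  then show ?thesis using gr_basis_Union[of "{-k..-1}"] by (simp add: minus_basis_def)
qed

lemma full_basis: "orthonormal_basis ip UNIV full_basis"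
proof -
  have "span (\<Union>i\<in>{-k..l}. gr i) = UNIV"
    unfolding set_eq_iff in_span_gr_iff using component_out by (smt (verit) atLeastAtMost_iff UNIV_I)
  then show ?thesis using gr_basis_Union[of "{-k..l}"] by (simp add: full_basis_def)
qed

lemma finite_minus_basis: "finite minus_basis"
  using minus_basis by (simp add: orthonormal_basis_def)

lemma minus_basis_hminus: "b \<in> minus_basis \<Longrightarrow> b \<in> hminus gr"
  using minus_basis by (auto simp: orthonormal_basis_def)

lemma minus_basis_expand: "(\<Sum>b\<in>minus_basis. ip b x *\<^sub>R b) = pr x"
proof -
  have "ip b (x - pr x) = 0" if "b \<in> minus_basis" for b
  proof -
    have "ip b (x - pr x) = ip (\<Sum>i=-k..l. component i b) (x - pr x)" by (simp add: component_sum)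
    also have "\<dots> = 0"
      unfolding ip.sum_left
    proof (rule sum.neutral, rule ballI)
      fix i
      show "ip (component i b) (x - pr x) = 0"
        using minus_basis_hminus[OF that]
        by (subst ip_component) (cases "i < 0"; simp add: component_diff component_pr hminus_iff ip.zero_left ip.zero_right)
    qed
    finally show ?thesis .
  qed
  then have "(\<Sum>b\<in>minus_basis. ip b x *\<^sub>R b) = (\<Sum>b\<in>minus_basis. ip b (pr x) *\<^sub>R b)"
    by (intro sum.cong) (auto simp: ip.diff_right)
  then show ?thesis using orthonormal_basis_expand[OF metric minus_basis pr_hminus] by simp
qed

definition ip1 :: "('h \<Rightarrow>\<^sub>L 'h) \<Rightarrow> ('h \<Rightarrow>\<^sub>L 'h) \<Rightarrow> real" where
  "ip1 f g = (\<Sum>b\<in>minus_basis. ip (f b) (g b))"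

definition ip2 :: "('h \<Rightarrow>\<^sub>L 'h \<Rightarrow>\<^sub>L 'h) \<Rightarrow> ('h \<Rightarrow>\<^sub>L 'h \<Rightarrow>\<^sub>L 'h) \<Rightarrow> real" where
  "ip2 B C = (\<Sum>a\<in>minus_basis. \<Sum>b\<in>minus_basis. ip (B a b) (C a b)) / 2"

lemma cochain1_eqI:
  assumes "cochain1 f" "cochain1 g" "\<And>b. b \<in> minus_basis \<Longrightarrow> f b = g b"
  shows "f = g"
proof (rule blinfun_eqI)
  fix x
  have "f (pr x) = g (pr x)"
    unfolding minus_basis_expand[symmetric] by (simp add: blinfun.bilinear_simps blinfun.sum_right assms(3))
  then show "f x = g x" using assms by (simp add: cochain1_def)
qed

lemma ip1_definite: "cochain1 f \<Longrightarrow> ip1 f f = 0 \<Longrightarrow> f = 0"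
proof (rule cochain1_eqI)
  assume f: "cochain1 f" "ip1 f f = 0"
  fix b assume "b \<in> minus_basis"
  then have "ip (f b) (f b) = 0"
    using f(2) finite_minus_basis unfolding ip1_def by (simp add: sum_nonneg_eq_0_iff ip_nonneg)
  then show "f b = blinfun_apply 0 b" using ip_pos by fastforce
qed (simp_all add: cochain1_simps)

lemma cochain2_eqI:
  assumes "cochain2 B" "cochain2 C" "\<And>a b. a \<in> minus_basis \<Longrightarrow> b \<in> minus_basis \<Longrightarrow> B a b = C a b"
  shows "B = C"
proof (intro blinfun_eqI)
  fix x y
  have "B (pr x) (pr y) = C (pr x) (pr y)"
    unfolding minus_basis_expand[symmetric]
    by (simp add: blinfun.bilinear_simps blinfun.sum_right blinfun.sum_left assms(3))
  then show "B x y = C x y"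
    using assms cochain2_right[OF assms(1)] cochain2_right[OF assms(2)] by (simp add: cochain2_def)
qed

lemma ip2_definite: "cochain2 B \<Longrightarrow> ip2 B B = 0 \<Longrightarrow> B = 0"
proof (rule cochain2_eqI)
  assume B: "cochain2 B" "ip2 B B = 0"
  fix a b assume "a \<in> minus_basis" "b \<in> minus_basis"
  then have "ip (B a b) (B a b) = 0"
    using B(2) finite_minus_basis unfolding ip2_def
    by (simp add: sum_nonneg_eq_0_iff sum_nonneg ip_nonneg)
  then show "B a b = (0 :: 'h \<Rightarrow>\<^sub>L 'h \<Rightarrow>\<^sub>L 'h) a b" using ip_pos by fastforce
qed (simp_all add: cochain2_simps)

lemma ip1_linear: "ip1 (f + g) h = ip1 f h + ip1 g h" "ip1 (c *\<^sub>R f) h = c * ip1 f h" "ip1 f 0 = 0"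
    "ip1 h (f - g) = ip1 h f - ip1 h g" "ip1 0 h = 0"
  by (simp_all add: ip1_def blinfun.bilinear_simps ip.add_left ip.add_right ip.diff_right ip.scaleR_left sum.distrib sum_subtractf
      sum_distrib_left ip.zero_right ip.zero_left)

lemma ip2_linear: "ip2 (f + g) h = ip2 f h + ip2 g h" "ip2 (c *\<^sub>R f) h = c * ip2 f h" "ip2 0 h = 0"
    "ip2 h (f + g) = ip2 h f + ip2 h g" "ip2 h (c *\<^sub>R f) = c * ip2 h f" "ip2 h 0 = 0"
  by (simp_all add: ip2_def blinfun.bilinear_simps ip.add_left ip.add_right ip.scaleR_left ip.scaleR_right sum.distrib
      sum_distrib_left ip.zero_right ip.zero_left add_divide_distrib)

lemma ip1_sum: "ip1 (sum f S) h = (\<Sum>i\<in>S. ip1 (f i) h)"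
  by (induction S rule: infinite_finite_induct) (simp_all add: ip1_linear)

lemma ip2_sum: "ip2 (sum f S) h = (\<Sum>i\<in>S. ip2 (f i) h)"
  by (induction S rule: infinite_finite_induct) (simp_all add: ip2_linear)

text \<open>\<open>elem b e\<close>, with \<open>b\<close> and \<open>e\<close> from orthonormal bases, is the basis of the space of \<open>1\<close>-cochains used to
  write down adjoints.\<close>

definition elem :: "'h \<Rightarrow> 'h \<Rightarrow> 'h \<Rightarrow>\<^sub>L 'h" where
  "elem b e = Blinfun (\<lambda>x. ip b (pr x) *\<^sub>R e)"

lemma elem_apply: "elem b e x = ip b (pr x) *\<^sub>R e"
  unfolding elem_def
  by (rule blinfun_apply_Blinfun, rule linearI) (simp_all add: pr_add pr_scaleR ip.add_right ip.scaleR_right scaleR_add_left)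

lemma cochain1_elem: "cochain1 (elem b e)"
  by (simp add: cochain1_def elem_apply)

lemma cochain1_expand:
  assumes "cochain1 f"
  shows "(\<Sum>b\<in>minus_basis. \<Sum>e\<in>full_basis. ip e (f b) *\<^sub>R elem b e) = f"
proof (rule blinfun_eqI)
  fix x
  have "blinfun_apply (\<Sum>b\<in>minus_basis. \<Sum>e\<in>full_basis. ip e (f b) *\<^sub>R elem b e) x
     = (\<Sum>b\<in>minus_basis. ip b (pr x) *\<^sub>R (\<Sum>e\<in>full_basis. ip e (f b) *\<^sub>R e))"
    by (simp add: blinfun.sum_left blinfun.bilinear_simps elem_apply scaleR_sum_right mult.commute)
  also have "\<dots> = (\<Sum>b\<in>minus_basis. ip b (pr x) *\<^sub>R f b)"
    by (simp add: orthonormal_basis_expand[OF metric full_basis])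
  also have "\<dots> = f (\<Sum>b\<in>minus_basis. ip b (pr x) *\<^sub>R b)"
    by (simp add: blinfun.sum_right blinfun.bilinear_simps)
  also have "\<dots> = f x" using assms by (simp add: minus_basis_expand cochain1_def)
  finally show "blinfun_apply (\<Sum>b\<in>minus_basis. \<Sum>e\<in>full_basis. ip e (f b) *\<^sub>R elem b e) x = f x" .
qed

text \<open>The metric adjoint of \<open>lie_d\<close>, expanded in the basis \<open>elem b e\<close>.  The formula is linear on all
  bilinear maps.\<close>

definition lie_dstar :: "('h \<Rightarrow>\<^sub>L 'h \<Rightarrow>\<^sub>L 'h) \<Rightarrow> 'h \<Rightarrow>\<^sub>L 'h" where
  "lie_dstar B = (\<Sum>b\<in>minus_basis. \<Sum>e\<in>full_basis. ip2 (lie_d (elem b e)) B *\<^sub>R elem b e)"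

lemma linear_lie_dstar: "linear lie_dstar"
  by (rule linearI) (simp_all add: lie_dstar_def ip2_linear scaleR_add_left sum.distrib scaleR_sum_right)

lemma cochain1_sum: "(\<And>i. i \<in> S \<Longrightarrow> cochain1 (f i)) \<Longrightarrow> cochain1 (sum f S)"
  by (induction S rule: infinite_finite_induct) (simp_all add: cochain1_simps)

lemma cochain1_lie_dstar: "cochain1 (lie_dstar B)"
  unfolding lie_dstar_def by (intro cochain1_sum cochain1_simps cochain1_elem)

lemma lie_d_sum: "lie_d (sum f S) = (\<Sum>i\<in>S. lie_d (f i))"
  by (induction S rule: infinite_finite_induct) (simp_all add: lie_d_linear)

lemma lie_dstar_adjoint:
  assumes "cochain1 f" shows "ip1 f (lie_dstar B) = ip2 (lie_d f) B"
proof -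
  have elem: "ip1 (elem b e) (lie_dstar B) = ip2 (lie_d (elem b e)) B" if "b \<in> minus_basis" "e \<in> full_basis" for b e
  proof -
    have ONm: "\<And>x y. x \<in> minus_basis \<Longrightarrow> y \<in> minus_basis \<Longrightarrow> ip x y = (if x = y then 1 else 0)"
      and ONf: "\<And>x y. x \<in> full_basis \<Longrightarrow> y \<in> full_basis \<Longrightarrow> ip x y = (if x = y then 1 else 0)"
      and fin: "finite minus_basis" "finite full_basis"
      using minus_basis full_basis by (auto simp: orthonormal_basis_def)
    have prb: "pr c = c" if "c \<in> minus_basis" for c using minus_basis_hminus[OF that] pr_id by blast
    have "ip1 (elem b e) (lie_dstar B) = (\<Sum>c\<in>minus_basis. if c = b then ip e (lie_dstar B b) else 0)"
      unfolding ip1_def elem_apply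
      by (intro sum.cong) (auto simp: prb ip.scaleR_left ONm that(1))
    also have "\<dots> = ip e (lie_dstar B b)" using fin that by simp
    also have "\<dots> = (\<Sum>c\<in>minus_basis. if c = b then ip e (\<Sum>e'\<in>full_basis. ip2 (lie_d (elem b e')) B *\<^sub>R e') else 0)"
      unfolding lie_dstar_def blinfun.sum_left ip.sum_right
      by (intro sum.cong) (auto simp: blinfun.bilinear_simps elem_apply prb that(1) ONm ip.scaleR_right ip.sum_right ip.zero_right)
    also have "\<dots> = (\<Sum>e'\<in>full_basis. ip2 (lie_d (elem b e')) B * ip e e')"
      using fin that by (simp add: ip.sum_right ip.scaleR_right)
    also have "\<dots> = (\<Sum>e'\<in>full_basis. if e' = e then ip2 (lie_d (elem b e)) B else 0)"
      by (intro sum.cong) (auto simp: ONf that(2))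
    also have "\<dots> = ip2 (lie_d (elem b e)) B" using fin that by simp
    finally show ?thesis .
  qed
  have "ip1 f (lie_dstar B) = (\<Sum>b\<in>minus_basis. \<Sum>e\<in>full_basis. ip e (f b) * ip1 (elem b e) (lie_dstar B))"
    by (subst cochain1_expand[OF assms, symmetric]) (simp add: ip1_sum ip1_linear)
  also have "\<dots> = (\<Sum>b\<in>minus_basis. \<Sum>e\<in>full_basis. ip e (f b) * ip2 (lie_d (elem b e)) B)"
    by (simp add: elem)
  also have "\<dots> = ip2 (lie_d f) B"
    by (subst (2) cochain1_expand[OF assms, symmetric]) (simp add: lie_d_sum lie_d_linear ip2_sum ip2_linear)
  finally show ?thesis .
qed

lemma cochain1_eq_ip1:
  assumes "cochain1 f" "cochain1 g" "\<And>h. cochain1 h \<Longrightarrow> ip1 h f = ip1 h g"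
  shows "f = g"
  using ip1_definite[of "f - g"] assms by (simp add: cochain1_simps ip1_linear)

text \<open>Homogeneous components of cochains.  They commute with \<open>lie_d\<close> and are self-adjoint, hence
  commute with \<open>lie_dstar\<close>.\<close>

definition hom1 :: "int \<Rightarrow> ('h \<Rightarrow>\<^sub>L 'h) \<Rightarrow> 'h \<Rightarrow>\<^sub>L 'h" where
  "hom1 s f = Blinfun (\<lambda>x. \<Sum>j=-k..l. component (j + s) (f (component j x)))"

definition hom2 :: "int \<Rightarrow> ('h \<Rightarrow>\<^sub>L 'h \<Rightarrow>\<^sub>L 'h) \<Rightarrow> 'h \<Rightarrow>\<^sub>L 'h \<Rightarrow>\<^sub>L 'h" where
  "hom2 s B = blinfun2 (\<lambda>x y. \<Sum>i=-k..l. \<Sum>j=-k..l. component (i + j + s) (B (component i x) (component j y)))"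

lemma hom1_apply: "hom1 s f x = (\<Sum>j=-k..l. component (j + s) (f (component j x)))"
  unfolding hom1_def
  by (rule blinfun_apply_Blinfun, rule linearI)
    (simp_all add: component_add component_scaleR blinfun.bilinear_simps sum.distrib scaleR_sum_right)

lemma hom2_apply: "hom2 s B x y = (\<Sum>i=-k..l. \<Sum>j=-k..l. component (i + j + s) (B (component i x) (component j y)))"
  unfolding hom2_def
  by (rule blinfun2_apply, unfold bilinear_def, intro conjI allI linearI)
    (simp_all add: component_add component_scaleR blinfun.bilinear_simps sum.distrib scaleR_sum_right)

lemma hom1_gr: "x \<in> gr j \<Longrightarrow> hom1 s f x = component (j + s) (f x)"
proof -
  assume x: "x \<in> gr j"
  have "hom1 s f x = (\<Sum>i=-k..l. if i = j then component (j + s) (f x) else 0)"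
    unfolding hom1_apply by (intro sum.cong) (auto simp: component_gr[OF x])
  then show ?thesis using x gr_trivial[of j] by (cases "j \<in> {-k..l}") auto
qed

lemma hom2_gr: "x \<in> gr i \<Longrightarrow> y \<in> gr j \<Longrightarrow> hom2 s B x y = component (i + j + s) (B x y)"
proof -
  assume x: "x \<in> gr i" and y: "y \<in> gr j"
  have "hom2 s B x y = (\<Sum>a=-k..l. hom1 (a + s) (B (component a x)) y)"
    unfolding hom2_apply hom1_apply by (intro sum.cong refl) (simp add: algebra_simps)
  also have "\<dots> = (\<Sum>a=-k..l. if a = i then component (i + j + s) (B x y) else 0)"
    by (intro sum.cong refl)
      (auto simp: hom1_gr[OF y] component_gr[OF x] blinfun.zero_right blinfun.zero_left algebra_simps)
  also have "\<dots> = component (i + j + s) (B x y)"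
    using x gr_trivial[of i] by (cases "i \<in> {-k..l}") (auto simp: blinfun.zero_left blinfun.zero_right)
  finally show ?thesis .
qed

lemma minus_basis_gr:
  assumes "b \<in> minus_basis" obtains i where "i < 0" "b \<in> gr i"
proof -
  obtain i where i: "i \<in> {-k..-1}" "b \<in> gr_basis i" using assms by (auto simp: minus_basis_def)
  moreover have "gr_basis i \<subseteq> gr i" using gr_basis[of i] by (simp add: orthonormal_basis_def)
  ultimately show ?thesis using that[of i] by auto
qed

lemma cochain1_hom1: "cochain1 f \<Longrightarrow> cochain1 (hom1 s f)"
  unfolding cochain1_def
proof (intro allI)
  fix x assume f: "\<forall>x. f (pr x) = f x"
  have "f (component j (pr x)) = f (component j x)" for j
    using cochain1_hfilt[of f "component j x"] f hfilt_gr[OF component_in, of 0 j x]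
    by (auto simp: component_pr cochain1_def)
  then show "hom1 s f (pr x) = hom1 s f x" by (simp add: hom1_apply)
qed

lemma cochain2_hom2: "cochain2 B \<Longrightarrow> cochain2 (hom2 s B)"
proof -
  assume B: "cochain2 B"
  have "B (component j (pr x)) = B (component j x)" for j x
    using cochain2_hfilt[OF B, of "component j x"] hfilt_gr[OF component_in, of 0 j x]
    by (auto simp: component_pr intro!: blinfun_eqI)
  then have 1: "hom2 s B (pr x) = hom2 s B x" for x by (intro blinfun_eqI) (simp add: hom2_apply)
  have "component (i + j + s) (B (component i x) (component j y))
      = - component (j + i + s) (B (component j y) (component i x))" for i j x y
    by (subst cochain2_anti[OF B]) (simp add: component_minus add.commute)
  then have "hom2 s B x y = - (\<Sum>i=-k..l. \<Sum>j=-k..l. component (j + i + s) (B (component j y) (component i x)))" for x y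
    unfolding hom2_apply sum_negf[symmetric] by (intro sum.cong refl)
  then have anti: "hom2 s B x y = - hom2 s B y x" for x y
    unfolding hom2_apply by (subst (asm) sum.swap)
  have "hom2 s B x x = 0" for x
    using anti[of x x] by (metis eq_neg_iff_add_eq_0 scaleR_2 scaleR_eq_0_iff zero_neq_numeral)
  then show ?thesis using 1 by (simp add: cochain2_def)
qed

lemma hom2_lie_d: "hom2 s (lie_d f) = lie_d (hom1 s f)"
proof (rule cochain2_eqI)
  fix a b assume "a \<in> minus_basis" "b \<in> minus_basis"
  then obtain i j where ij: "i < 0" "a \<in> gr i" "j < 0" "b \<in> gr j" by (metis minus_basis_gr)
  have ab: "pr a = a" "pr b = b" "br a b \<in> gr (i + j)" using ij by (auto simp: pr_gr br_gr)
  have "component (i + j + s) (br a (f b)) = br a (component (j + s) (f b))"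
    using component_br[OF ij(2), of "j + s" "f b"] by (simp add: add.assoc)
  moreover have "component (i + j + s) (br b (f a)) = br b (component (i + s) (f a))"
    using component_br[OF ij(4), of "i + s" "f a"] by (simp add: algebra_simps)
  ultimately show "hom2 s (lie_d f) a b = lie_d (hom1 s f) a b"
    by (simp add: hom2_gr[OF ij(2,4)] lie_d_apply ab hom1_gr[OF ij(2)] hom1_gr[OF ij(4)] hom1_gr[OF ab(3)] component_diff)
qed (simp_all add: cochain2_hom2 cochain2_lie_d)

lemma ip1_hom1: "ip1 (hom1 s f) g = ip1 f (hom1 s g)"
  unfolding ip1_def
proof (rule sum.cong)
  fix b assume "b \<in> minus_basis"
  then obtain i where "b \<in> gr i" by (metis minus_basis_gr)
  then show "ip (hom1 s f b) (g b) = ip (f b) (hom1 s g b)" by (simp add: hom1_gr ip_component_swap)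
qed simp

lemma ip2_hom2: "ip2 (hom2 s B) C = ip2 B (hom2 s C)"
proof -
  have "ip (hom2 s B a b) (C a b) = ip (B a b) (hom2 s C a b)" if "a \<in> minus_basis" "b \<in> minus_basis" for a b
    using that by (metis minus_basis_gr hom2_gr ip_component_swap)
  then show ?thesis unfolding ip2_def by simp
qed

lemma lie_dstar_hom2: "lie_dstar (hom2 s B) = hom1 s (lie_dstar B)"
proof (rule cochain1_eq_ip1)
  fix h assume h: "cochain1 h"
  have "ip1 h (lie_dstar (hom2 s B)) = ip2 (hom2 s (lie_d h)) B"
    by (simp add: lie_dstar_adjoint[OF h] ip2_hom2)
  then show "ip1 h (lie_dstar (hom2 s B)) = ip1 h (hom1 s (lie_dstar B))"
    by (simp add: hom2_lie_d lie_dstar_adjoint[OF cochain1_hom1[OF h], symmetric] ip1_hom1)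
qed (simp_all add: cochain1_hom1 cochain1_lie_dstar)

lemma cofilt1_iff_hom1: "cofilt1 r f \<longleftrightarrow> cochain1 f \<and> (\<forall>s<r. hom1 s f = 0)"
proof (intro iffI conjI allI impI)
  assume f: "cofilt1 r f"
  then show "cochain1 f" by (simp add: cofilt1_def)
  fix s assume "s < r"
  show "hom1 s f = 0"
  proof (rule blinfun_eqI)
    fix x
    have "component (j + s) (f (component j x)) = 0" for j
      using cofilt1_apply[OF f hfilt_gr[OF component_in order_refl, of j x] order_refl] \<open>s < r\<close> by (simp add: hfilt_iff)
    then show "hom1 s f x = blinfun_apply 0 x" by (simp add: hom1_apply)
  qed
next
  assume f: "cochain1 f \<and> (\<forall>s<r. hom1 s f = 0)"
  show "cofilt1 r f"
    unfolding cofilt1_def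
  proof (intro conjI allI ballI)
    fix i x assume x: "x \<in> hfilt gr i"
    have "component m (f (component j x)) = 0" if m: "m < i + r" for m j
    proof (cases "j < i")
      case True
      then show ?thesis using x by (simp add: hfilt_iff)
    next
      case False
      then have "hom1 (m - j) f = 0" using f m by simp
      then show ?thesis using hom1_gr[OF component_in, of "m - j" f j x] by simp
    qed
    then have "f (\<Sum>j=-k..l. component j x) \<in> hfilt gr (i + r)"
      unfolding blinfun.sum_right by (intro hfilt_sum) (simp add: hfilt_iff)
    then show "f x \<in> hfilt gr (i + r)" by (simp add: component_sum)
  qed (use f in simp)
qed

lemma cofilt1_lie_dstar:
  assumes B: "cofilt2 r B" shows "cofilt1 r (lie_dstar B)"
  unfolding cofilt1_iff_hom1
proof (intro conjI allI impI cochain1_lie_dstar)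
  fix s assume s: "s < r"
  have "hom2 s B = 0"
  proof (intro blinfun_eqI)
    fix x y
    have "component (i + j + s) (B (component i x) (component j y)) = 0" for i j
      using cofilt2_apply[OF B hfilt_gr[OF component_in order_refl, of i x] hfilt_gr[OF component_in order_refl, of j y] order_refl] s
      by (simp add: hfilt_iff)
    then show "hom2 s B x y = (0 :: 'h \<Rightarrow>\<^sub>L 'h \<Rightarrow>\<^sub>L 'h) x y" by (simp add: hom2_apply)
  qed
  then show "hom1 s (lie_dstar B) = 0"
    using lie_dstar_hom2[of s B] by (simp add: linear_0[OF linear_lie_dstar])
qed

text \<open>If \<open>f = lie_dstar B\<close> and \<open>lie_dstar (lie_d f) = 0\<close>, then \<open>lie_d f\<close> is orthogonal to itself, and \<open>f\<close> is
  orthogonal to itself because \<open>ip1 f f = ip2 (lie_d f) B\<close>.  Applied to the homogeneous components of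
  \<open>f\<close>, this also controls the homogeneity of \<open>f\<close>.\<close>

definition coexact :: "('h \<Rightarrow>\<^sub>L 'h) set" where
  "coexact = lie_dstar ` {B. cochain2 B}"

lemma coexact_injective:
  assumes "f \<in> coexact" "lie_dstar (lie_d f) = 0" shows "f = 0"
proof -
  obtain B where B: "f = lie_dstar B" using assms(1) by (auto simp: coexact_def)
  have f: "cochain1 f" by (simp add: B cochain1_lie_dstar)
  have "ip2 (lie_d f) (lie_d f) = 0"
    using lie_dstar_adjoint[OF f, of "lie_d f"] assms(2) by (simp add: ip1_linear)
  then have "lie_d f = 0" by (rule ip2_definite[OF cochain2_lie_d])
  then have "ip1 f f = 0" using lie_dstar_adjoint[OF f, of B] by (simp add: B[symmetric] ip2_linear)
  then show ?thesis by (rule ip1_definite[OF f])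
qed

lemma coexact_cofilt1:
  assumes "f \<in> coexact" "cofilt1 r (lie_dstar (lie_d f))" shows "cofilt1 r f"
proof -
  obtain B where B: "f = lie_dstar B" "cochain2 B" using assms(1) by (auto simp: coexact_def)
  have "hom1 s f = 0" if "s < r" for s
  proof (rule coexact_injective)
    show "hom1 s f \<in> coexact"
      using cochain2_hom2[OF B(2)] unfolding B(1) lie_dstar_hom2[symmetric] coexact_def by blast
    show "lie_dstar (lie_d (hom1 s f)) = 0"
      using assms(2) that by (simp add: cofilt1_iff_hom1 hom2_lie_d[symmetric] lie_dstar_hom2)
  qed
  then show ?thesis by (simp add: cofilt1_iff_hom1 B(1) cochain1_lie_dstar)
qed

lemma subspace_coexact: "subspace coexact"
  unfolding coexact_def
  by (intro linear_subspace_image linear_lie_dstar) (simp add: subspace_def cochain2_simps)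

lemma coexact_cochain1: "f \<in> coexact \<Longrightarrow> cochain1 f"
  by (auto simp: coexact_def cochain1_lie_dstar)

text \<open>\<open>lie_dstar \<circ> lie_d\<close> maps the finite dimensional space \<open>coexact\<close> injectively to itself, so it has a
  linear right inverse there.\<close>

lemma coexact_right_inverse:
  obtains G where "linear G" "\<And>f. f \<in> coexact \<Longrightarrow> G f \<in> coexact" "\<And>f. f \<in> coexact \<Longrightarrow> lie_dstar (lie_d (G f)) = f"
proof -
  let ?L = "\<lambda>f. lie_dstar (lie_d f)"
  have "linear lie_d" by (rule linearI) (simp_all add: lie_d_linear)
  then have L: "linear ?L"
    using linear_compose[OF _ linear_lie_dstar, of lie_d] by (simp add: o_def)
  have into: "?L f \<in> coexact" for f
    unfolding coexact_def using cochain2_lie_d by blast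
  define E where "E = (\<lambda>(b, e). elem b e) ` (minus_basis \<times> full_basis)"
  have fE: "finite E"
    using finite_minus_basis full_basis by (simp add: E_def orthonormal_basis_def)
  have spanE: "coexact \<subseteq> span E"
  proof
    fix f assume "f \<in> coexact"
    have "ip e (f b) *\<^sub>R elem b e \<in> span E" if "b \<in> minus_basis" "e \<in> full_basis" for b e
      using that by (intro span_scale span_base) (force simp: E_def)
    then have "(\<Sum>b\<in>minus_basis. \<Sum>e\<in>full_basis. ip e (f b) *\<^sub>R elem b e) \<in> span E"
      by (intro span_sum)
    then show "f \<in> span E"
      using cochain1_expand[OF coexact_cochain1[OF \<open>f \<in> coexact\<close>]] by simp
  qed
  obtain B where B: "B \<subseteq> coexact" "independent B" "coexact \<subseteq> span B"
    using maximal_independent_subset[of coexact] by blast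
  have finB: "finite B"
    using independent_span_bound[OF fE B(2)] B(1) spanE by blast
  have spanB: "span B = coexact"
    using B span_minimal[OF B(1) subspace_coexact] by blast
  have inj: "inj_on ?L (span B)"
    unfolding spanB linear_inj_on_iff_eq_0[OF L subspace_coexact] using coexact_injective by blast
  have ind: "independent (?L ` B)"
    using linear_independent_injective_image[OF L B(2) inj] .
  have card: "card (?L ` B) = card B"
    using inj_on_subset[OF inj span_superset] by (rule card_image)
  have surj: "coexact \<subseteq> ?L ` coexact"
  proof (rule ccontr)
    assume "\<not> coexact \<subseteq> ?L ` coexact"
    then obtain y where y: "y \<in> coexact" "y \<notin> ?L ` coexact" by blast
    have "span (?L ` B) = ?L ` coexact" using linear_span_image[OF L, of B] spanB by simp
    then have "independent (insert y (?L ` B))"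
      using independent_insertI[OF _ ind, of y] y by simp
    moreover have "insert y (?L ` B) \<subseteq> span B" using spanB into y by auto
    ultimately have "card (insert y (?L ` B)) \<le> card B"
      using independent_span_bound[OF finB] by blast
    moreover have "y \<notin> ?L ` B" using y B(1) by blast
    ultimately show False using card finB by simp
  qed
  obtain G where G: "range G \<subseteq> coexact" "linear G" "\<And>v. v \<in> ?L ` coexact \<Longrightarrow> ?L (G v) = v"
    using linear_exists_right_inverse_on[OF L subspace_coexact] by auto
  show ?thesis by (rule that[of G]) (use G surj in auto)
qed

end

section \<open>Cochains as functions on lists\<close>

context graded_lie
begin

definition list_cochain1 :: "('h \<Rightarrow>\<^sub>L 'h) \<Rightarrow> 'h list \<Rightarrow> 'h" where
  "list_cochain1 f xs = (if xs \<in> cochain_args gr 1 then f (xs ! 0) else 0)"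

definition list_cochain2 :: "('h \<Rightarrow>\<^sub>L 'h \<Rightarrow>\<^sub>L 'h) \<Rightarrow> 'h list \<Rightarrow> 'h" where
  "list_cochain2 B xs = (if xs \<in> cochain_args gr 2 then B (xs ! 0) (xs ! 1) else 0)"

lemma cochain_args_1: "xs \<in> cochain_args gr 1 \<longleftrightarrow> (\<exists>x\<in>hminus gr. xs = [x])"
  by (auto simp: cochain_args_def length_Suc_conv)

lemma cochain_args_2: "xs \<in> cochain_args gr 2 \<longleftrightarrow> (\<exists>x\<in>hminus gr. \<exists>y\<in>hminus gr. xs = [x, y])"
  by (auto simp: cochain_args_def numeral_2_eq_2 length_Suc_conv)

lemma list_cochain1_simp [simp]: "x \<in> hminus gr \<Longrightarrow> list_cochain1 f [x] = f x"
  by (simp add: list_cochain1_def cochain_args_1 del: One_nat_def)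

lemma list_cochain2_simp [simp]: "x \<in> hminus gr \<Longrightarrow> y \<in> hminus gr \<Longrightarrow> list_cochain2 B [x, y] = B x y"
  by (simp add: list_cochain2_def cochain_args_2)

lemma list_cochain1_cochains: "list_cochain1 f \<in> cochains gr 1"
  unfolding cochains_def
proof (intro CollectI conjI ballI allI impI)
  fix xs i c x y assume *: "xs \<in> cochain_args gr 1" "i < (1::nat)" "x \<in> hminus gr" "y \<in> hminus gr"
  then show "list_cochain1 f (xs[i := c *\<^sub>R x + y]) = c *\<^sub>R list_cochain1 f (xs[i := x]) + list_cochain1 f (xs[i := y])"
    using subspace_add[OF hminus_subspace subspace_scale[OF hminus_subspace *(3), of c] *(4)]
    by (auto simp: cochain_args_1 blinfun.bilinear_simps simp del: One_nat_def)
qed (auto simp: list_cochain1_def cochain_args_1 simp del: One_nat_def)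

lemma list_cochain2_cochains:
  assumes "cochain2 B" shows "list_cochain2 B \<in> cochains gr 2"
  unfolding cochains_def
proof (intro CollectI conjI ballI allI impI)
  fix xs i c x y assume *: "xs \<in> cochain_args gr 2" "i < (2::nat)" "x \<in> hminus gr" "y \<in> hminus gr"
  have "i = 0 \<or> i = 1" using *(2) by auto
  then show "list_cochain2 B (xs[i := c *\<^sub>R x + y]) = c *\<^sub>R list_cochain2 B (xs[i := x]) + list_cochain2 B (xs[i := y])"
    using * subspace_add[OF hminus_subspace subspace_scale[OF hminus_subspace *(3), of c] *(4)]
    by (auto simp: cochain_args_2 blinfun.bilinear_simps)
qed (use assms in \<open>auto simp: list_cochain2_def cochain_args_2 cochain2_def\<close>)

lemma cochains_1E:
  assumes "\<psi> \<in> cochains gr 1"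
  obtains f where "cochain1 f" "\<psi> = list_cochain1 f"
proof -
  have lin: "\<psi> [c *\<^sub>R x + y] = c *\<^sub>R \<psi> [x] + \<psi> [y]" if "x \<in> hminus gr" "y \<in> hminus gr" for c x y
  proof -
    have "[x] \<in> cochain_args gr 1" using that by (simp add: cochain_args_1 del: One_nat_def)
    then have "\<psi> ([x][0 := c *\<^sub>R x + y]) = c *\<^sub>R \<psi> ([x][0 := x]) + \<psi> ([x][0 := y])"
      using assms that unfolding cochains_def by blast
    then show ?thesis by simp
  qed
  have 0: "\<psi> [0] = 0" using lin[of 0 0 1] subspace_0[OF hminus_subspace] by simp
  have "linear (\<lambda>x. \<psi> [pr x])"
  proof (rule linearI)
    show "\<psi> [pr (x + y)] = \<psi> [pr x] + \<psi> [pr y]" for x y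
      using lin[of "pr x" "pr y" 1] by (simp add: pr_add)
    show "\<psi> [pr (c *\<^sub>R x)] = c *\<^sub>R \<psi> [pr x]" for c x
      using lin[of "pr x" 0 c] subspace_0[OF hminus_subspace] 0 by (simp add: pr_scaleR)
  qed
  then have ap: "Blinfun (\<lambda>x. \<psi> [pr x]) x = \<psi> [pr x]" for x by (rule blinfun_apply_Blinfun)
  show ?thesis
  proof (rule that)
    show "cochain1 (Blinfun (\<lambda>x. \<psi> [pr x]))" by (simp add: cochain1_def ap)
    show "\<psi> = list_cochain1 (Blinfun (\<lambda>x. \<psi> [pr x]))"
    proof
      fix xs
      show "\<psi> xs = list_cochain1 (Blinfun (\<lambda>x. \<psi> [pr x])) xs"
      proof (cases "xs \<in> cochain_args gr 1")
        case True
        then show ?thesis by (auto simp: cochain_args_1 ap pr_id simp del: One_nat_def)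
      next
        case False
        then show ?thesis using assms by (auto simp: cochains_def list_cochain1_def simp del: One_nat_def)
      qed
    qed
  qed
qed

lemma list_cochain1_inj:
  assumes "cochain1 f" "cochain1 g" "list_cochain1 f = list_cochain1 g" shows "f = g"
proof (rule blinfun_eqI)
  fix x
  have "f (pr x) = g (pr x)" using fun_cong[OF assms(3), of "[pr x]"] by simp
  then show "f x = g x" using assms by (simp add: cochain1_def)
qed

lemma lie_diff_list_cochain1:
  assumes "brk A = br" "grd A = gr"
  shows "lie_diff A 1 (list_cochain1 f) = list_cochain2 (lie_d f)"
proof
  fix xs
  show "lie_diff A 1 (list_cochain1 f) xs = list_cochain2 (lie_d f) xs"
  proof (cases "xs \<in> cochain_args gr 2")
    case True
    then obtain x y where xy: "x \<in> hminus gr" "y \<in> hminus gr" "xs = [x, y]" by (auto simp: cochain_args_2)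
    have sets: "{..1::nat} = {0, 1}" "{..<1::nat} = {0}" by auto
    have args: "[x, y] \<in> cochain_args gr (Suc 1)" using True xy by (simp add: numeral_2_eq_2)
    have "lie_diff A 1 (list_cochain1 f) [x, y] =
        (\<Sum>i\<in>{0, 1}. (-1) ^ i *\<^sub>R br ([x, y] ! i) (list_cochain1 f (drop_nth i [x, y])))
        + (\<Sum>j\<in>{0, 1}. \<Sum>i<j. (-1) ^ (i + j) *\<^sub>R
             list_cochain1 f (br ([x, y] ! i) ([x, y] ! j) # drop_nth i (drop_nth j [x, y])))"
      by (simp only: lie_diff_def assms args if_True sets(1))
    also have "\<dots> = br x (f y) - br y (f x) - f (br x y)"
      using sets(2) xy hminus_br by (simp add: drop_nth_def)
    finally show ?thesis using xy by (simp add: lie_d_apply pr_id)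
  next
    case False
    then show ?thesis by (simp add: lie_diff_def assms list_cochain2_def numeral_2_eq_2)
  qed
qed

end

context metric_lie
begin

lemma orthonormal_basis_chosen:
  "orthonormal_basis ip (hminus gr) (SOME B. orthonormal_basis ip (hminus gr) B)"
  by (rule someI_ex) (rule orthonormal_basis_exists[OF metric hminus_subspace])

lemma cochain_metric_1: "cochain_metric gr ip 1 (list_cochain1 f) (list_cochain1 g) = ip1 f g"
proof -
  define B where "B = (SOME B. orthonormal_basis ip (hminus gr) B)"
  have B: "orthonormal_basis ip (hminus gr) B" unfolding B_def by (rule orthonormal_basis_chosen)
  then have sub: "B \<subseteq> hminus gr" by (simp add: orthonormal_basis_def)
  have set: "{xs. length xs = 1 \<and> set xs \<subseteq> B} = (\<lambda>b. [b]) ` B"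
    by (auto simp: length_Suc_conv)
  have "cochain_metric gr ip 1 (list_cochain1 f) (list_cochain1 g) = (\<Sum>b\<in>B. ip (list_cochain1 f [b]) (list_cochain1 g [b]))"
    unfolding cochain_metric_def Let_def B_def[symmetric] set by (subst sum.reindex) (auto simp: inj_on_def)
  also have "\<dots> = (\<Sum>b\<in>B. ip (f b) (g b))"
    using sub by (intro sum.cong) auto
  also have "\<dots> = ip1 f g"
    unfolding ip1_def
    by (rule orthonormal_basis_trace[OF metric B minus_basis])
      (auto intro!: linearI simp: blinfun.bilinear_simps ip.add_left ip.add_right ip.scaleR_left ip.scaleR_right)
  finally show ?thesis .
qed

lemma cochain_metric_2: "cochain_metric gr ip 2 (list_cochain2 S) (list_cochain2 T) = ip2 S T"
proof -
  define B where "B = (SOME B. orthonormal_basis ip (hminus gr) B)"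
  have B: "orthonormal_basis ip (hminus gr) B" unfolding B_def by (rule orthonormal_basis_chosen)
  then have sub: "B \<subseteq> hminus gr" by (simp add: orthonormal_basis_def)
  have set: "{xs. length xs = 2 \<and> set xs \<subseteq> B} = (\<lambda>(a, b). [a, b]) ` (B \<times> B)"
    by (auto simp: numeral_2_eq_2 length_Suc_conv)
  have "cochain_metric gr ip 2 (list_cochain2 S) (list_cochain2 T)
      = (\<Sum>(a, b)\<in>B \<times> B. ip (list_cochain2 S [a, b]) (list_cochain2 T [a, b])) / 2"
    unfolding cochain_metric_def Let_def B_def[symmetric] set
    by (subst sum.reindex) (auto simp: inj_on_def case_prod_unfold o_def)
  also have "\<dots> = (\<Sum>a\<in>B. \<Sum>b\<in>B. ip (list_cochain2 S [a, b]) (list_cochain2 T [a, b])) / 2"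
    by (simp add: sum.cartesian_product)
  also have "\<dots> = (\<Sum>a\<in>B. \<Sum>b\<in>B. ip (S a b) (T a b)) / 2"
  proof -
    have "ip (list_cochain2 S [a, b]) (list_cochain2 T [a, b]) = ip (S a b) (T a b)" if "a \<in> B" "b \<in> B" for a b
      using that sub by (simp add: subset_eq)
    then show ?thesis by simp
  qed
  also have "\<dots> = (\<Sum>a\<in>B. \<Sum>b\<in>minus_basis. ip (S a b) (T a b)) / 2"
  proof -
    have "(\<Sum>b\<in>B. ip (S a b) (T a b)) = (\<Sum>b\<in>minus_basis. ip (S a b) (T a b))" for a
      by (rule orthonormal_basis_trace[OF metric B minus_basis])
        (auto intro!: linearI simp: blinfun.bilinear_simps ip.add_left ip.add_right ip.scaleR_left ip.scaleR_right)
    then show ?thesis by simp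
  qed
  also have "(\<Sum>a\<in>B. \<Sum>b\<in>minus_basis. ip (S a b) (T a b)) = (\<Sum>a\<in>minus_basis. \<Sum>b\<in>minus_basis. ip (S a b) (T a b))"
    by (rule orthonormal_basis_trace[OF metric B minus_basis, of "\<lambda>a a'. \<Sum>b\<in>minus_basis. ip (S a b) (T a' b)"])
      (auto intro!: linearI simp: blinfun.bilinear_simps ip.add_left ip.add_right ip.scaleR_left ip.scaleR_right
        sum.distrib sum_distrib_left)
  finally show ?thesis by (simp add: ip2_def)
qed

lemma adjoint_diff_eq:
  assumes A: "brk A = br" "grd A = gr"
  shows "adjoint_diff A ip 1 (list_cochain2 B) = list_cochain1 (lie_dstar B)"
  unfolding adjoint_diff_def A
proof (rule the_equality)
  have metric: "cochain_metric gr ip 1 (list_cochain1 h) (list_cochain1 f) =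
      cochain_metric gr ip (Suc 1) (lie_diff A 1 (list_cochain1 h)) (list_cochain2 B) \<longleftrightarrow> ip1 h f = ip1 h (lie_dstar B)"
    if "cochain1 h" for h f
  proof -
    have 2: "Suc 1 = 2" by simp
    show ?thesis
      unfolding lie_diff_list_cochain1[OF A] 2 cochain_metric_2 cochain_metric_1 lie_dstar_adjoint[OF that] ..
  qed
  show "list_cochain1 (lie_dstar B) \<in> cochains gr 1 \<and>
    (\<forall>\<omega>\<in>cochains gr 1. cochain_metric gr ip 1 \<omega> (list_cochain1 (lie_dstar B)) =
        cochain_metric gr ip (Suc 1) (lie_diff A 1 \<omega>) (list_cochain2 B))"
    using list_cochain1_cochains metric cochains_1E by metis
  fix \<psi> assume \<psi>: "\<psi> \<in> cochains gr 1 \<and> (\<forall>\<omega>\<in>cochains gr 1. cochain_metric gr ip 1 \<omega> \<psi> =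
        cochain_metric gr ip (Suc 1) (lie_diff A 1 \<omega>) (list_cochain2 B))"
  then obtain f where f: "cochain1 f" "\<psi> = list_cochain1 f" using cochains_1E by blast
  have "ip1 h f = ip1 h (lie_dstar B)" if "cochain1 h" for h
    using \<psi> metric[OF that, of f] list_cochain1_cochains f(2) by blast
  then have "f = lie_dstar B" by (rule cochain1_eq_ip1[OF f(1) cochain1_lie_dstar])
  then show "\<psi> = list_cochain1 (lie_dstar B)" using f by simp
qed

end

section \<open>Charts and derivatives on manifolds\<close>

lemma cinv_in: "x \<in> snd c ` fst c \<Longrightarrow> cinv c x \<in> fst c"
  unfolding cinv_def by (rule inv_into_into)

lemma chart_cinv: "x \<in> snd c ` fst c \<Longrightarrow> snd c (cinv c x) = x"
  unfolding cinv_def by (rule f_inv_into_f)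

context
  fixes M :: "('m, 'e::euclidean_space) mfd"
  assumes M: "smooth_manifold M"
begin

lemma chart_openin: "c \<in> atlas M \<Longrightarrow> openin (mtop M) (fst c)"
  using M by (simp add: smooth_manifold_def)

lemma chart_subset: "c \<in> atlas M \<Longrightarrow> p \<in> fst c \<Longrightarrow> p \<in> pts M"
  using chart_openin openin_subset by blast

lemma chart_image_open: "c \<in> atlas M \<Longrightarrow> open (snd c ` fst c)"
  using M by (simp add: smooth_manifold_def)

lemma chart_homeo: "c \<in> atlas M \<Longrightarrow>
    homeomorphic_map (subtopology (mtop M) (fst c)) (top_of_set (snd c ` fst c)) (snd c)"
  using M by (simp add: smooth_manifold_def)

lemma chart_topspace: "c \<in> atlas M \<Longrightarrow> topspace (subtopology (mtop M) (fst c)) = fst c"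
  using chart_openin openin_subset by (metis topspace_subtopology_subset)

lemma chart_inj: "c \<in> atlas M \<Longrightarrow> inj_on (snd c) (fst c)"
  using chart_homeo[of c] chart_topspace[of c] homeomorphic_imp_injective_map by fastforce

lemma cinv_chart: "c \<in> atlas M \<Longrightarrow> p \<in> fst c \<Longrightarrow> cinv c (snd c p) = p"
  unfolding cinv_def by (rule inv_into_f_f[OF chart_inj])

lemma chart_openin_image: "c \<in> atlas M \<Longrightarrow> openin (mtop M) W \<Longrightarrow> open (snd c ` (fst c \<inter> W))"
proof -
  assume c: "c \<in> atlas M" and W: "openin (mtop M) W"
  have "openin (subtopology (mtop M) (fst c)) (fst c \<inter> W)"
    using W by (metis openin_subtopology_Int2)
  then have "openin (top_of_set (snd c ` fst c)) (snd c ` (fst c \<inter> W))"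
    using homeomorphic_imp_open_map[OF chart_homeo[OF c]] by (simp add: open_map_def)
  then show ?thesis using chart_image_open[OF c] openin_open_trans by blast
qed

lemma cinv_continuous:
  assumes c: "c \<in> atlas M" shows "continuous_map (top_of_set (snd c ` fst c)) (mtop M) (cinv c)"
proof -
  obtain g where "homeomorphic_maps (subtopology (mtop M) (fst c)) (top_of_set (snd c ` fst c)) (snd c) g"
    using chart_homeo[OF c] by (auto simp: homeomorphic_map_maps)
  then have g: "continuous_map (top_of_set (snd c ` fst c)) (subtopology (mtop M) (fst c)) g"
    "\<And>p. p \<in> fst c \<Longrightarrow> g (snd c p) = p"
    using chart_topspace[OF c] by (auto simp: homeomorphic_maps_def)
  have "continuous_map (top_of_set (snd c ` fst c)) (mtop M) g"
    using g(1) by (simp add: continuous_map_in_subtopology)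
  then show ?thesis
    by (rule continuous_map_eq) (use g(2) cinv_chart[OF c] in auto)
qed

lemma pref_chart: "p \<in> pts M \<Longrightarrow> pref M p \<in> atlas M" and pref_mem: "p \<in> pts M \<Longrightarrow> p \<in> fst (pref M p)"
proof -
  have "\<exists>c. c \<in> atlas M \<and> p \<in> fst c" if "p \<in> pts M"
    using M that unfolding smooth_manifold_def by blast
  then show "p \<in> pts M \<Longrightarrow> pref M p \<in> atlas M" "p \<in> pts M \<Longrightarrow> p \<in> fst (pref M p)"
    unfolding pref_def using someI_ex[of "\<lambda>c. c \<in> atlas M \<and> p \<in> fst c"] by auto
qed

lemma smooth_map_ident: "smooth_map M M (\<lambda>p. p)"
proof -
  have "{p \<in> fst c. p \<in> fst d} = fst c \<inter> fst d" for c d :: "('m, 'e) chart" by auto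
  then show ?thesis using M by (auto simp: smooth_map_def smooth_manifold_def o_def)
qed

end

definition chart_deriv :: "('m, 'e::euclidean_space) chart \<Rightarrow> ('n, 'f::euclidean_space) chart
    \<Rightarrow> ('m \<Rightarrow> 'n) \<Rightarrow> 'm \<Rightarrow> 'e \<Rightarrow> 'f" where
  "chart_deriv c d f p = frechet_derivative (snd d \<circ> f \<circ> cinv c) (at (snd c p))"

lemma mderiv_eq: "mderiv M N f p = chart_deriv (pref M p) (pref N (f p)) f p"
  by (simp add: mderiv_def chart_deriv_def)

lemma chart_form_eq:
  "smooth_manifold M \<Longrightarrow> c \<in> atlas M \<Longrightarrow> p \<in> fst c \<Longrightarrow>
   chart_form M c \<kappa> (snd c p) v = \<kappa> p (chart_deriv c (pref M p) (\<lambda>p. p) p v)"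
  by (simp add: chart_form_def chart_deriv_def cinv_chart o_def)

lemma chart_field_eq:
  "smooth_manifold M \<Longrightarrow> c \<in> atlas M \<Longrightarrow> p \<in> fst c \<Longrightarrow>
   chart_field M c X (snd c p) = chart_deriv (pref M p) c (\<lambda>p. p) p (X p)"
  by (simp add: chart_field_def coords_def chart_deriv_def cinv_chart o_def)

lemma smooth_map_pts: "smooth_map M N f \<Longrightarrow> p \<in> pts M \<Longrightarrow> f p \<in> pts N"
  unfolding smooth_map_def continuous_map_def by blast

lemma smooth_map_preimage:
  "smooth_map M N f \<Longrightarrow> openin (mtop N) W \<Longrightarrow> openin (mtop M) {p \<in> pts M. f p \<in> W}"
  unfolding smooth_map_def by (blast intro: openin_continuous_map_preimage)

lemma smooth_map_open_dom:
  assumes "smooth_manifold M" "smooth_manifold N" "smooth_map M N f" "c \<in> atlas M" "openin (mtop N) W"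
  shows "open (snd c ` {p \<in> fst c. f p \<in> W})"
proof -
  have "openin (mtop M) {p \<in> pts M. f p \<in> W}"
    by (rule smooth_map_preimage[OF assms(3,5)])
  then have "open (snd c ` (fst c \<inter> {p \<in> pts M. f p \<in> W}))"
    by (rule chart_openin_image[OF assms(1,4)])
  moreover have "fst c \<inter> {p \<in> pts M. f p \<in> W} = {p \<in> fst c. f p \<in> W}"
    using chart_subset[OF assms(1,4)] by auto
  ultimately show ?thesis by simp
qed

lemma smooth_map_chart:
  assumes "smooth_map M N f" "c \<in> atlas M" "d \<in> atlas N"
  shows "smooth_on (snd c ` {p \<in> fst c. f p \<in> fst d}) (snd d \<circ> f \<circ> cinv c)"
  using assms by (simp add: smooth_map_def)

lemma chart_deriv_works:
  assumes "smooth_map M N f" "c \<in> atlas M" "d \<in> atlas N" "p \<in> fst c" "f p \<in> fst d"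
  shows "((snd d \<circ> f \<circ> cinv c) has_derivative chart_deriv c d f p) (at (snd c p))"
  unfolding chart_deriv_def
  using smooth_on_derivative[OF smooth_map_chart[OF assms(1-3)]] assms(4,5) by blast

lemma chart_deriv_linear:
  assumes "smooth_map M N f" "c \<in> atlas M" "d \<in> atlas N" "p \<in> fst c" "f p \<in> fst d"
  shows "linear (chart_deriv c d f p)"
  by (rule has_derivative_linear[OF chart_deriv_works[OF assms]])

lemma smooth_map_compose:
  assumes mf: "smooth_manifold M" "smooth_manifold N" "smooth_manifold K"
    and f: "smooth_map M N f" and g: "smooth_map N K g"
  shows "smooth_map M K (\<lambda>p. g (f p))"
  unfolding smooth_map_def
proof (intro conjI ballI)
  show "continuous_map (mtop M) (mtop K) (\<lambda>p. g (f p))"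
    using f g continuous_map_compose[of "mtop M" "mtop N" f "mtop K" g] by (simp add: smooth_map_def o_def)
  have gf: "continuous_map (mtop M) (mtop K) (\<lambda>p. g (f p))" by fact
  fix c e assume c: "c \<in> atlas M" and e: "e \<in> atlas K"
  have "{p \<in> fst c. g (f p) \<in> fst e} = {p \<in> fst c. f p \<in> {q \<in> pts N. g q \<in> fst e}}"
    using chart_subset[OF mf(1) c] smooth_map_pts[OF f] by auto
  moreover have og: "openin (mtop N) {q \<in> pts N. g q \<in> fst e}"
    by (rule smooth_map_preimage[OF g chart_openin[OF mf(3) e]])
  ultimately have op: "open (snd c ` {p \<in> fst c. g (f p) \<in> fst e})"
    using smooth_map_open_dom[OF mf(1,2) f c og] by simp
  show "smooth_on (snd c ` {p \<in> fst c. g (f p) \<in> fst e}) (snd e \<circ> (\<lambda>p. g (f p)) \<circ> cinv c)"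
  proof (rule smooth_on_locally[OF op])
    fix x assume "x \<in> snd c ` {p \<in> fst c. g (f p) \<in> fst e}"
    then obtain p where p: "p \<in> fst c" "g (f p) \<in> fst e" "x = snd c p" by auto
    define d where "d = pref N (f p)"
    have fp: "f p \<in> pts N" using p chart_subset[OF mf(1) c] smooth_map_pts[OF f] by blast
    then have d: "d \<in> atlas N" "f p \<in> fst d" by (simp_all add: d_def pref_chart pref_mem mf)
    let ?U = "snd c ` {p \<in> fst c. f p \<in> {q \<in> fst d. g q \<in> fst e}}"
    have "{q \<in> fst d. g q \<in> fst e} = fst d \<inter> {q \<in> pts N. g q \<in> fst e}"
      using chart_subset[OF mf(2) d(1)] by auto
    then have "openin (mtop N) {q \<in> fst d. g q \<in> fst e}"
      using openin_Int[OF chart_openin[OF mf(2) d(1)] og] by simp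
    then have U: "open ?U" by (rule smooth_map_open_dom[OF mf(1,2) f c])
    have "smooth_on ?U (\<lambda>x. (snd e \<circ> g \<circ> cinv d) ((snd d \<circ> f \<circ> cinv c) x))"
    proof (rule smooth_on_compose[OF U smooth_map_open_dom[OF mf(2,3) g d(1) chart_openin[OF mf(3) e]] smooth_map_chart[OF g d(1) e]])
      show "smooth_on ?U (snd d \<circ> f \<circ> cinv c)"
        by (rule smooth_on_subset[OF smooth_map_chart[OF f c d(1)]]) auto
      show "(snd d \<circ> f \<circ> cinv c) ` ?U \<subseteq> snd d ` {p \<in> fst d. g p \<in> fst e}"
        using cinv_chart[OF mf(1) c] by auto
    qed
    then have "smooth_on ?U (snd e \<circ> (\<lambda>p. g (f p)) \<circ> cinv c)"
      by (rule smooth_on_cong[OF U]) (auto simp: cinv_chart[OF mf(1) c] cinv_chart[OF mf(2) d(1)])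
    then show "\<exists>U. open U \<and> x \<in> U \<and> smooth_on U (snd e \<circ> (\<lambda>p. g (f p)) \<circ> cinv c)"
      using U p d by (intro exI[of _ ?U]) auto
  qed
qed

lemma chart_deriv_compose:
  assumes mf: "smooth_manifold M" "smooth_manifold N" "smooth_manifold K"
    and f: "smooth_map M N f" and g: "smooth_map N K g"
    and ch: "c \<in> atlas M" "d \<in> atlas N" "e \<in> atlas K" "p \<in> fst c" "f p \<in> fst d" "g (f p) \<in> fst e"
  shows "chart_deriv c e (\<lambda>p. g (f p)) p v = chart_deriv d e g (f p) (chart_deriv c d f p v)"
proof -
  let ?U = "snd c ` {p \<in> fst c. f p \<in> fst d}"
  have U: "open ?U" by (rule smooth_map_open_dom[OF mf(1,2) f ch(1) chart_openin[OF mf(2) ch(2)]])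
  have "((\<lambda>x. (snd e \<circ> g \<circ> cinv d) ((snd d \<circ> f \<circ> cinv c) x)) has_derivative
      (\<lambda>v. chart_deriv d e g (f p) (chart_deriv c d f p v))) (at (snd c p))"
    using has_derivative_compose[OF chart_deriv_works[OF f ch(1,2,4,5)], of "snd e \<circ> g \<circ> cinv d" "chart_deriv d e g (f p)"]
      chart_deriv_works[OF g ch(2,3,5,6)] ch by (simp add: cinv_chart[OF mf(1)])
  then have "((snd e \<circ> (\<lambda>p. g (f p)) \<circ> cinv c) has_derivative
      (\<lambda>v. chart_deriv d e g (f p) (chart_deriv c d f p v))) (at (snd c p))"
    by (rule has_derivative_transform_within_open[OF _ U])
      (use ch in \<open>auto simp: cinv_chart[OF mf(1) ch(1)] cinv_chart[OF mf(2) ch(2)]\<close>)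
  then show ?thesis
    unfolding chart_deriv_def[of c e] using frechet_derivative_at by metis
qed

lemma chart_deriv_ident:
  assumes mf: "smooth_manifold M" and c: "c \<in> atlas M" "p \<in> fst c"
  shows "chart_deriv c c (\<lambda>p. p) p v = v"
proof -
  have "((\<lambda>x. x) has_derivative (\<lambda>v. v)) (at (snd c p))" by (rule has_derivative_ident)
  then have "((snd c \<circ> (\<lambda>p. p) \<circ> cinv c) has_derivative (\<lambda>v. v)) (at (snd c p))"
    by (rule has_derivative_transform_within_open[OF _ chart_image_open[OF mf c(1)]])
      (use c in \<open>auto simp: cinv_chart[OF mf c(1)]\<close>)
  then show ?thesis unfolding chart_deriv_def using frechet_derivative_at by metis
qed

lemma chart_deriv_cong:
  assumes mf: "smooth_manifold M" and c: "c \<in> atlas M" "p \<in> fst c" and eq: "\<And>p. p \<in> pts M \<Longrightarrow> f p = g p"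
  shows "chart_deriv c d f p = chart_deriv c d g p"
proof -
  have "frechet_derivative (snd d \<circ> f \<circ> cinv c) (at x) = frechet_derivative (snd d \<circ> g \<circ> cinv c) (at x)"
    if x: "x \<in> snd c ` fst c" for x
  proof -
    have e: "(snd d \<circ> f \<circ> cinv c) y = (snd d \<circ> g \<circ> cinv c) y" if "y \<in> snd c ` fst c" for y
      using eq chart_subset[OF mf c(1) cinv_in[OF that]] by simp
    have "(snd d \<circ> f \<circ> cinv c has_derivative F) (at x) \<longleftrightarrow> (snd d \<circ> g \<circ> cinv c has_derivative F) (at x)" for F
      using has_derivative_transform_within_open[OF _ chart_image_open[OF mf c(1)] x] e by metis
    then show ?thesis by (simp add: frechet_derivative_def)
  qed
  then show ?thesis using c by (simp add: chart_deriv_def)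
qed

lemma chart_deriv_ident_inverse:
  assumes mf: "smooth_manifold M" and c: "c \<in> atlas M" "p \<in> fst c" "d \<in> atlas M" "p \<in> fst d"
  shows "chart_deriv d c (\<lambda>p. p) p (chart_deriv c d (\<lambda>p. p) p v) = v"
  using chart_deriv_compose[OF mf mf mf smooth_map_ident[OF mf] smooth_map_ident[OF mf] c(1,3,1,2,4,2)]
    chart_deriv_ident[OF mf c(1,2)] by simp

text \<open>Functions with values in a normed space need a notion of their own: spaces of operators are not of
  class \<open>euclidean_space\<close>, so they are not manifolds in the sense of \<open>mfd\<close>.\<close>

definition smooth_fun :: "('m, 'e::euclidean_space) mfd \<Rightarrow> ('m \<Rightarrow> 'v::real_normed_vector) \<Rightarrow> bool" where
  "smooth_fun M f \<longleftrightarrow> (\<forall>c\<in>atlas M. smooth_on (snd c ` fst c) (f \<circ> cinv c))"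

definition fun_deriv :: "('m, 'e::euclidean_space) chart \<Rightarrow> ('m \<Rightarrow> 'v::real_normed_vector) \<Rightarrow> 'm \<Rightarrow> 'e \<Rightarrow> 'v" where
  "fun_deriv c f p = frechet_derivative (f \<circ> cinv c) (at (snd c p))"

lemma fun_deriv_works:
  "smooth_fun M f \<Longrightarrow> c \<in> atlas M \<Longrightarrow> p \<in> fst c \<Longrightarrow> ((f \<circ> cinv c) has_derivative fun_deriv c f p) (at (snd c p))"
  unfolding smooth_fun_def fun_deriv_def by (blast intro: smooth_on_derivative)

lemma fun_deriv_linear: "smooth_fun M f \<Longrightarrow> c \<in> atlas M \<Longrightarrow> p \<in> fst c \<Longrightarrow> linear (fun_deriv c f p)"
  by (rule has_derivative_linear[OF fun_deriv_works])

lemma fun_deriv_compose: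
  assumes mf: "smooth_manifold M" "smooth_manifold N"
    and h: "smooth_map M N h" and f: "smooth_fun N f"
    and ch: "c \<in> atlas M" "d \<in> atlas N" "p \<in> fst c" "h p \<in> fst d"
  shows "((\<lambda>x. f (h (cinv c x))) has_derivative (\<lambda>v. fun_deriv d f (h p) (chart_deriv c d h p v))) (at (snd c p))"
    and "fun_deriv c (\<lambda>p. f (h p)) p v = fun_deriv d f (h p) (chart_deriv c d h p v)"
proof -
  let ?U = "snd c ` {p \<in> fst c. h p \<in> fst d}"
  have U: "open ?U" by (rule smooth_map_open_dom[OF mf h ch(1) chart_openin[OF mf(2) ch(2)]])
  have "((\<lambda>x. (f \<circ> cinv d) ((snd d \<circ> h \<circ> cinv c) x)) has_derivative
      (\<lambda>v. fun_deriv d f (h p) (chart_deriv c d h p v))) (at (snd c p))"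
    using has_derivative_compose[OF chart_deriv_works[OF h ch(1,2,3,4)], of "f \<circ> cinv d" "fun_deriv d f (h p)"]
      fun_deriv_works[OF f ch(2,4)] ch by (simp add: cinv_chart[OF mf(1)])
  then show *: "((\<lambda>x. f (h (cinv c x))) has_derivative (\<lambda>v. fun_deriv d f (h p) (chart_deriv c d h p v))) (at (snd c p))"
    by (rule has_derivative_transform_within_open[OF _ U])
      (use ch in \<open>auto simp: cinv_chart[OF mf(1) ch(1)] cinv_chart[OF mf(2) ch(2)]\<close>)
  show "fun_deriv c (\<lambda>p. f (h p)) p v = fun_deriv d f (h p) (chart_deriv c d h p v)"
    using fun_cong[OF frechet_derivative_at[OF *], of v] by (simp add: fun_deriv_def[of c] o_def)
qed

lemma smooth_fun_compose:
  assumes mf: "smooth_manifold M" "smooth_manifold N" and h: "smooth_map M N h" and f: "smooth_fun N f"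
  shows "smooth_fun M (\<lambda>p. f (h p))"
  unfolding smooth_fun_def
proof (intro ballI smooth_on_locally)
  fix c assume c: "c \<in> atlas M"
  then show "open (snd c ` fst c)" by (rule chart_image_open[OF mf(1)])
  fix x assume "x \<in> snd c ` fst c"
  then obtain p where p: "p \<in> fst c" "x = snd c p" by auto
  define d where "d = pref N (h p)"
  have "h p \<in> pts N" using p chart_subset[OF mf(1) c] smooth_map_pts[OF h] by blast
  then have d: "d \<in> atlas N" "h p \<in> fst d" by (simp_all add: d_def pref_chart pref_mem mf)
  let ?U = "snd c ` {p \<in> fst c. h p \<in> fst d}"
  have U: "open ?U" by (rule smooth_map_open_dom[OF mf h c chart_openin[OF mf(2) d(1)]])
  have "smooth_on (snd d ` fst d) (f \<circ> cinv d)"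
    using f d(1) unfolding smooth_fun_def by blast
  then have "smooth_on ?U (\<lambda>x. (f \<circ> cinv d) ((snd d \<circ> h \<circ> cinv c) x))"
    by (rule smooth_on_compose[OF U chart_image_open[OF mf(2) d(1)] _ smooth_map_chart[OF h c d(1)]])
      (use d cinv_chart[OF mf(1) c] in auto)
  then have "smooth_on ?U ((\<lambda>p. f (h p)) \<circ> cinv c)"
    by (rule smooth_on_cong[OF U]) (auto simp: cinv_chart[OF mf(1) c] cinv_chart[OF mf(2) d(1)])
  then show "\<exists>U. open U \<and> x \<in> U \<and> smooth_on U ((\<lambda>p. f (h p)) \<circ> cinv c)"
    using U p d by (intro exI[of _ ?U]) auto
qed

lemma fun_deriv_change:
  assumes mf: "smooth_manifold M" and f: "smooth_fun M f"
    and ch: "c \<in> atlas M" "d \<in> atlas M" "p \<in> fst c" "p \<in> fst d"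
  shows "fun_deriv c f p v = fun_deriv d f p (chart_deriv c d (\<lambda>p. p) p v)"
  using fun_deriv_compose(2)[OF mf mf smooth_map_ident[OF mf] f ch] by simp

section \<open>Maps from products of manifolds\<close>

text \<open>The chart expression of a map on a product in product charts, with both coordinates visible, so that
  derivatives in directions \<open>(v, 0)\<close> and \<open>(0, w)\<close> are the derivatives of the partial maps.\<close>

definition prod_dom :: "('m, 'e) chart \<Rightarrow> ('n, 'f) chart \<Rightarrow> ('k, 'g) chart \<Rightarrow> ('m \<times> 'n \<Rightarrow> 'k) \<Rightarrow> ('e \<times> 'f) set" where
  "prod_dom c d e f = {(x, y). x \<in> snd c ` fst c \<and> y \<in> snd d ` fst d \<and> f (cinv c x, cinv d y) \<in> fst e}"

definition prod_rep :: "('m, 'e) chart \<Rightarrow> ('n, 'f) chart \<Rightarrow> ('k, 'g) chart \<Rightarrow> ('m \<times> 'n \<Rightarrow> 'k) \<Rightarrow> 'e \<times> 'f \<Rightarrow> 'g" where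
  "prod_rep c d e f = (\<lambda>(x, y). snd e (f (cinv c x, cinv d y)))"

context
  fixes M :: "('m, 'e::euclidean_space) mfd" and N :: "('n, 'f::euclidean_space) mfd"
    and K :: "('k, 'g::euclidean_space) mfd" and f
  assumes mf: "smooth_manifold M" "smooth_manifold N" "smooth_manifold K"
    and f: "smooth_map (prod_mfd M N) K f"
begin

lemma prod_dom_open:
  assumes ch: "c \<in> atlas M" "d \<in> atlas N" "e \<in> atlas K"
  shows "open (prod_dom c d e f)"
proof -
  let ?S = "snd c ` fst c \<times> snd d ` fst d"
  have tp: "prod_topology (top_of_set (snd c ` fst c)) (top_of_set (snd d ` fst d)) = top_of_set ?S"
    by simp
  have 1: "continuous_map (top_of_set ?S) (prod_topology (mtop M) (mtop N)) (\<lambda>(x, y). (cinv c x, cinv d y))"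
    unfolding tp[symmetric] continuous_map_prod_top
    using cinv_continuous[OF mf(1) ch(1)] cinv_continuous[OF mf(2) ch(2)] by blast
  have 2: "continuous_map (prod_topology (mtop M) (mtop N)) (mtop K) f"
    using f by (simp add: smooth_map_def prod_mfd_def)
  have "continuous_map (top_of_set ?S) (mtop K) (f \<circ> (\<lambda>(x, y). (cinv c x, cinv d y)))"
    by (rule continuous_map_compose[OF 1 2])
  then have "openin (top_of_set ?S) {z \<in> ?S. (f \<circ> (\<lambda>(x, y). (cinv c x, cinv d y))) z \<in> fst e}"
    using openin_continuous_map_preimage[OF _ chart_openin[OF mf(3) ch(3)]] by fastforce
  moreover have "open ?S"
    by (rule open_Times[OF chart_image_open[OF mf(1) ch(1)] chart_image_open[OF mf(2) ch(2)]])
  ultimately have "open {z \<in> ?S. (f \<circ> (\<lambda>(x, y). (cinv c x, cinv d y))) z \<in> fst e}"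
    by (rule openin_open_trans)
  moreover have "{z \<in> ?S. (f \<circ> (\<lambda>(x, y). (cinv c x, cinv d y))) z \<in> fst e} = prod_dom c d e f"
    by (auto simp: prod_dom_def)
  ultimately show ?thesis by simp
qed

lemma prod_rep_smooth:
  assumes ch: "c \<in> atlas M" "d \<in> atlas N" "e \<in> atlas K"
  shows "smooth_on (prod_dom c d e f) (prod_rep c d e f)"
proof -
  let ?pc = "(fst c \<times> fst d, \<lambda>(x, y). (snd c x, snd d y))"
  have pc: "?pc \<in> atlas (prod_mfd M N)" unfolding prod_mfd_def mfd.simps using ch by blast
  have inj: "inj_on (snd ?pc) (fst ?pc)"
    using chart_inj[OF mf(1) ch(1)] chart_inj[OF mf(2) ch(2)] by (auto simp: inj_on_def)
  have cinv: "cinv ?pc (snd c p, snd d q) = (p, q)" if "p \<in> fst c" "q \<in> fst d" for p q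
    using inv_into_f_f[OF inj, of "(p, q)"] that by (simp add: cinv_def)
  have dom: "snd ?pc ` {p \<in> fst ?pc. f p \<in> fst e} = prod_dom c d e f"
  proof (intro Set.set_eqI iffI)
    fix z assume "z \<in> snd ?pc ` {p \<in> fst ?pc. f p \<in> fst e}"
    then show "z \<in> prod_dom c d e f"
      using cinv_chart[OF mf(1) ch(1)] cinv_chart[OF mf(2) ch(2)] by (auto simp: prod_dom_def)
  next
    fix z assume "z \<in> prod_dom c d e f"
    then obtain x y where z: "z = (x, y)" "x \<in> snd c ` fst c" "y \<in> snd d ` fst d" "f (cinv c x, cinv d y) \<in> fst e"
      by (auto simp: prod_dom_def)
    then have "z = snd ?pc (cinv c x, cinv d y)" "(cinv c x, cinv d y) \<in> fst ?pc"
      by (simp_all add: chart_cinv cinv_in)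
    then show "z \<in> snd ?pc ` {p \<in> fst ?pc. f p \<in> fst e}" using z(4) by blast
  qed
  have "smooth_on (prod_dom c d e f) (snd e \<circ> f \<circ> cinv ?pc)"
    using smooth_map_chart[OF f pc ch(3)] unfolding dom .
  then show ?thesis
  proof (rule smooth_on_cong[OF prod_dom_open[OF ch]])
    fix z assume "z \<in> prod_dom c d e f"
    then obtain p q where "z = (snd c p, snd d q)" "p \<in> fst c" "q \<in> fst d" by (auto simp: prod_dom_def)
    then show "(snd e \<circ> f \<circ> cinv ?pc) z = prod_rep c d e f z"
      using cinv_chart[OF mf(1) ch(1)] cinv_chart[OF mf(2) ch(2)] by (simp add: cinv prod_rep_def)
  qed
qed

lemma smooth_map_right:
  assumes p: "p \<in> pts M" shows "smooth_map N K (\<lambda>q. f (p, q))"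
  unfolding smooth_map_def
proof (intro conjI ballI)
  have "continuous_map (mtop N) (prod_topology (mtop M) (mtop N)) (\<lambda>q. (p, q))"
    using p by (simp add: continuous_map_pairedI)
  then show "continuous_map (mtop N) (mtop K) (\<lambda>q. f (p, q))"
    using f continuous_map_compose[of "mtop N" _ "\<lambda>q. (p, q)" "mtop K" f]
    by (simp add: smooth_map_def prod_mfd_def o_def)
  then have cont: "continuous_map (mtop N) (mtop K) (\<lambda>q. f (p, q))" .
  fix d e assume d: "d \<in> atlas N" and e: "e \<in> atlas K"
  define c where "c = pref M p"
  have c: "c \<in> atlas M" "p \<in> fst c" by (simp_all add: c_def pref_chart pref_mem mf p)
  let ?U = "snd d ` {q \<in> fst d. f (p, q) \<in> fst e}"
  have "openin (mtop N) {q \<in> pts N. f (p, q) \<in> fst e}"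
    by (rule openin_continuous_map_preimage[OF cont chart_openin[OF mf(3) e]])
  then have "open (snd d ` (fst d \<inter> {q \<in> pts N. f (p, q) \<in> fst e}))"
    by (rule chart_openin_image[OF mf(2) d])
  moreover have "fst d \<inter> {q \<in> pts N. f (p, q) \<in> fst e} = {q \<in> fst d. f (p, q) \<in> fst e}"
    using chart_subset[OF mf(2) d] by auto
  ultimately have U: "open ?U" by simp
  have "smooth_on ?U (\<lambda>y. prod_rep c d e f (snd c p, y))"
    by (rule smooth_on_compose[OF U prod_dom_open[OF c(1) d e] prod_rep_smooth[OF c(1) d e]
          smooth_on_Pair[OF U smooth_on_const smooth_on_id[OF U]]])
      (use c cinv_chart[OF mf(1) c(1)] cinv_chart[OF mf(2) d] in \<open>auto simp: prod_dom_def\<close>)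
  then show "smooth_on ?U (snd e \<circ> (\<lambda>q. f (p, q)) \<circ> cinv d)"
    by (rule smooth_on_cong[OF U]) (use c cinv_chart[OF mf(1) c(1)] in \<open>auto simp: prod_rep_def\<close>)
qed

lemma smooth_map_left:
  assumes q: "q \<in> pts N" shows "smooth_map M K (\<lambda>p. f (p, q))"
  unfolding smooth_map_def
proof (intro conjI ballI)
  have "continuous_map (mtop M) (prod_topology (mtop M) (mtop N)) (\<lambda>p. (p, q))"
    using q by (simp add: continuous_map_pairedI)
  then show "continuous_map (mtop M) (mtop K) (\<lambda>p. f (p, q))"
    using f continuous_map_compose[of "mtop M" _ "\<lambda>p. (p, q)" "mtop K" f]
    by (simp add: smooth_map_def prod_mfd_def o_def)
  then have cont: "continuous_map (mtop M) (mtop K) (\<lambda>p. f (p, q))" .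
  fix c e assume c: "c \<in> atlas M" and e: "e \<in> atlas K"
  define d where "d = pref N q"
  have d: "d \<in> atlas N" "q \<in> fst d" by (simp_all add: d_def pref_chart pref_mem mf q)
  let ?U = "snd c ` {p \<in> fst c. f (p, q) \<in> fst e}"
  have "openin (mtop M) {p \<in> pts M. f (p, q) \<in> fst e}"
    by (rule openin_continuous_map_preimage[OF cont chart_openin[OF mf(3) e]])
  then have "open (snd c ` (fst c \<inter> {p \<in> pts M. f (p, q) \<in> fst e}))"
    by (rule chart_openin_image[OF mf(1) c])
  moreover have "fst c \<inter> {p \<in> pts M. f (p, q) \<in> fst e} = {p \<in> fst c. f (p, q) \<in> fst e}"
    using chart_subset[OF mf(1) c] by auto
  ultimately have U: "open ?U" by simp
  have "smooth_on ?U (\<lambda>x. prod_rep c d e f (x, snd d q))"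
    by (rule smooth_on_compose[OF U prod_dom_open[OF c d(1) e] prod_rep_smooth[OF c d(1) e]
          smooth_on_Pair[OF U smooth_on_id[OF U] smooth_on_const]])
      (use d cinv_chart[OF mf(1) c] cinv_chart[OF mf(2) d(1)] in \<open>auto simp: prod_dom_def\<close>)
  then show "smooth_on ?U (snd e \<circ> (\<lambda>p. f (p, q)) \<circ> cinv c)"
    by (rule smooth_on_cong[OF U]) (use d cinv_chart[OF mf(2) d(1)] in \<open>auto simp: prod_rep_def\<close>)
qed

lemma prod_rep_partial:
  assumes ch: "c \<in> atlas M" "d \<in> atlas N" "e \<in> atlas K" "p \<in> fst c" "q \<in> fst d" "f (p, q) \<in> fst e"
  shows "(snd c p, snd d q) \<in> prod_dom c d e f"
    and "frechet_derivative (prod_rep c d e f) (at (snd c p, snd d q)) (v, 0) = chart_deriv c e (\<lambda>p. f (p, q)) p v"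
    and "frechet_derivative (prod_rep c d e f) (at (snd c p, snd d q)) (0, w) = chart_deriv d e (\<lambda>q. f (p, q)) q w"
proof -
  show in_dom: "(snd c p, snd d q) \<in> prod_dom c d e f"
    using ch cinv_chart[OF mf(1) ch(1)] cinv_chart[OF mf(2) ch(2)] by (auto simp: prod_dom_def)
  let ?T = "prod_rep c d e f"
  have T: "(?T has_derivative frechet_derivative ?T (at (snd c p, snd d q))) (at (snd c p, snd d q))"
    by (rule smooth_on_derivative[OF prod_rep_smooth[OF ch(1-3)] in_dom])
  have "((\<lambda>x. (x, snd d q)) has_derivative (\<lambda>v. (v, 0))) (at (snd c p))"
    by (auto intro!: derivative_eq_intros)
  from has_derivative_compose[OF this T]
  have "((\<lambda>x. ?T (x, snd d q)) has_derivative (\<lambda>v. frechet_derivative ?T (at (snd c p, snd d q)) (v, 0))) (at (snd c p))" .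
  moreover have "(\<lambda>x. ?T (x, snd d q)) = snd e \<circ> (\<lambda>p. f (p, q)) \<circ> cinv c"
    using cinv_chart[OF mf(2) ch(2,5)] by (auto simp: prod_rep_def)
  ultimately show "frechet_derivative ?T (at (snd c p, snd d q)) (v, 0) = chart_deriv c e (\<lambda>p. f (p, q)) p v"
    unfolding chart_deriv_def using frechet_derivative_at by metis
  have "((\<lambda>y. (snd c p, y)) has_derivative (\<lambda>v. (0, v))) (at (snd d q))"
    by (auto intro!: derivative_eq_intros)
  from has_derivative_compose[OF this T]
  have "((\<lambda>y. ?T (snd c p, y)) has_derivative (\<lambda>v. frechet_derivative ?T (at (snd c p, snd d q)) (0, v))) (at (snd d q))" .
  moreover have "(\<lambda>y. ?T (snd c p, y)) = snd e \<circ> (\<lambda>q. f (p, q)) \<circ> cinv d"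
    using cinv_chart[OF mf(1) ch(1,4)] by (auto simp: prod_rep_def)
  ultimately show "frechet_derivative ?T (at (snd c p, snd d q)) (0, w) = chart_deriv d e (\<lambda>q. f (p, q)) q w"
    unfolding chart_deriv_def using frechet_derivative_at by metis
qed

end

section \<open>The adjoint representation of a Lie group\<close>

locale lie_grp =
  fixes H :: "'g monoid" (structure) and M :: "('g, 'a::euclidean_space) mfd"
  assumes lie: "lie_group H M"
begin

sublocale group H using lie by (simp add: lie_group_def)

lemma mf: "smooth_manifold M" and pts: "pts M = carrier H"
  using lie by (simp_all add: lie_group_def)

definition mul :: "'g \<times> 'g \<Rightarrow> 'g" where "mul = (\<lambda>(x, y). x \<otimes> y)"

lemma mul_apply [simp]: "mul (x, y) = x \<otimes> y" by (simp add: mul_def)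

lemma smooth_mul: "smooth_map (prod_mfd M M) M mul"
  using lie by (simp add: lie_group_def mul_def)

definition c1 where "c1 = pref M \<one>"
definition x1 where "x1 = snd c1 \<one>"
definition S1 where "S1 = snd c1 ` fst c1"

lemma c1: "c1 \<in> atlas M" "\<one> \<in> fst c1"
  by (simp_all add: c1_def pref_chart pref_mem mf pts)

lemma S1: "open S1" "x1 \<in> S1"
  using chart_image_open[OF mf c1(1)] c1(2) by (auto simp: S1_def x1_def)

lemma cinv_S1: "x \<in> S1 \<Longrightarrow> cinv c1 x \<in> fst c1" "x \<in> S1 \<Longrightarrow> cinv c1 x \<in> carrier H" "x \<in> S1 \<Longrightarrow> snd c1 (cinv c1 x) = x"
  using chart_subset[OF mf c1(1)] by (auto simp: S1_def cinv_in chart_cinv pts)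

lemma cinv_x1 [simp]: "cinv c1 x1 = \<one>"
  by (simp add: x1_def cinv_chart[OF mf c1(1)] c1)

lemma smooth_left: "g \<in> carrier H \<Longrightarrow> smooth_map M M (\<lambda>y. g \<otimes> y)"
  using smooth_map_right[OF mf mf mf smooth_mul, of g] by (simp add: pts)

lemma smooth_right: "g \<in> carrier H \<Longrightarrow> smooth_map M M (\<lambda>y. y \<otimes> g)"
  using smooth_map_left[OF mf mf mf smooth_mul, of g] by (simp add: pts)

lemma smooth_conj: "g \<in> carrier H \<Longrightarrow> smooth_map M M (\<lambda>y. g \<otimes> y \<otimes> inv g)"
  using smooth_map_compose[OF mf mf mf smooth_left smooth_right, of g "inv g"] by simp

text \<open>The derivatives of left and right translation at the identity, and their inverses, as operators
  depending on a point of the chart \<open>c1\<close> at the identity.\<close>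

definition lmul :: "'a \<Rightarrow> 'a \<Rightarrow>\<^sub>L 'a" where
  "lmul x = Blinfun (chart_deriv c1 c1 (\<lambda>y. cinv c1 x \<otimes> y) \<one>)"

definition rmul :: "'a \<Rightarrow> 'a \<Rightarrow>\<^sub>L 'a" where
  "rmul x = Blinfun (chart_deriv c1 c1 (\<lambda>y. y \<otimes> cinv c1 x) \<one>)"

definition lmul_inv :: "'a \<Rightarrow> 'a \<Rightarrow>\<^sub>L 'a" where
  "lmul_inv x = Blinfun (chart_deriv c1 c1 (\<lambda>y. inv (cinv c1 x) \<otimes> y) (cinv c1 x))"

definition rmul_inv :: "'a \<Rightarrow> 'a \<Rightarrow>\<^sub>L 'a" where
  "rmul_inv x = Blinfun (chart_deriv c1 c1 (\<lambda>y. y \<otimes> inv (cinv c1 x)) (cinv c1 x))"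

lemma Blinfun_chart_deriv:
  fixes c :: "('m, 'e::euclidean_space) chart" and d :: "('n, 'f::euclidean_space) chart"
  assumes "smooth_map K L f" "c \<in> atlas K" "d \<in> atlas L" "p \<in> fst c" "f p \<in> fst d"
  shows "blinfun_apply (Blinfun (chart_deriv c d f p)) v = chart_deriv c d f p v"
  using chart_deriv_linear[OF assms] by (simp add: bounded_linear_Blinfun_apply linear_conv_bounded_linear)

lemma mul_apply_eq:
  assumes "x \<in> S1"
  shows lmul_apply: "lmul x v = chart_deriv c1 c1 (\<lambda>y. cinv c1 x \<otimes> y) \<one> v"
    and rmul_apply: "rmul x v = chart_deriv c1 c1 (\<lambda>y. y \<otimes> cinv c1 x) \<one> v"
    and lmul_inv_apply: "lmul_inv x v = chart_deriv c1 c1 (\<lambda>y. inv (cinv c1 x) \<otimes> y) (cinv c1 x) v"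
    and rmul_inv_apply: "rmul_inv x v = chart_deriv c1 c1 (\<lambda>y. y \<otimes> inv (cinv c1 x)) (cinv c1 x) v"
  unfolding lmul_def rmul_def lmul_inv_def rmul_inv_def using cinv_S1[OF assms] c1
  by (simp_all add: Blinfun_chart_deriv[OF smooth_left] Blinfun_chart_deriv[OF smooth_right])

lemma lmul_inverse:
  assumes x: "x \<in> S1"
  shows "lmul_inv x (lmul x v) = v" "lmul x (lmul_inv x v) = v"
    "rmul_inv x (rmul x v) = v" "rmul x (rmul_inv x v) = v"
proof -
  define g where "g = cinv c1 x"
  have g: "g \<in> fst c1" "g \<in> carrier H" using cinv_S1[OF x] by (simp_all add: g_def)
  have comp: "chart_deriv c1 c1 h' q (chart_deriv c1 c1 h p v) = v"
    if "smooth_map M M h" "smooth_map M M h'" "p \<in> fst c1" "q \<in> fst c1" "h p = q" "\<And>y. y \<in> carrier H \<Longrightarrow> h' (h y) = y" for h h' p q v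
  proof -
    have p: "h' q = p" using that chart_subset[OF mf c1(1)] pts by blast
    have "chart_deriv c1 c1 h' q (chart_deriv c1 c1 h p v) = chart_deriv c1 c1 (\<lambda>y. h' (h y)) p v"
      using chart_deriv_compose[OF mf mf mf that(1,2) c1(1) c1(1) c1(1), of p v] that p by simp
    also have "\<dots> = chart_deriv c1 c1 (\<lambda>y. y) p v"
      using chart_deriv_cong[OF mf c1(1) that(3), of "\<lambda>y. h' (h y)" "\<lambda>y. y" c1] that(6) by (simp add: pts)
    finally show ?thesis using chart_deriv_ident[OF mf c1(1) that(3)] by simp
  qed
  show "lmul_inv x (lmul x v) = v" "lmul x (lmul_inv x v) = v"
    "rmul_inv x (rmul x v) = v" "rmul x (rmul_inv x v) = v"
    unfolding mul_apply_eq[OF x] g_def[symmetric]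
    using g c1 by (auto intro!: comp smooth_left smooth_right simp: m_assoc[symmetric])
      (simp_all add: m_assoc)
qed

lemma mul_dom: "x \<in> S1 \<Longrightarrow> (x, x1) \<in> prod_dom c1 c1 c1 mul" "x \<in> S1 \<Longrightarrow> (x1, x) \<in> prod_dom c1 c1 c1 mul"
  using cinv_S1[of x] S1(2) by (simp_all add: prod_dom_def S1_def[symmetric])

lemma rep_deriv:
  assumes "x \<in> S1"
  shows "frechet_derivative (prod_rep c1 c1 c1 mul) (at (x, x1)) (0, v) = lmul x v"
    and "frechet_derivative (prod_rep c1 c1 c1 mul) (at (x1, x)) (v, 0) = rmul x v"
  using prod_rep_partial(3)[OF mf mf mf smooth_mul c1(1) c1(1) c1(1) cinv_S1(1)[OF assms] c1(2), of v]
    prod_rep_partial(2)[OF mf mf mf smooth_mul c1(1) c1(1) c1(1) c1(2) cinv_S1(1)[OF assms], of v]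
    cinv_S1[OF assms] by (simp_all add: mul_apply_eq[OF assms] x1_def[symmetric])

lemma smooth_rep_deriv:
  "smooth_on (prod_dom c1 c1 c1 mul) (\<lambda>z. frechet_derivative (prod_rep c1 c1 c1 mul) (at z) a)"
  by (rule smooth_on_frechet[OF prod_rep_smooth[OF mf mf mf smooth_mul c1(1) c1(1) c1(1)]])

lemma mul_dom_open: "open (prod_dom c1 c1 c1 mul)"
  by (rule prod_dom_open[OF mf mf mf smooth_mul c1(1) c1(1) c1(1)])

lemma smooth_lmul: "smooth_on S1 lmul"
proof (rule smooth_on_blinfunI[OF S1(1)])
  fix v
  have "smooth_on S1 (\<lambda>x. frechet_derivative (prod_rep c1 c1 c1 mul) (at (x, x1)) (0, v))"
    by (rule smooth_on_compose[OF S1(1) mul_dom_open smooth_rep_deriv smooth_on_Pair[OF S1(1) smooth_on_id[OF S1(1)] smooth_on_const]])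
      (auto simp: mul_dom)
  then show "smooth_on S1 (\<lambda>x. lmul x v)"
    by (rule smooth_on_cong[OF S1(1)]) (simp add: rep_deriv)
qed

lemma smooth_rmul: "smooth_on S1 rmul"
proof (rule smooth_on_blinfunI[OF S1(1)])
  fix v
  have "smooth_on S1 (\<lambda>x. frechet_derivative (prod_rep c1 c1 c1 mul) (at (x1, x)) (v, 0))"
    by (rule smooth_on_compose[OF S1(1) mul_dom_open smooth_rep_deriv smooth_on_Pair[OF S1(1) smooth_on_const smooth_on_id[OF S1(1)]]])
      (auto simp: mul_dom)
  then show "smooth_on S1 (\<lambda>x. rmul x v)"
    by (rule smooth_on_cong[OF S1(1)]) (simp add: rep_deriv)
qed

lemma smooth_lmul_inv: "smooth_on S1 lmul_inv" and smooth_rmul_inv: "smooth_on S1 rmul_inv"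
  by (rule smooth_on_blinfun_inverse[OF S1(1) smooth_lmul] smooth_on_blinfun_inverse[OF S1(1) smooth_rmul];
      simp add: lmul_inverse)+

lemma lmul_x1: "lmul x1 v = v" and rmul_x1: "rmul x1 v = v"
proof -
  have "chart_deriv c1 c1 (\<lambda>y. \<one> \<otimes> y) \<one> v = chart_deriv c1 c1 (\<lambda>y. y) \<one> v"
    by (subst chart_deriv_cong[OF mf c1, of "\<lambda>y. \<one> \<otimes> y" "\<lambda>y. y"]) (simp_all add: pts)
  then show "lmul x1 v = v" by (simp add: mul_apply_eq[OF S1(2)] chart_deriv_ident[OF mf c1])
  have "chart_deriv c1 c1 (\<lambda>y. y \<otimes> \<one>) \<one> v = chart_deriv c1 c1 (\<lambda>y. y) \<one> v"
    by (subst chart_deriv_cong[OF mf c1, of "\<lambda>y. y \<otimes> \<one>" "\<lambda>y. y"]) (simp_all add: pts)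
  then show "rmul x1 v = v" by (simp add: mul_apply_eq[OF S1(2)] chart_deriv_ident[OF mf c1])
qed

definition adj :: "'g \<Rightarrow> 'a \<Rightarrow>\<^sub>L 'a" where
  "adj g = Blinfun (mderiv M M (\<lambda>y. g \<otimes> y \<otimes> inv g) \<one>)"

lemma mderiv_conj:
  "g \<in> carrier H \<Longrightarrow> mderiv M M (\<lambda>y. g \<otimes> y \<otimes> inv g) \<one> = chart_deriv c1 c1 (\<lambda>y. g \<otimes> y \<otimes> inv g) \<one>"
  by (simp add: mderiv_eq c1_def)

lemma adj_apply: 
  assumes "g \<in> carrier H"
  shows "adj g v = mderiv M M (\<lambda>y. g \<otimes> y \<otimes> inv g) \<one> v" 
    "adj g v = chart_deriv c1 c1 (\<lambda>y. g \<otimes> y \<otimes> inv g) \<one> v"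
  unfolding adj_def mderiv_conj[OF assms]
  using Blinfun_chart_deriv[OF smooth_conj[OF assms] c1(1) c1(1) c1(2)] assms c1 by simp_all

lemma adj_mult:
  assumes "g \<in> carrier H" "h \<in> carrier H" shows "adj (g \<otimes> h) v = adj g (adj h v)"
proof -
  have "chart_deriv c1 c1 (\<lambda>y. (g \<otimes> h) \<otimes> y \<otimes> inv (g \<otimes> h)) \<one>
      = chart_deriv c1 c1 (\<lambda>y. g \<otimes> (h \<otimes> y \<otimes> inv h) \<otimes> inv g) \<one>"
    by (rule chart_deriv_cong[OF mf c1]) (use assms in \<open>simp add: pts m_assoc inv_mult_group\<close>)
  then show ?thesis
    using chart_deriv_compose[OF mf mf mf smooth_conj[OF assms(2)] smooth_conj[OF assms(1)] c1(1) c1(1) c1(1) c1(2)] assms c1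
    by (simp add: adj_apply(2))
qed

lemma adj_one: "adj \<one> v = v"
proof -
  have "chart_deriv c1 c1 (\<lambda>y. \<one> \<otimes> y \<otimes> inv \<one>) \<one> = chart_deriv c1 c1 (\<lambda>y. y) \<one>"
    by (rule chart_deriv_cong[OF mf c1]) (simp add: pts)
  then show ?thesis by (simp add: adj_apply(2) chart_deriv_ident[OF mf c1])
qed

text \<open>\<open>(g y g\<^sup>-\<^sup>1) g = g y\<close>, differentiated in \<open>y\<close> at the identity.  This reduces the smoothness and the
  derivative of the adjoint representation to those of translations.\<close>

lemma rmul_adj:
  assumes x: "x \<in> S1" shows "rmul x (adj (cinv c1 x) v) = lmul x v"
proof -
  define g where "g = cinv c1 x"
  have g: "g \<in> fst c1" "g \<in> carrier H" using cinv_S1[OF x] by (simp_all add: g_def)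
  have "chart_deriv c1 c1 (\<lambda>y. (g \<otimes> y \<otimes> inv g) \<otimes> g) \<one> = chart_deriv c1 c1 (\<lambda>y. g \<otimes> y) \<one>"
    by (rule chart_deriv_cong[OF mf c1]) (use g in \<open>simp add: pts m_assoc\<close>)
  then show ?thesis
    using chart_deriv_compose[OF mf mf mf smooth_conj[OF g(2)] smooth_right[OF g(2)] c1(1) c1(1) c1(1) c1(2)] g c1
    by (simp add: adj_apply(2) mul_apply_eq[OF x] g_def[symmetric])
qed

lemma smooth_adj: "smooth_on S1 (\<lambda>x. adj (cinv c1 x))"
proof -
  have "smooth_on S1 (\<lambda>x. rmul_inv x o\<^sub>L lmul x)"
    by (rule smooth_on_bilinear[OF bounded_bilinear_blinfun_compose S1(1) smooth_rmul_inv smooth_lmul])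
  then show ?thesis
  proof (rule smooth_on_cong[OF S1(1)])
    fix x assume x: "x \<in> S1"
    show "rmul_inv x o\<^sub>L lmul x = adj (cinv c1 x)"
      by (rule blinfun_eqI) (simp add: lmul_inverse[OF x] flip: rmul_adj[OF x])
  qed
qed

text \<open>In the chart, both the derivative of the adjoint representation and the bracket of left invariant
  fields are the antisymmetrised mixed second derivative of the multiplication.\<close>

lemma commutator_left_invariant:
  "commutator M (left_invariant H M v) (left_invariant H M w) \<one> =
     frechet_derivative (\<lambda>x. lmul x w) (at x1) v - frechet_derivative (\<lambda>x. lmul x v) (at x1) w"
proof -
  have cf: "chart_field M c1 (left_invariant H M w) x = lmul x w" if x: "x \<in> S1" for x w
  proof -
    define g where "g = cinv c1 x"
    have g: "g \<in> fst c1" "g \<in> carrier H" "g \<in> pts M" "snd c1 g = x" using cinv_S1[OF x] by (simp_all add: g_def pts)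
    have "chart_field M c1 (left_invariant H M w) (snd c1 g) =
        chart_deriv (pref M g) c1 (\<lambda>p. p) g (chart_deriv c1 (pref M g) (\<lambda>y. g \<otimes> y) \<one> w)"
      unfolding chart_field_eq[OF mf c1(1) g(1)] left_invariant_def mderiv_eq c1_def[symmetric] using g(2) by simp
    also have "\<dots> = chart_deriv c1 c1 (\<lambda>y. g \<otimes> y) \<one> w"
      using chart_deriv_compose[OF mf mf mf smooth_left[OF g(2)] smooth_map_ident[OF mf] c1(1) _ c1(1) c1(2), of "pref M g" w]
        pref_chart[OF mf g(3)] pref_mem[OF mf g(3)] g by simp
    finally show ?thesis using g(4) by (simp add: mul_apply_eq[OF x] g_def[symmetric])
  qed
  have fd: "frechet_derivative (chart_field M c1 (left_invariant H M w)) (at x1) v = frechet_derivative (\<lambda>x. lmul x w) (at x1) v" for v w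
  proof -
    have "((\<lambda>x. lmul x w) has_derivative frechet_derivative (\<lambda>x. lmul x w) (at x1)) (at x1)"
      by (rule smooth_on_derivative[OF smooth_on_blinfun_apply[OF S1(1) smooth_lmul smooth_on_const] S1(2)])
    then have "(chart_field M c1 (left_invariant H M w) has_derivative frechet_derivative (\<lambda>x. lmul x w) (at x1)) (at x1)"
      by (rule has_derivative_transform_within_open[OF _ S1]) (simp add: cf)
    then show ?thesis using frechet_derivative_at by metis
  qed
  show ?thesis
    by (simp add: commutator_def Let_def c1_def[symmetric] x1_def[symmetric] fd cf[OF S1(2)] lmul_x1)
qed

lemma deriv_adj:
  "frechet_derivative (\<lambda>x. adj (cinv c1 x)) (at x1) v w =
     frechet_derivative (\<lambda>x. lmul x w) (at x1) v - frechet_derivative (\<lambda>x. lmul x v) (at x1) w"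
proof -
  let ?T = "prod_rep c1 c1 c1 mul"
  let ?A = "\<lambda>x. adj (cinv c1 x)"
  note D = smooth_on_derivative[OF _ S1(2)]
  have Dl: "((\<lambda>x. lmul x w) has_derivative frechet_derivative (\<lambda>x. lmul x w) (at x1)) (at x1)"
    by (rule D[OF smooth_on_blinfun_apply[OF S1(1) smooth_lmul smooth_on_const]])
  have Dr: "((\<lambda>x. rmul x (?A x w)) has_derivative (\<lambda>v. rmul x1 (frechet_derivative ?A (at x1) v w)
      + frechet_derivative rmul (at x1) v (?A x1 w))) (at x1)"
    by (rule bounded_bilinear.FDERIV[OF bounded_bilinear_blinfun_apply D[OF smooth_rmul]])
      (use bounded_linear.has_derivative[OF blinfun.bounded_linear_left D[OF smooth_adj], of w] in simp)
  have "((\<lambda>x. lmul x w) has_derivative (\<lambda>v. rmul x1 (frechet_derivative ?A (at x1) v w)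
      + frechet_derivative rmul (at x1) v (?A x1 w))) (at x1)"
    by (rule has_derivative_transform_within_open[OF Dr S1]) (rule rmul_adj)
  from has_derivative_unique[OF Dl this]
  have 1: "frechet_derivative (\<lambda>x. lmul x w) (at x1) v = frechet_derivative ?A (at x1) v w + frechet_derivative rmul (at x1) v w"
    by (simp add: rmul_x1 adj_one)
  have "(x1, x1) \<in> prod_dom c1 c1 c1 mul" using mul_dom S1 by blast
  note D2 = smooth_on_derivative[OF smooth_rep_deriv this]
  have "((\<lambda>x. (x1, x)) has_derivative (\<lambda>v. (0, v))) (at x1)" by (auto intro!: derivative_eq_intros)
  from has_derivative_compose[OF this D2[of "(w, 0)"]]
  have "((\<lambda>x. rmul x w) has_derivative (\<lambda>v. frechet_derivative (\<lambda>z. frechet_derivative ?T (at z) (w, 0)) (at (x1, x1)) (0, v))) (at x1)"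
    by (rule has_derivative_transform_within_open[OF _ S1]) (simp add: rep_deriv)
  moreover have "((\<lambda>x. rmul x w) has_derivative (\<lambda>v. frechet_derivative rmul (at x1) v w)) (at x1)"
    by (rule bounded_linear.has_derivative[OF blinfun.bounded_linear_left D[OF smooth_rmul]])
  ultimately have 2: "frechet_derivative rmul (at x1) v w = frechet_derivative (\<lambda>z. frechet_derivative ?T (at z) (w, 0)) (at (x1, x1)) (0, v)"
    using has_derivative_unique by metis
  have "((\<lambda>x. (x, x1)) has_derivative (\<lambda>v. (v, 0))) (at x1)" by (auto intro!: derivative_eq_intros)
  from has_derivative_compose[OF this D2[of "(0, v)"]]
  have "((\<lambda>x. lmul x v) has_derivative (\<lambda>w. frechet_derivative (\<lambda>z. frechet_derivative ?T (at z) (0, v)) (at (x1, x1)) (w, 0))) (at x1)"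
    by (rule has_derivative_transform_within_open[OF _ S1]) (simp add: rep_deriv)
  then have 3: "frechet_derivative (\<lambda>x. lmul x v) (at x1) w = frechet_derivative (\<lambda>z. frechet_derivative ?T (at z) (0, v)) (at (x1, x1)) (w, 0)"
    using frechet_derivative_at by metis
  show ?thesis
    using 1 2 3 second_derivative_symmetric[OF prod_rep_smooth[OF mf mf mf smooth_mul c1(1) c1(1) c1(1)] mul_dom_open
        \<open>(x1, x1) \<in> prod_dom c1 c1 c1 mul\<close>, of "(w, 0)" "(0, v)"] by simp
qed

text \<open>The homomorphism equation \<open>F (x y) = F x \<circ> F y\<close> near the identity, differentiated in \<open>y\<close> at
  the identity.\<close>

lemma deriv_left_translate:
  fixes F :: "'a \<Rightarrow> 'v::real_normed_vector \<Rightarrow>\<^sub>L 'v"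
  assumes x: "x \<in> S1" and F: "smooth_on U F" "open U" "U \<subseteq> S1" "x \<in> U" "x1 \<in> U"
    and hom: "\<And>y. y \<in> U \<Longrightarrow> cinv c1 x \<otimes> cinv c1 y \<in> fst c1 \<Longrightarrow> snd c1 (cinv c1 x \<otimes> cinv c1 y) \<in> U
      \<Longrightarrow> F (snd c1 (cinv c1 x \<otimes> cinv c1 y)) = F x o\<^sub>L F y"
  shows "frechet_derivative F (at x) (lmul x v) = F x o\<^sub>L frechet_derivative F (at x1) v"
proof -
  define g where "g = cinv c1 x"
  have g: "g \<in> fst c1" "g \<in> carrier H" "snd c1 g = x" using cinv_S1[OF x] by (simp_all add: g_def)
  let ?L = "snd c1 \<circ> (\<lambda>y. g \<otimes> y) \<circ> cinv c1"
  have L: "(?L has_derivative (\<lambda>v. lmul x v)) (at x1)"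
    using chart_deriv_works[OF smooth_left[OF g(2)] c1(1) c1(1) c1(2)] g
    by (simp add: mul_apply_eq[OF x] g_def[symmetric] x1_def)
  let ?W = "snd c1 ` {p \<in> fst c1. g \<otimes> p \<in> fst c1}"
  have W: "open ?W" by (rule smooth_map_open_dom[OF mf mf smooth_left[OF g(2)] c1(1) chart_openin[OF mf c1(1)]])
  have LW: "continuous_on ?W ?L"
    by (rule smooth_on_continuous[OF smooth_map_chart[OF smooth_left[OF g(2)] c1(1) c1(1)]])
  define V where "V = U \<inter> (?W \<inter> ?L -` U)"
  have V: "open V" unfolding V_def
    by (rule open_Int[OF F(2) continuous_open_preimage[OF LW W F(2)]])
  have Lx1: "?L x1 = x" using g by simp
  have x1V: "x1 \<in> V" using F(4,5) Lx1 c1 g unfolding V_def by (auto simp: x1_def)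
  have DF: "(F has_derivative frechet_derivative F (at x)) (at (?L x1))"
    using smooth_on_derivative[OF F(1,4)] Lx1 by simp
  have "((\<lambda>y. F x o\<^sub>L F y) has_derivative (\<lambda>v. F x o\<^sub>L frechet_derivative F (at x1) v)) (at x1)"
    by (rule bounded_linear.has_derivative[OF bounded_bilinear.bounded_linear_right[OF bounded_bilinear_blinfun_compose]
          smooth_on_derivative[OF F(1,5)]])
  then have "((\<lambda>y. F (?L y)) has_derivative (\<lambda>v. F x o\<^sub>L frechet_derivative F (at x1) v)) (at x1)"
  proof (rule has_derivative_transform_within_open[OF _ V x1V])
    fix y assume y: "y \<in> V"
    then obtain p where p: "p \<in> fst c1" "g \<otimes> p \<in> fst c1" "y = snd c1 p" by (auto simp: V_def)
    then show "F x o\<^sub>L F y = F (?L y)"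
      using hom[of y] y cinv_chart[OF mf c1(1), of p] by (simp add: V_def g_def[symmetric])
  qed
  from has_derivative_unique[OF this has_derivative_compose[OF L DF]]
  show ?thesis by metis
qed

end

section \<open>One-forms in charts\<close>

lemma frechet_blinfun_apply:
  assumes "smooth_on S B" "x \<in> S"
  shows "((\<lambda>y. blinfun_apply (B y) w) has_derivative (\<lambda>v. frechet_derivative B (at x) v w)) (at x)"
    and "frechet_derivative (\<lambda>y. blinfun_apply (B y) w) (at x) v = frechet_derivative B (at x) v w"
proof -
  show *: "((\<lambda>y. blinfun_apply (B y) w) has_derivative (\<lambda>v. frechet_derivative B (at x) v w)) (at x)"
    by (rule bounded_linear.has_derivative[OF blinfun.bounded_linear_left smooth_on_derivative[OF assms]])
  show "frechet_derivative (\<lambda>y. blinfun_apply (B y) w) (at x) v = frechet_derivative B (at x) v w"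
    using fun_cong[OF frechet_derivative_at[OF *], of v] by simp
qed

definition form_rep :: "('m, 'e::euclidean_space) mfd \<Rightarrow> ('m \<Rightarrow> 'e \<Rightarrow> 'v::real_normed_vector)
    \<Rightarrow> ('m, 'e) chart \<Rightarrow> 'e \<Rightarrow> 'e \<Rightarrow>\<^sub>L 'v" where
  "form_rep M \<kappa> c x = Blinfun (chart_form M c \<kappa> x)"

definition form_d :: "('m, 'e::euclidean_space) mfd \<Rightarrow> ('m \<Rightarrow> 'e \<Rightarrow> 'v::real_normed_vector)
    \<Rightarrow> ('m, 'e) chart \<Rightarrow> 'e \<Rightarrow> 'e \<Rightarrow> 'e \<Rightarrow> 'v" where
  "form_d M \<kappa> c x v w = frechet_derivative (form_rep M \<kappa> c) (at x) v w - frechet_derivative (form_rep M \<kappa> c) (at x) w v"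

context
  fixes M :: "('m, 'e::euclidean_space) mfd" and \<kappa> :: "'m \<Rightarrow> 'e \<Rightarrow> 'v::real_normed_vector"
  assumes M: "smooth_manifold M" and \<kappa>: "one_form M \<kappa>"
begin

lemma chart_form_linear: "c \<in> atlas M \<Longrightarrow> p \<in> fst c \<Longrightarrow> linear (chart_form M c \<kappa> (snd c p))"
proof -
  assume c: "c \<in> atlas M" "p \<in> fst c"
  have p: "p \<in> pts M" using chart_subset[OF M c] .
  have "linear (chart_deriv c (pref M p) (\<lambda>p. p) p)"
    by (rule chart_deriv_linear[OF smooth_map_ident[OF M] c(1) pref_chart[OF M p] c(2) pref_mem[OF M p]])
  moreover have "linear (\<kappa> p)" using \<kappa> p by (simp add: one_form_def)
  ultimately have "linear (\<lambda>v. \<kappa> p (chart_deriv c (pref M p) (\<lambda>p. p) p v))"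
    using linear_compose by (fastforce simp: o_def)
  moreover have "chart_form M c \<kappa> (snd c p) = (\<lambda>v. \<kappa> p (chart_deriv c (pref M p) (\<lambda>p. p) p v))"
    by (rule ext) (rule chart_form_eq[OF M c])
  ultimately show ?thesis by simp
qed

lemma form_rep_apply: "c \<in> atlas M \<Longrightarrow> p \<in> fst c \<Longrightarrow> form_rep M \<kappa> c (snd c p) v = chart_form M c \<kappa> (snd c p) v"
  unfolding form_rep_def by (rule blinfun_apply_Blinfun[OF chart_form_linear])

lemma form_rep_eq: "c \<in> atlas M \<Longrightarrow> p \<in> fst c \<Longrightarrow> form_rep M \<kappa> c (snd c p) v = \<kappa> p (chart_deriv c (pref M p) (\<lambda>p. p) p v)"
  by (simp add: form_rep_apply chart_form_eq[OF M])

lemma form_rep_pref: "p \<in> pts M \<Longrightarrow> form_rep M \<kappa> (pref M p) (snd (pref M p) p) v = \<kappa> p v"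
  by (simp add: form_rep_eq pref_chart pref_mem M chart_deriv_ident[OF M])

lemma form_rep_smooth: "c \<in> atlas M \<Longrightarrow> smooth_on (snd c ` fst c) (form_rep M \<kappa> c)"
proof -
  assume c: "c \<in> atlas M"
  have o: "open (snd c ` fst c)" by (rule chart_image_open[OF M c])
  show ?thesis
  proof (rule smooth_on_blinfunI[OF o])
    fix v
    have "smooth_on (snd c ` fst c) (\<lambda>x. chart_form M c \<kappa> x v)" using \<kappa> c by (simp add: one_form_def)
    then show "smooth_on (snd c ` fst c) (\<lambda>x. form_rep M \<kappa> c x v)"
      by (rule smooth_on_cong[OF o]) (auto simp: form_rep_apply[OF c])
  qed
qed

lemma ext_deriv_eq: 
  assumes p: "p \<in> pts M"
  shows "ext_deriv M \<kappa> p v w = form_d M \<kappa> (pref M p) (snd (pref M p) p) v w"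
proof -
  let ?c = "pref M p"
  have c: "?c \<in> atlas M" "p \<in> fst ?c" by (simp_all add: pref_chart pref_mem M p)
  have o: "open (snd ?c ` fst ?c)" by (rule chart_image_open[OF M c(1)])
  have x: "snd ?c p \<in> snd ?c ` fst ?c" using c(2) by blast
  have "frechet_derivative (\<lambda>y. chart_form M ?c \<kappa> y w) (at (snd ?c p)) v = frechet_derivative (form_rep M \<kappa> ?c) (at (snd ?c p)) v w" for v w
  proof -
    have "((\<lambda>y. chart_form M ?c \<kappa> y w) has_derivative (\<lambda>v. frechet_derivative (form_rep M \<kappa> ?c) (at (snd ?c p)) v w)) (at (snd ?c p))"
      by (rule has_derivative_transform_within_open[OF frechet_blinfun_apply(1)[OF form_rep_smooth[OF c(1)] x] o x])
        (auto simp: form_rep_apply[OF c(1)])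
    then show ?thesis using frechet_derivative_at by metis
  qed
  then show ?thesis by (simp add: ext_deriv_def form_d_def Let_def)
qed

lemma form_rep_pullback:
  assumes h: "smooth_map M M h" and L: "\<And>p v. p \<in> pts M \<Longrightarrow> \<kappa> (h p) (mderiv M M h p v) = blinfun_apply L (\<kappa> p v)"
    and c: "c \<in> atlas M" "d \<in> atlas M" and p: "p \<in> fst c" "h p \<in> fst d"
  shows "form_rep M \<kappa> d (snd d (h p)) (chart_deriv c d h p v) = L (form_rep M \<kappa> c (snd c p) v)"
proof -
  have pp: "p \<in> pts M" "h p \<in> pts M" using chart_subset[OF M c(1) p(1)] chart_subset[OF M c(2) p(2)] .
  let ?p = "pref M p" and ?q = "pref M (h p)"
  have pq: "?p \<in> atlas M" "p \<in> fst ?p" "?q \<in> atlas M" "h p \<in> fst ?q" using pp by (simp_all add: pref_chart pref_mem M)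
  have "form_rep M \<kappa> d (snd d (h p)) (chart_deriv c d h p v)
      = \<kappa> (h p) (chart_deriv d ?q (\<lambda>p. p) (h p) (chart_deriv c d h p v))"
    by (simp add: form_rep_eq[OF c(2) p(2)])
  also have "chart_deriv d ?q (\<lambda>p. p) (h p) (chart_deriv c d h p v) = chart_deriv c ?q h p v"
    using chart_deriv_compose[OF M M M h smooth_map_ident[OF M] c pq(3) p pq(4)] by simp
  also have "chart_deriv c ?q h p v = chart_deriv ?p ?q h p (chart_deriv c ?p (\<lambda>p. p) p v)"
    using chart_deriv_compose[OF M M M smooth_map_ident[OF M] h c(1) pq(1,3) p(1) pq(2,4)] by simp
  finally show ?thesis using L[OF pp(1)] by (simp add: form_rep_eq[OF c(1) p(1)] mderiv_eq)
qed

text \<open>Naturality of the exterior derivative: the second derivatives of the chart expression of \<open>h\<close> cancel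
  by symmetry.\<close>

lemma form_d_pullback:
  assumes h: "smooth_map M M h" and L: "\<And>p v. p \<in> pts M \<Longrightarrow> \<kappa> (h p) (mderiv M M h p v) = blinfun_apply L (\<kappa> p v)"
    and c: "c \<in> atlas M" "d \<in> atlas M" and p: "p \<in> fst c" "h p \<in> fst d"
  shows "form_d M \<kappa> d (snd d (h p)) (chart_deriv c d h p v) (chart_deriv c d h p w) = L (form_d M \<kappa> c (snd c p) v w)"
proof -
  let ?\<tau> = "snd d \<circ> h \<circ> cinv c"
  let ?W = "snd c ` {p \<in> fst c. h p \<in> fst d}"
  let ?x = "snd c p"
  let ?D2 = "\<lambda>v w. frechet_derivative (\<lambda>y. frechet_derivative ?\<tau> (at y) w) (at ?x) v"
  have W: "open ?W" by (rule smooth_map_open_dom[OF M M h c(1) chart_openin[OF M c(2)]])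
  have x: "?x \<in> ?W" using p by blast
  have \<tau>: "smooth_on ?W ?\<tau>" by (rule smooth_map_chart[OF h c])
  have \<tau>x: "?\<tau> ?x = snd d (h p)" using cinv_chart[OF M c(1) p(1)] by simp
  have D\<tau>: "(?\<tau> has_derivative chart_deriv c d h p) (at ?x)" by (rule chart_deriv_works[OF h c p])
  have Dd: "(form_rep M \<kappa> d has_derivative frechet_derivative (form_rep M \<kappa> d) (at (snd d (h p)))) (at (?\<tau> ?x))"
    unfolding \<tau>x by (rule smooth_on_derivative[OF form_rep_smooth[OF c(2)]]) (use p in blast)
  have key: "frechet_derivative (form_rep M \<kappa> d) (at (snd d (h p))) (chart_deriv c d h p v) (chart_deriv c d h p w)
       + form_rep M \<kappa> d (snd d (h p)) (?D2 v w) = L (frechet_derivative (form_rep M \<kappa> c) (at ?x) v w)" for v w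
  proof -
    have "((\<lambda>y. form_rep M \<kappa> d (?\<tau> y) (frechet_derivative ?\<tau> (at y) w)) has_derivative
       (\<lambda>v. form_rep M \<kappa> d (?\<tau> ?x) (?D2 v w) + frechet_derivative (form_rep M \<kappa> d) (at (snd d (h p))) (chart_deriv c d h p v) (frechet_derivative ?\<tau> (at ?x) w))) (at ?x)"
      by (rule bounded_bilinear.FDERIV[OF bounded_bilinear_blinfun_apply has_derivative_compose[OF D\<tau> Dd]
            smooth_on_derivative[OF smooth_on_frechet[OF \<tau>] x]])
    then have 1: "((\<lambda>y. L (form_rep M \<kappa> c y w)) has_derivative
       (\<lambda>v. form_rep M \<kappa> d (?\<tau> ?x) (?D2 v w) + frechet_derivative (form_rep M \<kappa> d) (at (snd d (h p))) (chart_deriv c d h p v) (frechet_derivative ?\<tau> (at ?x) w))) (at ?x)"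
    proof (rule has_derivative_transform_within_open[OF _ W x])
      fix y assume "y \<in> ?W"
      then obtain r where r: "r \<in> fst c" "h r \<in> fst d" "y = snd c r" by auto
      have "frechet_derivative ?\<tau> (at y) w = chart_deriv c d h r w" by (simp add: chart_deriv_def r(3))
      moreover have "?\<tau> y = snd d (h r)" using cinv_chart[OF M c(1) r(1)] r(3) by simp
      ultimately show "form_rep M \<kappa> d (?\<tau> y) (frechet_derivative ?\<tau> (at y) w) = L (form_rep M \<kappa> c y w)"
        using form_rep_pullback[OF h L c r(1,2)] r(3) by simp
    qed
    have "snd c p \<in> snd c ` fst c" using p by blast
    then have 2: "((\<lambda>y. L (form_rep M \<kappa> c y w)) has_derivative (\<lambda>v. L (frechet_derivative (form_rep M \<kappa> c) (at ?x) v w))) (at ?x)"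
      by (intro bounded_linear.has_derivative[OF blinfun.bounded_linear_right] frechet_blinfun_apply(1)[OF form_rep_smooth[OF c(1)]])
    have 3: "frechet_derivative ?\<tau> (at ?x) w = chart_deriv c d h p w" by (simp add: chart_deriv_def)
    show ?thesis using fun_cong[OF has_derivative_unique[OF 1 2], of v] unfolding \<tau>x 3 by (simp add: add.commute)
  qed
  show ?thesis
    unfolding form_d_def blinfun.diff_right key[symmetric] second_derivative_symmetric[OF \<tau> W x, of v w] by simp
qed

end

section \<open>Smooth dependence of the formal curvature\<close>

text \<open>The space of operators on a Euclidean space is the direct sum of copies of the target, one for each
  basis vector; thus linear maps on spaces of cochains are bounded.\<close>

lemma bounded_linear_blinfun_domain:
  fixes L :: "('a::euclidean_space \<Rightarrow>\<^sub>L 'b::real_normed_vector) \<Rightarrow> 'v::real_normed_vector"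
  assumes L: "linear L" and fin: "\<And>K :: 'b \<Rightarrow> 'v. linear K \<Longrightarrow> bounded_linear K"
  shows "bounded_linear L"
proof -
  let ?e = "\<lambda>b w. blinfun_scaleR_left w o\<^sub>L blinfun_inner_left b :: 'a \<Rightarrow>\<^sub>L 'b"
  have eq: "(\<Sum>b\<in>Basis. ?e b (f b)) = f" for f :: "'a \<Rightarrow>\<^sub>L 'b"
    by (rule blinfun_eqI) (subst (3) euclidean_representation[symmetric],
      simp add: blinfun.bilinear_simps inner_commute del: euclidean_representation)
  have "?e b (v + w) = ?e b v + ?e b w" "?e b (c *\<^sub>R w) = c *\<^sub>R ?e b w" for b v w c
    by (rule blinfun_eqI, simp add: blinfun.bilinear_simps scaleR_add_right)+
  then have "linear (\<lambda>w. L (?e b w))" for b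
    by (intro linearI) (simp_all add: linear_add[OF L] linear_cmul[OF L])
  then have "bounded_linear (\<lambda>f. \<Sum>b\<in>Basis. L (?e b (blinfun_apply f b)))"
    by (intro bounded_linear_sum bounded_linear_compose[OF fin] blinfun.bounded_linear_left)
  moreover have "(\<Sum>b\<in>Basis. L (?e b (blinfun_apply f b))) = L f" for f
    by (subst (2) eq[symmetric]) (simp add: linear_sum[OF L])
  ultimately show ?thesis by simp
qed

lemma bounded_linear_blinfun1:
  fixes L :: "('a::euclidean_space \<Rightarrow>\<^sub>L 'b::euclidean_space) \<Rightarrow> 'v::real_normed_vector"
  shows "linear L \<Longrightarrow> bounded_linear L"
  by (erule bounded_linear_blinfun_domain) (simp add: linear_conv_bounded_linear)

lemma bounded_linear_blinfun2:
  fixes L :: "('a::euclidean_space \<Rightarrow>\<^sub>L 'b::euclidean_space \<Rightarrow>\<^sub>L 'c::euclidean_space) \<Rightarrow> 'v::real_normed_vector"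
  shows "linear L \<Longrightarrow> bounded_linear L"
  by (erule bounded_linear_blinfun_domain) (rule bounded_linear_blinfun1)

context graded_lie
begin

lemma bounded_linear_pr: "bounded_linear pr"
  using linear_pr by (simp add: linear_conv_bounded_linear)

definition unip_invB :: "('h \<Rightarrow>\<^sub>L 'h) \<Rightarrow> 'h \<Rightarrow>\<^sub>L 'h" where
  "unip_invB \<phi> = Blinfun (unip_inv \<phi>)"

lemma unip_invB_apply: "cofilt1 1 \<phi> \<Longrightarrow> unip_invB \<phi> x = unip_inv \<phi> x"
  unfolding unip_invB_def by (rule blinfun_apply_Blinfun[OF linear_unip_inv])

lemma smooth_unip_inv:
  assumes S: "open S" and \<phi>: "smooth_on S \<phi>" "\<And>x. x \<in> S \<Longrightarrow> cofilt1 1 (\<phi> x)"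
  shows "smooth_on S (\<lambda>x. unip_inv (\<phi> x) a)"
proof -
  have "smooth_on S (\<lambda>x. unip_invB (\<phi> x))"
  proof (rule smooth_on_blinfun_inverse[OF S, of "\<lambda>x. id_blinfun + \<phi> x"])
    show "smooth_on S (\<lambda>x. id_blinfun + \<phi> x)" by (intro smooth_on_add S smooth_on_const \<phi>)
    fix x z assume x: "x \<in> S"
    show "(id_blinfun + \<phi> x) (unip_invB (\<phi> x) z) = z"
      using unip_unip_inv[OF \<phi>(2)[OF x], of z] by (simp add: unip_invB_apply[OF \<phi>(2)[OF x]] unip_def blinfun.add_left)
    show "unip_invB (\<phi> x) ((id_blinfun + \<phi> x) z) = z"
      unfolding unip_invB_apply[OF \<phi>(2)[OF x]]
      by (rule unip_inv_unique[OF \<phi>(2)[OF x]]) (simp add: unip_def blinfun.add_left)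
  qed
  then have "smooth_on S (\<lambda>x. unip_invB (\<phi> x) a)"
    by (intro smooth_on_blinfun_apply S smooth_on_const)
  then show ?thesis by (rule smooth_on_cong[OF S]) (simp add: unip_invB_apply \<phi>)
qed

lemma smooth_fcurv:
  assumes S: "open S" and \<phi>: "smooth_on S \<phi>" "\<And>x. x \<in> S \<Longrightarrow> cofilt1 1 (\<phi> x)"
    and R: "smooth_on S R" and E: "smooth_on S E"
  shows "smooth_on S (\<lambda>x. fcurv (R x) (\<phi> x) (E x))"
proof (rule smooth_on_blinfunI[OF S], rule smooth_on_blinfunI[OF S])
  fix a b :: 'h
  note ap = smooth_on_blinfun_apply[OF S]
  note br = smooth_on_bilinear[OF br_bounded S]
  note prs = smooth_on_bounded_linear[OF bounded_linear_pr S]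
  have u: "smooth_on S (\<lambda>x. unip (\<phi> x) (v x))" if "smooth_on S v" for v
    unfolding unip_def by (intro smooth_on_add S that ap \<phi>)
  have cov: "smooth_on S (\<lambda>x. cov (\<phi> x) (E x) (v x) (w x))" if "smooth_on S v" "smooth_on S w" for v w
    unfolding cov_def by (intro smooth_on_diff S ap br prs E that \<phi>)
  have i: "smooth_on S (\<lambda>x. unip_inv (\<phi> x) c)" for c by (rule smooth_unip_inv[OF S \<phi>])
  have "smooth_on S (\<lambda>x. fcurv_val (R x) (\<phi> x) (E x) (pr a) (pr b))"
    unfolding fcurv_val_def fcurv_pre_def
    by (intro smooth_on_add smooth_on_diff S u cov ap br R i smooth_on_const)
  then show "smooth_on S (\<lambda>x. fcurv (R x) (\<phi> x) (E x) a b)"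
    by (rule smooth_on_cong[OF S]) (simp add: fcurv_apply \<phi>)
qed

end

section \<open>The adjoint action of the group of the model\<close>

text \<open>On a ball of radius less than \<open>1 / (2 C)\<close> the mean value theorem bounds the maximum of \<open>norm (f z)\<close> by half of
  itself.\<close>

lemma local_uniqueness_linear_ode:
  fixes f :: "'b::euclidean_space \<Rightarrow> 'v::real_normed_vector"
  assumes \<rho>: "0 < \<rho>" and D: "\<And>z. z \<in> ball x \<rho> \<Longrightarrow> (f has_derivative f' z) (at z)"
    and bound: "\<And>z v. z \<in> ball x \<rho> \<Longrightarrow> norm (f' z v) \<le> C * norm (f z) * norm v" and "f x = 0"
  shows "\<exists>\<delta>>0. \<forall>z\<in>ball x \<delta>. f z = 0"
proof -
  define c where "c = max C 0 + 1"
  have c: "c > 0" "C \<le> c" by (auto simp: c_def)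
  define \<delta> where "\<delta> = min (\<rho> / 2) (1 / (2 * c))"
  have \<delta>: "\<delta> > 0" using \<rho> c by (simp add: \<delta>_def)
  have sub: "cball x \<delta> \<subseteq> ball x \<rho>"
    using \<rho> by (auto simp: \<delta>_def)
  have cont: "continuous_on (cball x \<delta>) (\<lambda>z. norm (f z))"
    using D sub by (intro continuous_on_norm continuous_at_imp_continuous_on) (blast intro: has_derivative_continuous)
  obtain z0 where z0: "z0 \<in> cball x \<delta>" "\<And>z. z \<in> cball x \<delta> \<Longrightarrow> norm (f z) \<le> norm (f z0)"
    using continuous_attains_sup[OF compact_cball _ cont] \<delta> by force
  have "norm (f z0 - f x) \<le> c * norm (f z0) * norm (z0 - x)"
  proof (rule differentiable_bound[where S = "cball x \<delta>" and f' = f'])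
    show "(f has_derivative f' z) (at z within cball x \<delta>)" if "z \<in> cball x \<delta>" for z
      using D that sub has_derivative_at_withinI by blast
    show "onorm (f' z) \<le> c * norm (f z0)" if z: "z \<in> cball x \<delta>" for z
    proof (rule onorm_le)
      fix v
      have "norm (f' z v) \<le> C * norm (f z) * norm v" using bound sub z by blast
      also have "\<dots> \<le> c * norm (f z0) * norm v"
        using c z0(2)[OF z] by (intro mult_right_mono mult_mono) auto
      finally show "norm (f' z v) \<le> c * norm (f z0) * norm v" .
    qed
  qed (use z0 \<delta> in auto)
  also have "\<dots> \<le> c * norm (f z0) * (1 / (2 * c))"
    using z0(1) c by (intro mult_left_mono) (auto simp: \<delta>_def dist_norm norm_minus_commute)
  also have "\<dots> = norm (f z0) / 2" using c by simp
  finally have "norm (f z0) = 0" using assms(4) by simp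
  then have "f z = 0" if "z \<in> ball x \<delta>" for z
    using z0(2)[of z] that by auto
  then show ?thesis using \<delta> by blast
qed

text \<open>The translates of \<open>V\<close> show that both \<open>S\<close> and its complement, a union of cosets, are open.\<close>

lemma (in lie_grp) open_subgroup_eq_carrier:
  assumes conn: "connected_space (mtop M)" and V: "openin (mtop M) V" "\<one> \<in> V" "V \<subseteq> S"
    and S: "S \<subseteq> carrier H" "\<And>p q. p \<in> S \<Longrightarrow> q \<in> S \<Longrightarrow> p \<otimes> q \<in> S" "\<And>p. p \<in> S \<Longrightarrow> inv p \<in> S"
  shows "S = carrier H"
proof (rule ccontr)
  assume ne: "S \<noteq> carrier H"
  define W where "W q = {p \<in> pts M. inv q \<otimes> p \<in> V}" for q
  have W: "openin (mtop M) (W q)" "q \<in> W q" if "q \<in> carrier H" for q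
    using smooth_map_preimage[OF smooth_left[of "inv q"] V(1)] that V(2) by (auto simp: W_def pts)
  have V_S: "inv q \<otimes> p \<in> S" "p = q \<otimes> (inv q \<otimes> p)" "q = p \<otimes> inv (inv q \<otimes> p)" "p \<in> carrier H" if "q \<in> carrier H" "p \<in> W q" for p q
    using that V(3) by (auto simp: W_def pts m_assoc[symmetric] inv_mult_group)
  have 1: "(\<Union>q\<in>S. W q) = S"
    using V_S S W(2) by (auto; metis S(2) subsetD)
  have 2: "(\<Union>q\<in>carrier H - S. W q) = carrier H - S"
    using V_S S W(2) by (auto; metis S(2,3))
  have "openin (mtop M) S" "openin (mtop M) (carrier H - S)"
    using W(1) S(1) by (subst 1[symmetric], auto) (subst 2[symmetric], auto)
  moreover have "S \<noteq> {}" using V by auto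
  moreover have "carrier H - S \<noteq> {}" using ne S by auto
  ultimately show False
    using conn unfolding connected_space_def pts by (metis Diff_disjoint Un_Diff_cancel Un_upper2)
qed

locale cartan_ctx =
  fixes A :: "('h::euclidean_space, 'g, 'a::euclidean_space, 'b::euclidean_space) model"
  assumes model: "cartan_model A"
begin

sublocale graded_lie "brk A" "grd A" "depth A" "height A"
  using model by unfold_locales (simp add: cartan_model_def)

sublocale HG: lie_grp "Hgrp A" "Hmfd A"
  using model by unfold_locales (simp add: cartan_model_def)

sublocale QG: lie_grp "Qgrp A" "Qmfd A"
  using model by unfold_locales (simp add: cartan_model_def lie_subgroup_def)

lemma Q_subgroup: "subgroup (pts (Qmfd A)) (Hgrp A)"
  using model by (simp add: cartan_model_def lie_subgroup_def)

lemma Q_H: "q \<in> pts (Qmfd A) \<Longrightarrow> q \<in> carrier (Hgrp A)"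
  using subgroup.mem_carrier[OF Q_subgroup] .

lemma Q_inv: "q \<in> pts (Qmfd A) \<Longrightarrow> m_inv (Qgrp A) q = m_inv (Hgrp A) q"
  using HG.m_inv_consistent[OF Q_subgroup] .

lemma Q_closed: "q \<in> pts (Qmfd A) \<Longrightarrow> r \<in> pts (Qmfd A) \<Longrightarrow> q \<otimes>\<^bsub>Hgrp A\<^esub> r \<in> pts (Qmfd A)"
  "q \<in> pts (Qmfd A) \<Longrightarrow> m_inv (Hgrp A) q \<in> pts (Qmfd A)" "\<one>\<^bsub>Hgrp A\<^esub> \<in> pts (Qmfd A)"
  using Q_subgroup by (simp_all add: subgroup.m_closed subgroup.m_inv_closed subgroup.one_closed)

lemma smooth_incl: "smooth_map (Qmfd A) (Hmfd A) (\<lambda>x. x)"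
  using model by (simp add: cartan_model_def lie_subgroup_def)

lemma lieQ_range: "range (lieQ A) = hfilt (grd A) 0"
  using model by (simp add: cartan_model_def)

lemma lieid: "linear (lieid A)" "bij (lieid A)"
  and lieid_bracket: "lieid A (commutator (Hmfd A) (left_invariant (Hgrp A) (Hmfd A) v) (left_invariant (Hgrp A) (Hmfd A) w) \<one>\<^bsub>Hgrp A\<^esub>)
      = brk A (lieid A v) (lieid A w)"
  using model by (simp_all add: cartan_model_def lie_algebra_iso_def)

definition lieinv :: "'h \<Rightarrow> 'a" where "lieinv = inv_into UNIV (lieid A)"

lemma lieinv [simp]: "lieid A (lieinv x) = x" "lieinv (lieid A v) = v"
  unfolding lieinv_def using lieid(2) by (simp_all add: bij_is_surj surj_f_inv_f bij_is_inj)

lemma linear_lieinv: "linear lieinv"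
proof (rule linearI)
  show "lieinv (x + y) = lieinv x + lieinv y" for x y
    by (metis lieinv linear_add[OF lieid(1)])
  show "lieinv (c *\<^sub>R x) = c *\<^sub>R lieinv x" for c x
    by (metis lieinv linear_cmul[OF lieid(1)])
qed

definition AdB :: "'g \<Rightarrow> 'h \<Rightarrow>\<^sub>L 'h" where
  "AdB g = Blinfun (lieid A) o\<^sub>L HG.adj g o\<^sub>L Blinfun lieinv"

lemma AdB_apply: "AdB g x = lieid A (HG.adj g (lieinv x))"
  by (simp add: AdB_def blinfun_apply_Blinfun lieid linear_lieinv)

lemma Ad_eq: "g \<in> carrier (Hgrp A) \<Longrightarrow> Ad A g x = AdB g x"
  by (simp add: Ad_def AdB_apply HG.adj_apply(1) lieinv_def)

lemma AdB_mult: "g \<in> carrier (Hgrp A) \<Longrightarrow> h \<in> carrier (Hgrp A) \<Longrightarrow> AdB (g \<otimes>\<^bsub>Hgrp A\<^esub> h) x = AdB g (AdB h x)"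
  by (simp add: AdB_apply HG.adj_mult)

lemma AdB_one: "AdB \<one>\<^bsub>Hgrp A\<^esub> x = x"
  by (simp add: AdB_apply HG.adj_one)

lemma AdB_inv: "g \<in> carrier (Hgrp A) \<Longrightarrow> AdB g (AdB (m_inv (Hgrp A) g) x) = x"
    "g \<in> carrier (Hgrp A) \<Longrightarrow> AdB (m_inv (Hgrp A) g) (AdB g x) = x"
  by (simp_all add: AdB_mult[symmetric] AdB_one)

lemma smooth_AdB: "smooth_on HG.S1 (\<lambda>y. AdB (cinv HG.c1 y))"
  unfolding AdB_def
  by (intro smooth_on_bilinear[OF bounded_bilinear_blinfun_compose HG.S1(1)] smooth_on_const HG.smooth_adj)

lemma deriv_AdB: "frechet_derivative (\<lambda>y. AdB (cinv HG.c1 y)) (at HG.x1) v x = brk A (lieid A v) x"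
proof -
  have lin: "bounded_linear (\<lambda>B. lieid A (blinfun_apply B (lieinv x)))"
    using bounded_linear_compose[OF _ blinfun.bounded_linear_left] lieid(1) by (simp add: linear_conv_bounded_linear)
  have "((\<lambda>y. lieid A (HG.adj (cinv HG.c1 y) (lieinv x))) has_derivative
      (\<lambda>v. lieid A (frechet_derivative (\<lambda>y. HG.adj (cinv HG.c1 y)) (at HG.x1) v (lieinv x)))) (at HG.x1)"
    by (rule bounded_linear.has_derivative[OF lin smooth_on_derivative[OF HG.smooth_adj HG.S1(2)]])
  moreover have "((\<lambda>y. AdB (cinv HG.c1 y) x) has_derivative
      (\<lambda>v. frechet_derivative (\<lambda>y. AdB (cinv HG.c1 y)) (at HG.x1) v x)) (at HG.x1)"
    by (rule bounded_linear.has_derivative[OF blinfun.bounded_linear_left smooth_on_derivative[OF smooth_AdB HG.S1(2)]])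
  ultimately have "(\<lambda>v. frechet_derivative (\<lambda>y. AdB (cinv HG.c1 y)) (at HG.x1) v x)
      = (\<lambda>v. lieid A (frechet_derivative (\<lambda>y. HG.adj (cinv HG.c1 y)) (at HG.x1) v (lieinv x)))"
    unfolding AdB_apply by (rule has_derivative_unique[symmetric])
  then have "frechet_derivative (\<lambda>y. AdB (cinv HG.c1 y)) (at HG.x1) v x
      = lieid A (commutator (Hmfd A) (left_invariant (Hgrp A) (Hmfd A) v) (left_invariant (Hgrp A) (Hmfd A) (lieinv x)) \<one>\<^bsub>Hgrp A\<^esub>)"
    unfolding HG.commutator_left_invariant HG.deriv_adj by metis
  then show ?thesis by (simp add: lieid_bracket)
qed

text \<open>Both sides of \<open>Ad (g y g\<^sup>-\<^sup>1) = Ad g \<circ> Ad y \<circ> (Ad g)\<^sup>-\<^sup>1\<close> are differentiated in \<open>y\<close> at the identity; the derivative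
  of \<open>Ad\<close> there is the bracket.\<close>

lemma AdB_bracket:
  assumes g: "g \<in> carrier (Hgrp A)" shows "AdB g (brk A x y) = brk A (AdB g x) (AdB g y)"
proof -
  let ?c = "\<lambda>p. g \<otimes>\<^bsub>Hgrp A\<^esub> p \<otimes>\<^bsub>Hgrp A\<^esub> m_inv (Hgrp A) g"
  let ?K = "snd HG.c1 \<circ> ?c \<circ> cinv HG.c1"
  let ?F = "\<lambda>y. AdB (cinv HG.c1 y)"
  note F = smooth_on_derivative[OF smooth_AdB HG.S1(2)]
  have K: "(?K has_derivative HG.adj g) (at HG.x1)"
    using chart_deriv_works[OF HG.smooth_conj[OF g] HG.c1(1) HG.c1(1) HG.c1(2)] g HG.c1
    by (simp add: HG.adj_apply(2)[OF g, abs_def] HG.x1_def)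
  have "?K HG.x1 = HG.x1" using g HG.cinv_x1 by (simp add: HG.x1_def[symmetric])
  then have FK: "((\<lambda>y. ?F (?K y)) has_derivative (\<lambda>v. frechet_derivative ?F (at HG.x1) (HG.adj g v))) (at HG.x1)"
    using has_derivative_compose[OF K, of ?F "frechet_derivative ?F (at HG.x1)"] F by simp
  let ?W = "snd HG.c1 ` {p \<in> fst HG.c1. ?c p \<in> fst HG.c1}"
  have W: "open ?W"
    by (rule smooth_map_open_dom[OF HG.mf HG.mf HG.smooth_conj[OF g] HG.c1(1) chart_openin[OF HG.mf HG.c1(1)]])
  have "HG.x1 \<in> ?W" using HG.c1 g by (auto simp: HG.x1_def)
  have B: "bounded_linear (\<lambda>B. AdB g o\<^sub>L B o\<^sub>L AdB (m_inv (Hgrp A) g))"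
    by (intro bounded_linear_compose[OF bounded_bilinear.bounded_linear_left[OF bounded_bilinear_blinfun_compose]]
        bounded_bilinear.bounded_linear_right[OF bounded_bilinear_blinfun_compose])
  have "((\<lambda>y. ?F (?K y)) has_derivative (\<lambda>v. AdB g o\<^sub>L frechet_derivative ?F (at HG.x1) v o\<^sub>L AdB (m_inv (Hgrp A) g))) (at HG.x1)"
  proof (rule has_derivative_transform_within_open[OF bounded_linear.has_derivative[OF B F] W \<open>HG.x1 \<in> ?W\<close>])
    fix y assume "y \<in> ?W"
    then obtain p where p: "p \<in> fst HG.c1" "?c p \<in> fst HG.c1" "y = snd HG.c1 p" by auto
    then have "p \<in> carrier (Hgrp A)" using chart_subset[OF HG.mf HG.c1(1)] HG.pts by blast
    then show "AdB g o\<^sub>L AdB (cinv HG.c1 y) o\<^sub>L AdB (m_inv (Hgrp A) g) = ?F (?K y)"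
      using p g by (intro blinfun_eqI) (simp add: cinv_chart[OF HG.mf HG.c1(1)] AdB_mult)
  qed
  note uniq = has_derivative_unique[OF FK this]
  have "frechet_derivative ?F (at HG.x1) (HG.adj g v) z = AdB g (frechet_derivative ?F (at HG.x1) v (AdB (m_inv (Hgrp A) g) z))" for v z
    using fun_cong[OF uniq, of v] by simp
  then have "brk A (AdB g a) z = AdB g (brk A a (AdB (m_inv (Hgrp A) g) z))" for a z
    using deriv_AdB[of "HG.adj g (lieinv a)"] deriv_AdB[of "lieinv a"] by (simp add: AdB_apply)
  from this[of x "AdB g y"] show ?thesis using AdB_inv(2)[OF g] by simp
qed

text \<open>The part of the chart of \<open>Q\<close> at the identity that is covered by the chart of the ambient group at the
  identity.  Here \<open>AdQ\<close> is a composite of smooth maps of Euclidean spaces.\<close>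

definition SQ :: "'b set" where
  "SQ = snd QG.c1 ` {p \<in> fst QG.c1. p \<in> fst HG.c1}"

lemma SQ: "open SQ" "QG.x1 \<in> SQ" "SQ \<subseteq> QG.S1"
proof -
  show "open SQ" unfolding SQ_def
    by (rule smooth_map_open_dom[OF QG.mf HG.mf smooth_incl QG.c1(1) chart_openin[OF HG.mf HG.c1(1)]])
  show "QG.x1 \<in> SQ" using QG.c1(2) HG.c1(2) by (auto simp: SQ_def QG.x1_def)
  show "SQ \<subseteq> QG.S1" by (auto simp: SQ_def QG.S1_def)
qed

definition AdQ :: "'b \<Rightarrow> 'h \<Rightarrow>\<^sub>L 'h" where "AdQ z = AdB (cinv QG.c1 z)"

lemma AdQ_H: "z \<in> SQ \<Longrightarrow> AdQ z = AdB (cinv HG.c1 ((snd HG.c1 \<circ> (\<lambda>x. x) \<circ> cinv QG.c1) z))"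
  by (auto simp: SQ_def AdQ_def cinv_chart[OF QG.mf QG.c1(1)] cinv_chart[OF HG.mf HG.c1(1)])

lemma smooth_AdQ: "smooth_on SQ AdQ"
proof -
  have "smooth_on SQ (\<lambda>z. AdB (cinv HG.c1 ((snd HG.c1 \<circ> (\<lambda>x. x) \<circ> cinv QG.c1) z)))"
  proof (rule smooth_on_compose[OF SQ(1) HG.S1(1) smooth_AdB])
    show "smooth_on SQ (snd HG.c1 \<circ> (\<lambda>x. x) \<circ> cinv QG.c1)"
      using smooth_map_chart[OF smooth_incl QG.c1(1) HG.c1(1)] by (simp add: SQ_def)
    show "(snd HG.c1 \<circ> (\<lambda>x. x) \<circ> cinv QG.c1) ` SQ \<subseteq> HG.S1"
      by (auto simp: SQ_def HG.S1_def cinv_chart[OF QG.mf QG.c1(1)])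
  qed
  then show ?thesis by (rule smooth_on_cong[OF SQ(1)]) (simp add: AdQ_H)
qed

lemma lieQ_eq: "lieQ A v = lieid A (chart_deriv QG.c1 HG.c1 (\<lambda>x. x) \<one>\<^bsub>Hgrp A\<^esub> v)"
  by (simp add: lieQ_def mderiv_eq QG.c1_def HG.c1_def)

lemma linear_lieQ: "linear (lieQ A)"
  unfolding lieQ_eq
  using linear_compose[OF chart_deriv_linear[OF smooth_incl QG.c1(1) HG.c1(1)] lieid(1)] QG.c1 HG.c1
  by (simp add: o_def)

lemma lieQ_hfilt: "lieQ A v \<in> hfilt (grd A) 0"
  using lieQ_range by blast

lemma deriv_AdQ: "frechet_derivative AdQ (at QG.x1) v x = brk A (lieQ A v) x"
proof -
  let ?K = "snd HG.c1 \<circ> (\<lambda>x. x) \<circ> cinv QG.c1"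
  have K: "(?K has_derivative chart_deriv QG.c1 HG.c1 (\<lambda>x. x) \<one>\<^bsub>Hgrp A\<^esub>) (at QG.x1)"
    using chart_deriv_works[OF smooth_incl QG.c1(1) HG.c1(1)] QG.c1 HG.c1 by (simp add: QG.x1_def)
  have "?K QG.x1 = HG.x1" using QG.cinv_x1 by (simp add: HG.x1_def)
  then have "((\<lambda>y. AdB (cinv HG.c1 (?K y))) has_derivative
      (\<lambda>v. frechet_derivative (\<lambda>y. AdB (cinv HG.c1 y)) (at HG.x1) (chart_deriv QG.c1 HG.c1 (\<lambda>x. x) \<one>\<^bsub>Hgrp A\<^esub> v))) (at QG.x1)"
    using has_derivative_compose[OF K, of "\<lambda>y. AdB (cinv HG.c1 y)"] smooth_on_derivative[OF smooth_AdB HG.S1(2)] by simp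
  then have "(AdQ has_derivative
      (\<lambda>v. frechet_derivative (\<lambda>y. AdB (cinv HG.c1 y)) (at HG.x1) (chart_deriv QG.c1 HG.c1 (\<lambda>x. x) \<one>\<^bsub>Hgrp A\<^esub> v))) (at QG.x1)"
    by (rule has_derivative_transform_within_open[OF _ SQ(1,2)]) (simp add: AdQ_H)
  then have "frechet_derivative AdQ (at QG.x1) v
      = frechet_derivative (\<lambda>y. AdB (cinv HG.c1 y)) (at HG.x1) (chart_deriv QG.c1 HG.c1 (\<lambda>x. x) \<one>\<^bsub>Hgrp A\<^esub> v)"
    using frechet_derivative_at by metis
  then show ?thesis by (simp add: deriv_AdB lieQ_eq)
qed

text \<open>Since \<open>hfilt 0\<close>, the Lie algebra of \<open>Q\<close>, preserves \<open>hfilt i\<close> under the bracket, the part of \<open>AdQ z\<close> that maps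
  \<open>hfilt i\<close> to its complement satisfies a homogeneous linear differential equation in \<open>z\<close>.  It vanishes
  at the identity, hence near it, and so \<open>Q\<close>, being connected, preserves the filtration.\<close>

definition upper :: "int \<Rightarrow> 'h \<Rightarrow>\<^sub>L 'h" where
  "upper i = Blinfun (\<lambda>x. \<Sum>j\<in>{i..height A}. component j x)"

lemma upper_apply: "upper i x = (\<Sum>j\<in>{i..height A}. component j x)"
  unfolding upper_def
  by (rule blinfun_apply_Blinfun, rule linearI) (simp_all add: component_add component_scaleR sum.distrib scaleR_sum_right)

lemma component_upper: "component j (upper i x) = (if i \<le> j then component j x else 0)"
proof -
  have "component j (upper i x) = (\<Sum>a\<in>{i..height A}. if j = a then component j x else 0)"
    unfolding upper_apply component_of_sum by (intro sum.cong) (auto simp: component_component)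
  then show ?thesis using component_out[of j x] by auto
qed

lemma upper_hfilt: "upper i x \<in> hfilt (grd A) i"
  by (simp add: hfilt_iff component_upper)

lemma upper_id_iff: "upper i x = x \<longleftrightarrow> x \<in> hfilt (grd A) i"
proof
  assume "x \<in> hfilt (grd A) i"
  then show "upper i x = x"
    by - (rule component_eqI, auto simp: component_upper hfilt_iff)
qed (metis upper_hfilt)

lemma deriv_AdQ_translate:
  assumes z: "z \<in> SQ"
  shows "frechet_derivative AdQ (at z) v x = AdQ z (brk A (lieQ A (QG.lmul_inv z v)) x)"
proof -
  have zS: "z \<in> QG.S1" using z SQ by blast
  have "AdQ (snd QG.c1 (cinv QG.c1 z \<otimes>\<^bsub>Hgrp A\<^esub> cinv QG.c1 y)) = AdQ z o\<^sub>L AdQ y"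
    if "y \<in> SQ" "cinv QG.c1 z \<otimes>\<^bsub>Hgrp A\<^esub> cinv QG.c1 y \<in> fst QG.c1" for y
  proof -
    have "cinv QG.c1 z \<in> carrier (Hgrp A)" "cinv QG.c1 y \<in> carrier (Hgrp A)"
      using QG.cinv_S1(2)[of z] QG.cinv_S1(2)[of y] z that(1) SQ(3) by (auto intro!: Q_H)
    then show ?thesis
      using that by (intro blinfun_eqI) (simp add: AdQ_def cinv_chart[OF QG.mf QG.c1(1)] AdB_mult)
  qed
  then have "frechet_derivative AdQ (at z) (QG.lmul z (QG.lmul_inv z v)) = AdQ z o\<^sub>L frechet_derivative AdQ (at QG.x1) (QG.lmul_inv z v)"
    by (intro QG.deriv_left_translate[OF zS smooth_AdQ SQ(1,3) z SQ(2)]) simp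
  then show ?thesis by (simp add: QG.lmul_inverse[OF zS] deriv_AdQ)
qed

lemma AdQ_hfilt_local: "\<exists>\<delta>>0. ball QG.x1 \<delta> \<subseteq> SQ \<and> (\<forall>z\<in>ball QG.x1 \<delta>. \<forall>x\<in>hfilt (grd A) i. AdQ z x \<in> hfilt (grd A) i)"
proof -
  let ?P = "id_blinfun - upper i :: 'h \<Rightarrow>\<^sub>L 'h"
  define f where "f z = ?P o\<^sub>L AdQ z o\<^sub>L upper i" for z
  define f' where "f' z v = ?P o\<^sub>L frechet_derivative AdQ (at z) v o\<^sub>L upper i" for z v
  have f': "(f has_derivative f' z) (at z)" if "z \<in> SQ" for z
    unfolding f_def f'_def
    by (intro bounded_linear.has_derivative[OF _ smooth_on_derivative[OF smooth_AdQ that]]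
        bounded_linear_compose[OF bounded_bilinear.bounded_linear_left[OF bounded_bilinear_blinfun_compose]]
        bounded_bilinear.bounded_linear_right[OF bounded_bilinear_blinfun_compose])
  define ad where "ad w = Blinfun (brk A w)" for w
  have ad: "ad w x = brk A w x" for w x
    unfolding ad_def by (simp add: bounded_linear_Blinfun_apply[OF br.bounded_linear_right])
  have "linear (\<lambda>v. ad (lieQ A v))"
    by (rule linearI; rule blinfun_eqI)
      (simp_all add: ad blinfun.bilinear_simps linear_add[OF linear_lieQ] linear_cmul[OF linear_lieQ] br.add_left br.scaleR_left)
  then obtain K where K: "K > 0" "\<And>v. norm (ad (lieQ A v)) \<le> norm v * K"
    using bounded_linear.pos_bounded[of "\<lambda>v. ad (lieQ A v)"] by (auto simp: linear_conv_bounded_linear)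
  have f'_eq: "f' z v = f z o\<^sub>L ad (lieQ A (QG.lmul_inv z v)) o\<^sub>L upper i" if z: "z \<in> SQ" for z v
  proof (rule blinfun_eqI)
    fix x
    have "brk A (lieQ A w) (upper i x) \<in> hfilt (grd A) i" for w
      using hfilt_br[OF lieQ_hfilt upper_hfilt] by simp
    then show "f' z v x = (f z o\<^sub>L ad (lieQ A (QG.lmul_inv z v)) o\<^sub>L upper i) x"
      by (simp add: f_def f'_def ad deriv_AdQ_translate[OF z] upper_id_iff[THEN iffD2])
  qed
  have "isCont QG.lmul_inv QG.x1"
    using smooth_on_continuous[OF QG.smooth_lmul_inv] QG.S1 by (simp add: continuous_on_eq_continuous_at)
  then obtain \<rho>1 where \<rho>1: "\<rho>1 > 0" "\<And>z. dist z QG.x1 < \<rho>1 \<Longrightarrow> dist (QG.lmul_inv z) (QG.lmul_inv QG.x1) < 1"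
    unfolding continuous_at_eps_delta by (metis zero_less_one)
  obtain \<rho>2 where \<rho>2: "\<rho>2 > 0" "ball QG.x1 \<rho>2 \<subseteq> SQ" using SQ by (meson openE)
  define L where "L = norm (QG.lmul_inv QG.x1) + 1"
  have L: "norm (QG.lmul_inv z) \<le> L" if "z \<in> ball QG.x1 (min \<rho>1 \<rho>2)" for z
  proof -
    have "norm (QG.lmul_inv z - QG.lmul_inv QG.x1) < 1" using \<rho>1(2)[of z] that by (simp add: dist_norm norm_minus_commute)
    then show ?thesis using norm_triangle_sub[of "QG.lmul_inv z" "QG.lmul_inv QG.x1"] by (simp add: L_def)
  qed
  have "\<exists>\<delta>>0. \<forall>z\<in>ball QG.x1 \<delta>. f z = 0"
  proof (rule local_uniqueness_linear_ode[of "min \<rho>1 \<rho>2" _ _ f' "L * K * norm (upper i)"])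
    show "0 < min \<rho>1 \<rho>2" using \<rho>1 \<rho>2 by simp
    fix z assume z: "z \<in> ball QG.x1 (min \<rho>1 \<rho>2)"
    then have zS: "z \<in> SQ" using \<rho>2 by auto
    then show "(f has_derivative f' z) (at z)" by (rule f')
    fix v
    have "norm (f' z v) \<le> norm (f z) * norm (ad (lieQ A (QG.lmul_inv z v))) * norm (upper i)"
      unfolding f'_eq[OF zS] by (meson norm_blinfun_compose mult_right_mono norm_ge_zero order_trans)
    also have "\<dots> \<le> norm (f z) * (L * norm v * K) * norm (upper i)"
    proof (intro mult_right_mono mult_left_mono norm_ge_zero)
      have "norm (QG.lmul_inv z v) \<le> L * norm v"
        using norm_blinfun[of "QG.lmul_inv z" v] mult_right_mono[OF L[OF z] norm_ge_zero[of v]] by linarith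
      then show "norm (ad (lieQ A (QG.lmul_inv z v))) \<le> L * norm v * K"
        using K(2)[of "QG.lmul_inv z v"] mult_right_mono[of _ _ K] K(1) by (meson less_imp_le order_trans)
    qed
    finally show "norm (f' z v) \<le> L * K * norm (upper i) * norm (f z) * norm v" by (simp add: algebra_simps)
  next
    show "f QG.x1 = 0"
      by (rule blinfun_eqI) (simp add: f_def AdQ_def AdB_one QG.cinv_x1 blinfun.diff_left upper_id_iff[THEN iffD2] upper_hfilt)
  qed
  then obtain \<delta> where \<delta>: "\<delta> > 0" "\<And>z. z \<in> ball QG.x1 \<delta> \<Longrightarrow> f z = 0" by blast
  show ?thesis
  proof (intro exI[of _ "min \<delta> \<rho>2"] conjI ballI)
    show "min \<delta> \<rho>2 > 0" "ball QG.x1 (min \<delta> \<rho>2) \<subseteq> SQ" using \<delta> \<rho>2 by auto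
    fix z x assume z: "z \<in> ball QG.x1 (min \<delta> \<rho>2)" and x: "x \<in> hfilt (grd A) i"
    have "f z x = 0" using \<delta>(2)[of z] z by simp
    then have "AdQ z x - upper i (AdQ z x) = 0" using x by (simp add: f_def blinfun.diff_left upper_id_iff[THEN iffD2])
    then have "upper i (AdQ z x) = AdQ z x" by simp
    then show "AdQ z x \<in> hfilt (grd A) i" by (simp only: upper_id_iff)
  qed
qed

theorem AdB_hfilt:
  assumes q: "q \<in> pts (Qmfd A)" and x: "x \<in> hfilt (grd A) i"
  shows "AdB q x \<in> hfilt (grd A) i"
proof -
  let ?S = "{q \<in> pts (Qmfd A). \<forall>x\<in>hfilt (grd A) i. AdB q x \<in> hfilt (grd A) i \<and> AdB (m_inv (Hgrp A) q) x \<in> hfilt (grd A) i}"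
  obtain \<delta> where \<delta>: "\<delta> > 0" "ball QG.x1 \<delta> \<subseteq> SQ" "\<And>z x. z \<in> ball QG.x1 \<delta> \<Longrightarrow> x \<in> hfilt (grd A) i \<Longrightarrow> AdQ z x \<in> hfilt (grd A) i"
    using AdQ_hfilt_local by blast
  define V where "V = {p \<in> fst QG.c1. snd QG.c1 p \<in> ball QG.x1 \<delta>}"
  have V: "openin (mtop (Qmfd A)) V"
  proof -
    have "continuous_map (subtopology (mtop (Qmfd A)) (fst QG.c1)) (top_of_set (snd QG.c1 ` fst QG.c1)) (snd QG.c1)"
      by (rule homeomorphic_imp_continuous_map[OF chart_homeo[OF QG.mf QG.c1(1)]])
    then have "continuous_map (subtopology (mtop (Qmfd A)) (fst QG.c1)) euclidean (snd QG.c1)"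
      by (simp add: continuous_map_in_subtopology)
    from openin_continuous_map_preimage[OF this, of "ball QG.x1 \<delta>"]
    have "openin (subtopology (mtop (Qmfd A)) (fst QG.c1)) V"
      by (simp add: chart_topspace[OF QG.mf QG.c1(1)] V_def del: topspace_subtopology)
    then show ?thesis using openin_trans_full[OF _ chart_openin[OF QG.mf QG.c1(1)]] by blast
  qed
  have V1: "\<one>\<^bsub>Hgrp A\<^esub> \<in> V" using QG.c1(2) \<delta>(1) by (simp add: V_def QG.x1_def)
  have VS: "AdB p x \<in> hfilt (grd A) i" if "p \<in> V" "x \<in> hfilt (grd A) i" for p x
    using \<delta>(3)[of "snd QG.c1 p" x] that by (simp add: V_def AdQ_def cinv_chart[OF QG.mf QG.c1(1)])
  have sinv: "smooth_map (Qmfd A) (Qmfd A) (m_inv (Qgrp A))" using QG.lie by (simp add: lie_group_def)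
  let ?V = "V \<inter> {p \<in> pts (Qmfd A). m_inv (Qgrp A) p \<in> V}"
  have "?S = carrier (Qgrp A)"
  proof (rule QG.open_subgroup_eq_carrier[of ?V])
    show "connected_space (mtop (Qmfd A))" using model by (simp add: cartan_model_def)
    show "openin (mtop (Qmfd A)) ?V" by (rule openin_Int[OF V smooth_map_preimage[OF sinv V]])
    show "\<one>\<^bsub>Qgrp A\<^esub> \<in> ?V" using V1 Q_closed(3) Q_inv[OF Q_closed(3)] by simp
    show "?V \<subseteq> ?S" using VS by (auto simp: Q_inv)
    show "?S \<subseteq> carrier (Qgrp A)" by auto
    show "p \<otimes>\<^bsub>Qgrp A\<^esub> r \<in> ?S" if "p \<in> ?S" "r \<in> ?S" for p r
      using that by (auto simp: Q_closed AdB_mult HG.inv_mult_group Q_H)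
    show "m_inv (Qgrp A) p \<in> ?S" if "p \<in> ?S" for p
      using that by (auto simp: Q_closed Q_inv Q_H)
  qed
  then show ?thesis using q x by auto
qed

end

section \<open>The curvature of a Cartan connection\<close>

locale cartan_conn = cartan_ctx A
  for A :: "('h::euclidean_space, 'g, 'a::euclidean_space, 'b::euclidean_space) model" +
  fixes P :: "('p, 'c::euclidean_space, 'm, 'd::euclidean_space, 'g) pbundle" and \<kappa> :: "'p \<Rightarrow> 'c \<Rightarrow> 'h"
  assumes pbundle: "principal_bundle (Qgrp A) (Qmfd A) P" and conn: "cartan_connection A P \<kappa>"
begin

lemma mP: "smooth_manifold (total P)" and mB: "smooth_manifold (base P)"
  and smooth_bproj: "smooth_map (total P) (base P) (bproj P)"
  using pbundle by (simp_all add: principal_bundle_def)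

definition act :: "'p \<times> 'g \<Rightarrow> 'p" where "act = (\<lambda>(u, q). ract P u q)"

lemma act_apply [simp]: "act (u, q) = ract P u q" by (simp add: act_def)

lemma smooth_act: "smooth_map (prod_mfd (total P) (Qmfd A)) (total P) act"
  using pbundle by (simp add: principal_bundle_def act_def)

lemma ract_one: "u \<in> pts (total P) \<Longrightarrow> ract P u \<one>\<^bsub>Hgrp A\<^esub> = u"
  and bproj_ract: "u \<in> pts (total P) \<Longrightarrow> q \<in> pts (Qmfd A) \<Longrightarrow> bproj P (ract P u q) = bproj P u"
  using pbundle by (simp_all add: principal_bundle_def)

lemma smooth_ract: "q \<in> pts (Qmfd A) \<Longrightarrow> smooth_map (total P) (total P) (\<lambda>u. ract P u q)"
  using smooth_map_left[OF mP QG.mf mP smooth_act, of q] by simp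

lemma smooth_orbit: "u \<in> pts (total P) \<Longrightarrow> smooth_map (Qmfd A) (total P) (ract P u)"
  using smooth_map_right[OF mP QG.mf mP smooth_act, of u] by simp

lemma ract_pts: "u \<in> pts (total P) \<Longrightarrow> q \<in> pts (Qmfd A) \<Longrightarrow> ract P u q \<in> pts (total P)"
  using smooth_map_pts[OF smooth_ract] .

lemma one_form: "one_form (total P) \<kappa>"
  and vertical: "u \<in> pts (total P) \<Longrightarrow> \<kappa> u (mderiv (Qmfd A) (total P) (ract P u) \<one>\<^bsub>Hgrp A\<^esub> v) = lieQ A v"
  and bij: "u \<in> pts (total P) \<Longrightarrow> bij (\<kappa> u)"
  and equivariant: "q \<in> pts (Qmfd A) \<Longrightarrow> u \<in> pts (total P) \<Longrightarrow>
     \<kappa> (ract P u q) (mderiv (total P) (total P) (\<lambda>w. ract P w q) u v') = AdB (m_inv (Hgrp A) q) (\<kappa> u v')"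
  using conn by (simp_all add: cartan_connection_def Ad_eq Q_H)

abbreviation krep where "krep \<equiv> form_rep (total P) \<kappa>"

lemma krep_bij:
  assumes c: "c \<in> atlas (total P)" "u \<in> fst c" shows "bij (blinfun_apply (krep c (snd c u)))"
proof -
  have u: "u \<in> pts (total P)" using chart_subset[OF mP c] .
  let ?p = "pref (total P) u"
  have p: "?p \<in> atlas (total P)" "u \<in> fst ?p" using u by (simp_all add: pref_chart pref_mem mP)
  let ?D = "chart_deriv c ?p (\<lambda>p. p) u" and ?D' = "chart_deriv ?p c (\<lambda>p. p) u"
  have "?D' (?D v) = v" "?D (?D' v) = v" for v
    using chart_deriv_ident_inverse[OF mP c p] chart_deriv_ident_inverse[OF mP p c] by auto
  then have "bij ?D" by (intro o_bij[of ?D']) (auto simp: o_def)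
  then have "bij (\<kappa> u \<circ> ?D)" using bij[OF u] bij_comp by blast
  moreover have "blinfun_apply (krep c (snd c u)) = \<kappa> u \<circ> ?D"
    by (rule ext) (simp add: form_rep_eq[OF mP one_form c])
  ultimately show ?thesis by simp
qed

text \<open>The constant fields of the connection, in a chart.\<close>

definition kinv :: "('p, 'c) chart \<Rightarrow> 'c \<Rightarrow> 'h \<Rightarrow>\<^sub>L 'c" where
  "kinv c x = Blinfun (inv_into UNIV (blinfun_apply (krep c x)))"

lemma kinv:
  assumes c: "c \<in> atlas (total P)" "u \<in> fst c"
  shows "krep c (snd c u) (kinv c (snd c u) a) = a" "kinv c (snd c u) (krep c (snd c u) v) = v"
proof -
  let ?f = "blinfun_apply (krep c (snd c u))"
  have b: "bij ?f" by (rule krep_bij[OF c])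
  have "linear (inv_into UNIV ?f)"
  proof (rule linearI)
    show "inv_into UNIV ?f (x + y) = inv_into UNIV ?f x + inv_into UNIV ?f y" for x y
      using b by (intro inv_f_eq) (simp_all add: bij_is_inj bij_is_surj surj_f_inv_f blinfun.add_right)
    show "inv_into UNIV ?f (r *\<^sub>R x) = r *\<^sub>R inv_into UNIV ?f x" for r x
      using b by (intro inv_f_eq) (simp_all add: bij_is_inj bij_is_surj surj_f_inv_f blinfun.scaleR_right)
  qed
  then have "kinv c (snd c u) a = inv_into UNIV ?f a" for a unfolding kinv_def by (rule blinfun_apply_Blinfun)
  then show "krep c (snd c u) (kinv c (snd c u) a) = a" "kinv c (snd c u) (krep c (snd c u) v) = v"
    using b by (simp_all add: bij_is_inj bij_is_surj surj_f_inv_f)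
qed

lemma kinv_smooth:
  assumes c: "c \<in> atlas (total P)" shows "smooth_on (snd c ` fst c) (kinv c)"
  by (rule smooth_on_blinfun_inverse[OF chart_image_open[OF mP c] form_rep_smooth[OF mP one_form c]])
    (auto simp: kinv[OF c])

lemma const_field_eq:
  assumes u: "u \<in> pts (total P)"
  shows "const_field \<kappa> a u = kinv (pref (total P) u) (snd (pref (total P) u) u) a"
proof -
  let ?p = "pref (total P) u"
  have p: "?p \<in> atlas (total P)" "u \<in> fst ?p" using u by (simp_all add: pref_chart pref_mem mP)
  have "\<kappa> u (kinv ?p (snd ?p u) a) = a"
    using kinv(1)[OF p] form_rep_pref[OF mP one_form u] by simp
  then show ?thesis unfolding const_field_def by (rule inv_f_eq[OF bij_is_inj[OF bij[OF u]]])
qed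

lemma krep_ract:
  assumes q: "q \<in> pts (Qmfd A)" and c: "c \<in> atlas (total P)" "d \<in> atlas (total P)" "u \<in> fst c" "ract P u q \<in> fst d"
  shows "krep d (snd d (ract P u q)) (chart_deriv c d (\<lambda>u. ract P u q) u v) = AdB (m_inv (Hgrp A) q) (krep c (snd c u) v)"
  by (rule form_rep_pullback[OF mP one_form smooth_ract[OF q] equivariant[OF q] c])

lemma kinv_ract:
  assumes q: "q \<in> pts (Qmfd A)" and c: "c \<in> atlas (total P)" "d \<in> atlas (total P)" "u \<in> fst c" "ract P u q \<in> fst d"
  shows "chart_deriv c d (\<lambda>u. ract P u q) u (kinv c (snd c u) a) = kinv d (snd d (ract P u q)) (AdB (m_inv (Hgrp A) q) a)"
proof -
  have "krep d (snd d (ract P u q)) (chart_deriv c d (\<lambda>u. ract P u q) u (kinv c (snd c u) a)) = AdB (m_inv (Hgrp A) q) a"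
    unfolding krep_ract[OF q c] kinv(1)[OF c(1,3)] ..
  then show ?thesis using kinv(2)[OF c(2,4)] by metis
qed

lemma mderiv_id: "u \<in> pts (total P) \<Longrightarrow> \<kappa> u (mderiv (total P) (total P) (\<lambda>u. u) u v) = id_blinfun (\<kappa> u v)"
  by (simp add: mderiv_eq chart_deriv_ident[OF mP] pref_chart pref_mem mP)

lemma kinv_change:
  assumes c: "c \<in> atlas (total P)" "d \<in> atlas (total P)" "u \<in> fst c" "u \<in> fst d"
  shows "chart_deriv c d (\<lambda>u. u) u (kinv c (snd c u) a) = kinv d (snd d u) a"
proof -
  have "krep d (snd d u) (chart_deriv c d (\<lambda>u. u) u (kinv c (snd c u) a)) = a"
    using form_rep_pullback[OF mP one_form smooth_map_ident[OF mP] mderiv_id c] kinv(1)[OF c(1,3)] by simp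
  then show ?thesis using kinv(2)[OF c(2,4)] by metis
qed

text \<open>The definition of the curvature at \<open>u\<close> refers to the preferred chart of \<open>u\<close>, which depends on \<open>u\<close> in an
  uncontrolled way; smoothness is only visible in a fixed chart.\<close>

definition curv_chart :: "('p, 'c) chart \<Rightarrow> 'c \<Rightarrow> 'h \<Rightarrow>\<^sub>L 'h \<Rightarrow>\<^sub>L 'h" where
  "curv_chart c x = blinfun2 (\<lambda>a b. form_d (total P) \<kappa> c x (kinv c x a) (kinv c x b) + brk A a b)"

definition curv :: "'p \<Rightarrow> 'h \<Rightarrow>\<^sub>L 'h \<Rightarrow>\<^sub>L 'h" where
  "curv u = curv_chart (pref (total P) u) (snd (pref (total P) u) u)"

lemma curv_chart_apply:
  assumes "c \<in> atlas (total P)" "u \<in> fst c"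
  shows "curv_chart c (snd c u) a b = form_d (total P) \<kappa> c (snd c u) (kinv c (snd c u) a) (kinv c (snd c u) b) + brk A a b"
proof -
  have "linear (frechet_derivative (krep c) (at (snd c u)))"
    by (rule has_derivative_linear[OF smooth_on_derivative[OF form_rep_smooth[OF mP one_form assms(1)]]]) (use assms in blast)
  then show ?thesis
    unfolding curv_chart_def
    by (intro blinfun2_apply, unfold bilinear_def, intro conjI allI linearI)
      (simp_all add: form_d_def linear_add linear_cmul blinfun.bilinear_simps br.add_left br.add_right br.scaleR_left br.scaleR_right algebra_simps)
qed

lemma curv_apply: 
  assumes u: "u \<in> pts (total P)"
  shows "curvature A P \<kappa> u (const_field \<kappa> a u) (const_field \<kappa> b u) = curv u a b"
proof -
  let ?p = "pref (total P) u"
  have p: "?p \<in> atlas (total P)" "u \<in> fst ?p" using u by (simp_all add: pref_chart pref_mem mP)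
  have "\<kappa> u (const_field \<kappa> a u) = a" for a
    using bij[OF u] by (simp add: const_field_def bij_is_surj surj_f_inv_f)
  then show ?thesis
    by (simp add: curvature_def ext_deriv_eq[OF mP one_form u] curv_def curv_chart_apply[OF p] const_field_eq[OF u])
qed

lemma curv_chart_eq:
  assumes c: "c \<in> atlas (total P)" "u \<in> fst c"
  shows "curv_chart c (snd c u) = curv u"
proof (intro blinfun_eqI)
  fix a b
  have u: "u \<in> pts (total P)" using chart_subset[OF mP c] .
  let ?p = "pref (total P) u"
  have p: "?p \<in> atlas (total P)" "u \<in> fst ?p" using u by (simp_all add: pref_chart pref_mem mP)
  show "curv_chart c (snd c u) a b = curv u a b"
    using form_d_pullback[OF mP one_form smooth_map_ident[OF mP] mderiv_id c(1) p(1) c(2) p(2)]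
    by (simp add: curv_def curv_chart_apply[OF c] curv_chart_apply[OF p] flip: kinv_change[OF c(1) p(1) c(2) p(2)])
qed

text \<open>The right translations pull \<open>\<kappa>\<close> back to its image under automorphisms of the Lie algebra, and the
  exterior derivative is natural.\<close>

lemma curv_equivariant:
  assumes q: "q \<in> pts (Qmfd A)" and u: "u \<in> pts (total P)"
  shows "curv u a b = AdB q (curv (ract P u q) (AdB (m_inv (Hgrp A) q) a) (AdB (m_inv (Hgrp A) q) b))"
proof -
  let ?c = "pref (total P) u" and ?d = "pref (total P) (ract P u q)"
  have c: "?c \<in> atlas (total P)" "?d \<in> atlas (total P)" "u \<in> fst ?c" "ract P u q \<in> fst ?d"
    using u ract_pts[OF u q] by (simp_all add: pref_chart pref_mem mP)
  have g: "q \<in> carrier (Hgrp A)" "m_inv (Hgrp A) q \<in> carrier (Hgrp A)" using q Q_H Q_closed by auto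
  let ?i = "AdB (m_inv (Hgrp A) q)"
  have "curv (ract P u q) (?i a) (?i b) = ?i (curv u a b)"
    using form_d_pullback[OF mP one_form smooth_ract[OF q] equivariant[OF q] c, of "kinv ?c (snd ?c u) a" "kinv ?c (snd ?c u) b"]
    by (simp add: curv_def curv_chart_apply[OF c(2,4)] curv_chart_apply[OF c(1,3)] kinv_ract[OF q c]
        AdB_bracket[OF g(2)] blinfun.add_right)
  then show ?thesis by (simp add: AdB_inv(1)[OF g(1)])
qed

lemma smooth_curv: "smooth_fun (total P) curv"
  unfolding smooth_fun_def
proof (intro ballI)
  fix c assume c: "c \<in> atlas (total P)"
  have o: "open (snd c ` fst c)" by (rule chart_image_open[OF mP c])
  have "smooth_on (snd c ` fst c) (curv_chart c)"
  proof (rule smooth_on_blinfunI[OF o], rule smooth_on_blinfunI[OF o])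
    fix a b :: 'h
    note ap = smooth_on_blinfun_apply[OF o]
    have k: "smooth_on (snd c ` fst c) (\<lambda>x. kinv c x a)" for a
      by (rule ap[OF kinv_smooth[OF c] smooth_on_const])
    have D: "smooth_on (snd c ` fst c) (\<lambda>x. frechet_derivative (krep c) (at x) (kinv c x a))" for a
    proof -
      have lin: "linear (frechet_derivative (krep c) (at x))" if "x \<in> snd c ` fst c" for x
        by (rule has_derivative_linear[OF smooth_on_derivative[OF form_rep_smooth[OF mP one_form c] that]])
      have "smooth_on (snd c ` fst c) (\<lambda>x. \<Sum>i\<in>Basis. (kinv c x a \<bullet> i) *\<^sub>R frechet_derivative (krep c) (at x) i)"
        by (intro smooth_on_sum o smooth_on_bilinear[OF bounded_bilinear_scaleR o]
            smooth_on_bounded_linear[OF bounded_linear_inner_left o k] smooth_on_frechet form_rep_smooth[OF mP one_form c])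
      then show ?thesis
      proof (rule smooth_on_cong[OF o])
        fix x assume x: "x \<in> snd c ` fst c"
        show "(\<Sum>i\<in>Basis. (kinv c x a \<bullet> i) *\<^sub>R frechet_derivative (krep c) (at x) i) = frechet_derivative (krep c) (at x) (kinv c x a)"
          by (subst (3) euclidean_representation[symmetric]) (simp add: linear_sum[OF lin[OF x]] linear_cmul[OF lin[OF x]])
      qed
    qed
    have "smooth_on (snd c ` fst c) (\<lambda>x. form_d (total P) \<kappa> c x (kinv c x a) (kinv c x b) + brk A a b)"
      unfolding form_d_def by (intro smooth_on_add smooth_on_diff o ap D k smooth_on_const)
    then show "smooth_on (snd c ` fst c) (\<lambda>x. curv_chart c x a b)"
      by (rule smooth_on_cong[OF o]) (auto simp: curv_chart_apply[OF c])
  qed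
  then show "smooth_on (snd c ` fst c) (curv \<circ> cinv c)"
    by (rule smooth_on_cong[OF o]) (auto simp: curv_chart_eq[OF c] cinv_chart[OF mP c])
qed

text \<open>The constant fields of elements of \<open>hfilt 0\<close> are the fundamental fields of the action.\<close>

lemma kinv_lieQ:
  assumes u: "u \<in> pts (total P)" and c: "c \<in> atlas (total P)" "u \<in> fst c"
  shows "kinv c (snd c u) (lieQ A w) = chart_deriv QG.c1 c (ract P u) \<one>\<^bsub>Hgrp A\<^esub> w"
proof -
  let ?p = "pref (total P) u"
  have p: "?p \<in> atlas (total P)" "u \<in> fst ?p" using u by (simp_all add: pref_chart pref_mem mP)
  have one: "\<one>\<^bsub>Hgrp A\<^esub> \<in> fst QG.c1" using QG.c1(2) by simp
  have pd: "pref (Qmfd A) \<one>\<^bsub>Hgrp A\<^esub> = QG.c1" by (simp add: QG.c1_def)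
  have "\<kappa> u (chart_deriv QG.c1 ?p (ract P u) \<one>\<^bsub>Hgrp A\<^esub> w) = lieQ A w"
    using vertical[OF u, of w] by (simp add: mderiv_eq ract_one[OF u] pd)
  also have "chart_deriv QG.c1 ?p (ract P u) \<one>\<^bsub>Hgrp A\<^esub> w
      = chart_deriv c ?p (\<lambda>u. u) u (chart_deriv QG.c1 c (ract P u) \<one>\<^bsub>Hgrp A\<^esub> w)"
    using chart_deriv_compose[OF QG.mf mP mP smooth_orbit[OF u] smooth_map_ident[OF mP] QG.c1(1) c(1) p(1) one] c(2) p(2)
    by (simp add: ract_one[OF u])
  finally have "krep c (snd c u) (chart_deriv QG.c1 c (ract P u) \<one>\<^bsub>Hgrp A\<^esub> w) = lieQ A w"
    by (simp add: form_rep_eq[OF mP one_form c])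
  then show ?thesis using kinv(2)[OF c] by metis
qed

text \<open>In the chart expression \<open>T\<close> of the action, the derivative in the
  group direction of the equivariance of \<open>\<kappa>\<close> and the derivative along the bundle of the equation for
  fundamental fields share the mixed second derivative of \<open>T\<close>; their difference is the claim.\<close>

lemma curv_horizontal:
  assumes u: "u \<in> pts (total P)" and a: "a \<in> hfilt (grd A) 0"
  shows "curv u a b = 0"
proof -
  obtain w where w: "a = lieQ A w" using a lieQ_range by blast
  let ?c = "pref (total P) u"
  let ?x = "snd ?c u"
  have c: "?c \<in> atlas (total P)" "u \<in> fst ?c" using u by (simp_all add: pref_chart pref_mem mP)
  have xin: "?x \<in> snd ?c ` fst ?c" using c(2) by blast
  have o: "open (snd ?c ` fst ?c)" by (rule chart_image_open[OF mP c(1)])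
  have one: "\<one>\<^bsub>Hgrp A\<^esub> \<in> fst QG.c1" "\<one>\<^bsub>Hgrp A\<^esub> \<in> pts (Qmfd A)" using QG.c1(2) Q_closed(3) by simp_all
  have x1: "QG.x1 = snd QG.c1 \<one>\<^bsub>Hgrp A\<^esub>" by (simp add: QG.x1_def)
  define T where "T = prod_rep ?c QG.c1 ?c act"
  define \<Omega> where "\<Omega> = prod_dom ?c QG.c1 ?c act"
  have \<Omega>: "open \<Omega>" unfolding \<Omega>_def by (rule prod_dom_open[OF mP QG.mf mP smooth_act c(1) QG.c1(1) c(1)])
  have T: "smooth_on \<Omega> T" unfolding \<Omega>_def T_def by (rule prod_rep_smooth[OF mP QG.mf mP smooth_act c(1) QG.c1(1) c(1)])
  define v where "v = kinv ?c ?x b"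
  have base: "(snd ?c p, QG.x1) \<in> \<Omega>" "T (snd ?c p, QG.x1) = snd ?c p"
     "frechet_derivative T (at (snd ?c p, QG.x1)) (0, w) = kinv ?c (snd ?c p) a"
     "frechet_derivative T (at (snd ?c p, QG.x1)) (v, 0) = v" if p: "p \<in> fst ?c" for p
  proof -
    have pp: "p \<in> pts (total P)" using chart_subset[OF mP c(1) p] .
    have a1: "act (p, \<one>\<^bsub>Hgrp A\<^esub>) \<in> fst ?c" using p by (simp add: ract_one[OF pp])
    note part = prod_rep_partial[OF mP QG.mf mP smooth_act c(1) QG.c1(1) c(1) p one(1) a1]
    show "(snd ?c p, QG.x1) \<in> \<Omega>" using part(1) by (simp add: \<Omega>_def x1)
    show "T (snd ?c p, QG.x1) = snd ?c p"
      by (simp add: T_def prod_rep_def x1 cinv_chart[OF mP c(1) p] cinv_chart[OF QG.mf QG.c1(1) one(1)] ract_one[OF pp])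
    show "frechet_derivative T (at (snd ?c p, QG.x1)) (0, w) = kinv ?c (snd ?c p) a"
      using part(3)[of w] by (simp add: T_def x1 w kinv_lieQ[OF pp c(1) p])
    have "chart_deriv ?c ?c (\<lambda>p. ract P p \<one>\<^bsub>Hgrp A\<^esub>) p v = v"
      by (subst chart_deriv_cong[OF mP c(1) p ract_one], assumption, rule chart_deriv_ident[OF mP c(1) p])
    then show "frechet_derivative T (at (snd ?c p, QG.x1)) (v, 0) = v"
      using part(2)[of v] by (simp add: T_def x1)
  qed
  note b0 = base[OF c(2)]
  let ?K = "krep ?c"
  let ?DK = "frechet_derivative ?K (at ?x)"
  let ?D2 = "\<lambda>e. frechet_derivative (\<lambda>z. frechet_derivative T (at z) e) (at (?x, QG.x1))"
  have DK: "(?K has_derivative ?DK) (at ?x)" by (rule smooth_on_derivative[OF form_rep_smooth[OF mP one_form c(1)] xin])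
  have DT: "(T has_derivative frechet_derivative T (at (?x, QG.x1))) (at (?x, QG.x1))"
    by (rule smooth_on_derivative[OF T b0(1)])
  have DT2: "((\<lambda>z. frechet_derivative T (at z) e) has_derivative ?D2 e) (at (?x, QG.x1))" for e
    by (rule smooth_on_derivative[OF smooth_on_frechet[OF T] b0(1)])
  have i1: "((\<lambda>z. (?x, z)) has_derivative (\<lambda>w. (0, w))) (at QG.x1)"
    and i2: "((\<lambda>x. (x, QG.x1)) has_derivative (\<lambda>w. (w, 0))) (at ?x)"
    by (auto intro!: derivative_eq_intros)
  \<comment> \<open>differentiate the equivariance in the group direction\<close>
  have "((\<lambda>z. ?K (T (?x, z))) has_derivative (\<lambda>w. ?DK (frechet_derivative T (at (?x, QG.x1)) (0, w)))) (at QG.x1)"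
    using has_derivative_compose[OF has_derivative_compose[OF i1 DT], of ?K ?DK] DK b0(2) by simp
  from bounded_bilinear.FDERIV[OF bounded_bilinear_blinfun_apply this has_derivative_compose[OF i1 DT2]]
  have "((\<lambda>z. ?K (T (?x, z)) (frechet_derivative T (at (?x, z)) (v, 0))) has_derivative
     (\<lambda>w. ?K (T (?x, QG.x1)) (?D2 (v, 0) (0, w)) + ?DK (frechet_derivative T (at (?x, QG.x1)) (0, w)) (frechet_derivative T (at (?x, QG.x1)) (v, 0)))) (at QG.x1)" .
  from bounded_bilinear.FDERIV[OF bounded_bilinear_blinfun_apply smooth_on_derivative[OF smooth_AdQ SQ(2)] this]
  have 1: "((\<lambda>z. AdQ z (?K (T (?x, z)) (frechet_derivative T (at (?x, z)) (v, 0)))) has_derivative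
     (\<lambda>w. AdQ QG.x1 (?K (T (?x, QG.x1)) (?D2 (v, 0) (0, w)) + ?DK (frechet_derivative T (at (?x, QG.x1)) (0, w)) (frechet_derivative T (at (?x, QG.x1)) (v, 0)))
        + frechet_derivative AdQ (at QG.x1) w (?K (T (?x, QG.x1)) (frechet_derivative T (at (?x, QG.x1)) (v, 0))))) (at QG.x1)" .
  define Z where "Z = (\<lambda>z. (?x, z)) -` \<Omega>"
  have Z: "open Z" unfolding Z_def by (rule open_vimage[OF \<Omega>]) (intro continuous_intros)
  have Z1: "QG.x1 \<in> Z" using b0(1) by (simp add: Z_def)
  have "((\<lambda>z. ?K ?x v) has_derivative
     (\<lambda>w. AdQ QG.x1 (?K (T (?x, QG.x1)) (?D2 (v, 0) (0, w)) + ?DK (frechet_derivative T (at (?x, QG.x1)) (0, w)) (frechet_derivative T (at (?x, QG.x1)) (v, 0)))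
        + frechet_derivative AdQ (at QG.x1) w (?K (T (?x, QG.x1)) (frechet_derivative T (at (?x, QG.x1)) (v, 0))))) (at QG.x1)"
  proof (rule has_derivative_transform_within_open[OF 1 Z Z1])
    fix z assume "z \<in> Z"
    then obtain q where q: "q \<in> fst QG.c1" "z = snd QG.c1 q" "ract P u q \<in> fst ?c"
      by (auto simp: Z_def \<Omega>_def prod_dom_def cinv_chart[OF mP c] cinv_chart[OF QG.mf QG.c1(1)])
    have qq: "q \<in> pts (Qmfd A)" using chart_subset[OF QG.mf QG.c1(1) q(1)] .
    have "frechet_derivative T (at (?x, z)) (v, 0) = chart_deriv ?c ?c (\<lambda>u. ract P u q) u v"
      using prod_rep_partial(2)[OF mP QG.mf mP smooth_act c(1) QG.c1(1) c(1) c(2) q(1)] q(2,3) by (simp add: T_def)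
    moreover have "T (?x, z) = snd ?c (ract P u q)"
      by (simp add: T_def prod_rep_def cinv_chart[OF mP c] cinv_chart[OF QG.mf QG.c1(1) q(1)] q(2))
    ultimately show "AdQ z (?K (T (?x, z)) (frechet_derivative T (at (?x, z)) (v, 0))) = ?K ?x v"
      using krep_ract[OF qq c(1) c(1) c(2) q(3)]
      by (simp add: AdQ_def q(2) cinv_chart[OF QG.mf QG.c1(1) q(1)] AdB_inv(1)[OF Q_H[OF qq]])
  qed
  from has_derivative_unique[OF has_derivative_const this]
  have e1: "?K ?x (?D2 (v, 0) (0, w)) + ?DK (kinv ?c ?x a) v + brk A a (?K ?x v) = 0"
    by (drule_tac fun_cong[where x = w]) (simp add: b0 deriv_AdQ w[symmetric] AdQ_def AdB_one QG.cinv_x1)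
  \<comment> \<open>differentiate the equation of the fundamental field along the bundle\<close>
  have "((\<lambda>x. ?K x (frechet_derivative T (at (x, QG.x1)) (0, w))) has_derivative
     (\<lambda>v. ?K ?x (?D2 (0, w) (v, 0)) + ?DK v (frechet_derivative T (at (?x, QG.x1)) (0, w)))) (at ?x)"
    by (rule bounded_bilinear.FDERIV[OF bounded_bilinear_blinfun_apply DK has_derivative_compose[OF i2 DT2]])
  then have "((\<lambda>x. a) has_derivative
     (\<lambda>v. ?K ?x (?D2 (0, w) (v, 0)) + ?DK v (frechet_derivative T (at (?x, QG.x1)) (0, w)))) (at ?x)"
    by (rule has_derivative_transform_within_open[OF _ o xin]) (auto simp: base kinv[OF c(1)])
  from has_derivative_unique[OF has_derivative_const this]
  have e2: "?K ?x (?D2 (0, w) (v, 0)) + ?DK v (kinv ?c ?x a) = 0"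
    by (drule_tac fun_cong[where x = v]) (simp add: b0)
  have sym: "?D2 (v, 0) (0, w) = ?D2 (0, w) (v, 0)"
    by (rule second_derivative_symmetric[OF T \<Omega> b0(1)])
  have "?DK (kinv ?c ?x a) v - ?DK v (kinv ?c ?x a) + brk A a (?K ?x v)
      = (?K ?x (?D2 (v, 0) (0, w)) + ?DK (kinv ?c ?x a) v + brk A a (?K ?x v))
        - (?K ?x (?D2 (0, w) (v, 0)) + ?DK v (kinv ?c ?x a))"
    unfolding sym by simp
  then have "?DK (kinv ?c ?x a) v - ?DK v (kinv ?c ?x a) + brk A a (?K ?x v) = 0"
    unfolding e1 e2 by simp
  then show ?thesis
    by (simp add: curv_def curv_chart_apply[OF c] form_d_def v_def kinv[OF c])
qed

lemma cochain2_curv: 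
  assumes u: "u \<in> pts (total P)" shows "cochain2 (curv u)"
  unfolding cochain2_def
proof (intro conjI allI)
  have c: "pref (total P) u \<in> atlas (total P)" "u \<in> fst (pref (total P) u)" using u by (simp_all add: pref_chart pref_mem mP)
  show "curv u a a = 0" for a by (simp add: curv_def curv_chart_apply[OF c] form_d_def)
  show "curv u (pr a) = curv u a" for a
    using curv_horizontal[OF u pr_diff_hfilt, of a] by (intro blinfun_eqI) (simp add: blinfun.bilinear_simps)
qed

end

section \<open>Deformations of a Cartan connection\<close>

lemma smooth_fun_const: "smooth_fun M (\<lambda>p. c)"
  by (simp add: smooth_fun_def o_def)

lemma smooth_fun_add:
  "smooth_manifold M \<Longrightarrow> smooth_fun M f \<Longrightarrow> smooth_fun M g \<Longrightarrow> smooth_fun M (\<lambda>p. f p + g p)"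
  by (simp add: smooth_fun_def o_def smooth_on_add chart_image_open)

lemma smooth_fun_bounded_linear:
  "smooth_manifold M \<Longrightarrow> bounded_linear L \<Longrightarrow> smooth_fun M f \<Longrightarrow> smooth_fun M (\<lambda>p. L (f p))"
  unfolding smooth_fun_def o_def
  by (intro ballI, rule smooth_on_bounded_linear, assumption, erule (1) chart_image_open, blast)

lemma fun_deriv_add:
  assumes "smooth_fun M f" "smooth_fun M g" "c \<in> atlas M" "p \<in> fst c"
  shows "fun_deriv c (\<lambda>p. f p + g p) p v = fun_deriv c f p v + fun_deriv c g p v"
  using fun_cong[OF frechet_derivative_at[OF has_derivative_add[OF fun_deriv_works[OF assms(1,3,4)] fun_deriv_works[OF assms(2-4)]]], of v]
  by (simp add: fun_deriv_def o_def)

lemma fun_deriv_bounded_linear: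
  assumes "bounded_linear L" "smooth_fun M f" "c \<in> atlas M" "p \<in> fst c"
  shows "fun_deriv c (\<lambda>p. L (f p)) p v = L (fun_deriv c f p v)"
  using fun_cong[OF frechet_derivative_at[OF bounded_linear.has_derivative[OF assms(1) fun_deriv_works[OF assms(2-4)]]], of v]
  by (simp add: fun_deriv_def o_def)

lemma fun_deriv_annihilate:
  assumes mf: "smooth_manifold M" and L: "bounded_linear L" and f: "smooth_fun M f" "\<And>p. p \<in> pts M \<Longrightarrow> L (f p) = 0"
    and c: "c \<in> atlas M" "p \<in> fst c"
  shows "L (fun_deriv c f p v) = 0"
proof -
  have "((\<lambda>x. L ((f \<circ> cinv c) x)) has_derivative (\<lambda>v. L (fun_deriv c f p v))) (at (snd c p))"
    by (rule bounded_linear.has_derivative[OF L fun_deriv_works[OF f(1) c]])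
  then have "((\<lambda>x. 0) has_derivative (\<lambda>v. L (fun_deriv c f p v))) (at (snd c p))"
    by (rule has_derivative_transform_within_open[OF _ chart_image_open[OF mf c(1)]])
      (use c f(2) chart_subset[OF mf c(1)] in \<open>auto simp: cinv_chart[OF mf c(1)]\<close>)
  from has_derivative_unique[OF this has_derivative_const] show ?thesis by metis
qed

context graded_lie
begin

text \<open>The condition is the vanishing of a family of bounded linear functionals; as such it passes to
  derivatives.\<close>

lemma cofilt1_iff_functionals:
  "cofilt1 r f \<longleftrightarrow> (\<forall>x. f (x - pr x) = 0) \<and> (\<forall>i m. \<forall>x\<in>hfilt gr i. m < i + r \<longrightarrow> component m (f x) = 0)"
  unfolding cofilt1_def cochain1_def by (auto simp: hfilt_iff blinfun.diff_right)

lemma fun_deriv_cofilt1: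
  assumes mf: "smooth_manifold M" and f: "smooth_fun M f" "\<And>p. p \<in> pts M \<Longrightarrow> cofilt1 r (f p)"
    and c: "c \<in> atlas M" "p \<in> fst c"
  shows "cofilt1 r (fun_deriv c f p v)"
  unfolding cofilt1_iff_functionals
proof (intro conjI allI ballI impI)
  show "fun_deriv c f p v (x - pr x) = 0" for x
    by (rule fun_deriv_annihilate[OF mf blinfun.bounded_linear_left f(1) _ c])
      (use f(2) in \<open>simp add: cofilt1_iff_functionals\<close>)
  fix i m x assume x: "x \<in> hfilt gr i" "m < i + r"
  have L: "bounded_linear (\<lambda>g. component m (blinfun_apply g x))"
    using bounded_linear_compose[OF _ blinfun.bounded_linear_left, of "component m" x] linear_component
    by (simp add: linear_conv_bounded_linear)
  show "component m (fun_deriv c f p v x) = 0"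
    by (rule fun_deriv_annihilate[OF mf L f(1) _ c]) (use f(2) x in \<open>auto simp: cofilt1_iff_functionals\<close>)
qed

lemma cofilt2_homogeneousI:
  assumes B: "cochain2 B" and h: "\<And>i j a b. i < 0 \<Longrightarrow> j < 0 \<Longrightarrow> a \<in> gr i \<Longrightarrow> b \<in> gr j \<Longrightarrow> B a b \<in> hfilt gr (i + j + r)"
  shows "cofilt2 r B"
proof (rule cofilt2I[OF B])
  fix i j x y assume *: "x \<in> hfilt gr i" "y \<in> hfilt gr j" "x \<in> hminus gr" "y \<in> hminus gr"
  have "B (component a x) (component b y) \<in> hfilt gr (i + j + r)" for a b
  proof -
    consider "a < i \<or> 0 \<le> a" | "b < j \<or> 0 \<le> b" | "i \<le> a" "a < 0" "j \<le> b" "b < 0" by linarith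
    then show ?thesis
    proof cases
      case 1
      then have "component a x = 0" using * by (auto simp: hfilt_iff hminus_iff)
      then show ?thesis by (simp add: blinfun.zero_left blinfun.zero_right)
    next
      case 2
      then have "component b y = 0" using * by (auto simp: hfilt_iff hminus_iff)
      then show ?thesis by (simp add: blinfun.zero_right)
    next
      case 3
      then show ?thesis using hfilt_mono[OF h[of a b "component a x" "component b y"]] by simp
    qed
  qed
  then have "B (\<Sum>a=-k..l. component a x) (\<Sum>b=-k..l. component b y) \<in> hfilt gr (i + j + r)"
    unfolding blinfun.sum_right blinfun.sum_left by (intro hfilt_sum)
  then show "B x y \<in> hfilt gr (i + j + r)" by (simp add: component_sum)
qed

end

locale normalization = cartan_conn A P \<kappa>
  for A :: "('h::euclidean_space, 'g, 'a::euclidean_space, 'b::euclidean_space) model"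
    and P :: "('p, 'c::euclidean_space, 'm, 'd::euclidean_space, 'g) pbundle" and \<kappa> :: "'p \<Rightarrow> 'c \<Rightarrow> 'h" +
  fixes ip :: "'h \<Rightarrow> 'h \<Rightarrow> real"
  assumes regular: "regular_cartan_connection A P \<kappa>" and admissible: "admissible_metric A ip"
begin

sublocale metric_lie "brk A" "grd A" "depth A" "height A" ip
  using admissible by unfold_locales (simp_all add: admissible_metric_def)

definition kderiv :: "('p \<Rightarrow> 'h \<Rightarrow>\<^sub>L 'h) \<Rightarrow> 'p \<Rightarrow> 'h \<Rightarrow>\<^sub>L 'h \<Rightarrow>\<^sub>L 'h" where
  "kderiv \<phi> u = Blinfun (\<lambda>x. fun_deriv (pref (total P) u) \<phi> u (kinv (pref (total P) u) (snd (pref (total P) u) u) x))"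

lemma kderiv_apply:
  assumes \<phi>: "smooth_fun (total P) \<phi>" and c: "c \<in> atlas (total P)" "u \<in> fst c"
  shows "kderiv \<phi> u x = fun_deriv c \<phi> u (kinv c (snd c u) x)"
proof -
  have u: "u \<in> pts (total P)" using chart_subset[OF mP c] .
  let ?p = "pref (total P) u"
  have p: "?p \<in> atlas (total P)" "u \<in> fst ?p" using u by (simp_all add: pref_chart pref_mem mP)
  have "linear (\<lambda>x. fun_deriv ?p \<phi> u (kinv ?p (snd ?p u) x))"
    using linear_compose[OF blinfun.bounded_linear_right[THEN bounded_linear.linear] fun_deriv_linear[OF \<phi> p], of "kinv ?p (snd ?p u)"]
    by (simp add: o_def)
  then have "kderiv \<phi> u x = fun_deriv ?p \<phi> u (kinv ?p (snd ?p u) x)"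
    unfolding kderiv_def by (rule blinfun_apply_Blinfun)
  then show ?thesis
    using fun_deriv_change[OF mP \<phi> c(1) p(1) c(2) p(2)] kinv_change[OF c(1) p(1) c(2) p(2)] by simp
qed

lemma P_chart:
  assumes "u \<in> pts (total P)"
  shows "pref (total P) u \<in> atlas (total P)" "u \<in> fst (pref (total P) u)"
  using assms by (simp_all add: pref_chart pref_mem mP)

lemma kderiv_add:
  assumes "smooth_fun (total P) \<phi>" "smooth_fun (total P) \<psi>" "u \<in> pts (total P)"
  shows "kderiv (\<lambda>u. \<phi> u + \<psi> u) u = kderiv \<phi> u + kderiv \<psi> u"
  by (rule blinfun_eqI)
    (simp add: kderiv_apply[OF _ P_chart[OF assms(3)]] assms smooth_fun_add mP fun_deriv_add[OF assms(1,2) P_chart[OF assms(3)]] blinfun.add_left)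

lemma kderiv_cofilt1:
  assumes "smooth_fun (total P) \<phi>" "\<And>u. u \<in> pts (total P) \<Longrightarrow> cofilt1 r (\<phi> u)" "u \<in> pts (total P)"
  shows "cofilt1 r (kderiv \<phi> u x)"
  by (simp add: kderiv_apply[OF assms(1) P_chart[OF assms(3)]] fun_deriv_cofilt1[OF mP assms(1,2) P_chart[OF assms(3)]])

lemma smooth_kderiv:
  assumes \<phi>: "smooth_fun (total P) \<phi>" shows "smooth_fun (total P) (kderiv \<phi>)"
  unfolding smooth_fun_def
proof (intro ballI)
  fix c assume c: "c \<in> atlas (total P)"
  have o: "open (snd c ` fst c)" by (rule chart_image_open[OF mP c])
  have sm: "smooth_on (snd c ` fst c) (\<phi> \<circ> cinv c)" using \<phi> c by (simp add: smooth_fun_def)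
  show "smooth_on (snd c ` fst c) (kderiv \<phi> \<circ> cinv c)"
  proof (rule smooth_on_blinfunI[OF o])
    fix a :: 'h
    have "smooth_on (snd c ` fst c) (\<lambda>x. kinv c x a)"
      by (rule smooth_on_blinfun_apply[OF o kinv_smooth[OF c] smooth_on_const])
    then have "smooth_on (snd c ` fst c) (\<lambda>x. \<Sum>i\<in>Basis. (kinv c x a \<bullet> i) *\<^sub>R frechet_derivative (\<phi> \<circ> cinv c) (at x) i)"
      by (intro smooth_on_sum o smooth_on_bilinear[OF bounded_bilinear_scaleR o]
            smooth_on_bounded_linear[OF bounded_linear_inner_left o] smooth_on_frechet sm)
    then show "smooth_on (snd c ` fst c) (\<lambda>x. (kderiv \<phi> \<circ> cinv c) x a)"
    proof (rule smooth_on_cong[OF o])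
      fix x assume x: "x \<in> snd c ` fst c"
      then obtain u where u: "u \<in> fst c" "x = snd c u" by blast
      have lin: "linear (frechet_derivative (\<phi> \<circ> cinv c) (at x))"
        by (rule has_derivative_linear[OF smooth_on_derivative[OF sm x]])
      have "(kderiv \<phi> \<circ> cinv c) x a = frechet_derivative (\<phi> \<circ> cinv c) (at x) (kinv c x a)"
        by (simp add: u cinv_chart[OF mP c] kderiv_apply[OF \<phi> c u(1)] fun_deriv_def)
      then show "(\<Sum>i\<in>Basis. (kinv c x a \<bullet> i) *\<^sub>R frechet_derivative (\<phi> \<circ> cinv c) (at x) i) = (kderiv \<phi> \<circ> cinv c) x a"
        by (subst (asm) euclidean_representation[of "kinv c x a", symmetric]) (simp add: linear_sum[OF lin] linear_cmul[OF lin])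
    qed
  qed
qed

definition formal :: "('p \<Rightarrow> 'h \<Rightarrow>\<^sub>L 'h) \<Rightarrow> 'p \<Rightarrow> 'h \<Rightarrow>\<^sub>L 'h \<Rightarrow>\<^sub>L 'h" where
  "formal \<phi> u = fcurv (curv u) (\<phi> u) (kderiv \<phi> u)"

lemma smooth_formal:
  assumes \<phi>: "smooth_fun (total P) \<phi>" "\<And>u. u \<in> pts (total P) \<Longrightarrow> cofilt1 1 (\<phi> u)"
  shows "smooth_fun (total P) (formal \<phi>)"
  unfolding smooth_fun_def
proof (intro ballI)
  fix c assume c: "c \<in> atlas (total P)"
  have sm: "smooth_on (snd c ` fst c) (\<phi> \<circ> cinv c)" "smooth_on (snd c ` fst c) (curv \<circ> cinv c)"
    "smooth_on (snd c ` fst c) (kderiv \<phi> \<circ> cinv c)"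
    using \<phi>(1) smooth_curv smooth_kderiv[OF \<phi>(1)] c by (simp_all add: smooth_fun_def)
  have "smooth_on (snd c ` fst c) (\<lambda>x. fcurv ((curv \<circ> cinv c) x) ((\<phi> \<circ> cinv c) x) ((kderiv \<phi> \<circ> cinv c) x))"
    by (rule smooth_fcurv[OF chart_image_open[OF mP c] sm(1) _ sm(2,3)])
      (use \<phi>(2) chart_subset[OF mP c] in \<open>auto simp: cinv_chart[OF mP c]\<close>)
  then show "smooth_on (snd c ` fst c) (formal \<phi> \<circ> cinv c)" by (simp add: formal_def o_def)
qed

lemma curvature_fun_eq:
  assumes "u \<in> pts (total P)" shows "curvature_fun A P \<kappa> u = list_cochain2 (curv u)"
  by (rule ext) (simp add: curvature_fun_def list_cochain2_def curv_apply[OF assms])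

lemma cofilt2_curv: 
  assumes u: "u \<in> pts (total P)" shows "cofilt2 1 (curv u)"
proof (rule cofilt2_homogeneousI[OF cochain2_curv[OF u]])
  fix i j a b assume *: "i < 0" "j < 0" "a \<in> grd A i" "b \<in> grd A j"
  have "curvature_fun A P \<kappa> u [a, b] \<in> hfilt (grd A) (i + j + 1)"
    using regular u * unfolding regular_cartan_connection_def by blast
  then show "curv u a b \<in> hfilt (grd A) (i + j + 1)"
    using gr_hminus * by (simp add: curvature_fun_eq[OF u])
qed

lemma cochain2_formal:
  assumes "u \<in> pts (total P)" "cofilt1 1 (\<phi> u)" shows "cochain2 (formal \<phi> u)"
  unfolding formal_def by (rule cochain2_fcurv[OF assms(2) cochain2_curv[OF assms(1)]])

text \<open>Subtracting from \<open>\<phi>\<close> the preimage of \<open>lie_dstar (formal \<phi> u)\<close> under \<open>lie_dstar \<circ> lie_d\<close> cancels the leading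
  term, and the remaining change of the formal curvature has higher homogeneity.\<close>

lemma normalize_step:
  assumes \<phi>: "smooth_fun (total P) \<phi>" "\<And>u. u \<in> pts (total P) \<Longrightarrow> cofilt1 1 (\<phi> u)" "\<And>u. u \<in> pts (total P) \<Longrightarrow> \<phi> u \<in> coexact"
    and r: "1 \<le> r" and d: "\<And>u. u \<in> pts (total P) \<Longrightarrow> cofilt1 r (lie_dstar (formal \<phi> u))"
  shows "\<exists>\<phi>'. smooth_fun (total P) \<phi>' \<and> (\<forall>u\<in>pts (total P). cofilt1 1 (\<phi>' u) \<and> \<phi>' u \<in> coexact \<and>
      cofilt1 (r + 1) (lie_dstar (formal \<phi>' u)))"
proof -
  obtain G where G: "linear G" "\<And>f. f \<in> coexact \<Longrightarrow> G f \<in> coexact" "\<And>f. f \<in> coexact \<Longrightarrow> lie_dstar (lie_d (G f)) = f"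
    by (rule coexact_right_inverse) blast
  define \<psi> where "\<psi> u = - G (lie_dstar (formal \<phi> u))" for u
  have cx: "lie_dstar (formal \<phi> u) \<in> coexact" if "u \<in> pts (total P)" for u
    using cochain2_formal[of u \<phi>] \<phi>(2) that by (auto simp: coexact_def)
  have ld: "lie_dstar (lie_d (\<psi> u)) = - lie_dstar (formal \<phi> u)" if "u \<in> pts (total P)" for u
    using G(3)[OF cx[OF that]] lie_d_linear(2)[of "-1" "G (lie_dstar (formal \<phi> u))"]
      linear_neg[OF linear_lie_dstar, of "lie_d (G (lie_dstar (formal \<phi> u)))"] by (simp add: \<psi>_def)
  have \<psi>x: "\<psi> u \<in> coexact" if "u \<in> pts (total P)" for u
    unfolding \<psi>_def by (intro subspace_neg subspace_coexact G(2) cx that)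
  have \<psi>r: "cofilt1 r (\<psi> u)" if "u \<in> pts (total P)" for u
    by (rule coexact_cofilt1[OF \<psi>x[OF that]]) (simp add: ld that cofilt1_simps d)
  have \<psi>s: "smooth_fun (total P) \<psi>"
  proof -
    have "linear (\<lambda>B. - G (lie_dstar B))"
      using linear_compose[OF linear_compose[OF linear_lie_dstar G(1)] linear_uminus] by (simp add: o_def)
    then have "bounded_linear (\<lambda>B. - G (lie_dstar B))" by (rule bounded_linear_blinfun2)
    from smooth_fun_bounded_linear[OF mP this smooth_formal[OF \<phi>(1,2)]]
    show ?thesis by (simp add: \<psi>_def[abs_def])
  qed
  show ?thesis
  proof (intro exI[of _ "\<lambda>u. \<phi> u + \<psi> u"] conjI ballI)
    show "smooth_fun (total P) (\<lambda>u. \<phi> u + \<psi> u)" by (rule smooth_fun_add[OF mP \<phi>(1) \<psi>s])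
    fix u assume u: "u \<in> pts (total P)"
    show "cofilt1 1 (\<phi> u + \<psi> u)" by (intro cofilt1_simps \<phi> u cofilt1_mono[OF \<psi>r r])
    show "\<phi> u + \<psi> u \<in> coexact" by (intro subspace_add subspace_coexact \<phi> \<psi>x u)
    have "cofilt2 (r + 1) (formal (\<lambda>u. \<phi> u + \<psi> u) u - formal \<phi> u - lie_d (\<psi> u))"
      unfolding formal_def kderiv_add[OF \<phi>(1) \<psi>s u]
      by (intro fcurv_perturb r \<phi> u \<psi>r cofilt2_curv kderiv_cofilt1 \<psi>s)
    from cofilt1_lie_dstar[OF this]
    show "cofilt1 (r + 1) (lie_dstar (formal (\<lambda>u. \<phi> u + \<psi> u) u))"
      by (simp add: linear_diff[OF linear_lie_dstar] ld[OF u])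
  qed
qed

lemma formal_0: "u \<in> pts (total P) \<Longrightarrow> formal (\<lambda>u. 0) u = curv u"
proof -
  assume u: "u \<in> pts (total P)"
  have "fun_deriv c (\<lambda>u. 0 :: 'h \<Rightarrow>\<^sub>L 'h) u = (\<lambda>v. 0)" for c :: "('p, 'c) chart"
    by (simp add: fun_deriv_def o_def)
  then have "kderiv (\<lambda>u. 0) u = 0"
    by (intro blinfun_eqI) (simp add: kderiv_apply[OF smooth_fun_const P_chart[OF u]])
  then show ?thesis by (simp add: formal_def fcurv_0[OF cochain2_curv[OF u]])
qed

text \<open>No cochain has homogeneity above \<open>height A + depth A\<close>, so the recursion ends.\<close>

lemma formal_normalization:
  obtains \<phi> where "smooth_fun (total P) \<phi>" "\<And>u. u \<in> pts (total P) \<Longrightarrow> cofilt1 1 (\<phi> u)"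
    "\<And>u. u \<in> pts (total P) \<Longrightarrow> \<phi> u \<in> coexact" "\<And>u. u \<in> pts (total P) \<Longrightarrow> lie_dstar (formal \<phi> u) = 0"
proof -
  have "\<exists>\<phi>. smooth_fun (total P) \<phi> \<and> (\<forall>u\<in>pts (total P). cofilt1 1 (\<phi> u) \<and> \<phi> u \<in> coexact \<and>
      cofilt1 (int n + 1) (lie_dstar (formal \<phi> u)))" for n
  proof (induction n)
    case 0
    show ?case
      by (intro exI[of _ "\<lambda>u. 0"])
        (simp add: smooth_fun_const cofilt1_simps subspace_0 subspace_coexact formal_0 cofilt1_lie_dstar cofilt2_curv)
  next
    case (Suc n)
    then obtain \<phi> where \<phi>: "smooth_fun (total P) \<phi>" "\<And>u. u \<in> pts (total P) \<Longrightarrow> cofilt1 1 (\<phi> u)"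
      "\<And>u. u \<in> pts (total P) \<Longrightarrow> \<phi> u \<in> coexact" "\<And>u. u \<in> pts (total P) \<Longrightarrow> cofilt1 (int n + 1) (lie_dstar (formal \<phi> u))"
      by blast
    have "1 \<le> int n + 1" by simp
    from normalize_step[OF \<phi>(1,2,3) this \<phi>(4)] show ?case by (simp add: add.commute)
  qed
  from this[of "nat (height A + depth A)"]
  obtain \<phi> where \<phi>: "smooth_fun (total P) \<phi>" "\<And>u. u \<in> pts (total P) \<Longrightarrow> cofilt1 1 (\<phi> u)"
      "\<And>u. u \<in> pts (total P) \<Longrightarrow> \<phi> u \<in> coexact" "\<And>u. u \<in> pts (total P) \<Longrightarrow> cofilt1 (int (nat (height A + depth A)) + 1) (lie_dstar (formal \<phi> u))"
    by blast
  have "lie_dstar (formal \<phi> u) = 0" if "u \<in> pts (total P)" for u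
    by (rule cofilt1_top[OF \<phi>(4)[OF that]]) simp
  with that[OF \<phi>(1-3)] show ?thesis by blast
qed

section \<open>Equivariance of the solution\<close>

definition act1 :: "'g \<Rightarrow> ('h \<Rightarrow>\<^sub>L 'h) \<Rightarrow> 'h \<Rightarrow>\<^sub>L 'h" where
  "act1 q f = AdB q o\<^sub>L f o\<^sub>L AdB (m_inv (Hgrp A) q)"

definition act2 :: "'g \<Rightarrow> ('h \<Rightarrow>\<^sub>L 'h \<Rightarrow>\<^sub>L 'h) \<Rightarrow> 'h \<Rightarrow>\<^sub>L 'h \<Rightarrow>\<^sub>L 'h" where
  "act2 q B = blinfun2 (\<lambda>x y. AdB q (B (AdB (m_inv (Hgrp A) q) x) (AdB (m_inv (Hgrp A) q) y)))"

lemma act1_apply: "act1 q f x = AdB q (f (AdB (m_inv (Hgrp A) q) x))"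
  by (simp add: act1_def)

lemma act2_apply: "act2 q B x y = AdB q (B (AdB (m_inv (Hgrp A) q) x) (AdB (m_inv (Hgrp A) q) y))"
  unfolding act2_def
  by (rule blinfun2_apply, unfold bilinear_def, intro conjI allI linearI) (simp_all add: blinfun.bilinear_simps)

lemma AdB_inv_hfilt: "q \<in> pts (Qmfd A) \<Longrightarrow> x \<in> hfilt (grd A) i \<Longrightarrow> AdB (m_inv (Hgrp A) q) x \<in> hfilt (grd A) i"
  by (intro AdB_hfilt Q_closed)

lemma cochain1_AdB_inv:
  assumes q: "q \<in> pts (Qmfd A)" and f: "cochain1 f"
  shows "f (AdB (m_inv (Hgrp A) q) (pr x)) = f (AdB (m_inv (Hgrp A) q) x)"
proof -
  have "f (AdB (m_inv (Hgrp A) q) (x - pr x)) = 0"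
    by (rule cochain1_hfilt[OF f AdB_inv_hfilt[OF q pr_diff_hfilt]])
  then show ?thesis by (simp add: blinfun.diff_right)
qed

lemma cochain1_act1: "q \<in> pts (Qmfd A) \<Longrightarrow> cochain1 f \<Longrightarrow> cochain1 (act1 q f)"
  using cochain1_AdB_inv[of q f] by (simp add: cochain1_def[of "act1 q f"] act1_apply)

lemma cofilt1_act1: "q \<in> pts (Qmfd A) \<Longrightarrow> cofilt1 r f \<Longrightarrow> cofilt1 r (act1 q f)"
  using cochain1_act1[of q f] by (simp add: cofilt1_def act1_apply AdB_hfilt AdB_inv_hfilt)

lemma cochain2_act2: 
  assumes q: "q \<in> pts (Qmfd A)" and B: "cochain2 B" shows "cochain2 (act2 q B)"
  unfolding cochain2_def
proof (intro conjI allI)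
  show "act2 q B x x = 0" for x using B by (simp add: act2_apply cochain2_def)
  fix x
  have "B (AdB (m_inv (Hgrp A) q) (x - pr x)) y = 0" for y
    by (rule cochain2_hfilt[OF B AdB_inv_hfilt[OF q pr_diff_hfilt]])
  then show "act2 q B (pr x) = act2 q B x"
    by (intro blinfun_eqI) (simp add: act2_apply blinfun.diff_right blinfun.diff_left)
qed

lemma Ad_minus_eq: "q \<in> pts (Qmfd A) \<Longrightarrow> Ad_minus A (m_inv (Hgrp A) q) x = pr (AdB (m_inv (Hgrp A) q) x)"
  by (simp add: Ad_minus_def Ad_eq Q_H Q_closed proj_minus_eq)

lemma cochain_action_1:
  assumes q: "q \<in> pts (Qmfd A)" and f: "cochain1 f"
  shows "cochain_action A 1 q (list_cochain1 f) = list_cochain1 (act1 q f)"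
proof
  fix xs
  show "cochain_action A 1 q (list_cochain1 f) xs = list_cochain1 (act1 q f) xs"
  proof (cases "xs \<in> cochain_args (grd A) 1")
    case True
    then obtain x where "x \<in> hminus (grd A)" "xs = [x]" by (auto simp: cochain_args_1 simp del: One_nat_def)
    then show ?thesis
      using True f by (simp add: cochain_action_def Ad_eq Q_H[OF q] Ad_minus_eq[OF q] act1_apply cochain1_def del: One_nat_def)
  qed (simp add: cochain_action_def list_cochain1_def del: One_nat_def)
qed

lemma cochain_action_2:
  assumes q: "q \<in> pts (Qmfd A)" and B: "cochain2 B"
  shows "cochain_action A (Suc 1) q (list_cochain2 B) = list_cochain2 (act2 q B)"
proof
  fix xs
  have 2: "Suc 1 = 2" by simp
  show "cochain_action A (Suc 1) q (list_cochain2 B) xs = list_cochain2 (act2 q B) xs"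
  proof (cases "xs \<in> cochain_args (grd A) 2")
    case True
    then obtain x y where "x \<in> hminus (grd A)" "y \<in> hminus (grd A)" "xs = [x, y]" by (auto simp: cochain_args_2)
    then show ?thesis
      using True B cochain2_right[OF B] unfolding 2
      by (simp add: cochain_action_def Ad_eq Q_H[OF q] Ad_minus_eq[OF q] act2_apply cochain2_def)
  qed (simp add: cochain_action_def list_cochain2_def 2 del: One_nat_def)
qed

text \<open>The admissibility of the metric in degree \<open>1\<close>, in terms of operators.\<close>

lemma lie_dstar_equivariant:
  assumes q: "q \<in> pts (Qmfd A)" and B: "cochain2 B"
  shows "lie_dstar (act2 q B) = act1 q (lie_dstar B)"
proof -
  have "list_cochain2 B \<in> cochains (grd A) (Suc 1)"
    using list_cochain2_cochains[OF B] by (simp add: numeral_2_eq_2)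
  then have "adjoint_diff A ip 1 (cochain_action A (Suc 1) q (list_cochain2 B)) = cochain_action A 1 q (adjoint_diff A ip 1 (list_cochain2 B))"
    using admissible q unfolding admissible_metric_def by blast
  then have "list_cochain1 (lie_dstar (act2 q B)) = list_cochain1 (act1 q (lie_dstar B))"
    unfolding cochain_action_2[OF q B] adjoint_diff_eq[OF refl refl] cochain_action_1[OF q cochain1_lie_dstar] .
  then show ?thesis
    by (rule list_cochain1_inj[OF cochain1_lie_dstar cochain1_act1[OF q cochain1_lie_dstar]])
qed

text \<open>The translate \<open>q \<cdot> \<phi>\<close> of a field of cochains; \<open>\<phi>\<close> is equivariant if all its translates are \<open>\<phi>\<close>.\<close>

definition translate :: "'g \<Rightarrow> ('p \<Rightarrow> 'h \<Rightarrow>\<^sub>L 'h) \<Rightarrow> 'p \<Rightarrow> 'h \<Rightarrow>\<^sub>L 'h" where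
  "translate q \<phi> u = act1 q (\<phi> (ract P u q))"

lemma bounded_linear_act1: "bounded_linear (act1 q)"
  unfolding act1_def
  by (intro bounded_linear_compose[OF bounded_bilinear.bounded_linear_left[OF bounded_bilinear_blinfun_compose]]
      bounded_bilinear.bounded_linear_right[OF bounded_bilinear_blinfun_compose])

lemma smooth_translate:
  assumes "q \<in> pts (Qmfd A)" "smooth_fun (total P) \<phi>" shows "smooth_fun (total P) (translate q \<phi>)"
  using smooth_fun_bounded_linear[OF mP bounded_linear_act1 smooth_fun_compose[OF mP mP smooth_ract[OF assms(1)] assms(2)]]
  by (simp add: translate_def[abs_def])

lemma kderiv_translate:
  assumes q: "q \<in> pts (Qmfd A)" and \<phi>: "smooth_fun (total P) \<phi>" and u: "u \<in> pts (total P)"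
  shows "kderiv (translate q \<phi>) u x y = AdB q (kderiv \<phi> (ract P u q) (AdB (m_inv (Hgrp A) q) x) (AdB (m_inv (Hgrp A) q) y))"
proof -
  let ?c = "pref (total P) u" and ?d = "pref (total P) (ract P u q)"
  note c = P_chart[OF u] P_chart[OF ract_pts[OF u q]]
  have s: "smooth_fun (total P) (\<lambda>u. \<phi> (ract P u q))"
    by (rule smooth_fun_compose[OF mP mP smooth_ract[OF q] \<phi>])
  have "kderiv (translate q \<phi>) u x = fun_deriv ?c (\<lambda>u. act1 q (\<phi> (ract P u q))) u (kinv ?c (snd ?c u) x)"
    using kderiv_apply[OF smooth_translate[OF q \<phi>] c(1,2)] by (simp add: translate_def[abs_def])
  also have "\<dots> = act1 q (fun_deriv ?d \<phi> (ract P u q) (kinv ?d (snd ?d (ract P u q)) (AdB (m_inv (Hgrp A) q) x)))"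
    unfolding fun_deriv_bounded_linear[OF bounded_linear_act1 s c(1,2)] fun_deriv_compose(2)[OF mP mP smooth_ract[OF q] \<phi> c(1,3,2,4)]
      kinv_ract[OF q c(1,3,2,4)] ..
  also have "\<dots> = act1 q (kderiv \<phi> (ract P u q) (AdB (m_inv (Hgrp A) q) x))"
    by (simp add: kderiv_apply[OF \<phi> c(3,4)])
  finally show ?thesis by (simp add: act1_apply)
qed

text \<open>The curve \<open>q \<mapsto> q \<cdot> \<phi> - \<phi>\<close> stays in the cochains of homogeneity \<open>r\<close>, hence so does its derivative at the
  identity in the direction of \<open>b\<close>.  Composing with \<open>AdB q\<close> from the right avoids differentiating the
  inverse.\<close>

lemma vertical_defect:
  assumes \<phi>: "smooth_fun (total P) \<phi>"
    and S: "\<And>q. q \<in> pts (Qmfd A) \<Longrightarrow> cofilt1 r (translate q \<phi> u - \<phi> u)"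
    and u: "u \<in> pts (total P)" and b: "b \<in> hfilt (grd A) 0" and y: "y \<in> hfilt (grd A) j"
  shows "kderiv \<phi> u b y + brk A b (\<phi> u y) - \<phi> u (brk A b y) \<in> hfilt (grd A) (j + r)"
proof -
  obtain w where w: "b = lieQ A w" using b lieQ_range by blast
  note c = P_chart[OF u]
  let ?c = "pref (total P) u"
  have one: "\<one>\<^bsub>Hgrp A\<^esub> \<in> fst QG.c1" using QG.c1(2) by simp
  have x1: "QG.x1 = snd QG.c1 \<one>\<^bsub>Hgrp A\<^esub>" by (simp add: QG.x1_def)
  have u1: "ract P u \<one>\<^bsub>Hgrp A\<^esub> \<in> fst ?c" using c by (simp add: ract_one[OF u])
  define F where "F z = AdQ z (\<phi> (ract P u (cinv QG.c1 z)) y) - \<phi> u (AdQ z y)" for z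
  have D\<phi>: "((\<lambda>z. \<phi> (ract P u (cinv QG.c1 z))) has_derivative
      (\<lambda>w. fun_deriv ?c \<phi> u (chart_deriv QG.c1 ?c (ract P u) \<one>\<^bsub>Hgrp A\<^esub> w))) (at QG.x1)"
    using fun_deriv_compose(1)[OF QG.mf mP smooth_orbit[OF u] \<phi> QG.c1(1) c(1) one u1] by (simp add: ract_one[OF u] x1)
  have AdQ1: "AdQ QG.x1 z = z" for z by (simp add: AdQ_def AdB_one QG.cinv_x1)
  note DA = smooth_on_derivative[OF smooth_AdQ SQ(2)]
  have DF: "(F has_derivative (\<lambda>w. (AdQ QG.x1 (fun_deriv ?c \<phi> u (chart_deriv QG.c1 ?c (ract P u) \<one>\<^bsub>Hgrp A\<^esub> w) y)
       + frechet_derivative AdQ (at QG.x1) w (\<phi> (ract P u (cinv QG.c1 QG.x1)) y)) - \<phi> u (frechet_derivative AdQ (at QG.x1) w y))) (at QG.x1)"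
    unfolding F_def
    by (intro has_derivative_diff bounded_bilinear.FDERIV[OF bounded_bilinear_blinfun_apply DA]
        bounded_linear.has_derivative[OF blinfun.bounded_linear_right] bounded_linear.has_derivative[OF blinfun.bounded_linear_left] DA D\<phi>)
  have Fz: "F z \<in> hfilt (grd A) (j + r)" if z: "z \<in> SQ" for z
  proof -
    let ?q = "cinv QG.c1 z"
    have q: "?q \<in> pts (Qmfd A)" using z SQ(3) QG.cinv_S1(2)[of z] by auto
    have "F z = (translate ?q \<phi> u - \<phi> u) (AdB ?q y)"
      by (simp add: F_def AdQ_def translate_def act1_apply blinfun.diff_left AdB_inv(2)[OF Q_H[OF q]])
    also have "\<dots> \<in> hfilt (grd A) (j + r)"
      by (rule cofilt1_apply[OF S[OF q] AdB_hfilt[OF q y]]) simp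
    finally show ?thesis .
  qed
  have "component m (kderiv \<phi> u b y + brk A b (\<phi> u y) - \<phi> u (brk A b y)) = 0" if m: "m < j + r" for m
  proof -
    have "bounded_linear (component m)" using linear_component by (simp add: linear_conv_bounded_linear)
    from bounded_linear.has_derivative[OF this DF]
    have "((\<lambda>z. 0) has_derivative (\<lambda>w. component m ((AdQ QG.x1 (fun_deriv ?c \<phi> u (chart_deriv QG.c1 ?c (ract P u) \<one>\<^bsub>Hgrp A\<^esub> w) y)
       + frechet_derivative AdQ (at QG.x1) w (\<phi> (ract P u (cinv QG.c1 QG.x1)) y)) - \<phi> u (frechet_derivative AdQ (at QG.x1) w y)))) (at QG.x1)"
      by (rule has_derivative_transform_within_open[OF _ SQ(1,2)]) (use Fz m in \<open>simp add: hfilt_iff\<close>)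
    from fun_cong[OF has_derivative_unique[OF this has_derivative_const], of w]
    show ?thesis
      by (simp add: QG.cinv_x1 AdQ1 deriv_AdQ w[symmetric] ract_one[OF u]
          kderiv_apply[OF \<phi> c] kinv_lieQ[OF u c, of w, unfolded w[symmetric]])
  qed
  then show ?thesis by (simp add: hfilt_iff)
qed

lemma formal_translate:
  assumes \<phi>: "smooth_fun (total P) \<phi>" "\<And>u. u \<in> pts (total P) \<Longrightarrow> cofilt1 1 (\<phi> u)"
    and S: "\<And>q u. q \<in> pts (Qmfd A) \<Longrightarrow> u \<in> pts (total P) \<Longrightarrow> cofilt1 r (translate q \<phi> u - \<phi> u)"
    and q: "q \<in> pts (Qmfd A)" and u: "u \<in> pts (total P)"
  shows "cofilt2 (r + 1) (formal (translate q \<phi>) u - act2 q (formal \<phi> (ract P u q)))"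
proof (rule cofilt2I)
  have v: "ract P u q \<in> pts (total P)" by (rule ract_pts[OF u q])
  have g: "q \<in> carrier (Hgrp A)" by (rule Q_H[OF q])
  have \<phi>q: "cofilt1 1 (translate q \<phi> u)" unfolding translate_def by (rule cofilt1_act1[OF q \<phi>(2)[OF v]])
  show "cochain2 (formal (translate q \<phi>) u - act2 q (formal \<phi> (ract P u q)))"
    by (intro cochain2_simps cochain2_formal cochain2_act2 \<phi>q \<phi> u v q)
  fix i j x y assume *: "i < 0" "j < 0" "x \<in> hfilt (grd A) i" "y \<in> hfilt (grd A) j" "x \<in> hminus (grd A)" "y \<in> hminus (grd A)"
  have "fcurv (curv u) (translate q \<phi> u) (kderiv (translate q \<phi>) u) x y
     - AdB q (fcurv (curv (ract P u q)) (\<phi> (ract P u q)) (kderiv \<phi> (ract P u q)) (AdB (m_inv (Hgrp A) q) x) (AdB (m_inv (Hgrp A) q) y))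
     \<in> hfilt (grd A) (i + j + (r + 1))"
  proof (rule fcurv_transform)
    show "AdB q (AdB (m_inv (Hgrp A) q) x) = x" "AdB (m_inv (Hgrp A) q) (AdB q x) = x" for x
      using AdB_inv[OF g] by simp_all
    show "AdB q (brk A x y) = brk A (AdB q x) (AdB q y)" for x y by (rule AdB_bracket[OF g])
    show "x \<in> hfilt (grd A) i \<Longrightarrow> AdB q x \<in> hfilt (grd A) i" "x \<in> hfilt (grd A) i \<Longrightarrow> AdB (m_inv (Hgrp A) q) x \<in> hfilt (grd A) i" for x i
      by (rule AdB_hfilt[OF q], assumption, rule AdB_inv_hfilt[OF q], assumption)
    show "cochain1 (kderiv \<phi> (ract P u q) z)" for z
      using kderiv_cofilt1[OF \<phi> v] by (simp add: cofilt1_def)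
    show "translate q \<phi> u x = AdB q (\<phi> (ract P u q) (AdB (m_inv (Hgrp A) q) x))" for x
      by (simp add: translate_def act1_apply)
    show "curv u x y = AdB q (curv (ract P u q) (AdB (m_inv (Hgrp A) q) x) (AdB (m_inv (Hgrp A) q) y))" for x y
      by (rule curv_equivariant[OF q u])
    show "kderiv (translate q \<phi>) u x y = AdB q (kderiv \<phi> (ract P u q) (AdB (m_inv (Hgrp A) q) x) (AdB (m_inv (Hgrp A) q) y))" for x y
      by (rule kderiv_translate[OF q \<phi>(1) u])
    show "kderiv \<phi> (ract P u q) b y + brk A b (\<phi> (ract P u q) y) - \<phi> (ract P u q) (brk A b y) \<in> hfilt (grd A) (j + r)"
      if "b \<in> hfilt (grd A) 0" "y \<in> hfilt (grd A) j" for b y j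
      by (rule vertical_defect[OF \<phi>(1) S[OF _ v] v that])
  qed (use * \<phi>q \<phi> v cochain2_curv u in auto)
  then show "(formal (translate q \<phi>) u - act2 q (formal \<phi> (ract P u q))) x y \<in> hfilt (grd A) (i + j + (r + 1))"
    by (simp add: formal_def blinfun.diff_left act2_apply)
qed

text \<open>A solution in \<open>coexact\<close> is unique degree by degree, and its translates solve the
  equation to one degree more than they are known to agree with it; hence they agree in all degrees.\<close>

lemma formal_solution_equivariant:
  assumes \<phi>: "smooth_fun (total P) \<phi>" "\<And>u. u \<in> pts (total P) \<Longrightarrow> cofilt1 1 (\<phi> u)"
    "\<And>u. u \<in> pts (total P) \<Longrightarrow> \<phi> u \<in> coexact" "\<And>u. u \<in> pts (total P) \<Longrightarrow> lie_dstar (formal \<phi> u) = 0"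
    and q: "q \<in> pts (Qmfd A)" and u: "u \<in> pts (total P)"
  shows "translate q \<phi> u = \<phi> u"
proof -
  have \<phi>q: "cofilt1 1 (translate q \<phi> u)" if "q \<in> pts (Qmfd A)" "u \<in> pts (total P)" for q u
    unfolding translate_def by (rule cofilt1_act1[OF that(1) \<phi>(2)[OF ract_pts[OF that(2,1)]]])
  have S: "\<forall>q\<in>pts (Qmfd A). \<forall>u\<in>pts (total P). cofilt1 (int n + 1) (translate q \<phi> u - \<phi> u)" for n
  proof (induction n)
    case 0
    show ?case using \<phi>q \<phi>(2) by (auto intro: cofilt1_simps)
  next
    case (Suc n)
    let ?r = "int n + 1"
    have IH: "\<And>q u. q \<in> pts (Qmfd A) \<Longrightarrow> u \<in> pts (total P) \<Longrightarrow> cofilt1 ?r (translate q \<phi> u - \<phi> u)" using Suc by blast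
    show ?case
    proof (intro ballI)
      fix q u assume q: "q \<in> pts (Qmfd A)" and u: "u \<in> pts (total P)"
      have v: "ract P u q \<in> pts (total P)" by (rule ract_pts[OF u q])
      define \<psi> where "\<psi> u = translate q \<phi> u - \<phi> u" for u
      have tr: "translate q \<phi> = (\<lambda>u. \<phi> u + \<psi> u)" by (simp add: \<psi>_def)
      have \<psi>s: "smooth_fun (total P) \<psi>"
        using smooth_fun_add[OF mP smooth_translate[OF q \<phi>(1)] smooth_fun_bounded_linear[OF mP bounded_linear_minus[OF bounded_linear_ident] \<phi>(1)]]
        by (simp add: \<psi>_def[abs_def])
      have \<psi>r: "cofilt1 ?r (\<psi> u)" if "u \<in> pts (total P)" for u unfolding \<psi>_def by (rule IH[OF q that])
      have r: "1 \<le> ?r" by simp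
      have "cofilt2 (?r + 1) (formal (translate q \<phi>) u - formal \<phi> u - lie_d (\<psi> u))"
        unfolding tr formal_def kderiv_add[OF \<phi>(1) \<psi>s u]
        by (intro fcurv_perturb r \<phi> u \<psi>r cofilt2_curv kderiv_cofilt1 \<psi>s)
      from cofilt1_lie_dstar[OF this]
      have 1: "cofilt1 (?r + 1) (lie_dstar (formal (translate q \<phi>) u) - lie_dstar (lie_d (\<psi> u)))"
        by (simp add: linear_diff[OF linear_lie_dstar] \<phi>(4)[OF u])
      have "lie_dstar (act2 q (formal \<phi> (ract P u q))) = 0"
        unfolding lie_dstar_equivariant[OF q cochain2_formal[of "ract P u q" \<phi>, OF v \<phi>(2)[OF v]]] \<phi>(4)[OF v]
        by (rule linear_0[OF bounded_linear.linear[OF bounded_linear_act1]])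
      then have 2: "cofilt1 (?r + 1) (lie_dstar (formal (translate q \<phi>) u))"
        using cofilt1_lie_dstar[OF formal_translate[OF \<phi>(1,2) IH q u]] by (simp add: linear_diff[OF linear_lie_dstar])
      have 3: "cofilt1 (?r + 1) (lie_dstar (lie_d (\<psi> u)))"
        using cofilt1_simps(3)[OF 2 1] by simp
      have "translate q \<phi> u \<in> coexact"
      proof -
        obtain B where B: "cochain2 B" "\<phi> (ract P u q) = lie_dstar B" using \<phi>(3)[OF v] by (auto simp: coexact_def)
        then show ?thesis
          unfolding translate_def B(2) lie_dstar_equivariant[OF q B(1), symmetric] coexact_def
          using cochain2_act2[OF q B(1)] by blast
      qed
      then have "\<psi> u \<in> coexact" unfolding \<psi>_def by (intro subspace_diff subspace_coexact \<phi>(3) u)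
      from coexact_cofilt1[OF this 3] show "cofilt1 (int (Suc n) + 1) (translate q \<phi> u - \<phi> u)"
        by (simp add: \<psi>_def add.commute)
    qed
  qed
  have "cofilt1 (int (nat (height A + depth A)) + 1) (translate q \<phi> u - \<phi> u)" using S q u by blast
  then have "translate q \<phi> u - \<phi> u = 0" by (rule cofilt1_top) simp
  then show ?thesis by simp
qed

end

section \<open>The normal Cartan connection\<close>

context normalization
begin

definition deform :: "('p \<Rightarrow> 'h \<Rightarrow>\<^sub>L 'h) \<Rightarrow> 'p \<Rightarrow> 'c \<Rightarrow> 'h" where
  "deform \<phi> u v = unip (\<phi> u) (\<kappa> u v)"

context
  fixes \<phi> :: "'p \<Rightarrow> 'h \<Rightarrow>\<^sub>L 'h"
  assumes \<phi>: "smooth_fun (total P) \<phi>" "\<And>u. u \<in> pts (total P) \<Longrightarrow> cofilt1 1 (\<phi> u)"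
    and eqv: "\<And>q u. q \<in> pts (Qmfd A) \<Longrightarrow> u \<in> pts (total P) \<Longrightarrow> translate q \<phi> u = \<phi> u"
begin

lemma chart_form_deform:
  "chart_form (total P) c (deform \<phi>) x v = unip (\<phi> (cinv c x)) (chart_form (total P) c \<kappa> x v)"
  by (simp add: chart_form_def deform_def)

lemma one_form_deform: "one_form (total P) (deform \<phi>)"
  unfolding one_form_def
proof (intro conjI ballI allI)
  fix u assume u: "u \<in> pts (total P)"
  have "linear (\<kappa> u)" using one_form u by (simp add: one_form_def)
  then show "linear (deform \<phi> u)"
    using linear_compose[OF _ linear_unip[of "\<phi> u"], of "\<kappa> u"] by (simp add: o_def deform_def[abs_def])
next
  fix c v assume c: "c \<in> atlas (total P)"
  have o: "open (snd c ` fst c)" by (rule chart_image_open[OF mP c])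
  have 1: "smooth_on (snd c ` fst c) (\<lambda>x. chart_form (total P) c \<kappa> x v)"
    using one_form c by (simp add: one_form_def)
  have 2: "smooth_on (snd c ` fst c) (\<phi> \<circ> cinv c)" using \<phi>(1) c by (simp add: smooth_fun_def)
  have "smooth_on (snd c ` fst c) (\<lambda>x. chart_form (total P) c \<kappa> x v + (\<phi> \<circ> cinv c) x (chart_form (total P) c \<kappa> x v))"
    by (intro smooth_on_add o 1 smooth_on_blinfun_apply 2)
  then show "smooth_on (snd c ` fst c) (\<lambda>x. chart_form (total P) c (deform \<phi>) x v)"
    by (simp add: chart_form_deform unip_def)
qed

lemma cartan_connection_deform: "cartan_connection A P (deform \<phi>)"
  unfolding cartan_connection_def
proof (intro conjI ballI allI)
  show "one_form (total P) (deform \<phi>)" by (rule one_form_deform)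
  fix u assume u: "u \<in> pts (total P)"
  have c1: "cochain1 (\<phi> u)" using \<phi>(2)[OF u] by (simp add: cofilt1_def)
  show "deform \<phi> u (mderiv (Qmfd A) (total P) (ract P u) \<one>\<^bsub>Hgrp A\<^esub> v) = lieQ A v" for v
    by (simp add: deform_def vertical[OF u] unip_def cochain1_hfilt[OF c1 lieQ_hfilt])
  show "bij (deform \<phi> u)"
    using bij_comp[OF bij[OF u] bij_unip[OF \<phi>(2)[OF u]]] by (simp add: deform_def[abs_def] o_def)
next
  fix q u v assume q: "q \<in> pts (Qmfd A)" and u: "u \<in> pts (total P)"
  let ?x = "\<kappa> u v"
  have "AdB (m_inv (Hgrp A) q) (\<phi> u ?x) = \<phi> (ract P u q) (AdB (m_inv (Hgrp A) q) ?x)"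
    unfolding eqv[OF q u, symmetric] translate_def act1_apply AdB_inv(2)[OF Q_H[OF q]] ..
  then show "deform \<phi> (ract P u q) (mderiv (total P) (total P) (\<lambda>w. ract P w q) u v) = Ad A (m_inv (Hgrp A) q) (deform \<phi> u v)"
    by (simp add: deform_def equivariant[OF q u] Ad_eq Q_H Q_closed q unip_def blinfun.add_right)
qed

interpretation N: cartan_conn A P "deform \<phi>"
  by unfold_locales (rule pbundle, rule cartan_connection_deform)

lemma form_rep_deform:
  assumes c: "c \<in> atlas (total P)" "u \<in> fst c"
  shows "form_rep (total P) (deform \<phi>) c (snd c u) v = unip (\<phi> u) (krep c (snd c u) v)"
  by (simp add: form_rep_eq[OF mP one_form_deform c] form_rep_eq[OF mP one_form c] deform_def)

lemma kinv_deform: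
  assumes c: "c \<in> atlas (total P)" "u \<in> fst c"
  shows "N.kinv c (snd c u) a = kinv c (snd c u) (unip_inv (\<phi> u) a)"
proof -
  have u: "u \<in> pts (total P)" using chart_subset[OF mP c] .
  have "form_rep (total P) (deform \<phi>) c (snd c u) (kinv c (snd c u) (unip_inv (\<phi> u) a)) = a"
    by (simp add: form_rep_deform[OF c] kinv[OF c] unip_unip_inv[OF \<phi>(2)[OF u]])
  then show ?thesis using N.kinv(2)[OF c] by metis
qed

lemma const_field_deform: "u \<in> pts (total P) \<Longrightarrow> const_field (deform \<phi>) a u = const_field \<kappa> (unip_inv (\<phi> u) a) u"
  by (simp add: N.const_field_eq const_field_eq kinv_deform P_chart)

lemma form_d_deform:
  assumes c: "c \<in> atlas (total P)" "u \<in> fst c"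
  shows "form_d (total P) (deform \<phi>) c (snd c u) v w =
    fun_deriv c \<phi> u v (krep c (snd c u) w) - fun_deriv c \<phi> u w (krep c (snd c u) v) + unip (\<phi> u) (form_d (total P) \<kappa> c (snd c u) v w)"
proof -
  let ?x = "snd c u"
  have x: "?x \<in> snd c ` fst c" using c by blast
  have o: "open (snd c ` fst c)" by (rule chart_image_open[OF mP c(1)])
  have "frechet_derivative (form_rep (total P) (deform \<phi>) c) (at ?x) v w =
      fun_deriv c \<phi> u v (krep c ?x w) + unip (\<phi> u) (frechet_derivative (krep c) (at ?x) v w)" for v w
  proof -
    note k = frechet_blinfun_apply(1)[OF form_rep_smooth[OF mP one_form c(1)] x, of w]
    have "((\<lambda>y. krep c y w + (\<phi> \<circ> cinv c) y (krep c y w)) has_derivative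
       (\<lambda>v. frechet_derivative (krep c) (at ?x) v w + ((\<phi> \<circ> cinv c) ?x (frechet_derivative (krep c) (at ?x) v w) + fun_deriv c \<phi> u v (krep c ?x w)))) (at ?x)"
      by (rule has_derivative_add[OF k bounded_bilinear.FDERIV[OF bounded_bilinear_blinfun_apply fun_deriv_works[OF \<phi>(1) c] k]])
    then have 1: "((\<lambda>y. form_rep (total P) (deform \<phi>) c y w) has_derivative
       (\<lambda>v. frechet_derivative (krep c) (at ?x) v w + ((\<phi> \<circ> cinv c) ?x (frechet_derivative (krep c) (at ?x) v w) + fun_deriv c \<phi> u v (krep c ?x w)))) (at ?x)"
      by (rule has_derivative_transform_within_open[OF _ o x])
        (auto simp: form_rep_deform[OF c(1)] cinv_chart[OF mP c(1)] unip_def)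
    from fun_cong[OF has_derivative_unique[OF frechet_blinfun_apply(1)[OF form_rep_smooth[OF mP one_form_deform c(1)] x] 1], of v]
    show ?thesis by (simp add: unip_def cinv_chart[OF mP c])
  qed
  then show ?thesis by (simp add: form_d_def linear_diff[OF linear_unip])
qed

text \<open>Here the translates agree with \<open>\<phi>\<close> in all degrees, so \<open>r\<close> can be chosen such that every value lies in
  \<open>hfilt (height A + 1) = 0\<close>.\<close>

lemma kderiv_vertical:
  assumes u: "u \<in> pts (total P)" and c: "c \<in> hfilt (grd A) 0"
  shows "kderiv \<phi> u c y + brk A c (\<phi> u y) - \<phi> u (brk A c y) = 0"
proof -
  have "kderiv \<phi> u c y + brk A c (\<phi> u y) - \<phi> u (brk A c y) \<in> hfilt (grd A) (- depth A + (height A + depth A + 1))"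
    by (rule vertical_defect[OF \<phi>(1) _ u c hfilt_bot[OF order_refl]]) (simp add: eqv u cofilt1_simps)
  then show ?thesis by (rule hfilt_top[rotated]) simp
qed

text \<open>For an equivariant \<open>\<phi>\<close> the covariant derivative is the actual one, and what remains is the product rule
  for the exterior derivative of \<open>(1 + \<phi>) \<circ> \<kappa>\<close>.\<close>

lemma curv_deform:
  assumes u: "u \<in> pts (total P)" and ab: "a \<in> hminus (grd A)" "b \<in> hminus (grd A)"
  shows "N.curv u a b = formal \<phi> u a b"
proof -
  note c = P_chart[OF u]
  let ?x = "unip_inv (\<phi> u) a" and ?y = "unip_inv (\<phi> u) b"
  have cov: "cov (\<phi> u) (kderiv \<phi> u) x y = kderiv \<phi> u x y" for x y
    by (rule cov_equivariant) (rule kderiv_vertical[OF u])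
  show ?thesis
    by (simp add: N.curv_def N.curv_chart_apply[OF c] kinv_deform[OF c] form_d_deform[OF c] kinv[OF c] kderiv_apply[OF \<phi>(1) c, symmetric]
      formal_def fcurv_apply[OF \<phi>(2)[OF u]] fcurv_val_def fcurv_pre_def pr_id ab cov curv_def curv_chart_apply[OF c])
qed

lemma curvature_fun_deform:
  assumes u: "u \<in> pts (total P)"
  shows "curvature_fun A P (deform \<phi>) u = list_cochain2 (formal \<phi> u)"
proof
  fix xs
  show "curvature_fun A P (deform \<phi>) u xs = list_cochain2 (formal \<phi> u) xs"
  proof (cases "xs \<in> cochain_args (grd A) 2")
    case True
    then obtain a b where "a \<in> hminus (grd A)" "b \<in> hminus (grd A)" "xs = [a, b]" by (auto simp: cochain_args_2)
    then show ?thesis using True by (simp add: curvature_fun_def N.curv_apply[OF u] curv_deform[OF u])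
  qed (simp add: curvature_fun_def list_cochain2_def)
qed

lemma regular_deform: "regular_cartan_connection A P (deform \<phi>)"
  unfolding regular_cartan_connection_def
proof (intro conjI ballI allI impI)
  show "cartan_connection A P (deform \<phi>)" by (rule cartan_connection_deform)
  fix u i j a b assume u: "u \<in> pts (total P)" and *: "i < 0" "j < 0" "a \<in> grd A i" "b \<in> grd A j"
  have "cofilt2 1 (formal \<phi> u)"
    unfolding formal_def by (intro cofilt2_fcurv \<phi> u cofilt2_curv kderiv_cofilt1)
  then have "formal \<phi> u a b \<in> hfilt (grd A) (i + j + 1)"
    by (rule cofilt2_apply[OF _ hfilt_gr[OF *(3) order_refl] hfilt_gr[OF *(4) order_refl] order_refl])
  then show "curvature_fun A P (deform \<phi>) u [a, b] \<in> hfilt (grd A) (i + j + 1)"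
    using gr_hminus * by (simp add: curvature_fun_deform[OF u])
qed

text \<open>\<open>bproj\<close> is constant on the orbits of the action.\<close>

lemma mderiv_bproj_vertical:
  assumes u: "u \<in> pts (total P)" and a: "a \<in> hfilt (grd A) 0"
  shows "mderiv (total P) (base P) (bproj P) u (const_field \<kappa> a u) = 0"
proof -
  obtain w where w: "a = lieQ A w" using a lieQ_range by blast
  note c = P_chart[OF u]
  let ?c = "pref (total P) u" and ?e = "pref (base P) (bproj P u)"
  have pb: "bproj P u \<in> pts (base P)" by (rule smooth_map_pts[OF smooth_bproj u])
  have e: "?e \<in> atlas (base P)" "bproj P u \<in> fst ?e" by (simp_all add: pref_chart pref_mem mB pb)
  have one: "\<one>\<^bsub>Hgrp A\<^esub> \<in> fst QG.c1" using QG.c1(2) by simp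
  have "mderiv (total P) (base P) (bproj P) u (const_field \<kappa> a u)
      = chart_deriv ?c ?e (bproj P) u (chart_deriv QG.c1 ?c (ract P u) \<one>\<^bsub>Hgrp A\<^esub> w)"
    by (simp add: mderiv_eq const_field_eq[OF u] w kinv_lieQ[OF u c])
  also have "\<dots> = chart_deriv QG.c1 ?e (\<lambda>q. bproj P (ract P u q)) \<one>\<^bsub>Hgrp A\<^esub> w"
    using chart_deriv_compose[OF QG.mf mP mB smooth_orbit[OF u] smooth_bproj QG.c1(1) c(1) e(1) one] c(2) e(2)
    by (simp add: ract_one[OF u])
  also have "\<dots> = chart_deriv QG.c1 ?e (\<lambda>q. bproj P u) \<one>\<^bsub>Hgrp A\<^esub> w"
    by (subst chart_deriv_cong[OF QG.mf QG.c1(1) one bproj_ract[OF u]]) auto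
  also have "\<dots> = 0" by (simp add: chart_deriv_def o_def)
  finally show ?thesis .
qed

text \<open>The constant fields of \<open>\<kappa>\<close> and of \<open>deform \<phi>\<close> of degree \<open>-1\<close> differ by vertical fields.\<close>

lemma induced_frame_deform:
  assumes u: "u \<in> pts (total P)" shows "induced_frame A P (deform \<phi>) u = induced_frame A P \<kappa> u"
  unfolding induced_frame_def
proof (rule restrict_ext)
  fix a assume a: "a \<in> grd A (- 1)"
  let ?D = "mderiv (total P) (base P) (bproj P) u"
  note c = P_chart[OF u]
  have pb: "bproj P u \<in> pts (base P)" by (rule smooth_map_pts[OF smooth_bproj u])
  have lin: "linear ?D"
    unfolding mderiv_eq by (rule chart_deriv_linear[OF smooth_bproj c(1) _ c(2)]) (simp_all add: pref_chart pref_mem mB pb)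
  let ?x = "unip_inv (\<phi> u) a"
  have x: "?x \<in> hfilt (grd A) (- 1)" by (rule unip_inv_hfilt[OF \<phi>(2)[OF u] hfilt_gr[OF a order_refl]])
  have "a - ?x = \<phi> u ?x" using unip_unip_inv[OF \<phi>(2)[OF u], of a] by (simp add: unip_def algebra_simps)
  moreover have "\<phi> u ?x \<in> hfilt (grd A) 0" by (rule cofilt1_apply[OF \<phi>(2)[OF u] x]) simp
  ultimately have "?D (const_field \<kappa> (a - ?x) u) = 0" by (simp add: mderiv_bproj_vertical[OF u])
  then have "?D (const_field \<kappa> a u) - ?D (const_field \<kappa> ?x u) = 0"
    by (simp add: const_field_eq[OF u] blinfun.diff_right linear_diff[OF lin])
  then show "?D (const_field (deform \<phi>) a u) = ?D (const_field \<kappa> a u)"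
    by (simp add: const_field_deform[OF u])
qed

text \<open>\<open>1 + \<phi>\<close> is a bijection of \<open>hfilt (- 1)\<close>.\<close>

lemma induced_filtration_deform: "induced_filtration A P (deform \<phi>) (- 1) x = induced_filtration A P \<kappa> (- 1) x"
proof -
  let ?D = "\<lambda>u. mderiv (total P) (base P) (bproj P) u"
  have "{?D u (const_field (deform \<phi>) a u) | u a. u \<in> pts (total P) \<and> bproj P u = x \<and> a \<in> hfilt (grd A) (- 1)}
     = {?D u (const_field \<kappa> a u) | u a. u \<in> pts (total P) \<and> bproj P u = x \<and> a \<in> hfilt (grd A) (- 1)}" (is "?L = ?R")
  proof
    show "?L \<subseteq> ?R"
      using const_field_deform unip_inv_hfilt[OF \<phi>(2)] by fastforce
    show "?R \<subseteq> ?L"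
    proof
      fix y assume "y \<in> ?R"
      then obtain u a where u: "u \<in> pts (total P)" "bproj P u = x" "a \<in> hfilt (grd A) (- 1)" "y = ?D u (const_field \<kappa> a u)"
        by blast
      have "unip (\<phi> u) a \<in> hfilt (grd A) (- 1)" using u unip_hfilt_iff[OF \<phi>(2)] by blast
      moreover have "const_field (deform \<phi>) (unip (\<phi> u) a) u = const_field \<kappa> a u"
        using const_field_deform[OF u(1)] unip_inv_unique[OF \<phi>(2)[OF u(1)] refl, of a] by simp
      ultimately show "y \<in> ?L" using u by (metis (mono_tags, lifting) mem_Collect_eq)
    qed
  qed
  then show ?thesis by (simp add: induced_filtration_def)
qed

lemma induces_tanaka_deform: "induces_tanaka A P \<kappa> D PG j \<Longrightarrow> induces_tanaka A P (deform \<phi>) D PG j"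
  by (simp add: induces_tanaka_def induced_filtration_deform induced_frame_deform)

lemma normal_deform:
  assumes "\<And>u. u \<in> pts (total P) \<Longrightarrow> lie_dstar (formal \<phi> u) = 0"
  shows "normal_cartan_connection A ip P (deform \<phi>)"
  unfolding normal_cartan_connection_def
proof (intro conjI ballI regular_deform)
  fix u assume u: "u \<in> pts (total P)"
  have "adjoint_diff A ip 1 (list_cochain2 (formal \<phi> u)) = list_cochain1 0"
    unfolding adjoint_diff_eq[OF refl refl] assms[OF u] ..
  then show "adjoint_diff A ip 1 (curvature_fun A P (deform \<phi>) u) = (\<lambda>_. 0)"
    unfolding curvature_fun_deform[OF u] by (simp add: fun_eq_iff list_cochain1_def del: One_nat_def)
qed

end

end

theorem theorem1:
  fixes A :: "('h::euclidean_space, 'g, 'a::euclidean_space, 'b::euclidean_space) model"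
    and ip :: "'h \<Rightarrow> 'h \<Rightarrow> real"
    and P :: "('p, 'c::euclidean_space, 'm, 'd::euclidean_space, 'g) pbundle"
    and \<kappa> :: "'p \<Rightarrow> 'c \<Rightarrow> 'h"
    and D :: "'m \<Rightarrow> 'd set"
    and PG :: "('m \<times> ('h \<Rightarrow> 'd)) set"
    and j :: "'p set \<Rightarrow> 'm \<times> ('h \<Rightarrow> 'd)"
  assumes "cartan_model A"
    and "principal_bundle (Qgrp A) (Qmfd A) P"
    and "tanaka_structure A (base P) D PG"
    and "regular_cartan_connection A P \<kappa>"
    and "induces_tanaka A P \<kappa> D PG j"
    and "admissible_metric A ip"
  shows "\<exists>\<kappa>n. normal_cartan_connection A ip P \<kappa>n \<and> induces_tanaka A P \<kappa>n D PG j"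
proof -
  interpret normalization A P \<kappa> ip
    using assms by unfold_locales (auto simp: regular_cartan_connection_def)
  obtain \<phi> where \<phi>: "smooth_fun (total P) \<phi>" "\<And>u. u \<in> pts (total P) \<Longrightarrow> cofilt1 1 (\<phi> u)"
    "\<And>u. u \<in> pts (total P) \<Longrightarrow> \<phi> u \<in> coexact" "\<And>u. u \<in> pts (total P) \<Longrightarrow> lie_dstar (formal \<phi> u) = 0"
    using formal_normalization by blast
  note eqv = formal_solution_equivariant[OF \<phi>]
  show ?thesis
    using normal_deform[OF \<phi>(1,2) eqv \<phi>(4)] induces_tanaka_deform[OF \<phi>(1,2) eqv assms(5)] by blast
qed

end
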